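(* Let $(M,\Omega)$ be a compact connected symplectic manifold of dimension $2n$, let $\nabla_0\in\mathbb S(M,\Omega)$, and let $s,t$ be nonzero real numbers. For nonzero real numbers $a,b$ let $$\widehat{\mathbb M}^{a,b}(\nabla)=b\Big(\mathrm{vol}^{-1}+\bar{\mathcal K}(\nabla)\Big)+3a\,\mathrm{Ric}(\nabla)+3b^{-1}a^2(\nabla-\nabla_0)\in C^\infty(M)\oplus\mathsf S^2(M)\oplus\mathsf S^3(M),$$ where $\mathrm{vol}=\int_M\Omega_n$ and $\bar{\mathcal K}(\nabla)=\mathcal K(\nabla)-\mathrm{vol}^{-1}\int_M\mathcal K(\nabla)\Omega_n$, and define $\mathbb N_{a,b}:\mathbb S(M,\Omega)\to\mathbb R$ by $\mathbb N_{a,b}(\nabla)=\langle\!\langle\widehat{\mathbb M}^{a,b}(\nabla),\widehat{\mathbb M}^{a,b}(\nabla)\rangle\!\rangle$. Then the first variation of $\mathbb N_{s/3,t}$ at $\nabla\in\mathbb S(M,\Omega)$ in the direction $\Pi\in\mathsf S^3(M)$ is $$\delta_\Pi\mathbb N_{s/3,t}(\nabla)=2\,\mathbb\Omega\big(t^2\mathscr H_\nabla(\mathcal K(\nabla))+s^2\delta^*_\nabla\mathrm{Ric}(\nabla),\Pi\big),$$ so the critical points of $\mathbb N_{s/3,t}$ (with respect to arbitrary variations $\Pi\in\mathsf S^3(M)$) are exactly the $\nabla\in\mathbb S(M,\Omega)$ solving $$t^2\mathscr H_\nabla(\mathcal K(\nabla))+s^2\delta^*_\nabla\mathrm{Ri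c}(\nabla)=0.$$
   Context: Conventions. $\Omega_n=\frac1{n!}\Omega^n$. Abstract indices and the summation convention are used; $(\cdots)$ and $[\cdots]$ around indices denote complete symmetrization/antisymmetrization. $\Omega^{ij}$ is defined by $\Omega^{ip}\Omega_{pj}=-\delta_j{}^i$; indices are raised/lowered by $X^i=\Omega^{ip}X_p$, $X_i=X^p\Omega_{pi}$, keeping horizontal position. $\mathsf S^k(M)=\Gamma(S^k(T^*M))$. Hamiltonian vector field: $H_f^i=\Omega^{pi}df_p$. $\mathbb S(M,\Omega)$ is the space of torsion-free affine connections $\nabla$ with $\nabla\Omega=0$, an affine space modeled on $\mathsf S^3(M)$ ($\nabla+\Pi$ means $\nabla+\Pi_{ij}{}^k$, $\Pi_{ijk}=\Pi_{(ijk)}$). Curvature: $2\nabla_{[i}\nabla_{j]}X^k=R_{ijp}{}^kX^p$, $R_{ijkl}=R_{ijk}{}^p\Omega_{pl}$, $\mathrm{Ric}_{ij}=R_{ij}=R_{pij}{}^p$. Pairing: for $\alpha,\beta\in\mathsf S^k(M)$, $\langle\!\langle\alpha,\beta\rangle\!\rangle=\int_M\alpha_{i_1\dots i_k}\beta^{i_1\dots i_k}\,\Omega_n$, extended to sums of tensors of different degrees by declaring components of different degree orthogonal. $\mathbb\Omega(\alpha,\beta)=\langle\!\langle\alpha,\beta\rangle\!\rangle$ for $\alpha,\beta\in T_\nabla\mathbb S(M,\Omega)=\mathsf S^3(M)$ is the symplectic form on $\mathbb S(M,\Omega)$. $\delta_\Pi F(\nabla)=\frac{d}{dt}|_{t=0}F(\nabla+t\Pi)$.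 $\delta^*_\nabla\alpha_{i_1\dots i_{k+1}}=-\nabla_{(i_1}\alpha_{i_2\dots i_{k+1})}$ for $\alpha\in\mathsf S^k(M)$. For $f\in C^\infty(M)$, $\mathscr H_\nabla(f)_{ijk}=(\mathfrak L_{H_f}\nabla)_{ij}{}^p\Omega_{pk}\in\mathsf S^3(M)$, where $(\mathfrak L_X\nabla)_{ij}{}^k=\nabla_i\nabla_jX^k+X^pR_{pij}{}^k$. $\mathcal K(\nabla)=\nabla^i\nabla^jR_{ij}-\frac12R^{ij}R_{ij}+\frac14R^{ijkl}R_{ijkl}$. *)

theory Defs
  imports "HOL-Analysis.Analysis"
begin

section \<open>Smooth functions on open subsets of coordinate space\<close>

definition pd :: "'n::finite \<Rightarrow> (real^'n \<Rightarrow> real) \<Rightarrow> real^'n \<Rightarrow> real" where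
  "pd i f x = frechet_derivative f (at x) (axis i 1)"

primrec iterated_pd :: "'n::finite list \<Rightarrow> (real^'n \<Rightarrow> real) \<Rightarrow> real^'n \<Rightarrow> real" where
  "iterated_pd [] f = f"
| "iterated_pd (i # js) f = pd i (iterated_pd js f)"

text \<open>Used for open \<open>S\<close> only: every iterated partial derivative is Frechet differentiable,
  hence continuous, on \<open>S\<close>; this is \<open>C\<^sup>\<infinity>\<close>.\<close>

definition smooth_on :: "(real^'n::finite) set \<Rightarrow> (real^'n \<Rightarrow> real) \<Rightarrow> bool" where
  "smooth_on S f \<longleftrightarrow> (\<forall>js. \<forall>x\<in>S. iterated_pd js f differentiable (at x))"


section \<open>Smooth manifolds\<close>

text \<open>The manifold is the whole type \<open>'m\<close>; a chart is a pair of a domain and a coordinate map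
  whose values outside the domain are irrelevant. The dimension is \<open>CARD('n)\<close>.\<close>

type_synonym ('m, 'n) chart = "'m set \<times> ('m \<Rightarrow> real^'n)"

abbreviation cdom :: "('m, 'n::finite) chart \<Rightarrow> 'm set" where "cdom c \<equiv> fst c"
abbreviation coords :: "('m, 'n::finite) chart \<Rightarrow> 'm \<Rightarrow> real^'n" where "coords c \<equiv> snd c"
abbreviation cimage :: "('m, 'n::finite) chart \<Rightarrow> (real^'n) set" where
  "cimage c \<equiv> coords c ` cdom c"

definition in_chart :: "('m, 'n::finite) chart \<Rightarrow> ('m \<Rightarrow> 'b) \<Rightarrow> real^'n \<Rightarrow> 'b" where
  "in_chart c f x = f (inv_into (cdom c) (coords c) x)"

text \<open>\<open>\<partial>\<^sub>i f\<close> at the point \<open>p\<close> with respect to the coordinates of \<open>c\<close>.\<close>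

definition chart_pd :: "('m, 'n::finite) chart \<Rightarrow> 'n \<Rightarrow> ('m \<Rightarrow> real) \<Rightarrow> 'm \<Rightarrow> real" where
  "chart_pd c i f p = pd i (in_chart c f) (coords c p)"

definition smooth_atlas :: "('m::topological_space, 'n::finite) chart set \<Rightarrow> bool" where
  "smooth_atlas A \<longleftrightarrow>
     (\<Union>c\<in>A. cdom c) = UNIV \<and>
     (\<forall>c\<in>A. open (cdom c) \<and> open (cimage c) \<and>
        homeomorphism (cdom c) (cimage c) (coords c) (inv_into (cdom c) (coords c))) \<and>
     (\<forall>c\<in>A. \<forall>d\<in>A. \<forall>a. smooth_on (coords c ` (cdom c \<inter> cdom d)) (in_chart c (\<lambda>p. coords d p $ a)))"


section \<open>Tensor fields\<close>

text \<open>A tensor field is given by its components \<open>T c p us ls\<close> in every chart \<open>c\<close> of the atlas and at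
  every \<open>p\<close> in the domain of \<open>c\<close>; \<open>us\<close> is the list of upper and \<open>ls\<close> the list of lower indices.
  Functions on the manifold are the tensor fields of type (0,0). Values for other \<open>c\<close>, \<open>p\<close>, or
  for lists of the wrong length, are irrelevant everywhere.\<close>

type_synonym ('m, 'n) tensor = "('m, 'n) chart \<Rightarrow> 'm \<Rightarrow> 'n list \<Rightarrow> 'n list \<Rightarrow> real"

definition idx :: "nat \<Rightarrow> 'n list set" where
  "idx k = {js. length js = k}"

text \<open>\<open>jac c d p a i\<close> is the derivative of the \<open>a\<close>-th coordinate of \<open>c\<close> by the \<open>i\<close>-th coordinate of \<open>d\<close>.\<close>

definition jac :: "('m, 'n::finite) chart \<Rightarrow> ('m, 'n) chart \<Rightarrow> 'm \<Rightarrow> 'n \<Rightarrow> 'n \<Rightarrow> real" where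
  "jac c d p a i = chart_pd d i (\<lambda>q. coords c q $ a) p"

definition tensor_field ::
    "('m, 'n::finite) chart set \<Rightarrow> nat \<Rightarrow> nat \<Rightarrow> ('m, 'n) tensor \<Rightarrow> bool" where
  "tensor_field A r k T \<longleftrightarrow>
     (\<forall>c\<in>A. \<forall>us\<in>idx r. \<forall>ls\<in>idx k. smooth_on (cimage c) (in_chart c (\<lambda>p. T c p us ls))) \<and>
     (\<forall>c\<in>A. \<forall>d\<in>A. \<forall>p\<in>cdom c \<inter> cdom d. \<forall>us\<in>idx r. \<forall>ls\<in>idx k.
        T d p us ls =
          (\<Sum>vs\<in>idx r. \<Sum>ms\<in>idx k.
             (\<Prod>m<r. jac d c p (us ! m) (vs ! m)) * (\<Prod>m<k. jac c d p (ms ! m) (ls ! m))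
               * T c p vs ms))"

definition vanishes :: "('m, 'n::finite) chart set \<Rightarrow> nat \<Rightarrow> ('m, 'n) tensor \<Rightarrow> bool" where
  "vanishes A k T \<longleftrightarrow> (\<forall>c\<in>A. \<forall>p\<in>cdom c. \<forall>ls\<in>idx k. T c p [] ls = 0)"

definition Sk :: "('m, 'n::finite) chart set \<Rightarrow> nat \<Rightarrow> ('m, 'n) tensor set" where
  "Sk A k = {T. tensor_field A 0 k T \<and>
     (\<forall>c\<in>A. \<forall>p\<in>cdom c. \<forall>ls\<in>idx k. \<forall>\<sigma>. \<sigma> permutes {..<k} \<longrightarrow>
        T c p [] (permute_list \<sigma> ls) = T c p [] ls)}"

definition symmetrize :: "('m, 'n::finite) tensor \<Rightarrow> ('m, 'n) tensor" where
  "symmetrize T = (\<lambda>c p us ls.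
     (1 / fact (length ls)) * (\<Sum>\<sigma> | \<sigma> permutes {..<length ls}. T c p us (permute_list \<sigma> ls)))"

definition tadd :: "('m, 'n) tensor \<Rightarrow> ('m, 'n) tensor \<Rightarrow> ('m, 'n) tensor" where
  "tadd S T = (\<lambda>c p us ls. S c p us ls + T c p us ls)"

definition tscale :: "real \<Rightarrow> ('m, 'n) tensor \<Rightarrow> ('m, 'n) tensor" where
  "tscale a T = (\<lambda>c p us ls. a * T c p us ls)"

definition tconst :: "real \<Rightarrow> ('m, 'n) tensor" where
  "tconst a = (\<lambda>c p us ls. a)"


section \<open>Symplectic manifolds\<close>

definition two_form_matrix ::
    "('m, 'n::finite) tensor \<Rightarrow> ('m, 'n) chart \<Rightarrow> 'm \<Rightarrow> real^'n^'n" where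
  "two_form_matrix \<Omega> c p = (\<chi> i j. \<Omega> c p [] [i, j])"

definition symplectic_manifold ::
    "nat \<Rightarrow> ('m::t2_space, 'n::finite) chart set \<Rightarrow> ('m, 'n) tensor \<Rightarrow> bool" where
  "symplectic_manifold n A \<Omega> \<longleftrightarrow>
     CARD('n) = 2 * n \<and> smooth_atlas A \<and> tensor_field A 0 2 \<Omega> \<and>
     (\<forall>c\<in>A. \<forall>p\<in>cdom c.
        (\<forall>i j. \<Omega> c p [] [i, j] = - \<Omega> c p [] [j, i]) \<and>
        (\<forall>i j k. chart_pd c i (\<lambda>q. \<Omega> c q [] [j, k]) p + chart_pd c j (\<lambda>q. \<Omega> c q [] [k, i]) p
                  + chart_pd c k (\<lambda>q. \<Omega> c q [] [i, j]) p = 0) \<and>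
        invertible (two_form_matrix \<Omega> c p))"

text \<open>\<open>\<Omega>\<^sup>i\<^sup>j\<close>, normalised by \<open>\<Omega>\<^sup>i\<^sup>p \<Omega>\<^sub>p\<^sub>j = - \<delta>\<^sub>j\<^sup>i\<close>; whence the sign.\<close>

definition \<Omega>up ::
    "('m, 'n::finite) tensor \<Rightarrow> ('m, 'n) chart \<Rightarrow> 'm \<Rightarrow> 'n \<Rightarrow> 'n \<Rightarrow> real" where
  "\<Omega>up \<Omega> c p i j = - (matrix_inv (two_form_matrix \<Omega> c p) $ i $ j)"

text \<open>\<open>\<alpha>\<^sup>i\<^sup>1\<^sup>\<dots>\<^sup>i\<^sup>k\<close>, obtained from \<open>X\<^sup>i = \<Omega>\<^sup>i\<^sup>p X\<^sub>p\<close> in each slot; the raised indices are passed as a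
  plain list.\<close>

definition raise_all ::
    "('m, 'n::finite) tensor \<Rightarrow> ('m, 'n) tensor \<Rightarrow> ('m, 'n) chart \<Rightarrow> 'm \<Rightarrow> 'n list \<Rightarrow> real" where
  "raise_all \<Omega> T c p is =
     (\<Sum>js\<in>idx (length is). (\<Prod>m<length is. \<Omega>up \<Omega> c p (is ! m) (js ! m)) * T c p [] js)"

text \<open>The function \<open>\<alpha>\<^sub>i\<^sub>1\<^sub>\<dots>\<^sub>i\<^sub>k \<beta>\<^sup>i\<^sup>1\<^sup>\<dots>\<^sup>i\<^sup>k\<close>.\<close>

definition full_contraction ::
    "('m, 'n::finite) tensor \<Rightarrow> nat \<Rightarrow> ('m, 'n) tensor \<Rightarrow> ('m, 'n) tensor \<Rightarrow> ('m, 'n) tensor" where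
  "full_contraction \<Omega> k \<alpha> \<beta> = (\<lambda>c p _ _. \<Sum>is\<in>idx k. \<alpha> c p [] is * raise_all \<Omega> \<beta> c p is)"


section \<open>Integration against \<open>\<Omega>\<^sub>n\<close>\<close>

definition index_enum :: "nat \<Rightarrow> 'n::finite" where
  "index_enum = (SOME e. bij_betw e {..<CARD('n)} UNIV)"

text \<open>The coefficient of \<open>\<Omega>\<^sub>n = \<Omega>\<^sup>n / n!\<close>, that is its value on the coordinate frame taken in the
  order \<open>index_enum\<close>, by the permutation formula for the \<open>n\<close>-th wedge power of a 2-form,
  \<open>2n = CARD('n)\<close>.\<close>

definition \<Omega>n_coeff :: "('m, 'n::finite) tensor \<Rightarrow> ('m, 'n) chart \<Rightarrow> 'm \<Rightarrow> real" where
  "\<Omega>n_coeff \<Omega> c p =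
     (let n = CARD('n) div 2 in
        1 / fact n * (1 / 2 ^ n *
          (\<Sum>\<sigma> | \<sigma> permutes (UNIV :: 'n set). of_int (sign \<sigma>) *
             (\<Prod>k<n. \<Omega> c p [] [\<sigma> (index_enum (2 * k)), \<sigma> (index_enum (2 * k + 1))]))))"

definition partition_of_unity ::
    "('m::topological_space, 'n::finite) chart set \<Rightarrow> ('m, 'n) chart set
      \<Rightarrow> (('m, 'n) chart \<Rightarrow> 'm \<Rightarrow> real) \<Rightarrow> bool" where
  "partition_of_unity A C \<rho> \<longleftrightarrow>
     finite C \<and> C \<subseteq> A \<and>
     (\<forall>c\<in>C. (\<forall>d\<in>A. smooth_on (cimage d) (in_chart d (\<rho> c))) \<and>
            (\<forall>p. 0 \<le> \<rho> c p) \<and> closure {p. \<rho> c p \<noteq> 0} \<subseteq> cdom c) \<and>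
     (\<forall>p. (\<Sum>c\<in>C. \<rho> c p) = 1)"

text \<open>The integral of the function \<open>F\<close> against \<open>\<Omega>\<^sub>n\<close> over a compact manifold oriented by \<open>\<Omega>\<^sub>n\<close>. In a
  positively oriented chart the coefficient of \<open>\<Omega>\<^sub>n\<close> is positive, so the absolute value implements
  the orientation in arbitrary charts (and makes the choice of \<open>index_enum\<close> irrelevant). For
  smooth \<open>F\<close> the value does not depend on the chosen partition of unity.\<close>

definition integral_\<Omega>n ::
    "('m::topological_space, 'n::finite) chart set \<Rightarrow> ('m, 'n) tensor \<Rightarrow> ('m, 'n) tensor \<Rightarrow> real" where
  "integral_\<Omega>n A \<Omega> F =
     (let (C, \<rho>) = (SOME (C, \<rho>). partition_of_unity A C \<rho>) in
        \<Sum>c\<in>C. set_lebesgue_integral lborel (cimage c)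
          (in_chart c (\<lambda>p. \<rho> c p * F c p [] [] * \<bar>\<Omega>n_coeff \<Omega> c p\<bar>)))"

definition pairing ::
    "('m::topological_space, 'n::finite) chart set \<Rightarrow> ('m, 'n) tensor \<Rightarrow> nat
      \<Rightarrow> ('m, 'n) tensor \<Rightarrow> ('m, 'n) tensor \<Rightarrow> real" where
  "pairing A \<Omega> k \<alpha> \<beta> = integral_\<Omega>n A \<Omega> (full_contraction \<Omega> k \<alpha> \<beta>)"

text \<open>The pairing on \<open>C\<^sup>\<infinity>(M) \<oplus> S\<^sup>2(M) \<oplus> S\<^sup>3(M)\<close>, with components of different degree orthogonal.\<close>

definition pairing023 ::
    "('m::topological_space, 'n::finite) chart set \<Rightarrow> ('m, 'n) tensor
      \<Rightarrow> ('m, 'n) tensor \<times> ('m, 'n) tensor \<times> ('m, 'n) tensor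
      \<Rightarrow> ('m, 'n) tensor \<times> ('m, 'n) tensor \<times> ('m, 'n) tensor \<Rightarrow> real" where
  "pairing023 A \<Omega> = (\<lambda>(\<alpha>0, \<alpha>2, \<alpha>3) (\<beta>0, \<beta>2, \<beta>3).
     pairing A \<Omega> 0 \<alpha>0 \<beta>0 + pairing A \<Omega> 2 \<alpha>2 \<beta>2 + pairing A \<Omega> 3 \<alpha>3 \<beta>3)"

definition symplectic_form ::
    "('m::topological_space, 'n::finite) chart set \<Rightarrow> ('m, 'n) tensor
      \<Rightarrow> ('m, 'n) tensor \<Rightarrow> ('m, 'n) tensor \<Rightarrow> real" where
  "symplectic_form A \<Omega> \<alpha> \<beta> = pairing A \<Omega> 3 \<alpha> \<beta>"


section \<open>Affine connections\<close>

text \<open>\<open>\<Gamma> c p i j k\<close> is the Christoffel symbol \<open>\<Gamma>\<^sub>i\<^sub>j\<^sup>k\<close> in the chart \<open>c\<close>: the covariant derivative of the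
  \<open>j\<close>-th coordinate field in the direction of the \<open>i\<close>-th has \<open>k\<close>-th component \<open>\<Gamma>\<^sub>i\<^sub>j\<^sup>k\<close>.\<close>

type_synonym ('m, 'n) conn = "('m, 'n) chart \<Rightarrow> 'm \<Rightarrow> 'n \<Rightarrow> 'n \<Rightarrow> 'n \<Rightarrow> real"

definition affine_connection :: "('m, 'n::finite) chart set \<Rightarrow> ('m, 'n) conn \<Rightarrow> bool" where
  "affine_connection A \<Gamma> \<longleftrightarrow>
     (\<forall>c\<in>A. \<forall>i j k. smooth_on (cimage c) (in_chart c (\<lambda>p. \<Gamma> c p i j k))) \<and>
     (\<forall>c\<in>A. \<forall>d\<in>A. \<forall>p\<in>cdom c \<inter> cdom d. \<forall>i j k.
        \<Gamma> d p i j k =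
          (\<Sum>e\<in>UNIV. jac d c p k e *
             (chart_pd d i (\<lambda>q. jac c d q e j) p +
              (\<Sum>a\<in>UNIV. \<Sum>b\<in>UNIV. jac c d p a i * jac c d p b j * \<Gamma> c p a b e))))"

text \<open>The covariant derivative; the new lower index comes first, so that
  \<open>cov \<Gamma> (cov \<Gamma> T) c p us (i # j # ls)\<close> is \<open>\<nabla>\<^sub>i \<nabla>\<^sub>j T\<close>.\<close>

definition cov :: "('m, 'n::finite) conn \<Rightarrow> ('m, 'n) tensor \<Rightarrow> ('m, 'n) tensor" where
  "cov \<Gamma> T = (\<lambda>c p us ls. case ls of [] \<Rightarrow> 0 | i # js \<Rightarrow>
     chart_pd c i (\<lambda>q. T c q us js) p
     + (\<Sum>m<length us. \<Sum>l\<in>UNIV. \<Gamma> c p i l (us ! m) * T c p (us[m := l]) js)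
     - (\<Sum>m<length js. \<Sum>l\<in>UNIV. \<Gamma> c p i (js ! m) l * T c p us (js[m := l])))"

text \<open>The space of symplectic connections.\<close>

definition SConn ::
    "('m, 'n::finite) chart set \<Rightarrow> ('m, 'n) tensor \<Rightarrow> ('m, 'n) conn set" where
  "SConn A \<Omega> = {\<Gamma>. affine_connection A \<Gamma> \<and>
     (\<forall>c\<in>A. \<forall>p\<in>cdom c. \<forall>i j k. \<Gamma> c p i j k = \<Gamma> c p j i k) \<and>
     vanishes A 3 (cov \<Gamma> \<Omega>)}"

text \<open>\<open>\<nabla> + \<Pi>\<^sub>i\<^sub>j\<^sup>k\<close>, where \<open>P\<close> is \<open>\<Pi>\<^sub>i\<^sub>j\<^sub>k\<close>.\<close>

definition conn_add ::
    "('m, 'n::finite) tensor \<Rightarrow> ('m, 'n) conn \<Rightarrow> ('m, 'n) tensor \<Rightarrow> ('m, 'n) conn" where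
  "conn_add \<Omega> \<Gamma> P = (\<lambda>c p i j k. \<Gamma> c p i j k + (\<Sum>q\<in>UNIV. \<Omega>up \<Omega> c p k q * P c p [] [i, j, q]))"

definition conn_diff ::
    "('m, 'n::finite) tensor \<Rightarrow> ('m, 'n) conn \<Rightarrow> ('m, 'n) conn \<Rightarrow> ('m, 'n) tensor" where
  "conn_diff \<Omega> \<Gamma> \<Gamma>0 = (\<lambda>c p _ ls. \<Sum>q\<in>UNIV.
     (\<Gamma> c p (ls ! 0) (ls ! 1) q - \<Gamma>0 c p (ls ! 0) (ls ! 1) q) * \<Omega> c p [] [q, ls ! 2])"

text \<open>\<open>curv \<Gamma> c p i j l k\<close> is \<open>R\<^sub>i\<^sub>j\<^sub>l\<^sup>k\<close>, read off from \<open>2 \<nabla>\<^sub>[\<^sub>i \<nabla>\<^sub>j\<^sub>] X\<^sup>k = R\<^sub>i\<^sub>j\<^sub>p\<^sup>k X\<^sup>p\<close> by taking for \<open>X\<close> the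
  \<open>l\<close>-th coordinate vector field of the chart \<open>c\<close>.\<close>

definition coordinate_field :: "'n \<Rightarrow> ('m, 'n) tensor" where
  "coordinate_field l = (\<lambda>_ _ us _. if us = [l] then 1 else 0)"

definition curv ::
    "('m, 'n::finite) conn \<Rightarrow> ('m, 'n) chart \<Rightarrow> 'm \<Rightarrow> 'n \<Rightarrow> 'n \<Rightarrow> 'n \<Rightarrow> 'n \<Rightarrow> real" where
  "curv \<Gamma> c p i j l k =
     cov \<Gamma> (cov \<Gamma> (coordinate_field l)) c p [k] [i, j]
     - cov \<Gamma> (cov \<Gamma> (coordinate_field l)) c p [k] [j, i]"

definition curv_low ::
    "('m, 'n::finite) tensor \<Rightarrow> ('m, 'n) conn \<Rightarrow> ('m, 'n) tensor" where
  "curv_low \<Omega> \<Gamma> = (\<lambda>c p _ ls. \<Sum>q\<in>UNIV.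
     curv \<Gamma> c p (ls ! 0) (ls ! 1) (ls ! 2) q * \<Omega> c p [] [q, ls ! 3])"

definition Ric :: "('m, 'n::finite) conn \<Rightarrow> ('m, 'n) tensor" where
  "Ric \<Gamma> = (\<lambda>c p _ ls. \<Sum>q\<in>UNIV. curv \<Gamma> c p q (ls ! 0) (ls ! 1) q)"

definition \<K> :: "('m, 'n::finite) tensor \<Rightarrow> ('m, 'n) conn \<Rightarrow> ('m, 'n) tensor" where
  "\<K> \<Omega> \<Gamma> = (\<lambda>c p us ls.
     (\<Sum>i\<in>UNIV. \<Sum>j\<in>UNIV. \<Sum>a\<in>UNIV. \<Sum>b\<in>UNIV.
        \<Omega>up \<Omega> c p i a * \<Omega>up \<Omega> c p j b * cov \<Gamma> (cov \<Gamma> (Ric \<Gamma>)) c p [] [a, b, i, j])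
     - 1 / 2 * full_contraction \<Omega> 2 (Ric \<Gamma>) (Ric \<Gamma>) c p us ls
     + 1 / 4 * full_contraction \<Omega> 4 (curv_low \<Omega> \<Gamma>) (curv_low \<Omega> \<Gamma>) c p us ls)"

definition \<delta>star :: "('m, 'n::finite) conn \<Rightarrow> ('m, 'n) tensor \<Rightarrow> ('m, 'n) tensor" where
  "\<delta>star \<Gamma> \<alpha> = tscale (- 1) (symmetrize (cov \<Gamma> \<alpha>))"

text \<open>\<open>H\<^sub>f\<^sup>i = \<Omega>\<^sup>p\<^sup>i df\<^sub>p\<close>\<close>

definition hamiltonian_field ::
    "('m, 'n::finite) tensor \<Rightarrow> ('m, 'n) tensor \<Rightarrow> ('m, 'n) tensor" where
  "hamiltonian_field \<Omega> f = (\<lambda>c p us _.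
     \<Sum>q\<in>UNIV. \<Omega>up \<Omega> c p q (us ! 0) * chart_pd c q (\<lambda>x. f c x [] []) p)"

text \<open>\<open>lie_conn X \<Gamma> c p i j k\<close> is the Lie derivative \<open>\<nabla>\<^sub>i \<nabla>\<^sub>j X\<^sup>k + X\<^sup>p R\<^sub>p\<^sub>i\<^sub>j\<^sup>k\<close> of the connection.\<close>

definition lie_conn ::
    "('m, 'n::finite) tensor \<Rightarrow> ('m, 'n) conn \<Rightarrow> ('m, 'n) chart \<Rightarrow> 'm \<Rightarrow> 'n \<Rightarrow> 'n \<Rightarrow> 'n \<Rightarrow> real" where
  "lie_conn X \<Gamma> c p i j k =
     cov \<Gamma> (cov \<Gamma> X) c p [k] [i, j] + (\<Sum>q\<in>UNIV. X c p [q] [] * curv \<Gamma> c p q i j k)"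

definition \<H> ::
    "('m, 'n::finite) tensor \<Rightarrow> ('m, 'n) conn \<Rightarrow> ('m, 'n) tensor \<Rightarrow> ('m, 'n) tensor" where
  "\<H> \<Omega> \<Gamma> f = (\<lambda>c p _ ls. \<Sum>q\<in>UNIV.
     lie_conn (hamiltonian_field \<Omega> f) \<Gamma> c p (ls ! 0) (ls ! 1) q * \<Omega> c p [] [q, ls ! 2])"


section \<open>The functional and its variations\<close>

definition vol :: "('m::topological_space, 'n::finite) chart set \<Rightarrow> ('m, 'n) tensor \<Rightarrow> real" where
  "vol A \<Omega> = integral_\<Omega>n A \<Omega> (tconst 1)"

definition \<K>bar ::
    "('m::topological_space, 'n::finite) chart set \<Rightarrow> ('m, 'n) tensor \<Rightarrow> ('m, 'n) conn
      \<Rightarrow> ('m, 'n) tensor" where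
  "\<K>bar A \<Omega> \<Gamma> = tadd (\<K> \<Omega> \<Gamma>) (tconst (- (inverse (vol A \<Omega>) * integral_\<Omega>n A \<Omega> (\<K> \<Omega> \<Gamma>))))"

definition Mhat ::
    "('m::topological_space, 'n::finite) chart set \<Rightarrow> ('m, 'n) tensor \<Rightarrow> ('m, 'n) conn
      \<Rightarrow> real \<Rightarrow> real \<Rightarrow> ('m, 'n) conn
      \<Rightarrow> ('m, 'n) tensor \<times> ('m, 'n) tensor \<times> ('m, 'n) tensor" where
  "Mhat A \<Omega> \<Gamma>0 a b \<Gamma> =
     (tscale b (tadd (tconst (inverse (vol A \<Omega>))) (\<K>bar A \<Omega> \<Gamma>)),
      tscale (3 * a) (Ric \<Gamma>),
      tscale (3 * inverse b * a\<^sup>2) (conn_diff \<Omega> \<Gamma> \<Gamma>0))"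

definition NN ::
    "('m::topological_space, 'n::finite) chart set \<Rightarrow> ('m, 'n) tensor \<Rightarrow> ('m, 'n) conn
      \<Rightarrow> real \<Rightarrow> real \<Rightarrow> ('m, 'n) conn \<Rightarrow> real" where
  "NN A \<Omega> \<Gamma>0 a b \<Gamma> = pairing023 A \<Omega> (Mhat A \<Omega> \<Gamma>0 a b \<Gamma>) (Mhat A \<Omega> \<Gamma>0 a b \<Gamma>)"

text \<open>The first variation of \<open>F\<close> at \<open>\<Gamma>\<close> in the direction \<open>P\<close> exists and equals \<open>D\<close>.\<close>

definition has_first_variation ::
    "('m, 'n::finite) tensor \<Rightarrow> (('m, 'n) conn \<Rightarrow> real) \<Rightarrow> ('m, 'n) conn \<Rightarrow> ('m, 'n) tensor
      \<Rightarrow> real \<Rightarrow> bool" where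
  "has_first_variation \<Omega> F \<Gamma> P D \<longleftrightarrow>
     ((\<lambda>\<epsilon>. F (conn_add \<Omega> \<Gamma> (tscale \<epsilon> P))) has_real_derivative D) (at 0)"

definition critical_point ::
    "('m, 'n::finite) chart set \<Rightarrow> ('m, 'n) tensor \<Rightarrow> (('m, 'n) conn \<Rightarrow> real) \<Rightarrow> ('m, 'n) conn
      \<Rightarrow> bool" where
  "critical_point A \<Omega> F \<Gamma> \<longleftrightarrow>
     \<Gamma> \<in> SConn A \<Omega> \<and> (\<forall>P\<in>Sk A 3. has_first_variation \<Omega> F \<Gamma> P 0)"

end

theory Submission
  imports Defs
begin

text \<open>The functional splits by degree. In degree 3 it vanishes identically: \<open>\<Omega>\<^sup>i\<^sup>j\<close> is skew, so the pairing is
  skew on tensors of odd degree. In degree 0 it is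
  \<open>t\<^sup>2 \<integral> K\<^sup>2\<close> up to terms in the total \<open>\<integral> K\<close>, and in degree 2 it is \<open>s\<^sup>2 \<integral> \<langle>Ric, Ric\<rangle>\<close> (\<open>NN_eq\<close>).

  Along \<open>\<nabla> + \<epsilon> \<Pi>\<close> the variation of \<open>Ric\<close> is \<open>- div \<Pi>\<close>. Since divergence and covariant derivative are
  adjoint (\<open>integration_by_parts\<close>) and \<open>\<Pi>\<close> is symmetric, the second term varies by
  \<open>- 2 s\<^sup>2 \<integral> \<langle>\<nabla> Ric, \<Pi>\<rangle> = 2 s\<^sup>2 \<langle>\<langle>\<delta>\<^sup>* Ric, \<Pi>\<rangle>\<rangle>\<close>. For the first term the essential fact is that
  \<open>\<integral> f K\<close> varies by \<open>\<langle>\<langle>\<H>(f), \<Pi>\<rangle>\<rangle>\<close> for every function \<open>f\<close> (\<open>integral_\<K>_deriv\<close>): \<open>K\<close> is a moment map for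
  the action of Hamiltonian diffeomorphisms. It follows by moving the two divergences in \<open>K\<close> to
  \<open>f\<close>, differentiating in \<open>\<epsilon>\<close>, and integrating by parts once more; the result is \<open>\<H>(f)\<close> by the
  contracted second Bianchi identity, which for symplectic connections reads \<open>div R = \<nabla> Ric\<close>.
  With \<open>f = 1\<close> it shows that the total \<open>\<integral> K\<close> does not vary, with \<open>f = K(\<nabla>)\<close> that \<open>\<integral> K\<^sup>2\<close> varies by
  \<open>2 \<langle>\<langle>\<H>(K), \<Pi>\<rangle>\<rangle>\<close>. The equation for critical points is then the nondegeneracy of the pairing
  (\<open>pairing_nondegenerate\<close>), as the left-hand side of the equation is itself a symmetric tensor.

  Differentiation under the integral sign is harmless because every quantity involved is
  polynomial in \<open>\<epsilon>\<close>. Integration by parts rests on the divergence theorem (\<open>integral_diverg\<close>): the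
  coefficient of \<open>\<Omega>\<^sub>n\<close> is a Pfaffian, which transforms by the Jacobian determinant and is parallel for a
  symplectic connection, so that in a chart divergences are coordinate divergences of
  densities, and these are glued by a partition of unity.

  Tensors with lower indices are handled slot by slot, by recursion on the list of indices:
  \<open>tr\<close> changes coordinates, \<open>dop\<close> is the action of a matrix as a derivation, and \<open>fcf\<close> is the full
  contraction of two tensors.\<close>

section \<open>Smooth functions on open sets\<close>

lemma pd_eqI: "(f has_derivative f') (at x) \<Longrightarrow> pd i f x = f' (axis i 1)"
  unfolding pd_def using frechet_derivative_at by metis

lemma pd_cong:
  assumes "open S" "x \<in> S" "\<And>y. y \<in> S \<Longrightarrow> f y = g y"
  shows "pd i f x = pd i g x"
proof -
  have "(f has_derivative f') (at x) \<longleftrightarrow> (g has_derivative f') (at x)" for f'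
    using has_derivative_transform_within_open[of f f' x UNIV S g]
      has_derivative_transform_within_open[of g f' x UNIV S f] assms by auto
  then show ?thesis unfolding pd_def frechet_derivative_def by simp
qed

lemma differentiable_cong_open:
  assumes "open S" "x \<in> S" "\<And>y. y \<in> S \<Longrightarrow> f y = g y" "f differentiable (at x)"
  shows "g differentiable (at x)"
  using assms has_derivative_transform_within_open[of f _ x UNIV S g]
  unfolding differentiable_def by auto

lemma smooth_on_differentiable: "smooth_on S f \<Longrightarrow> x \<in> S \<Longrightarrow> f differentiable (at x)"
  unfolding smooth_on_def by (metis iterated_pd.simps(1))

lemma smooth_on_subset: "smooth_on S f \<Longrightarrow> T \<subseteq> S \<Longrightarrow> smooth_on T f"
  unfolding smooth_on_def by blast

lemma iterated_pd_snoc: "iterated_pd js (pd i f) = iterated_pd (js @ [i]) f"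
  by (induction js) auto

lemma smooth_on_pd: "smooth_on S f \<Longrightarrow> smooth_on S (pd i f)"
  unfolding smooth_on_def by (simp add: iterated_pd_snoc)

text \<open>Smoothness by coinduction: every closure property below is obtained by exhibiting a class of
  differentiable functions whose partial derivatives stay, locally, in the class. This avoids
  formulas for iterated derivatives of products and composites.\<close>

lemma smooth_on_coinduct:
  assumes S: "open S" and f: "P f"
    and step: "\<And>f. P f \<Longrightarrow> (\<forall>x\<in>S. f differentiable (at x)) \<and>
                 (\<forall>i. \<exists>g. P g \<and> (\<forall>x\<in>S. pd i f x = g x))"
  shows "smooth_on S f"
proof -
  have ex: "\<exists>g. P g \<and> (\<forall>x\<in>S. iterated_pd js f x = g x)" for js
  proof (induction js)
    case Nil
    then show ?case using f by auto
  next
    case (Cons i js)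
    then obtain g where g: "P g" "\<forall>x\<in>S. iterated_pd js f x = g x" by blast
    from step[OF g(1)] obtain h where h: "P h" "\<forall>x\<in>S. pd i g x = h x" by blast
    have "pd i (iterated_pd js f) x = h x" if "x \<in> S" for x
      using pd_cong[OF S that, of "iterated_pd js f" g i] g(2) h(2) that by simp
    then show ?case using h(1) by auto
  qed
  show ?thesis
    unfolding smooth_on_def
  proof (intro allI ballI)
    fix js x assume x: "x \<in> S"
    obtain g where g: "P g" "\<forall>x\<in>S. iterated_pd js f x = g x" using ex by blast
    show "iterated_pd js f differentiable (at x)"
      using differentiable_cong_open[OF S x, of g "iterated_pd js f"] g step[OF g(1)] x by auto
  qed
qed

lemma smooth_on_cong:
  assumes S: "open S" and fg: "\<And>x. x \<in> S \<Longrightarrow> f x = g x" and f: "smooth_on S f"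
  shows "smooth_on S g"
proof (rule smooth_on_coinduct[OF S, of "\<lambda>g. \<exists>f. smooth_on S f \<and> (\<forall>x\<in>S. f x = g x)"])
  show "\<exists>f. smooth_on S f \<and> (\<forall>x\<in>S. f x = g x)" using f fg by auto
next
  fix g assume "\<exists>f. smooth_on S f \<and> (\<forall>x\<in>S. f x = g x)"
  then obtain f where f: "smooth_on S f" "\<forall>x\<in>S. f x = g x" by blast
  have "pd i g x = pd i f x" if "x \<in> S" for i x using pd_cong[OF S that, of g f] f by auto
  moreover have "g differentiable at x" if "x \<in> S" for x
    using differentiable_cong_open[OF S that, of f g] f smooth_on_differentiable that by blast
  ultimately show "(\<forall>x\<in>S. g differentiable at x) \<and>
         (\<forall>i. \<exists>h. (\<exists>f. smooth_on S f \<and> (\<forall>x\<in>S. f x = h x)) \<and> (\<forall>x\<in>S. pd i g x = h x))"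
    using smooth_on_pd[OF f(1)] by metis
qed

lemma smooth_on_local:
  assumes "\<And>x. x \<in> S \<Longrightarrow> \<exists>T. open T \<and> x \<in> T \<and> smooth_on T f"
  shows "smooth_on S f"
  using assms unfolding smooth_on_def by blast

text \<open>The subalgebra generated by \<open>B\<close>, the class to which coinduction is applied.\<close>

inductive_set fun_alg :: "(real^'n::finite \<Rightarrow> real) set \<Rightarrow> (real^'n \<Rightarrow> real) set" for B where
  base: "b \<in> B \<Longrightarrow> b \<in> fun_alg B"
| const: "(\<lambda>x. r) \<in> fun_alg B"
| add: "f \<in> fun_alg B \<Longrightarrow> g \<in> fun_alg B \<Longrightarrow> (\<lambda>x. f x + g x) \<in> fun_alg B"
| mult: "f \<in> fun_alg B \<Longrightarrow> g \<in> fun_alg B \<Longrightarrow> (\<lambda>x. f x * g x) \<in> fun_alg B"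

lemma fun_alg_sum:
  "(\<And>i. i \<in> I \<Longrightarrow> f i \<in> fun_alg B) \<Longrightarrow> (\<lambda>x. \<Sum>i\<in>I. f i x) \<in> fun_alg B"
proof (induction I rule: infinite_finite_induct)
  case (insert i I)
  then show ?case using fun_alg.add[of "f i" B "\<lambda>x. \<Sum>i\<in>I. f i x"] by simp
qed (auto intro: fun_alg.const)

lemma pd_const [simp]: "pd i (\<lambda>x. r) x = 0"
  by (simp add: pd_def)

lemma pd_add:
  assumes "f differentiable (at x)" "g differentiable (at x)"
  shows "pd i (\<lambda>x. f x + g x) x = pd i f x + pd i g x"
proof -
  from assms obtain f' g' where d: "(f has_derivative f') (at x)" "(g has_derivative g') (at x)"
    unfolding differentiable_def by blast
  show ?thesis using pd_eqI[OF has_derivative_add[OF d]] pd_eqI[OF d(1)] pd_eqI[OF d(2)] by simp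
qed

lemma pd_mult:
  assumes "f differentiable (at x)" "g differentiable (at x)"
  shows "pd i (\<lambda>x. f x * g x) x = pd i f x * g x + f x * pd i g x"
proof -
  from assms obtain f' g' where d: "(f has_derivative f') (at x)" "(g has_derivative g') (at x)"
    unfolding differentiable_def by blast
  show ?thesis using pd_eqI[OF has_derivative_mult[OF d]] pd_eqI[OF d(1)] pd_eqI[OF d(2)] by simp
qed

lemma fun_alg_smooth:
  assumes S: "open S"
    and B: "\<And>b. b \<in> B \<Longrightarrow> (\<forall>x\<in>S. b differentiable (at x)) \<and>
                (\<forall>i. \<exists>g\<in>fun_alg B. \<forall>x\<in>S. pd i b x = g x)"
    and f: "f \<in> fun_alg B"
  shows "smooth_on S f"
proof (rule smooth_on_coinduct[OF S, of "\<lambda>f. f \<in> fun_alg B", OF f])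
  fix f assume "f \<in> fun_alg B"
  then show "(\<forall>x\<in>S. f differentiable at x) \<and>
         (\<forall>i. \<exists>g. g \<in> fun_alg B \<and> (\<forall>x\<in>S. pd i f x = g x))"
  proof induction
    case (base b)
    then show ?case using B by blast
  next
    case (const r)
    then show ?case using fun_alg.const[of 0 B] by fastforce
  next
    case (add f g)
    show ?case
    proof (intro conjI ballI allI)
      fix i
      obtain f' g' where "f' \<in> fun_alg B" "\<forall>x\<in>S. pd i f x = f' x"
        "g' \<in> fun_alg B" "\<forall>x\<in>S. pd i g x = g' x" using add by blast
      then show "\<exists>h. h \<in> fun_alg B \<and> (\<forall>x\<in>S. pd i (\<lambda>x. f x + g x) x = h x)"
        using add by (intro exI[of _ "\<lambda>x. f' x + g' x"]) (auto simp: pd_add intro: fun_alg.add)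
    qed (use add in auto)
  next
    case (mult f g)
    show ?case
    proof (intro conjI ballI allI)
      fix i
      obtain f' g' where "f' \<in> fun_alg B" "\<forall>x\<in>S. pd i f x = f' x"
        "g' \<in> fun_alg B" "\<forall>x\<in>S. pd i g x = g' x" using mult by blast
      then show "\<exists>h. h \<in> fun_alg B \<and> (\<forall>x\<in>S. pd i (\<lambda>x. f x * g x) x = h x)"
        using mult by (intro exI[of _ "\<lambda>x. f' x * g x + f x * g' x"])
          (auto simp: pd_mult intro!: fun_alg.add fun_alg.mult)
    qed (use mult in auto)
  qed
qed

lemma fun_alg_smooth_functions:
  assumes S: "open S" and f: "f \<in> fun_alg {g. smooth_on S g}"
  shows "smooth_on S f"
proof (rule fun_alg_smooth[OF S _ f])
  fix b assume "b \<in> {g. smooth_on S g}"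
  then have b: "smooth_on S b" by simp
  show "(\<forall>x\<in>S. b differentiable at x) \<and>
         (\<forall>i. \<exists>g\<in>fun_alg {g. smooth_on S g}. \<forall>x\<in>S. pd i b x = g x)"
    using smooth_on_differentiable[OF b] smooth_on_pd[OF b] fun_alg.base by blast
qed

lemma smooth_on_const: "open S \<Longrightarrow> smooth_on S (\<lambda>x. r)"
  by (rule fun_alg_smooth_functions) (auto intro: fun_alg.const)

lemma smooth_on_add: "open S \<Longrightarrow> smooth_on S f \<Longrightarrow> smooth_on S g \<Longrightarrow> smooth_on S (\<lambda>x. f x + g x)"
  by (rule fun_alg_smooth_functions) (auto intro: fun_alg.intros)

lemma smooth_on_mult: "open S \<Longrightarrow> smooth_on S f \<Longrightarrow> smooth_on S g \<Longrightarrow> smooth_on S (\<lambda>x. f x * g x)"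
  by (rule fun_alg_smooth_functions) (auto intro: fun_alg.intros)

lemma smooth_on_coordinate:
  fixes S :: "(real^'n::finite) set"
  shows "open S \<Longrightarrow> smooth_on S (\<lambda>x. x $ a)"
proof (rule fun_alg_smooth[of S "{\<lambda>x. x $ a}"])
  fix b :: "real^'n \<Rightarrow> real" assume "b \<in> {\<lambda>x. x $ a}"
  then have b: "b = (\<lambda>x. x $ a)" by simp
  have d: "((\<lambda>x::real^'n. x $ a) has_derivative (\<lambda>x. x $ a)) (at x)" for x
    by (simp add: bounded_linear_imp_has_derivative bounded_linear_vec_nth)
  show "(\<forall>x\<in>S. b differentiable at x) \<and> (\<forall>i. \<exists>g\<in>fun_alg {\<lambda>x. x $ a}. \<forall>x\<in>S. pd i b x = g x)"
    unfolding b
  proof (intro conjI ballI allI)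
    show "\<exists>g\<in>fun_alg {\<lambda>x::real^'n. x $ a}. \<forall>x\<in>S. pd i (\<lambda>x. x $ a) x = g x" for i
      using pd_eqI[OF d, of i] by (intro bexI[OF _ fun_alg.const[of "axis i 1 $ a"]]) auto
  qed (use d differentiableI in auto)
qed (auto intro: fun_alg.base)

text \<open>Composition with a function of one variable, given with all its derivatives \<open>h k\<close>.\<close>

lemma smooth_on_compose_real:
  assumes S: "open S" and u: "smooth_on S u"
    and h: "\<And>k x. x \<in> S \<Longrightarrow> (h k has_real_derivative h (Suc k) (u x)) (at (u x))"
  shows "smooth_on S (\<lambda>x. h 0 (u x))"
proof (rule fun_alg_smooth[OF S, of "{g. smooth_on S g} \<union> (\<lambda>k x. h k (u x)) ` UNIV"])
  let ?B = "{g. smooth_on S g} \<union> (\<lambda>k x. h k (u x)) ` UNIV"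
  fix b assume "b \<in> ?B"
  then consider "smooth_on S b" | k where "b = (\<lambda>x. h k (u x))" by auto
  then show "(\<forall>x\<in>S. b differentiable at x) \<and> (\<forall>i. \<exists>g\<in>fun_alg ?B. \<forall>x\<in>S. pd i b x = g x)"
  proof cases
    case 1
    then show ?thesis
      using smooth_on_differentiable[OF 1] smooth_on_pd[OF 1] fun_alg.base[of _ ?B] by blast
  next
    case (2 k)
    have d: "\<exists>u'. (u has_derivative u') (at x) \<and>
        (b has_derivative (\<lambda>y. h (Suc k) (u x) * u' y)) (at x)" if x: "x \<in> S" for x
    proof -
      obtain u' where u': "(u has_derivative u') (at x)"
        using smooth_on_differentiable[OF u x] differentiable_def by blast
      have "(h k has_derivative (*) (h (Suc k) (u x))) (at (u x))"
        using h[OF x] by (simp add: has_field_derivative_def)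
      then have "(b has_derivative (\<lambda>y. h (Suc k) (u x) * u' y)) (at x)"
        using has_derivative_compose[OF u'] 2 by auto
      then show ?thesis using u' by blast
    qed
    have "pd i b x = h (Suc k) (u x) * pd i u x" if "x \<in> S" for i x
    proof -
      from d[OF that] obtain u' where "(u has_derivative u') (at x)"
        "(b has_derivative (\<lambda>y. h (Suc k) (u x) * u' y)) (at x)" by blast
      from pd_eqI[OF this(1)] pd_eqI[OF this(2)] show ?thesis by simp
    qed
    moreover have "(\<lambda>x. h (Suc k) (u x) * pd i u x) \<in> fun_alg ?B" for i
      using smooth_on_pd[OF u, of i] by (intro fun_alg.mult fun_alg.base) auto
    moreover have "\<forall>x\<in>S. b differentiable (at x)" using d differentiableI by blast
    ultimately show ?thesis by meson
  qed
qed (auto intro!: fun_alg.base)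

lemma smooth_on_inverse:
  fixes f :: "real^'n::finite \<Rightarrow> real"
  assumes S: "open S" and u: "smooth_on S f" and nz: "\<And>x. x \<in> S \<Longrightarrow> f x \<noteq> 0"
  shows "smooth_on S (\<lambda>x. inverse (f x))"
proof -
  define h where "h = (\<lambda>k x. (- 1) ^ k * fact k * inverse (x::real) ^ Suc k)"
  have "((\<lambda>x. inverse x ^ Suc k) has_real_derivative - (1 + real k) * inverse x ^ Suc (Suc k)) (at x)"
    if "x \<noteq> 0" for x :: real and k
    using DERIV_power[OF DERIV_inverse[OF that], of "Suc k"] by (simp add: algebra_simps)
  then have "(h k has_real_derivative (- 1) ^ k * fact k * (- (1 + real k) * inverse (f x) ^ Suc (Suc k))) (at (f x))"
    if "x \<in> S" for k x
    unfolding h_def using nz[OF that] by (intro DERIV_cmult) simp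
  moreover have "(- 1) ^ k * fact k * (- (1 + real k) * inverse (f x) ^ Suc (Suc k)) = h (Suc k) (f x)" for k x
    by (simp add: h_def algebra_simps)
  ultimately have "(h k has_real_derivative h (Suc k) (f x)) (at (f x))" if "x \<in> S" for k x
    using that by simp
  from smooth_on_compose_real[OF S u, of h, OF this] show ?thesis by (simp add: h_def)
qed

lemma sum_axis:
  fixes v :: "'k::finite \<Rightarrow> real"
  shows "(\<Sum>a\<in>UNIV. v a *\<^sub>R axis a 1) = (\<chi> a. v a)"
  by (simp add: vec_eq_iff axis_def if_distrib[of "\<lambda>x. _ * x"] cong: if_cong)

text \<open>By the chain rule, the composites with smooth functions together with the derivatives of \<open>\<phi>\<close> generate
  an algebra that is closed under differentiation.\<close>

lemma smooth_on_compose: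
  fixes \<phi> :: "real^'n::finite \<Rightarrow> real^'k::finite"
  assumes S: "open S" and T: "open T" and \<phi>: "\<And>a. smooth_on S (\<lambda>x. \<phi> x $ a)"
    and im: "\<phi> ` S \<subseteq> T" and f: "smooth_on T f"
  shows "smooth_on S (\<lambda>x. f (\<phi> x))"
    and "\<And>x i. x \<in> S \<Longrightarrow> pd i (\<lambda>x. f (\<phi> x)) x = (\<Sum>a\<in>UNIV. pd a f (\<phi> x) * pd i (\<lambda>x. \<phi> x $ a) x)"
proof -
  have deriv: "(\<lambda>x. g (\<phi> x)) differentiable (at x) \<and>
      (\<forall>i. pd i (\<lambda>x. g (\<phi> x)) x = (\<Sum>a\<in>UNIV. pd a g (\<phi> x) * pd i (\<lambda>x. \<phi> x $ a) x))"
    if x: "x \<in> S" and g: "smooth_on T g" for g x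
  proof -
    have "\<forall>a. \<exists>D. ((\<lambda>x. \<phi> x $ a) has_derivative D) (at x)"
      using smooth_on_differentiable[OF \<phi> x] differentiable_def by blast
    then obtain D where D: "\<And>a. ((\<lambda>x. \<phi> x $ a) has_derivative D a) (at x)" by metis
    have \<phi>': "(\<phi> has_derivative (\<lambda>h. \<chi> a. D a h)) (at x)"
    proof -
      have "((\<lambda>x. \<Sum>a\<in>UNIV. \<phi> x $ a *\<^sub>R axis a (1::real)) has_derivative (\<lambda>h. \<Sum>a\<in>UNIV. D a h *\<^sub>R axis a 1)) (at x)"
        by (intro has_derivative_sum has_derivative_scaleR_left D)
      then have "((\<lambda>x. \<chi> a. \<phi> x $ a) has_derivative (\<lambda>h. \<chi> a. D a h)) (at x)"
        by (simp only: sum_axis)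
      then show ?thesis by (simp only: vec_lambda_eta)
    qed
    obtain g' where g': "(g has_derivative g') (at (\<phi> x))"
      using smooth_on_differentiable[OF g] im x differentiable_def by blast
    have lin: "linear g'" using g' has_derivative_linear by blast
    have c: "((\<lambda>x. g (\<phi> x)) has_derivative (\<lambda>h. g' (\<chi> a. D a h))) (at x)"
      using has_derivative_compose[OF \<phi>' g'] .
    have "g' v = (\<Sum>a\<in>UNIV. g' (axis a 1) * v $ a)" for v
    proof -
      have "v = (\<Sum>a\<in>UNIV. v $ a *\<^sub>R axis a 1)"
        using sum_axis[of "\<lambda>a. v $ a"] by (simp only: vec_lambda_eta)
      then have "g' v = g' (\<Sum>a\<in>UNIV. v $ a *\<^sub>R axis a 1)" by simp
      also have "\<dots> = (\<Sum>a\<in>UNIV. g' (axis a 1) * v $ a)"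
        using lin by (simp add: linear_sum linear_scale mult.commute)
      finally show ?thesis .
    qed
    from this[of "\<chi> a. D a (axis i 1)" for i]
    have "pd i (\<lambda>x. g (\<phi> x)) x = (\<Sum>a\<in>UNIV. pd a g (\<phi> x) * pd i (\<lambda>x. \<phi> x $ a) x)" for i
      by (simp only: pd_eqI[OF c] pd_eqI[OF g'] pd_eqI[OF D] vec_lambda_beta)
    then show ?thesis using c differentiableI by blast
  qed
  show "\<And>x i. x \<in> S \<Longrightarrow> pd i (\<lambda>x. f (\<phi> x)) x = (\<Sum>a\<in>UNIV. pd a f (\<phi> x) * pd i (\<lambda>x. \<phi> x $ a) x)"
    using deriv f by blast
  let ?B = "{g. smooth_on S g} \<union> (\<lambda>g x. g (\<phi> x)) ` {g. smooth_on T g}"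
  show "smooth_on S (\<lambda>x. f (\<phi> x))"
  proof (rule fun_alg_smooth[OF S, of ?B])
    fix b assume "b \<in> ?B"
    then consider "smooth_on S b" | g where "b = (\<lambda>x. g (\<phi> x))" "smooth_on T g" by auto
    then show "(\<forall>x\<in>S. b differentiable at x) \<and> (\<forall>i. \<exists>g\<in>fun_alg ?B. \<forall>x\<in>S. pd i b x = g x)"
    proof cases
      case 1
      then show ?thesis
        using smooth_on_differentiable[OF 1] smooth_on_pd[OF 1] fun_alg.base[of _ ?B] by blast
    next
      case (2 g)
      have "(\<lambda>x. \<Sum>a\<in>UNIV. pd a g (\<phi> x) * pd i (\<lambda>x. \<phi> x $ a) x) \<in> fun_alg ?B" for i
        using smooth_on_pd[OF 2(2)] smooth_on_pd[OF \<phi>] by (intro fun_alg_sum fun_alg.mult fun_alg.base) auto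
      then show ?thesis using deriv[OF _ 2(2)] 2(1) by meson
    qed
  qed (use f in \<open>auto intro!: fun_alg.base\<close>)
qed

lemma DERIV_along_axis:
  assumes "f differentiable (at (y + s *\<^sub>R axis i 1))"
  shows "((\<lambda>s. f (y + s *\<^sub>R axis i 1)) has_real_derivative pd i f (y + s *\<^sub>R axis i 1)) (at s)"
proof -
  obtain f' where f': "(f has_derivative f') (at (y + s *\<^sub>R axis i 1))"
    using assms differentiable_def by blast
  have "((\<lambda>s. y + s *\<^sub>R axis i 1) has_derivative (\<lambda>h. h *\<^sub>R axis i 1)) (at s)"
    by (auto intro!: derivative_eq_intros)
  from has_derivative_compose[OF this f']
  have "((\<lambda>s. f (y + s *\<^sub>R axis i 1)) has_derivative (\<lambda>h. f' (h *\<^sub>R axis i 1))) (at s)" .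
  moreover have "f' (h *\<^sub>R axis i 1) = pd i f (y + s *\<^sub>R axis i 1) * h" for h
    using has_derivative_linear[OF f'] pd_eqI[OF f', of i] by (simp add: linear_scale mult.commute)
  ultimately show ?thesis by (simp add: has_field_derivative_def)
qed

lemma second_difference:
  fixes f :: "real^'n::finite \<Rightarrow> real"
  assumes f: "smooth_on S f" and h: "0 < h"
    and box: "\<And>s t. 0 \<le> s \<Longrightarrow> s \<le> h \<Longrightarrow> 0 \<le> t \<Longrightarrow> t \<le> h \<Longrightarrow> x + s *\<^sub>R axis i 1 + t *\<^sub>R axis j 1 \<in> S"
  obtains s t where "0 < s" "s < h" "0 < t" "t < h"
    "f (x + h *\<^sub>R axis i 1 + h *\<^sub>R axis j 1) - f (x + h *\<^sub>R axis i 1) - f (x + h *\<^sub>R axis j 1) + f x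
      = h\<^sup>2 * pd j (pd i f) (x + s *\<^sub>R axis i 1 + t *\<^sub>R axis j 1)"
proof -
  define u where "u = (\<lambda>s t. x + s *\<^sub>R axis i 1 + t *\<^sub>R (axis j 1 :: real^'n))"
  have u1: "u s t = (x + t *\<^sub>R axis j 1) + s *\<^sub>R axis i 1" for s t by (simp add: u_def)
  have d1: "((\<lambda>s. f (u s t)) has_real_derivative pd i f (u s t)) (at s)"
    if "0 \<le> s" "s \<le> h" "0 \<le> t" "t \<le> h" for s t
    unfolding u1 using box[OF that] smooth_on_differentiable[OF f]
    by (intro DERIV_along_axis) (simp add: ac_simps)
  have d2: "((\<lambda>t. pd i f (u s t)) has_real_derivative pd j (pd i f) (u s t)) (at t)"
    if "0 \<le> s" "s \<le> h" "0 \<le> t" "t \<le> h" for s t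
    unfolding u_def using box[OF that] smooth_on_differentiable[OF smooth_on_pd[OF f]]
    by (intro DERIV_along_axis) (simp add: ac_simps)
  have "\<exists>s. 0 < s \<and> s < h \<and> (f (u h h) - f (u h 0)) - (f (u 0 h) - f (u 0 0))
      = (h - 0) * (pd i f (u s h) - pd i f (u s 0))"
    using h d1 by (intro MVT2[of 0 h "\<lambda>s. f (u s h) - f (u s 0)"]) (auto intro!: DERIV_diff)
  then obtain s where s: "0 < s" "s < h" "(f (u h h) - f (u h 0)) - (f (u 0 h) - f (u 0 0))
      = (h - 0) * (pd i f (u s h) - pd i f (u s 0))" by blast
  have "\<exists>t. 0 < t \<and> t < h \<and> pd i f (u s h) - pd i f (u s 0) = (h - 0) * pd j (pd i f) (u s t)"
    using h d2 s by (intro MVT2) auto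
  then obtain t where "0 < t" "t < h"
    "pd i f (u s h) - pd i f (u s 0) = (h - 0) * pd j (pd i f) (u s t)" by blast
  with s show thesis by (intro that[of s t]) (auto simp: u_def power2_eq_square algebra_simps)
qed

text \<open>Symmetry of second derivatives: both mixed derivatives are limits of the same symmetric second
  difference quotient.\<close>

lemma pd_commute:
  assumes S: "open S" and f: "smooth_on S f" and x: "x \<in> S"
  shows "pd i (pd j f) x = pd j (pd i f) x"
proof -
  have "\<bar>pd i (pd j f) x - pd j (pd i f) x\<bar> \<le> 2 * e" if e: "e > 0" for e
  proof -
    have c: "isCont (pd i (pd j f)) x" "isCont (pd j (pd i f)) x"
      using smooth_on_differentiable[OF smooth_on_pd[OF smooth_on_pd[OF f]] x]
        differentiable_imp_continuous_within by blast+
    from c[unfolded continuous_at_eps_delta] e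
    obtain d1 d2 where d: "d1 > 0" "d2 > 0"
      "\<And>y. dist y x < d1 \<Longrightarrow> dist (pd i (pd j f) y) (pd i (pd j f) x) < e"
      "\<And>y. dist y x < d2 \<Longrightarrow> dist (pd j (pd i f) y) (pd j (pd i f) x) < e" by metis
    obtain d3 where d3: "d3 > 0" "ball x d3 \<subseteq> S" using S x open_contains_ball by blast
    define h where "h = min d1 (min d2 d3) / 3"
    have h: "h > 0" using d d3 by (simp add: h_def)
    have near: "dist (x + s *\<^sub>R axis i 1 + t *\<^sub>R axis j 1) x < min d1 (min d2 d3)"
      if "0 \<le> s" "s \<le> h" "0 \<le> t" "t \<le> h" for s t i j
    proof -
      have "dist (x + s *\<^sub>R axis i 1 + t *\<^sub>R axis j 1) x = norm (s *\<^sub>R axis i (1::real) + t *\<^sub>R axis j 1)"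
        by (simp add: dist_norm)
      also have "\<dots> \<le> s + t" using that norm_triangle_ineq[of "s *\<^sub>R axis i (1::real)" "t *\<^sub>R axis j 1"]
        by (simp add: norm_axis_1)
      also have "\<dots> < min d1 (min d2 d3)" using that h by (simp add: h_def)
      finally show ?thesis .
    qed
    have box: "x + s *\<^sub>R axis i 1 + t *\<^sub>R axis j 1 \<in> S"
      if "0 \<le> s" "s \<le> h" "0 \<le> t" "t \<le> h" for s t i j
      using near[OF that, of i j] d3(2) by (auto simp: dist_commute)
    obtain s t where st: "0 < s" "s < h" "0 < t" "t < h"
      "f (x + h *\<^sub>R axis i 1 + h *\<^sub>R axis j 1) - f (x + h *\<^sub>R axis i 1) - f (x + h *\<^sub>R axis j 1) + f x
      = h\<^sup>2 * pd j (pd i f) (x + s *\<^sub>R axis i 1 + t *\<^sub>R axis j 1)"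
      using second_difference[OF f h, of x i j] box by blast
    obtain s' t' where st': "0 < s'" "s' < h" "0 < t'" "t' < h"
      "f (x + h *\<^sub>R axis j 1 + h *\<^sub>R axis i 1) - f (x + h *\<^sub>R axis j 1) - f (x + h *\<^sub>R axis i 1) + f x
      = h\<^sup>2 * pd i (pd j f) (x + s' *\<^sub>R axis j 1 + t' *\<^sub>R axis i 1)"
      using second_difference[OF f h, of x j i] box by blast
    have "h\<^sup>2 * pd j (pd i f) (x + s *\<^sub>R axis i 1 + t *\<^sub>R axis j 1)
        = h\<^sup>2 * pd i (pd j f) (x + s' *\<^sub>R axis j 1 + t' *\<^sub>R axis i 1)"
      unfolding st(5)[symmetric] st'(5)[symmetric] by (simp add: ac_simps)
    then have eq: "pd j (pd i f) (x + s *\<^sub>R axis i 1 + t *\<^sub>R axis j 1)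
        = pd i (pd j f) (x + s' *\<^sub>R axis j 1 + t' *\<^sub>R axis i 1)" using h by simp
    have "dist (pd j (pd i f) (x + s *\<^sub>R axis i 1 + t *\<^sub>R axis j 1)) (pd j (pd i f) x) < e"
      using d(4) near[of s t i j] st by auto
    moreover have "dist (pd i (pd j f) (x + s' *\<^sub>R axis j 1 + t' *\<^sub>R axis i 1)) (pd i (pd j f) x) < e"
      using d(3) near[of s' t' j i] st' by auto
    ultimately show ?thesis unfolding eq dist_real_def by linarith
  qed
  then have "\<bar>pd i (pd j f) x - pd j (pd i f) x\<bar> \<le> 0 + e" if "e > 0" for e
    using that by (metis add_0 field_sum_of_halves half_gt_zero mult_2)
  from field_le_epsilon[OF this] show ?thesis by simp
qed

text \<open>The derivatives of \<open>exp (- 1 / t)\<close>, extended by \<open>0\<close> to \<open>t \<le> 0\<close>, are polynomials in \<open>1 / t\<close> times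
  the same function, and the exponential beats every polynomial at \<open>0\<close>.\<close>

primrec flat_poly :: "nat \<Rightarrow> real poly" where
  "flat_poly 0 = 1"
| "flat_poly (Suc k) = [:0, 0, 1:] * (flat_poly k - pderiv (flat_poly k))"

definition flat :: "nat \<Rightarrow> real \<Rightarrow> real" where
  "flat k t = (if t > 0 then poly (flat_poly k) (inverse t) * exp (- inverse t) else 0)"

lemma poly_div_exp_tendsto_0: "((\<lambda>x. poly p x * exp (- x)) \<longlongrightarrow> (0::real)) at_top"
proof -
  have "((\<lambda>x. \<Sum>i\<le>degree p. coeff p i * (x ^ i / exp x)) \<longlongrightarrow> (\<Sum>i\<le>degree p. coeff p i * 0)) at_top"
    by (intro tendsto_sum tendsto_mult tendsto_const tendsto_power_div_exp_0)
  then show ?thesis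
    by (simp add: poly_altdef sum_distrib_right exp_minus divide_inverse mult.assoc)
qed

lemma flat_DERIV: "(flat k has_real_derivative flat (Suc k) t) (at t)"
proof -
  consider "t > 0" | "t < 0" | "t = 0" by linarith
  then show ?thesis
  proof cases
    case 1
    have "((\<lambda>t. poly (flat_poly k) (inverse t) * exp (- inverse t)) has_real_derivative flat (Suc k) t) (at t)"
      using 1 by (auto intro!: derivative_eq_intros DERIV_chain2[OF poly_DERIV]
          simp: flat_def algebra_simps power2_eq_square)
    then show ?thesis
      using has_field_derivative_transform_within_open[of _ _ t "{0<..}" "flat k"] 1 by (auto simp: flat_def)
  next
    case 2
    have "((\<lambda>t. 0) has_real_derivative flat (Suc k) t) (at t)" using 2 by (simp add: flat_def)
    then show ?thesis
      using has_field_derivative_transform_within_open[of "\<lambda>_. 0" _ t "{..<0}" "flat k"] 2 by (auto simp: flat_def)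
  next
    case 3
    have "((\<lambda>y. flat k y / y) \<longlongrightarrow> 0) (at_right 0)"
    proof -
      have "((\<lambda>x. poly ([:0, 1:] * flat_poly k) x * exp (- x)) \<longlongrightarrow> (0::real)) at_top"
        by (rule poly_div_exp_tendsto_0)
      then have "((\<lambda>x. flat k (inverse x) / inverse x) \<longlongrightarrow> 0) at_top"
        by (rule Lim_transform_eventually)
          (auto simp: flat_def divide_inverse intro!: eventually_mono[OF eventually_gt_at_top[of 0]])
      then show ?thesis by (simp add: filterlim_at_right_to_top)
    qed
    moreover have "((\<lambda>y. flat k y / y) \<longlongrightarrow> 0) (at_left 0)"
      by (rule tendsto_eventually) (auto simp: flat_def eventually_at_left_field intro!: exI[of _ "-1"])
    ultimately have "((\<lambda>y. flat k y / y) \<longlongrightarrow> 0) (at 0)"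
      by (simp add: filterlim_at_split)
    then show ?thesis using 3 by (simp add: has_field_derivative_iff flat_def)
  qed
qed

lemma smooth_on_uminus: "open S \<Longrightarrow> smooth_on S f \<Longrightarrow> smooth_on S (\<lambda>x. - f x)"
  using smooth_on_mult[OF _ smooth_on_const[of S "-1"], of f] by simp

lemma smooth_on_diff: "open S \<Longrightarrow> smooth_on S f \<Longrightarrow> smooth_on S g \<Longrightarrow> smooth_on S (\<lambda>x. f x - g x)"
  using smooth_on_add[OF _ _ smooth_on_uminus, of S f g] by simp

lemma smooth_on_sum:
  "open S \<Longrightarrow> (\<And>i. i \<in> I \<Longrightarrow> smooth_on S (f i)) \<Longrightarrow> smooth_on S (\<lambda>x. \<Sum>i\<in>I. f i x)"
  by (induction I rule: infinite_finite_induct) (auto intro: smooth_on_const smooth_on_add)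

lemma smooth_on_prod:
  "open S \<Longrightarrow> (\<And>i. i \<in> I \<Longrightarrow> smooth_on S (f i)) \<Longrightarrow> smooth_on S (\<lambda>x. \<Prod>i\<in>I. f i x)"
  by (induction I rule: infinite_finite_induct) (auto intro: smooth_on_const smooth_on_mult)

text \<open>The function \<open>flat 0\<close> of \<open>r\<^sup>2 - \<bar>x - a\<bar>\<^sup>2\<close>.\<close>

lemma exists_smooth_bump:
  fixes a :: "real^'n::finite"
  obtains \<phi> where "smooth_on UNIV \<phi>" "\<And>x. 0 \<le> \<phi> x" "\<And>x. \<phi> x \<noteq> 0 \<longleftrightarrow> x \<in> ball a r"
proof -
  consider "r > 0" | "r \<le> 0" by linarith
  then show thesis
  proof cases
    case 1
    define u where "u = (\<lambda>x. r\<^sup>2 - (\<Sum>i\<in>UNIV. (x $ i - a $ i) * (x $ i - a $ i)))"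
    have u: "u x = r\<^sup>2 - (dist a x)\<^sup>2" for x
      unfolding u_def dist_norm power2_norm_eq_inner inner_vec_def
      by (simp add: algebra_simps sum_subtractf sum.distrib)
    have "smooth_on UNIV u"
      unfolding u_def by (intro smooth_on_diff smooth_on_sum smooth_on_mult smooth_on_const smooth_on_coordinate) auto
    then have "smooth_on UNIV (\<lambda>x. flat 0 (u x))"
      using smooth_on_compose_real[OF open_UNIV, of u flat] flat_DERIV by blast
    moreover have "u x > 0 \<longleftrightarrow> x \<in> ball a r" for x
    proof -
      have "(dist a x)\<^sup>2 < r\<^sup>2 \<longleftrightarrow> dist a x < r"
        using 1 power2_less_imp_less[of "dist a x" r] power_strict_mono[of "dist a x" r 2]
        by (metis less_imp_le pos2 zero_le_dist)
      then show ?thesis by (simp add: u)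
    qed
    then have "flat 0 (u x) \<noteq> 0 \<longleftrightarrow> x \<in> ball a r" for x by (simp add: flat_def)
    moreover have "0 \<le> flat 0 (u x)" for x by (simp add: flat_def)
    ultimately show thesis using that by blast
  next
    case 2
    then show thesis using that[of "\<lambda>x. 0"] smooth_on_const by (auto simp: ball_empty)
  qed
qed

lemma smooth_on_continuous: "smooth_on S f \<Longrightarrow> continuous_on S f"
  by (meson continuous_at_imp_continuous_on differentiable_imp_continuous_within smooth_on_differentiable)

section \<open>The differential algebra of smooth functions in a chart\<close>

definition smf :: "('m, 'n::finite) chart \<Rightarrow> 'm set \<Rightarrow> ('m \<Rightarrow> real) \<Rightarrow> bool" where
  "smf c W F \<longleftrightarrow> smooth_on (coords c ` W) (in_chart c F)"

locale chart_domain =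
  fixes c :: "('m::topological_space, 'n::finite) chart" and W :: "'m set"
  assumes open_W: "open W" and W_cdom: "W \<subseteq> cdom c" and inj_coords: "inj_on (coords c) (cdom c)"
    and open_image: "open (coords c ` W)"
begin

lemma in_chart_coords: "p \<in> cdom c \<Longrightarrow> in_chart c F (coords c p) = F p"
  by (simp add: in_chart_def inv_into_f_f inj_coords)

lemma in_chart_coords_W [simp]: "p \<in> W \<Longrightarrow> in_chart c F (coords c p) = F p"
  using in_chart_coords W_cdom by blast

lemma in_chart_cong: "(\<And>p. p \<in> W \<Longrightarrow> F p = G p) \<Longrightarrow> x \<in> coords c ` W \<Longrightarrow> in_chart c F x = in_chart c G x"
  by auto

lemma smf_cong: "smf c W F \<Longrightarrow> (\<And>p. p \<in> W \<Longrightarrow> F p = G p) \<Longrightarrow> smf c W G"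
  unfolding smf_def
  by (rule smooth_on_cong[OF open_image, of "in_chart c F"]) (auto intro: in_chart_cong simp del: image_iff)

lemma chart_pd_cong: "p \<in> W \<Longrightarrow> (\<And>q. q \<in> W \<Longrightarrow> F q = G q) \<Longrightarrow> chart_pd c i F p = chart_pd c i G p"
  unfolding chart_pd_def by (rule pd_cong[OF open_image]) (auto intro: in_chart_cong)

lemma smf_differentiable: "smf c W F \<Longrightarrow> p \<in> W \<Longrightarrow> in_chart c F differentiable (at (coords c p))"
  unfolding smf_def using smooth_on_differentiable by blast

lemma smf_chart_pd [intro]: "smf c W F \<Longrightarrow> smf c W (chart_pd c i F)"
  unfolding smf_def
proof (rule smooth_on_cong[OF open_image])
  assume "smooth_on (coords c ` W) (in_chart c F)"
  then show "smooth_on (coords c ` W) (pd i (in_chart c F))" by (rule smooth_on_pd)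
  show "pd i (in_chart c F) x = in_chart c (chart_pd c i F) x" if "x \<in> coords c ` W" for x
    using that by (auto simp: chart_pd_def)
qed

lemma chart_pd_commute:
  assumes "smf c W F" "p \<in> W"
  shows "chart_pd c i (chart_pd c j F) p = chart_pd c j (chart_pd c i F) p"
proof -
  have "pd i (in_chart c (chart_pd c j F)) (coords c p) = pd i (pd j (in_chart c F)) (coords c p)" for i j
  proof (rule pd_cong[OF open_image])
    show "coords c p \<in> coords c ` W" using assms by simp
    show "in_chart c (chart_pd c j F) y = pd j (in_chart c F) y" if "y \<in> coords c ` W" for y
      using that by (auto simp: chart_pd_def)
  qed
  moreover have "pd i (pd j (in_chart c F)) (coords c p) = pd j (pd i (in_chart c F)) (coords c p)"
    using pd_commute[OF open_image] assms by (simp add: smf_def)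
  ultimately have "pd i (in_chart c (chart_pd c j F)) (coords c p) = pd j (in_chart c (chart_pd c i F)) (coords c p)"
    by simp
  then show ?thesis by (simp add: chart_pd_def[of c i "chart_pd c j F"] chart_pd_def[of c j "chart_pd c i F"])
qed

lemma smf_const [simp, intro]: "smf c W (\<lambda>p. r)"
  unfolding smf_def in_chart_def using smooth_on_const[OF open_image] .

lemma smf_add [intro]: "smf c W F \<Longrightarrow> smf c W G \<Longrightarrow> smf c W (\<lambda>p. F p + G p)"
  unfolding smf_def in_chart_def using smooth_on_add[OF open_image] .

lemma smf_mult [intro]: "smf c W F \<Longrightarrow> smf c W G \<Longrightarrow> smf c W (\<lambda>p. F p * G p)"
  unfolding smf_def in_chart_def using smooth_on_mult[OF open_image] .

lemma smf_uminus [intro]: "smf c W F \<Longrightarrow> smf c W (\<lambda>p. - F p)"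
  unfolding smf_def in_chart_def using smooth_on_uminus[OF open_image] .

lemma smf_diff [intro]: "smf c W F \<Longrightarrow> smf c W G \<Longrightarrow> smf c W (\<lambda>p. F p - G p)"
  unfolding smf_def in_chart_def using smooth_on_diff[OF open_image] .

lemma smf_sum [intro]: "(\<And>i. i \<in> I \<Longrightarrow> smf c W (F i)) \<Longrightarrow> smf c W (\<lambda>p. \<Sum>i\<in>I. F i p)"
  unfolding smf_def in_chart_def using smooth_on_sum[OF open_image] .

lemma smf_prod [intro]: "(\<And>i. i \<in> I \<Longrightarrow> smf c W (F i)) \<Longrightarrow> smf c W (\<lambda>p. \<Prod>i\<in>I. F i p)"
  unfolding smf_def in_chart_def using smooth_on_prod[OF open_image] .

lemma smf_inverse [intro]:
  assumes "smf c W F" "\<And>p. p \<in> W \<Longrightarrow> F p \<noteq> 0"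
  shows "smf c W (\<lambda>p. inverse (F p))"
proof -
  have "in_chart c F x \<noteq> 0" if "x \<in> coords c ` W" for x
    using that assms(2) by auto
  then show ?thesis
    using assms smooth_on_inverse[OF open_image] unfolding smf_def in_chart_def by blast
qed

lemma chart_pd_const [simp]: "chart_pd c i (\<lambda>p. r) p = 0"
proof -
  have "in_chart c (\<lambda>p. r) = (\<lambda>x. r)" by (rule ext) (simp add: in_chart_def)
  then show ?thesis by (simp add: chart_pd_def)
qed

lemma chart_pd_add:
  "smf c W F \<Longrightarrow> smf c W G \<Longrightarrow> p \<in> W \<Longrightarrow> chart_pd c i (\<lambda>p. F p + G p) p = chart_pd c i F p + chart_pd c i G p"
proof -
  assume a: "smf c W F" "smf c W G" "p \<in> W"
  have "in_chart c (\<lambda>p. F p + G p) = (\<lambda>x. in_chart c F x + in_chart c G x)"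
    by (rule ext) (simp add: in_chart_def)
  then show ?thesis
    using pd_add[OF smf_differentiable[OF a(1,3)] smf_differentiable[OF a(2,3)], of i]
    by (simp add: chart_pd_def)
qed

lemma chart_pd_mult:
  assumes "smf c W F" "smf c W G" "p \<in> W"
  shows "chart_pd c i (\<lambda>p. F p * G p) p = chart_pd c i F p * G p + F p * chart_pd c i G p"
proof -
  have "in_chart c (\<lambda>p. F p * G p) = (\<lambda>x. in_chart c F x * in_chart c G x)"
    by (rule ext) (simp add: in_chart_def)
  then show ?thesis
    using pd_mult[OF smf_differentiable[OF assms(1,3)] smf_differentiable[OF assms(2,3)], of i] assms(3)
    by (simp add: chart_pd_def)
qed

lemma chart_pd_cmult:
  "smf c W F \<Longrightarrow> p \<in> W \<Longrightarrow> chart_pd c i (\<lambda>p. r * F p) p = r * chart_pd c i F p"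
  by (simp add: chart_pd_mult)

lemma chart_pd_uminus: "smf c W F \<Longrightarrow> p \<in> W \<Longrightarrow> chart_pd c i (\<lambda>p. - F p) p = - chart_pd c i F p"
  using chart_pd_cmult[of F p i "-1"] by simp

lemma chart_pd_diff:
  "smf c W F \<Longrightarrow> smf c W G \<Longrightarrow> p \<in> W \<Longrightarrow> chart_pd c i (\<lambda>p. F p - G p) p = chart_pd c i F p - chart_pd c i G p"
  using chart_pd_add[of F "\<lambda>p. - G p" p i] by (simp add: chart_pd_uminus smf_uminus)

lemma chart_pd_sum:
  "(\<And>i. i \<in> I \<Longrightarrow> smf c W (F i)) \<Longrightarrow> p \<in> W \<Longrightarrow>
     chart_pd c a (\<lambda>p. \<Sum>i\<in>I. F i p) p = (\<Sum>i\<in>I. chart_pd c a (F i) p)"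
  by (induction I rule: infinite_finite_induct) (auto simp: chart_pd_add smf_sum)

lemma chart_pd_prod:
  "finite I \<Longrightarrow> (\<And>i. i \<in> I \<Longrightarrow> smf c W (F i)) \<Longrightarrow> p \<in> W \<Longrightarrow>
     chart_pd c a (\<lambda>p. \<Prod>i\<in>I. F i p) p = (\<Sum>i\<in>I. chart_pd c a (F i) p * (\<Prod>j\<in>I - {i}. F j p))"
proof (induction I rule: finite_induct)
  case (insert i I)
  have "(\<Prod>j\<in>insert i I - {k}. F j p) = F i p * (\<Prod>j\<in>I - {k}. F j p)" if "k \<in> I" for k
  proof -
    have "insert i I - {k} = insert i (I - {k})" using insert that by auto
    then show ?thesis using insert by simp
  qed
  then have "(\<Sum>k\<in>I. chart_pd c a (F k) p * (\<Prod>j\<in>insert i I - {k}. F j p))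
      = (\<Sum>k\<in>I. F i p * (chart_pd c a (F k) p * (\<Prod>j\<in>I - {k}. F j p)))"
    by (intro sum.cong) auto
  then show ?case using insert by (simp add: chart_pd_mult smf_prod sum_distrib_left)
qed auto

lemma smf_subset: "smf c W F \<Longrightarrow> V \<subseteq> W \<Longrightarrow> smf c V F"
  unfolding smf_def by (meson image_mono smooth_on_subset)

end

lemma smf_local:
  assumes "\<And>p. p \<in> W \<Longrightarrow> \<exists>V. p \<in> V \<and> open (coords c ` V) \<and> smf c V F"
  shows "smf c W F"
  unfolding smf_def
proof (rule smooth_on_local)
  fix x assume "x \<in> coords c ` W"
  then obtain p where p: "p \<in> W" "x = coords c p" by blast
  from assms[OF p(1)] obtain V where "p \<in> V" "open (coords c ` V)" "smf c V F" by blast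
  then show "\<exists>T. open T \<and> x \<in> T \<and> smooth_on T (in_chart c F)"
    using p by (intro exI[of _ "coords c ` V"]) (auto simp: smf_def)
qed

locale atlas =
  fixes A :: "('m::t2_space, 'n::finite) chart set"
  assumes smooth_atlas: "smooth_atlas A"
begin

lemma open_cdom: "c \<in> A \<Longrightarrow> open (cdom c)"
  and open_cimage: "c \<in> A \<Longrightarrow> open (cimage c)"
  and chart_homeo: "c \<in> A \<Longrightarrow> homeomorphism (cdom c) (cimage c) (coords c) (inv_into (cdom c) (coords c))"
  and charts_cover: "\<exists>c\<in>A. p \<in> cdom c"
  and transition_smooth: "c \<in> A \<Longrightarrow> d \<in> A \<Longrightarrow>
      smooth_on (coords c ` (cdom c \<inter> cdom d)) (in_chart c (\<lambda>p. coords d p $ a))"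
  using smooth_atlas unfolding smooth_atlas_def by blast+

lemma chart_inj: "c \<in> A \<Longrightarrow> inj_on (coords c) (cdom c)"
  using chart_homeo[of c] unfolding homeomorphism_def by (metis inj_on_inverseI)

lemma continuous_coords: "c \<in> A \<Longrightarrow> continuous_on (cdom c) (coords c)"
  using chart_homeo homeomorphism_cont1 by blast

lemma continuous_inv_coords: "c \<in> A \<Longrightarrow> continuous_on (cimage c) (inv_into (cdom c) (coords c))"
  using chart_homeo homeomorphism_cont2 by blast

lemma chart_domainI:
  assumes "c \<in> A" "open W" "W \<subseteq> cdom c"
  shows "chart_domain c W"
proof
  show "open (coords c ` W)"
  proof -
    have "openin (top_of_set (cimage c)) (coords c ` W)"
      using assms open_cdom by (intro homeomorphism_imp_open_map[OF chart_homeo]) (auto simp: openin_open_eq)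
    then show ?thesis using open_cimage[OF assms(1)] openin_open_trans by blast
  qed
qed (use assms chart_inj in auto)

lemma chart_domain_cdom: "c \<in> A \<Longrightarrow> chart_domain c (cdom c)"
  using chart_domainI open_cdom by blast

lemma chart_domain_overlap: "c \<in> A \<Longrightarrow> d \<in> A \<Longrightarrow> chart_domain c (cdom c \<inter> cdom d)"
  and chart_domain_overlap': "c \<in> A \<Longrightarrow> d \<in> A \<Longrightarrow> chart_domain d (cdom c \<inter> cdom d)"
  by (auto intro!: chart_domainI open_cdom)

lemma smf_coords:
  assumes "c \<in> A" "d \<in> A" "W \<subseteq> cdom c \<inter> cdom d"
  shows "smf d W (\<lambda>p. coords c p $ a)"
  unfolding smf_def
proof (rule smooth_on_subset)
  show "smooth_on (coords d ` (cdom d \<inter> cdom c)) (in_chart d (\<lambda>p. coords c p $ a))"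
    by (rule transition_smooth[OF assms(2,1)])
qed (use assms in auto)

lemma transition:
  assumes cd: "c \<in> A" "d \<in> A" and W: "open W" "W \<subseteq> cdom c \<inter> cdom d" and F: "smf c W F"
  shows smf_transition: "smf d W F"
    and chart_pd_transition: "p \<in> W \<Longrightarrow> chart_pd d i F p = (\<Sum>a\<in>UNIV. chart_pd c a F p * jac c d p a i)"
proof -
  interpret C: chart_domain c W using chart_domainI cd W by blast
  interpret D: chart_domain d W using chart_domainI cd W by blast
  define \<phi> where "\<phi> = (\<lambda>x. coords c (inv_into (cdom d) (coords d) x))"
  have \<phi>a: "(\<lambda>x. \<phi> x $ a) = in_chart d (\<lambda>p. coords c p $ a)" for a
    by (rule ext) (simp add: \<phi>_def in_chart_def)
  have sm: "smooth_on (coords d ` W) (\<lambda>x. \<phi> x $ a)" for a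
    unfolding \<phi>a using smf_coords[OF cd W(2)] by (simp add: smf_def)
  have \<phi>p: "\<phi> (coords d p) = coords c p" if "p \<in> W" for p
    using that W D.inj_coords by (auto simp: \<phi>_def inv_into_f_f)
  then have im: "\<phi> ` coords d ` W \<subseteq> coords c ` W" by auto
  have sF: "smooth_on (coords c ` W) (in_chart c F)" using F by (simp add: smf_def)
  have eq: "in_chart c F (\<phi> x) = in_chart d F x" if x: "x \<in> coords d ` W" for x
  proof -
    obtain p where p: "p \<in> W" "x = coords d p" using x by blast
    then show ?thesis using \<phi>p[of p] C.in_chart_coords D.in_chart_coords W by auto
  qed
  note comp = smooth_on_compose[OF D.open_image C.open_image sm im sF]
  show "smf d W F"
    unfolding smf_def using smooth_on_cong[OF D.open_image _ comp(1)] eq by blast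
  show "chart_pd d i F p = (\<Sum>a\<in>UNIV. chart_pd c a F p * jac c d p a i)" if p: "p \<in> W"
  proof -
    have "chart_pd d i F p = pd i (\<lambda>x. in_chart c F (\<phi> x)) (coords d p)"
      unfolding chart_pd_def using eq p by (intro pd_cong[OF D.open_image]) auto
    also have "\<dots> = (\<Sum>a\<in>UNIV. chart_pd c a F p * jac c d p a i)"
      using comp(2)[of "coords d p" i] p \<phi>p[OF p] by (simp add: chart_pd_def jac_def \<phi>a)
    finally show ?thesis .
  qed
qed

lemma smf_jac: "c \<in> A \<Longrightarrow> d \<in> A \<Longrightarrow> open W \<Longrightarrow> W \<subseteq> cdom c \<inter> cdom d \<Longrightarrow> smf d W (\<lambda>p. jac c d p a i)"
  unfolding jac_def
  by (rule chart_domain.smf_chart_pd[OF chart_domainI[of d W] smf_coords]) auto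

lemma chart_pd_coord:
  assumes "c \<in> A" "p \<in> cdom c"
  shows "chart_pd c i (\<lambda>q. coords c q $ a) p = (if a = i then 1 else 0)"
proof -
  interpret C: chart_domain c "cdom c" using chart_domain_cdom assms by blast
  have "chart_pd c i (\<lambda>q. coords c q $ a) p = pd i (\<lambda>x. x $ a) (coords c p)"
    unfolding chart_pd_def using assms
    by (intro pd_cong[OF open_cimage[OF assms(1)]]) (auto simp: C.in_chart_coords)
  also have "((\<lambda>x. x $ a) has_derivative (\<lambda>x. x $ a)) (at (coords c p))"
    by (simp add: bounded_linear_imp_has_derivative bounded_linear_vec_nth)
  then have "pd i (\<lambda>x. x $ a) (coords c p) = axis i 1 $ a" by (rule pd_eqI)
  finally show ?thesis by (auto simp: axis_def)
qed

lemma jac_inverse: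
  assumes "c \<in> A" "d \<in> A" "p \<in> cdom c" "p \<in> cdom d"
  shows "(\<Sum>a\<in>UNIV. jac d c p k a * jac c d p a i) = (if k = i then 1 else 0)"
proof -
  have "chart_pd d i (\<lambda>q. coords d q $ k) p
      = (\<Sum>a\<in>UNIV. chart_pd c a (\<lambda>q. coords d q $ k) p * jac c d p a i)"
    using assms smf_coords[of d c "cdom c \<inter> cdom d" k] open_Int[OF open_cdom[OF assms(1)] open_cdom[OF assms(2)]]
    by (intro chart_pd_transition[of c d "cdom c \<inter> cdom d"]) auto
  then show ?thesis using chart_pd_coord[of d p i k] assms by (simp add: jac_def)
qed

end

section \<open>Algebra of index lists\<close>

lemma finite_idx [simp]: "finite (idx k :: 'n::finite list set)"
  using finite_lists_length_eq[of "UNIV :: 'n set" k] by (simp add: idx_def)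

lemma idx_0 [simp]: "idx 0 = {[]}"
  by (auto simp: idx_def)

lemma Nil_in_idx [simp]: "[] \<in> idx k \<longleftrightarrow> k = 0"
  by (auto simp: idx_def)

lemma Cons_in_idx_Suc [simp]: "i # js \<in> idx (Suc k) \<longleftrightarrow> js \<in> idx k"
  by (simp add: idx_def)

lemma idx_Suc_cases:
  assumes "ls \<in> idx (Suc k)" obtains i js where "ls = i # js" "js \<in> idx k"
  using assms by (cases ls) (auto simp: idx_def)

lemma sum_idx_Suc: "(\<Sum>is\<in>idx (Suc k). F is) = (\<Sum>i\<in>(UNIV::'n::finite set). \<Sum>is\<in>idx k. F (i # is))"
proof -
  have "(\<Sum>i\<in>(UNIV::'n set). \<Sum>is\<in>idx k. F (i # is)) = (\<Sum>(i, is)\<in>UNIV \<times> idx k. F (i # is))"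
    by (simp add: sum.cartesian_product)
  also have "\<dots> = (\<Sum>is\<in>idx (Suc k). F is)"
    by (rule sum.reindex_bij_witness[of _ "\<lambda>ls. (hd ls, tl ls)" "\<lambda>(i, is). i # is"])
      (auto elim: idx_Suc_cases)
  finally show ?thesis ..
qed

text \<open>Entries of the tensor powers of the matrix \<open>M\<close>.\<close>

definition kp :: "('a \<Rightarrow> 'b \<Rightarrow> real) \<Rightarrow> 'a list \<Rightarrow> 'b list \<Rightarrow> real" where
  "kp M is js = (\<Prod>m<length is. M (is ! m) (js ! m))"

lemma kp_Nil [simp]: "kp M [] js = 1"
  by (simp add: kp_def)

lemma kp_Cons [simp]: "kp M (i # is) (j # js) = M i j * kp M is js"
  by (simp add: kp_def prod.lessThan_Suc_shift del: prod.lessThan_Suc)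

text \<open>The derivation of the tensor algebra induced by an endomorphism, on components with lower
  indices; \<open>dop (\<Gamma> c p i)\<close> is the algebraic part of the covariant derivative.\<close>

definition dop :: "('n::finite \<Rightarrow> 'n \<Rightarrow> real) \<Rightarrow> ('n list \<Rightarrow> real) \<Rightarrow> 'n list \<Rightarrow> real" where
  "dop G T ls = (\<Sum>m<length ls. \<Sum>l\<in>UNIV. G (ls ! m) l * T (ls[m := l]))"

lemma dop_Nil [simp]: "dop G T [] = 0"
  by (simp add: dop_def)

lemma dop_Cons [simp]: "dop G T (j # ls) = (\<Sum>l\<in>UNIV. G j l * T (l # ls)) + dop G (\<lambda>ls. T (j # ls)) ls"
  by (simp add: dop_def sum.lessThan_Suc_shift del: sum.lessThan_Suc)

lemma dop_cong:
  "ls \<in> idx k \<Longrightarrow> (\<And>ms. ms \<in> idx k \<Longrightarrow> S ms = T ms) \<Longrightarrow> dop G S ls = dop G T ls"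
  unfolding dop_def by (intro sum.cong) (auto simp: idx_def)

lemma dop_sum: "dop G (\<lambda>ls. \<Sum>a\<in>I. r a * T a ls) ls = (\<Sum>a\<in>I. r a * dop G (T a) ls)"
  unfolding dop_def
  by (simp add: sum_distrib_left sum.swap[of _ I] ac_simps)

lemma dop_add: "dop G (\<lambda>ls. S ls + T ls) ls = dop G S ls + dop G T ls"
  unfolding dop_def by (simp add: sum.distrib algebra_simps)

lemma dop_cmult: "dop G (\<lambda>ls. r * T ls) ls = r * dop G T ls"
  using dop_sum[of G "\<lambda>_. r" "\<lambda>_. T" "{()}" ls] by simp

lemma dop_generator_sum: "dop (\<lambda>i l. \<Sum>a\<in>I. r a * G a i l) T ls = (\<Sum>a\<in>I. r a * dop (G a) T ls)"
  by (induction I rule: infinite_finite_induct)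
    (auto simp: dop_def sum.distrib algebra_simps sum_distrib_left)

text \<open>Change of coordinates on components with lower indices.\<close>

definition tr :: "('n::finite \<Rightarrow> 'n \<Rightarrow> real) \<Rightarrow> nat \<Rightarrow> ('n list \<Rightarrow> real) \<Rightarrow> 'n list \<Rightarrow> real" where
  "tr J k T ls = (\<Sum>ms\<in>idx k. kp J ms ls * T ms)"

lemma tr_0 [simp]: "tr J 0 T ls = T []"
  by (simp add: tr_def)

lemma tr_Suc: "tr J (Suc k) T (j # ls) = (\<Sum>a\<in>UNIV. J a j * tr J k (\<lambda>as. T (a # as)) ls)"
  unfolding tr_def sum_idx_Suc by (simp add: sum_distrib_left mult.assoc)

lemma tr_cong: "(\<And>ms. ms \<in> idx k \<Longrightarrow> S ms = T ms) \<Longrightarrow> tr J k S ls = tr J k T ls"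
  unfolding tr_def by (intro sum.cong) auto

lemma tr_sum: "tr J k (\<lambda>ls. \<Sum>a\<in>I. r a * T a ls) ls = (\<Sum>a\<in>I. r a * tr J k (T a) ls)"
  unfolding tr_def by (simp add: sum_distrib_left sum.swap[of _ I] ac_simps)

lemma tr_add: "tr J k (\<lambda>ls. S ls + T ls) ls = tr J k S ls + tr J k T ls"
  unfolding tr_def by (simp add: sum.distrib algebra_simps)

lemma tr_diff: "tr J k (\<lambda>ls. S ls - T ls) ls = tr J k S ls - tr J k T ls"
  unfolding tr_def by (simp add: sum_subtractf algebra_simps)

lemma tr_cmult: "tr J k (\<lambda>ls. r * T ls) ls = r * tr J k T ls"
  unfolding tr_def by (simp add: sum_distrib_left ac_simps)

text \<open>Full contraction of two lists of lower indices by means of the bivector \<open>W\<close>.\<close>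

definition fcf :: "('n::finite \<Rightarrow> 'n \<Rightarrow> real) \<Rightarrow> nat \<Rightarrow> ('n list \<Rightarrow> real) \<Rightarrow> ('n list \<Rightarrow> real) \<Rightarrow> real" where
  "fcf W k \<alpha> \<beta> = (\<Sum>is\<in>idx k. \<Sum>js\<in>idx k. \<alpha> is * kp W is js * \<beta> js)"

lemma fcf_0 [simp]: "fcf W 0 \<alpha> \<beta> = \<alpha> [] * \<beta> []"
  by (simp add: fcf_def)

lemma fcf_Suc:
  "fcf W (Suc k) \<alpha> \<beta> = (\<Sum>i\<in>UNIV. \<Sum>j\<in>UNIV. W i j * fcf W k (\<lambda>is. \<alpha> (i # is)) (\<lambda>js. \<beta> (j # js)))"
proof -
  have "(\<Sum>is\<in>idx k. \<Sum>j\<in>UNIV. \<Sum>js\<in>idx k. \<alpha> (i # is) * kp W (i # is) (j # js) * \<beta> (j # js))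
      = (\<Sum>j\<in>UNIV. W i j * fcf W k (\<lambda>is. \<alpha> (i # is)) (\<lambda>js. \<beta> (j # js)))" for i
    unfolding fcf_def by (subst sum.swap) (simp add: sum_distrib_left ac_simps)
  then show ?thesis unfolding fcf_def[of W "Suc k"] sum_idx_Suc by simp
qed

lemma fcf_cong:
  "(\<And>is. is \<in> idx k \<Longrightarrow> \<alpha> is = \<alpha>' is) \<Longrightarrow> (\<And>is. is \<in> idx k \<Longrightarrow> \<beta> is = \<beta>' is) \<Longrightarrow>
    fcf W k \<alpha> \<beta> = fcf W k \<alpha>' \<beta>'"
  unfolding fcf_def by (intro sum.cong) auto

lemma fcf_add_left: "fcf W k (\<lambda>is. \<alpha> is + \<alpha>' is) \<beta> = fcf W k \<alpha> \<beta> + fcf W k \<alpha>' \<beta>"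
  and fcf_add_right: "fcf W k \<alpha> (\<lambda>is. \<beta> is + \<beta>' is) = fcf W k \<alpha> \<beta> + fcf W k \<alpha> \<beta>'"
  and fcf_diff_left: "fcf W k (\<lambda>is. \<alpha> is - \<alpha>' is) \<beta> = fcf W k \<alpha> \<beta> - fcf W k \<alpha>' \<beta>"
  and fcf_diff_right: "fcf W k \<alpha> (\<lambda>is. \<beta> is - \<beta>' is) = fcf W k \<alpha> \<beta> - fcf W k \<alpha> \<beta>'"
  and fcf_uminus_left: "fcf W k (\<lambda>is. - \<alpha> is) \<beta> = - fcf W k \<alpha> \<beta>"
  and fcf_uminus_right: "fcf W k \<alpha> (\<lambda>is. - \<beta> is) = - fcf W k \<alpha> \<beta>"
  and fcf_cmult_left: "fcf W k (\<lambda>is. r * \<alpha> is) \<beta> = r * fcf W k \<alpha> \<beta>"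
  and fcf_cmult_right: "fcf W k \<alpha> (\<lambda>is. r * \<beta> is) = r * fcf W k \<alpha> \<beta>"
  unfolding fcf_def
  by (simp_all add: sum.distrib sum_subtractf sum_negf sum_distrib_left algebra_simps)

lemma fcf_sum_left: "fcf W k (\<lambda>is. \<Sum>a\<in>I. r a * \<alpha> a is) \<beta> = (\<Sum>a\<in>I. r a * fcf W k (\<alpha> a) \<beta>)"
proof (induction I rule: infinite_finite_induct)
  case (insert x F)
  then show ?case by (simp add: fcf_add_left fcf_cmult_left)
qed (simp_all add: fcf_def)

lemma fcf_sum_right: "fcf W k \<alpha> (\<lambda>is. \<Sum>a\<in>I. r a * \<beta> a is) = (\<Sum>a\<in>I. r a * fcf W k \<alpha> (\<beta> a))"
proof (induction I rule: infinite_finite_induct)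
  case (insert x F)
  then show ?case by (simp add: fcf_add_right fcf_cmult_right)
qed (simp_all add: fcf_def)

text \<open>One sign for each slot; in odd degree the contraction is skew.\<close>

lemma fcf_swap:
  assumes "\<And>i j. W i j = - W j i"
  shows "fcf W k \<alpha> \<beta> = (- 1) ^ k * fcf W k \<beta> \<alpha>"
proof (induction k arbitrary: \<alpha> \<beta>)
  case (Suc k)
  have "fcf W (Suc k) \<alpha> \<beta>
      = (\<Sum>i\<in>UNIV. \<Sum>j\<in>UNIV. (- 1) ^ Suc k * (W j i * fcf W k (\<lambda>js. \<beta> (j # js)) (\<lambda>is. \<alpha> (i # is))))"
    unfolding fcf_Suc
    by (intro sum.cong refl) (subst Suc, subst assms, simp)
  also have "\<dots> = (- 1) ^ Suc k * fcf W (Suc k) \<beta> \<alpha>"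
    unfolding fcf_Suc sum_distrib_left by (rule sum.swap)
  finally show ?case .
qed simp

lemma fcf_tr:
  assumes W: "\<And>a b. W' a b = (\<Sum>i\<in>UNIV. \<Sum>j\<in>UNIV. J a i * W i j * J b j)"
  shows "fcf W k (tr J k \<alpha>) (tr J k \<beta>) = fcf W' k \<alpha> \<beta>"
proof (induction k arbitrary: \<alpha> \<beta>)
  case (Suc k)
  let ?F = "\<lambda>a b. fcf W' k (\<lambda>as. \<alpha> (a # as)) (\<lambda>bs. \<beta> (b # bs))"
  have "fcf W (Suc k) (tr J (Suc k) \<alpha>) (tr J (Suc k) \<beta>)
      = (\<Sum>i\<in>UNIV. \<Sum>j\<in>UNIV. W i j * (\<Sum>a\<in>UNIV. J a i * (\<Sum>b\<in>UNIV. J b j * ?F a b)))"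
    unfolding fcf_Suc tr_Suc fcf_sum_left fcf_sum_right Suc ..
  also have "\<dots> = (\<Sum>i\<in>UNIV. \<Sum>j\<in>UNIV. \<Sum>a\<in>UNIV. \<Sum>b\<in>UNIV. (J a i * W i j * J b j) * ?F a b)"
    by (simp add: sum_distrib_left ac_simps)
  also have "\<dots> = (\<Sum>i\<in>UNIV. \<Sum>a\<in>UNIV. \<Sum>j\<in>UNIV. \<Sum>b\<in>UNIV. (J a i * W i j * J b j) * ?F a b)"
    by (rule sum.cong[OF refl], rule sum.swap)
  also have "\<dots> = (\<Sum>a\<in>UNIV. \<Sum>i\<in>UNIV. \<Sum>j\<in>UNIV. \<Sum>b\<in>UNIV. (J a i * W i j * J b j) * ?F a b)"
    by (rule sum.swap)
  also have "\<dots> = (\<Sum>a\<in>UNIV. \<Sum>i\<in>UNIV. \<Sum>b\<in>UNIV. \<Sum>j\<in>UNIV. (J a i * W i j * J b j) * ?F a b)"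
    by (rule sum.cong[OF refl], rule sum.cong[OF refl], rule sum.swap)
  also have "\<dots> = (\<Sum>a\<in>UNIV. \<Sum>b\<in>UNIV. \<Sum>i\<in>UNIV. \<Sum>j\<in>UNIV. (J a i * W i j * J b j) * ?F a b)"
    by (rule sum.cong[OF refl], rule sum.swap)
  also have "\<dots> = (\<Sum>a\<in>UNIV. \<Sum>b\<in>UNIV. W' a b * ?F a b)"
    by (simp add: W sum_distrib_right)
  finally show ?case by (simp add: fcf_Suc)
qed simp

context chart_domain
begin

lemma smf_kp: "(\<And>i j. smf c W (\<lambda>p. M p i j)) \<Longrightarrow> smf c W (\<lambda>p. kp (M p) is js)"
  unfolding kp_def by (intro smf_prod)

lemma smf_tr:
  "(\<And>i j. smf c W (\<lambda>p. J p i j)) \<Longrightarrow> (\<And>ls. ls \<in> idx k \<Longrightarrow> smf c W (\<lambda>p. T p ls)) \<Longrightarrow> smf c W (\<lambda>p. tr (J p) k (T p) ls)"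
  unfolding tr_def by (intro smf_sum smf_mult smf_kp)

lemma smf_fcf:
  "(\<And>i j. smf c W (\<lambda>p. M p i j)) \<Longrightarrow> (\<And>ls. ls \<in> idx k \<Longrightarrow> smf c W (\<lambda>p. \<alpha> p ls)) \<Longrightarrow>
   (\<And>ls. ls \<in> idx k \<Longrightarrow> smf c W (\<lambda>p. \<beta> p ls)) \<Longrightarrow> smf c W (\<lambda>p. fcf (M p) k (\<alpha> p) (\<beta> p))"
  unfolding fcf_def by (intro smf_sum smf_mult smf_kp)

lemma smf_dop:
  "(\<And>i j. smf c W (\<lambda>p. G p i j)) \<Longrightarrow> (\<And>ls. ls \<in> idx k \<Longrightarrow> smf c W (\<lambda>p. T p ls)) \<Longrightarrow> ls \<in> idx k \<Longrightarrow>
    smf c W (\<lambda>p. dop (G p) (T p) ls)"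
  unfolding dop_def by (intro smf_sum smf_mult) (auto simp: idx_def)

text \<open>The inhomogeneous term \<open>DJ\<close> in the transformation law \<open>G\<close> of the connection cancels the
  derivatives of the transformation matrix, slot by slot.\<close>

lemma tr_derivation:
  assumes J: "\<And>i j. smf c W (\<lambda>p. J p i j)"
    and T: "\<And>ls. ls \<in> idx k \<Longrightarrow> smf c W (\<lambda>p. T p ls)"
    and p: "p \<in> W" and ls: "ls \<in> idx k"
    and G: "\<And>j e. (\<Sum>l\<in>UNIV. G j l * J p e l) = chart_pd c i (\<lambda>p. J p e j) p + (\<Sum>b\<in>UNIV. J p b j * G' b e)"
  shows "chart_pd c i (\<lambda>p. tr (J p) k (T p) ls) p - dop G (tr (J p) k (T p)) ls
      = tr (J p) k (\<lambda>ms. chart_pd c i (\<lambda>p. T p ms) p - dop G' (T p) ms) ls"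
  using T ls
proof (induction k arbitrary: T ls)
  case (Suc k)
  from \<open>ls \<in> idx (Suc k)\<close> obtain j js where ls: "ls = j # js" and js: "js \<in> idx k" by (rule idx_Suc_cases)
  let ?T = "\<lambda>a p as. T p (a # as)"
  let ?X = "\<lambda>a. tr (J p) k (?T a p) js"
  have T: "smf c W (\<lambda>p. ?T a p as)" if "as \<in> idx k" for a as using Suc.prems(1) that by simp
  have IH: "chart_pd c i (\<lambda>p. tr (J p) k (?T a p) js) p - dop G (tr (J p) k (?T a p)) js
      = tr (J p) k (\<lambda>ms. chart_pd c i (\<lambda>p. ?T a p ms) p - dop G' (?T a p) ms) js" for a
    by (rule Suc.IH[OF T js])
  have "chart_pd c i (\<lambda>p. tr (J p) (Suc k) (T p) ls) p
      = (\<Sum>a\<in>UNIV. chart_pd c i (\<lambda>p. J p a j) p * ?X a + J p a j * chart_pd c i (\<lambda>p. tr (J p) k (?T a p) js) p)"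
    unfolding ls tr_Suc
    by (subst chart_pd_sum) (auto intro!: smf_mult smf_tr J T p sum.cong chart_pd_mult)
  moreover have "dop G (tr (J p) (Suc k) (T p)) ls = (\<Sum>a\<in>UNIV. (\<Sum>l\<in>UNIV. G j l * J p a l) * ?X a)
      + (\<Sum>a\<in>UNIV. J p a j * dop G (tr (J p) k (?T a p)) js)"
  proof -
    have "(\<Sum>l\<in>UNIV. G j l * (\<Sum>a\<in>UNIV. J p a l * ?X a)) = (\<Sum>a\<in>UNIV. (\<Sum>l\<in>UNIV. G j l * J p a l) * ?X a)"
      by (simp add: sum_distrib_left sum_distrib_right mult.assoc) (rule sum.swap)
    then show ?thesis unfolding ls dop_Cons tr_Suc dop_sum by simp
  qed
  moreover have "tr (J p) (Suc k) (\<lambda>ms. chart_pd c i (\<lambda>p. T p ms) p - dop G' (T p) ms) ls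
      = (\<Sum>a\<in>UNIV. J p a j * tr (J p) k (\<lambda>ms. chart_pd c i (\<lambda>p. ?T a p ms) p - dop G' (?T a p) ms) js)
        - (\<Sum>e\<in>UNIV. (\<Sum>b\<in>UNIV. J p b j * G' b e) * ?X e)"
  proof -
    have "tr (J p) k (\<lambda>as. chart_pd c i (\<lambda>p. T p (a # as)) p - dop G' (T p) (a # as)) js
       = tr (J p) k (\<lambda>ms. chart_pd c i (\<lambda>p. ?T a p ms) p - dop G' (?T a p) ms) js - (\<Sum>e\<in>UNIV. G' a e * ?X e)" for a
      unfolding dop_Cons tr_sum[symmetric] tr_diff[symmetric] by (simp add: algebra_simps)
    note A = this
    have B: "(\<Sum>a\<in>UNIV. J p a j * (\<Sum>e\<in>UNIV. G' a e * ?X e)) = (\<Sum>e\<in>UNIV. (\<Sum>b\<in>UNIV. J p b j * G' b e) * ?X e)"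
      by (simp add: sum_distrib_left sum_distrib_right mult.assoc) (rule sum.swap)
    show ?thesis unfolding ls tr_Suc A right_diff_distrib sum_subtractf B ..
  qed
  ultimately show ?case
    unfolding G IH[symmetric] by (simp add: algebra_simps sum.distrib sum_subtractf)
qed simp

text \<open>If \<open>M\<close> is parallel, its derivative cancels the algebraic parts of the covariant derivatives of both
  factors in every slot, which leaves the Leibniz rule.\<close>

lemma fcf_derivation:
  assumes M: "\<And>i j. smf c W (\<lambda>p. M p i j)"
    and \<alpha>: "\<And>ls. ls \<in> idx k \<Longrightarrow> smf c W (\<lambda>p. \<alpha> p ls)" and \<beta>: "\<And>ls. ls \<in> idx k \<Longrightarrow> smf c W (\<lambda>p. \<beta> p ls)"
    and p: "p \<in> W"
    and par: "\<And>i j. chart_pd c a (\<lambda>p. M p i j) p = - (\<Sum>l\<in>UNIV. G l i * M p l j) - (\<Sum>l\<in>UNIV. G l j * M p i l)"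
  shows "chart_pd c a (\<lambda>p. fcf (M p) k (\<alpha> p) (\<beta> p)) p
    = fcf (M p) k (\<lambda>ls. chart_pd c a (\<lambda>p. \<alpha> p ls) p - dop G (\<alpha> p) ls) (\<beta> p)
      + fcf (M p) k (\<alpha> p) (\<lambda>ls. chart_pd c a (\<lambda>p. \<beta> p ls) p - dop G (\<beta> p) ls)"
  using \<alpha> \<beta>
proof (induction k arbitrary: \<alpha> \<beta>)
  case 0
  then show ?case using p by (simp add: chart_pd_mult)
next
  case (Suc k)
  let ?a = "\<lambda>i p is. \<alpha> p (i # is)" and ?b = "\<lambda>j p js. \<beta> p (j # js)"
  have ab: "smf c W (\<lambda>p. ?a i p is)" "smf c W (\<lambda>p. ?b i p is)" if "is \<in> idx k" for i "is"
    using Suc.prems that by simp_all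
  let ?F = "\<lambda>i j. fcf (M p) k (?a i p) (?b j p)"
  let ?Da = "\<lambda>i ls. chart_pd c a (\<lambda>p. ?a i p ls) p - dop G (?a i p) ls"
  let ?Db = "\<lambda>i ls. chart_pd c a (\<lambda>p. ?b i p ls) p - dop G (?b i p) ls"
  have IH: "chart_pd c a (\<lambda>p. fcf (M p) k (?a i p) (?b j p)) p
      = fcf (M p) k (?Da i) (?b j p) + fcf (M p) k (?a i p) (?Db j)" for i j
    by (rule Suc.IH) (use ab in auto)
  have "chart_pd c a (\<lambda>p. fcf (M p) (Suc k) (\<alpha> p) (\<beta> p)) p
      = (\<Sum>i\<in>UNIV. \<Sum>j\<in>UNIV. chart_pd c a (\<lambda>p. M p i j * fcf (M p) k (?a i p) (?b j p)) p)"
    unfolding fcf_Suc using p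
    by (subst chart_pd_sum, intro smf_sum smf_mult smf_fcf M ab, simp_all,
        subst chart_pd_sum, intro smf_mult smf_fcf M ab, simp_all)
  also have "\<dots> = (\<Sum>i\<in>UNIV. \<Sum>j\<in>UNIV. chart_pd c a (\<lambda>p. M p i j) p * ?F i j
      + M p i j * (fcf (M p) k (?Da i) (?b j p) + fcf (M p) k (?a i p) (?Db j)))"
    using p IH by (intro sum.cong refl) (subst chart_pd_mult, intro M, intro smf_fcf M ab, simp_all)
  finally have L: "chart_pd c a (\<lambda>p. fcf (M p) (Suc k) (\<alpha> p) (\<beta> p)) p = \<dots>" .
  have Ra: "fcf (M p) (Suc k) (\<lambda>ls. chart_pd c a (\<lambda>p. \<alpha> p ls) p - dop G (\<alpha> p) ls) (\<beta> p)
     = (\<Sum>i\<in>UNIV. \<Sum>j\<in>UNIV. M p i j * (fcf (M p) k (?Da i) (?b j p) - (\<Sum>l\<in>UNIV. G i l * ?F l j)))"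
    unfolding fcf_Suc dop_Cons fcf_sum_left[symmetric] fcf_diff_left[symmetric] by (simp add: algebra_simps)
  have Rb: "fcf (M p) (Suc k) (\<alpha> p) (\<lambda>ls. chart_pd c a (\<lambda>p. \<beta> p ls) p - dop G (\<beta> p) ls)
     = (\<Sum>i\<in>UNIV. \<Sum>j\<in>UNIV. M p i j * (fcf (M p) k (?a i p) (?Db j) - (\<Sum>l\<in>UNIV. G j l * ?F i l)))"
    unfolding fcf_Suc dop_Cons fcf_sum_right[symmetric] fcf_diff_right[symmetric] by (simp add: algebra_simps)
  have s1: "(\<Sum>i\<in>UNIV. \<Sum>j\<in>UNIV. (\<Sum>l\<in>UNIV. G l i * M p l j) * ?F i j)
      = (\<Sum>i\<in>UNIV. \<Sum>j\<in>UNIV. M p i j * (\<Sum>l\<in>UNIV. G i l * ?F l j))"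
  proof -
    have "(\<Sum>i\<in>UNIV. \<Sum>j\<in>UNIV. (\<Sum>l\<in>UNIV. G l i * M p l j) * ?F i j)
       = (\<Sum>i\<in>UNIV. \<Sum>l\<in>UNIV. \<Sum>j\<in>UNIV. G l i * M p l j * ?F i j)"
      by (simp add: sum_distrib_right) (rule sum.cong[OF refl], rule sum.swap)
    also have "\<dots> = (\<Sum>l\<in>UNIV. \<Sum>i\<in>UNIV. \<Sum>j\<in>UNIV. G l i * M p l j * ?F i j)"
      by (rule sum.swap)
    also have "\<dots> = (\<Sum>i\<in>UNIV. \<Sum>j\<in>UNIV. M p i j * (\<Sum>l\<in>UNIV. G i l * ?F l j))"
      by (simp add: sum_distrib_left ac_simps) (rule sum.cong[OF refl], rule sum.swap)
    finally show ?thesis .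
  qed
  have s2: "(\<Sum>i\<in>UNIV. \<Sum>j\<in>UNIV. (\<Sum>l\<in>UNIV. G l j * M p i l) * ?F i j)
      = (\<Sum>i\<in>UNIV. \<Sum>j\<in>UNIV. M p i j * (\<Sum>l\<in>UNIV. G j l * ?F i l))"
    by (simp add: sum_distrib_left sum_distrib_right ac_simps) (rule sum.cong[OF refl], rule sum.swap)
  show ?case
    unfolding L Ra Rb par using s1 s2
    by (simp add: algebra_simps sum.distrib sum_subtractf sum_negf)
qed

end

section \<open>Tensor fields with lower indices\<close>

text \<open>The tensor law between two charts only, on part of their overlap. It also applies to functions
  that are defined near one point, such as the coordinates of a chart.\<close>

definition ltf :: "('m, 'n::finite) chart \<Rightarrow> ('m, 'n) chart \<Rightarrow> 'm set \<Rightarrow> nat \<Rightarrow> ('m, 'n) tensor \<Rightarrow> bool" where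
  "ltf c d W k T \<longleftrightarrow> (\<forall>ls\<in>idx k. smf c W (\<lambda>p. T c p [] ls)) \<and>
     (\<forall>p\<in>W. \<forall>ls\<in>idx k. T d p [] ls = tr (jac c d p) k (T c p []) ls)"

lemma cov_Cons: "cov \<Gamma> T c p [] (i # js) = chart_pd c i (\<lambda>q. T c q [] js) p - dop (\<Gamma> c p i) (T c p []) js"
  by (simp add: cov_def dop_def)

lemma full_contraction_fcf: "full_contraction \<Omega> k \<alpha> \<beta> c p us ls = fcf (\<Omega>up \<Omega> c p) k (\<alpha> c p []) (\<beta> c p [])"
proof -
  have "\<alpha> c p [] is * raise_all \<Omega> \<beta> c p is
      = (\<Sum>js\<in>idx k. \<alpha> c p [] is * kp (\<Omega>up \<Omega> c p) is js * \<beta> c p [] js)" if "is \<in> idx k" for "is"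
    using that unfolding raise_all_def kp_def by (simp add: idx_def sum_distrib_left mult.assoc)
  then show ?thesis unfolding full_contraction_def fcf_def by (intro sum.cong) auto
qed

text \<open>\<open>hook\<close> yields the 1-form whose divergence is the difference of the two sides in integration by
  parts.\<close>

definition ctr :: "('m, 'n::finite) tensor \<Rightarrow> ('m, 'n) tensor \<Rightarrow> ('m, 'n) tensor" where
  "ctr \<Omega> T = (\<lambda>c p us ls. \<Sum>i\<in>UNIV. \<Sum>a\<in>UNIV. \<Omega>up \<Omega> c p i a * T c p us (a # i # ls))"

definition hook :: "('m, 'n::finite) tensor \<Rightarrow> nat \<Rightarrow> ('m, 'n) tensor \<Rightarrow> ('m, 'n) tensor \<Rightarrow> ('m, 'n) tensor" where
  "hook \<Omega> k \<alpha> \<beta> = (\<lambda>c p us ls. fcf (\<Omega>up \<Omega> c p) k (\<alpha> c p []) (\<lambda>ms. \<beta> c p [] (hd ls # ms)))"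

definition tmul :: "('m, 'n) tensor \<Rightarrow> ('m, 'n) tensor \<Rightarrow> ('m, 'n) tensor" where
  "tmul f T = (\<lambda>c p us ls. f c p [] [] * T c p us ls)"

text \<open>The divergence \<open>\<nabla>\<^sup>i \<beta>\<^sub>i\<^sub>\<dots>\<close>.\<close>

definition diverg :: "('m, 'n::finite) tensor \<Rightarrow> ('m, 'n) conn \<Rightarrow> ('m, 'n) tensor \<Rightarrow> ('m, 'n) tensor" where
  "diverg \<Omega> \<Gamma> \<beta> = ctr \<Omega> (cov \<Gamma> \<beta>)"

context atlas
begin

lemma tensor_field_iff:
  "tensor_field A 0 k T \<longleftrightarrow>
     (\<forall>c\<in>A. \<forall>ls\<in>idx k. smf c (cdom c) (\<lambda>p. T c p [] ls)) \<and>
     (\<forall>c\<in>A. \<forall>d\<in>A. \<forall>p\<in>cdom c \<inter> cdom d. \<forall>ls\<in>idx k. T d p [] ls = tr (jac c d p) k (T c p []) ls)"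
proof -
  have "(\<Sum>ms\<in>idx k. (\<Prod>m<k. jac c d p (ms ! m) (ls ! m)) * T c p [] ms)
      = tr (jac c d p) k (T c p []) ls" for c d p and ls :: "'n list"
    unfolding tr_def kp_def by (intro sum.cong) (auto simp: idx_def)
  then show ?thesis unfolding tensor_field_def smf_def by simp
qed

lemma tensor_field_smf: "tensor_field A 0 k T \<Longrightarrow> c \<in> A \<Longrightarrow> ls \<in> idx k \<Longrightarrow> smf c (cdom c) (\<lambda>p. T c p [] ls)"
  unfolding tensor_field_iff by blast

lemma tensor_field_tr: "tensor_field A 0 k T \<Longrightarrow> c \<in> A \<Longrightarrow> d \<in> A \<Longrightarrow> p \<in> cdom c \<Longrightarrow> p \<in> cdom d \<Longrightarrow> ls \<in> idx k \<Longrightarrow>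
    T d p [] ls = tr (jac c d p) k (T c p []) ls"
  unfolding tensor_field_iff by blast

lemma tensor_field_ltf: "tensor_field A 0 k T \<Longrightarrow> c \<in> A \<Longrightarrow> d \<in> A \<Longrightarrow> ltf c d (cdom c \<inter> cdom d) k T"
  unfolding tensor_field_iff ltf_def
  using chart_domain.smf_subset[OF chart_domain_cdom] by (meson IntD1 IntD2 inf_le1)

lemma tensor_fieldI:
  assumes "\<And>c ls. c \<in> A \<Longrightarrow> ls \<in> idx k \<Longrightarrow> smf c (cdom c) (\<lambda>p. T c p [] ls)"
    and "\<And>c d p ls. c \<in> A \<Longrightarrow> d \<in> A \<Longrightarrow> p \<in> cdom c \<Longrightarrow> p \<in> cdom d \<Longrightarrow> ls \<in> idx k \<Longrightarrow>
       T d p [] ls = tr (jac c d p) k (T c p []) ls"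
  shows "tensor_field A 0 k T"
  unfolding tensor_field_iff using assms by blast

lemma conn_smf: "affine_connection A \<Gamma> \<Longrightarrow> c \<in> A \<Longrightarrow> smf c (cdom c) (\<lambda>p. \<Gamma> c p i j k)"
  unfolding affine_connection_def smf_def by blast

lemma smf_cov:
  assumes \<Gamma>: "affine_connection A \<Gamma>" and c: "c \<in> A" and W: "open W" "W \<subseteq> cdom c"
    and T: "\<And>ls. ls \<in> idx k \<Longrightarrow> smf c W (\<lambda>p. T c p [] ls)" and ls: "ls \<in> idx (Suc k)"
  shows "smf c W (\<lambda>p. cov \<Gamma> T c p [] ls)"
proof -
  interpret C: chart_domain c W using chart_domainI c W by blast
  interpret C0: chart_domain c "cdom c" using chart_domain_cdom c by blast
  from ls obtain i js where js: "ls = i # js" "js \<in> idx k" by (rule idx_Suc_cases)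
  have "smf c W (\<lambda>p. \<Gamma> c p i j l)" for j l using C0.smf_subset[OF conn_smf[OF \<Gamma> c]] W by blast
  then show ?thesis unfolding js cov_Cons
    by (intro C.smf_diff C.smf_chart_pd C.smf_dop[of _ k] T js) (auto intro: T)
qed

text \<open>The transformation law of the Christoffel symbols in the form required by \<open>tr_derivation\<close>.\<close>

lemma conn_transform:
  assumes \<Gamma>: "affine_connection A \<Gamma>" and cd: "c \<in> A" "d \<in> A" "p \<in> cdom c" "p \<in> cdom d"
  shows "(\<Sum>l\<in>UNIV. \<Gamma> d p i j l * jac c d p e l)
    = chart_pd d i (\<lambda>q. jac c d q e j) p
      + (\<Sum>b\<in>UNIV. jac c d p b j * (\<Sum>a\<in>UNIV. jac c d p a i * \<Gamma> c p a b e))"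
proof -
  define X where "X = (\<lambda>e. chart_pd d i (\<lambda>q. jac c d q e j) p +
              (\<Sum>a\<in>UNIV. \<Sum>b\<in>UNIV. jac c d p a i * jac c d p b j * \<Gamma> c p a b e))"
  have "\<Gamma> d p i j l = (\<Sum>e'\<in>UNIV. jac d c p l e' * X e')" for l
    using \<Gamma> cd unfolding affine_connection_def X_def by blast
  then have "(\<Sum>l\<in>UNIV. \<Gamma> d p i j l * jac c d p e l)
      = (\<Sum>l\<in>UNIV. \<Sum>e'\<in>UNIV. (jac c d p e l * jac d c p l e') * X e')"
    by (simp add: sum_distrib_right sum_distrib_left ac_simps)
  also have "\<dots> = (\<Sum>e'\<in>UNIV. (\<Sum>l\<in>UNIV. jac c d p e l * jac d c p l e') * X e')"
    by (subst sum.swap) (simp add: sum_distrib_right)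
  also have "\<dots> = (\<Sum>e'\<in>UNIV. (if e = e' then 1 else 0) * X e')"
    using jac_inverse[OF cd(2,1,4,3)] by simp
  also have "\<dots> = X e" by (simp add: if_distrib[of "\<lambda>x. x * _"] cong: if_cong)
  finally have **: "(\<Sum>l\<in>UNIV. \<Gamma> d p i j l * jac c d p e l) = X e" .
  have *: "(\<Sum>a\<in>UNIV. \<Sum>b\<in>UNIV. jac c d p a i * jac c d p b j * \<Gamma> c p a b e)
      = (\<Sum>b\<in>UNIV. jac c d p b j * (\<Sum>a\<in>UNIV. jac c d p a i * \<Gamma> c p a b e))"
    by (subst sum.swap) (simp add: sum_distrib_left ac_simps)
  show ?thesis unfolding ** unfolding X_def * ..
qed

lemma ltf_cov:
  assumes \<Gamma>: "affine_connection A \<Gamma>" and cd: "c \<in> A" "d \<in> A" and W: "open W" "W \<subseteq> cdom c \<inter> cdom d"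
    and T: "ltf c d W k T"
  shows "ltf c d W (Suc k) (cov \<Gamma> T)"
  unfolding ltf_def
proof (intro conjI ballI)
  interpret D: chart_domain d W using chart_domainI cd W by blast
  have Ts: "smf c W (\<lambda>p. T c p [] ls)" if "ls \<in> idx k" for ls using T that by (simp add: ltf_def)
  show "smf c W (\<lambda>p. cov \<Gamma> T c p [] ls)" if "ls \<in> idx (Suc k)" for ls
    using smf_cov[OF \<Gamma> cd(1) W(1), of k T ls] Ts that W(2) by blast
  fix p and ls :: "'n list" assume p: "p \<in> W" and "ls \<in> idx (Suc k)"
  then obtain i js where js: "ls = i # js" "js \<in> idx k" using idx_Suc_cases by blast
  have pcd: "p \<in> cdom c" "p \<in> cdom d" using p W by auto
  have Td: "smf d W (\<lambda>p. T c p [] ls)" if "ls \<in> idx k" for ls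
    by (rule smf_transition[OF cd W Ts[OF that]])
  have J: "smf d W (\<lambda>p. jac c d p a b)" for a b by (rule smf_jac[OF cd W])
  let ?J = "jac c d p"
  let ?G = "\<lambda>b e. \<Sum>a\<in>UNIV. ?J a i * \<Gamma> c p a b e"
  have "cov \<Gamma> T d p [] ls = chart_pd d i (\<lambda>p. tr (jac c d p) k (T c p []) js) p
      - dop (\<Gamma> d p i) (tr ?J k (T c p [])) js"
  proof -
    have "chart_pd d i (\<lambda>q. T d q [] js) p = chart_pd d i (\<lambda>p. tr (jac c d p) k (T c p []) js) p"
      using T js p by (intro D.chart_pd_cong) (auto simp: ltf_def)
    moreover have "dop (\<Gamma> d p i) (T d p []) js = dop (\<Gamma> d p i) (tr ?J k (T c p [])) js"
      using T js p by (intro dop_cong[of _ k]) (auto simp: ltf_def)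
    ultimately show ?thesis by (simp add: js cov_Cons)
  qed
  also have "\<dots> = tr ?J k (\<lambda>ms. chart_pd d i (\<lambda>p. T c p [] ms) p - dop ?G (T c p []) ms) js"
    using D.tr_derivation[of "jac c d" k "\<lambda>p. T c p []" p js "\<Gamma> d p i" i ?G, OF J Td p js(2)]
      conn_transform[OF \<Gamma> cd pcd] by blast
  also have "\<dots> = tr ?J k (\<lambda>ms. \<Sum>a\<in>UNIV. ?J a i * cov \<Gamma> T c p [] (a # ms)) js"
  proof (rule tr_cong)
    fix ms :: "'n list" assume ms: "ms \<in> idx k"
    have "chart_pd d i (\<lambda>p. T c p [] ms) p = (\<Sum>a\<in>UNIV. ?J a i * chart_pd c a (\<lambda>p. T c p [] ms) p)"
      using chart_pd_transition[OF cd W Ts[OF ms] p] by (simp add: mult.commute)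
    then show "chart_pd d i (\<lambda>p. T c p [] ms) p - dop ?G (T c p []) ms
        = (\<Sum>a\<in>UNIV. ?J a i * cov \<Gamma> T c p [] (a # ms))"
      by (simp add: cov_Cons dop_generator_sum right_diff_distrib sum_subtractf)
  qed
  finally show "cov \<Gamma> T d p [] ls = tr ?J (Suc k) (cov \<Gamma> T c p []) ls"
    unfolding js tr_Suc tr_sum .
qed

lemma tensor_field_cov:
  assumes "affine_connection A \<Gamma>" "tensor_field A 0 k T"
  shows "tensor_field A 0 (Suc k) (cov \<Gamma> T)"
proof (rule tensor_fieldI)
  show "smf c (cdom c) (\<lambda>p. cov \<Gamma> T c p [] ls)" if "c \<in> A" "ls \<in> idx (Suc k)" for c ls
    using smf_cov[OF assms(1) that(1) open_cdom[OF that(1)] subset_refl, of k T ls]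
      tensor_field_smf[OF assms(2) that(1)] that(2) by blast
  show "cov \<Gamma> T d p [] ls = tr (jac c d p) (Suc k) (cov \<Gamma> T c p []) ls"
    if "c \<in> A" "d \<in> A" "p \<in> cdom c" "p \<in> cdom d" "ls \<in> idx (Suc k)" for c d p ls
  proof -
    have "ltf c d (cdom c \<inter> cdom d) (Suc k) (cov \<Gamma> T)"
      using that by (intro ltf_cov assms tensor_field_ltf open_Int open_cdom) auto
    then show ?thesis using that unfolding ltf_def by blast
  qed
qed

lemma tensor_field_tmul:
  assumes "tensor_field A 0 0 f" "tensor_field A 0 k T"
  shows "tensor_field A 0 k (tmul f T)"
proof (rule tensor_fieldI)
  show "smf c (cdom c) (\<lambda>p. tmul f T c p [] ls)" if "c \<in> A" "ls \<in> idx k" for c ls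
    unfolding tmul_def using that assms
    by (intro chart_domain.smf_mult[OF chart_domain_cdom] tensor_field_smf[of 0 f] tensor_field_smf[of k T]) auto
  show "tmul f T d p [] ls = tr (jac c d p) k (tmul f T c p []) ls"
    if "c \<in> A" "d \<in> A" "p \<in> cdom c" "p \<in> cdom d" "ls \<in> idx k" for c d p ls
    using tensor_field_tr[OF assms(1) that(1-4), of "[]"] tensor_field_tr[OF assms(2) that]
    by (simp add: tmul_def tr_cmult)
qed

lemma tensor_field_tadd:
  assumes "tensor_field A 0 k S" "tensor_field A 0 k T"
  shows "tensor_field A 0 k (tadd S T)"
proof (rule tensor_fieldI)
  show "smf c (cdom c) (\<lambda>p. tadd S T c p [] ls)" if "c \<in> A" "ls \<in> idx k" for c ls
    unfolding tadd_def using that assms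
    by (intro chart_domain.smf_add[OF chart_domain_cdom] tensor_field_smf[of k S] tensor_field_smf[of k T]) auto
  show "tadd S T d p [] ls = tr (jac c d p) k (tadd S T c p []) ls"
    if "c \<in> A" "d \<in> A" "p \<in> cdom c" "p \<in> cdom d" "ls \<in> idx k" for c d p ls
    using tensor_field_tr[OF assms(1) that] tensor_field_tr[OF assms(2) that]
    by (simp add: tadd_def tr_add)
qed

lemma tensor_field_tscale:
  assumes "tensor_field A 0 k T"
  shows "tensor_field A 0 k (tscale r T)"
proof (rule tensor_fieldI)
  show "smf c (cdom c) (\<lambda>p. tscale r T c p [] ls)" if "c \<in> A" "ls \<in> idx k" for c ls
    unfolding tscale_def using that assms
    by (intro chart_domain.smf_mult[OF chart_domain_cdom] chart_domain.smf_const[OF chart_domain_cdom]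
        tensor_field_smf[of k T]) auto
  show "tscale r T d p [] ls = tr (jac c d p) k (tscale r T c p []) ls"
    if "c \<in> A" "d \<in> A" "p \<in> cdom c" "p \<in> cdom d" "ls \<in> idx k" for c d p ls
    using tensor_field_tr[OF assms(1) that] by (simp add: tscale_def tr_cmult)
qed

lemma tensor_field_cong:
  assumes T: "tensor_field A 0 k T"
    and eq: "\<And>c p ls. c \<in> A \<Longrightarrow> p \<in> cdom c \<Longrightarrow> ls \<in> idx k \<Longrightarrow> T c p [] ls = S c p [] ls"
  shows "tensor_field A 0 k S"
proof (rule tensor_fieldI)
  show "smf c (cdom c) (\<lambda>p. S c p [] ls)" if "c \<in> A" "ls \<in> idx k" for c ls
    by (rule chart_domain.smf_cong[OF chart_domain_cdom[OF that(1)] tensor_field_smf[OF T that]])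
      (rule eq[OF that(1) _ that(2)])
  show "S d p [] ls = tr (jac c d p) k (S c p []) ls"
    if "c \<in> A" "d \<in> A" "p \<in> cdom c" "p \<in> cdom d" "ls \<in> idx k" for c d p ls
    using tensor_field_tr[OF T that] eq that tr_cong[of k "T c p []" "S c p []"] by auto
qed

lemma tensor_field_tconst: "tensor_field A 0 0 (tconst r)"
  by (rule tensor_fieldI) (auto simp: tconst_def intro: chart_domain.smf_const[OF chart_domain_cdom])

end

section \<open>The symplectic form and its inverse\<close>

lemma matrix_inv:
  fixes M :: "real^'n::finite^'n"
  assumes "invertible M"
  shows "M ** matrix_inv M = mat 1" "matrix_inv M ** M = mat 1"
  using someI_ex[OF assms[unfolded invertible_def]] unfolding matrix_inv_def by auto

lemma sum_delta_mult:
  "(\<Sum>i\<in>UNIV. (if i = k then r else 0) * f i) = r * f (k::'n::finite)"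
  "(\<Sum>i\<in>UNIV. (if k = i then r else 0) * f i) = r * f k"
  "(\<Sum>i\<in>UNIV. f i * (if i = k then r else 0)) = r * f k"
  "(\<Sum>i\<in>UNIV. f i * (if k = i then r else 0)) = (r::real) * f k"
  by (simp_all add: if_distrib[of "\<lambda>x. x * _"] if_distrib[of "\<lambda>x. _ * x"] mult.commute cong: if_cong)

locale symplectic = atlas A
  for A :: "('m::t2_space, 'n::finite) chart set" +
  fixes \<Omega> :: "('m, 'n) tensor" and n :: nat
  assumes sympl: "symplectic_manifold n A \<Omega>"
begin

abbreviation "\<omega> \<equiv> \<Omega>up \<Omega>"

lemma \<Omega>_tensor: "tensor_field A 0 2 \<Omega>"
  and card_n: "CARD('n) = 2 * n"
  and \<Omega>_skew: "c \<in> A \<Longrightarrow> p \<in> cdom c \<Longrightarrow> \<Omega> c p [] [i, j] = - \<Omega> c p [] [j, i]"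
  and \<Omega>_invertible: "c \<in> A \<Longrightarrow> p \<in> cdom c \<Longrightarrow> invertible (two_form_matrix \<Omega> c p)"
  using sympl unfolding symplectic_manifold_def by blast+

lemma \<Omega>_smf: "c \<in> A \<Longrightarrow> smf c (cdom c) (\<lambda>p. \<Omega> c p [] [i, j])"
  using tensor_field_smf[OF \<Omega>_tensor] by (simp add: idx_def)

lemma \<omega>\<Omega>: "c \<in> A \<Longrightarrow> p \<in> cdom c \<Longrightarrow> (\<Sum>k\<in>UNIV. \<omega> c p i k * \<Omega> c p [] [k, j]) = (if i = j then - 1 else 0)"
  and \<Omega>\<omega>: "c \<in> A \<Longrightarrow> p \<in> cdom c \<Longrightarrow> (\<Sum>k\<in>UNIV. \<Omega> c p [] [i, k] * \<omega> c p k j) = (if i = j then - 1 else 0)"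
proof -
  assume cp: "c \<in> A" "p \<in> cdom c"
  let ?M = "two_form_matrix \<Omega> c p"
  have M: "matrix_inv ?M ** ?M = mat 1" "?M ** matrix_inv ?M = mat 1"
    using matrix_inv[OF \<Omega>_invertible[OF cp]] by auto
  have "(\<Sum>k\<in>UNIV. \<omega> c p i k * \<Omega> c p [] [k, j]) = - ((matrix_inv ?M ** ?M) $ i $ j)"
    by (simp add: matrix_matrix_mult_def \<Omega>up_def two_form_matrix_def sum_negf)
  then show "(\<Sum>k\<in>UNIV. \<omega> c p i k * \<Omega> c p [] [k, j]) = (if i = j then - 1 else 0)"
    unfolding M by (simp add: mat_def)
  have "(\<Sum>k\<in>UNIV. \<Omega> c p [] [i, k] * \<omega> c p k j) = - ((?M ** matrix_inv ?M) $ i $ j)"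
    by (simp add: matrix_matrix_mult_def \<Omega>up_def two_form_matrix_def sum_negf)
  then show "(\<Sum>k\<in>UNIV. \<Omega> c p [] [i, k] * \<omega> c p k j) = (if i = j then - 1 else 0)"
    unfolding M by (simp add: mat_def)
qed

lemma \<omega>_unique:
  assumes cp: "c \<in> A" "p \<in> cdom c"
    and X: "\<And>i j. (\<Sum>k\<in>UNIV. X i k * \<Omega> c p [] [k, j]) = (if i = j then - 1 else 0)"
  shows "X i j = \<omega> c p i j"
proof -
  have "(\<Sum>l\<in>UNIV. (\<Sum>k\<in>UNIV. X i k * \<Omega> c p [] [k, l]) * \<omega> c p l j)
      = (\<Sum>k\<in>UNIV. X i k * (\<Sum>l\<in>UNIV. \<Omega> c p [] [k, l] * \<omega> c p l j))"
    by (simp add: sum_distrib_left sum_distrib_right mult.assoc) (rule sum.swap)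
  then show ?thesis unfolding X \<Omega>\<omega>[OF cp] by (simp add: sum_delta_mult)
qed

lemma \<omega>_skew: "c \<in> A \<Longrightarrow> p \<in> cdom c \<Longrightarrow> \<omega> c p i j = - \<omega> c p j i"
proof -
  assume cp: "c \<in> A" "p \<in> cdom c"
  have "(\<Sum>k\<in>UNIV. - \<omega> c p k i * \<Omega> c p [] [k, j]) = (if i = j then - 1 else 0)" for i j
  proof -
    have "(\<Sum>k\<in>UNIV. - \<omega> c p k i * \<Omega> c p [] [k, j]) = (\<Sum>k\<in>UNIV. \<Omega> c p [] [j, k] * \<omega> c p k i)"
      by (intro sum.cong refl) (subst \<Omega>_skew[OF cp], simp)
    then show ?thesis using \<Omega>\<omega>[OF cp] by auto
  qed
  from \<omega>_unique[OF cp, of "\<lambda>i j. - \<omega> c p j i", OF this] show ?thesis by simp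
qed

text \<open>By Cramer's rule, the entries of \<open>\<omega>\<close> are rational functions of those of \<open>\<Omega>\<close>.\<close>

lemma \<omega>_smf:
  assumes c: "c \<in> A"
  shows "smf c (cdom c) (\<lambda>p. \<omega> c p i j)"
proof -
  interpret C: chart_domain c "cdom c" using chart_domain_cdom c by blast
  define D where "D = (\<lambda>p. det (two_form_matrix \<Omega> c p))"
  define N where "N = (\<lambda>p. det (\<chi> a b. if b = i then axis j 1 $ a else two_form_matrix \<Omega> c p $ a $ b))"
  have eq: "- (N p * inverse (D p)) = \<omega> c p i j" and D0: "D p \<noteq> 0" if p: "p \<in> cdom c" for p
  proof -
    let ?M = "two_form_matrix \<Omega> c p"
    show D0: "D p \<noteq> 0" using \<Omega>_invertible[OF c p] unfolding D_def invertible_det_nz .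
    have "?M *v (matrix_inv ?M *v axis j 1) = axis j 1"
      using matrix_inv[OF \<Omega>_invertible[OF c p]] by (simp add: matrix_vector_mul_assoc)
    then have "matrix_inv ?M *v axis j 1
        = (\<chi> k. det (\<chi> a b. if b = k then axis j 1 $ a else ?M $ a $ b) / det ?M)"
      using cramer[of ?M "matrix_inv ?M *v axis j 1" "axis j 1"] D0 by (simp add: D_def)
    then have "(matrix_inv ?M *v axis j 1) $ i = N p / D p" by (simp add: N_def D_def)
    moreover have "(matrix_inv ?M *v axis j 1) $ i = matrix_inv ?M $ i $ j"
      by (simp add: matrix_vector_mult_def axis_def if_distrib[of "\<lambda>x. _ * x"] cong: if_cong)
    ultimately show "- (N p * inverse (D p)) = \<omega> c p i j" by (simp add: \<Omega>up_def divide_inverse)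
  qed
  have M: "smf c (cdom c) (\<lambda>p. two_form_matrix \<Omega> c p $ a $ b)" for a b
    by (simp add: two_form_matrix_def \<Omega>_smf[OF c])
  have "smf c (cdom c) D"
    unfolding D_def det_def by (intro C.smf_sum C.smf_mult C.smf_prod C.smf_const M)
  moreover have "smf c (cdom c) N"
  proof -
    have "smf c (cdom c) (\<lambda>p. if b = i then axis j 1 $ a else two_form_matrix \<Omega> c p $ a $ b)" for a b
      using M by (cases "b = i") simp_all
    then show ?thesis unfolding N_def det_def by (intro C.smf_sum C.smf_mult C.smf_prod C.smf_const) simp
  qed
  ultimately have "smf c (cdom c) (\<lambda>p. - (N p * inverse (D p)))"
    using D0 by (intro C.smf_uminus C.smf_mult C.smf_inverse) auto
  then show ?thesis by (rule C.smf_cong) (rule eq)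
qed

lemma \<Omega>_transform:
  assumes "c \<in> A" "d \<in> A" "p \<in> cdom c" "p \<in> cdom d"
  shows "\<Omega> d p [] [i, j] = (\<Sum>a\<in>UNIV. \<Sum>b\<in>UNIV. jac c d p a i * jac c d p b j * \<Omega> c p [] [a, b])"
proof -
  have "[i, j] \<in> idx 2" by (simp add: idx_def)
  from tensor_field_tr[OF \<Omega>_tensor assms this]
  have "\<Omega> d p [] [i, j] = tr (jac c d p) (Suc (Suc 0)) (\<Omega> c p []) [i, j]"
    by (simp add: numeral_2_eq_2)
  then show ?thesis by (simp add: tr_Suc sum_distrib_left mult.assoc)
qed

lemma \<omega>_transform:
  assumes cd: "c \<in> A" "d \<in> A" "p \<in> cdom c" "p \<in> cdom d"
  shows "\<omega> c p a b = (\<Sum>i\<in>UNIV. \<Sum>j\<in>UNIV. jac c d p a i * \<omega> d p i j * jac c d p b j)"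
proof -
  let ?J = "jac c d p" and ?K = "jac d c p"
  let ?X = "\<lambda>a b. \<Sum>i\<in>UNIV. \<Sum>j\<in>UNIV. ?J a i * \<omega> d p i j * ?J b j"
  have KJ: "(\<Sum>b\<in>UNIV. ?K k b * ?J b j) = (if k = j then 1 else 0)" for k j
    using jac_inverse[OF cd] .
  have JK: "(\<Sum>b\<in>UNIV. ?J k b * ?K b j) = (if k = j then 1 else 0)" for k j
    using jac_inverse[OF cd(2,1,4,3)] .
  have "(\<Sum>b\<in>UNIV. ?X a b * \<Omega> c p [] [b, e]) = (if a = e then - 1 else 0)" for a e
  proof -
    have 1: "(\<Sum>b\<in>UNIV. ?J b j * \<Omega> c p [] [b, e]) = (\<Sum>l\<in>UNIV. ?K l e * \<Omega> d p [] [j, l])" for j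
    proof -
      have "(\<Sum>b\<in>UNIV. ?J b j * \<Omega> c p [] [b, e])
        = (\<Sum>b\<in>UNIV. \<Sum>k\<in>UNIV. \<Sum>l\<in>UNIV. ?K k b * ?J b j * (?K l e * \<Omega> d p [] [k, l]))"
        unfolding \<Omega>_transform[OF cd(2,1,4,3)] by (simp add: sum_distrib_left ac_simps)
      also have "\<dots> = (\<Sum>k\<in>UNIV. \<Sum>b\<in>UNIV. \<Sum>l\<in>UNIV. ?K k b * ?J b j * (?K l e * \<Omega> d p [] [k, l]))"
        by (rule sum.swap)
      also have "\<dots> = (\<Sum>k\<in>UNIV. (\<Sum>b\<in>UNIV. ?K k b * ?J b j) * (\<Sum>l\<in>UNIV. ?K l e * \<Omega> d p [] [k, l]))"
        by (simp add: sum_distrib_left sum_distrib_right) (rule sum.cong[OF refl], rule sum.swap)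
      finally show ?thesis unfolding KJ by (simp add: sum_delta_mult)
    qed
    have "(\<Sum>b\<in>UNIV. ?X a b * \<Omega> c p [] [b, e])
        = (\<Sum>b\<in>UNIV. \<Sum>i\<in>UNIV. \<Sum>j\<in>UNIV. ?J a i * \<omega> d p i j * (?J b j * \<Omega> c p [] [b, e]))"
      by (simp add: sum_distrib_left sum_distrib_right ac_simps)
    also have "\<dots> = (\<Sum>i\<in>UNIV. \<Sum>b\<in>UNIV. \<Sum>j\<in>UNIV. ?J a i * \<omega> d p i j * (?J b j * \<Omega> c p [] [b, e]))"
      by (rule sum.swap)
    also have "\<dots> = (\<Sum>i\<in>UNIV. \<Sum>j\<in>UNIV. \<Sum>b\<in>UNIV. ?J a i * \<omega> d p i j * (?J b j * \<Omega> c p [] [b, e]))"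
      by (rule sum.cong[OF refl], rule sum.swap)
    also have "\<dots> = (\<Sum>i\<in>UNIV. \<Sum>j\<in>UNIV. ?J a i * \<omega> d p i j * (\<Sum>l\<in>UNIV. ?K l e * \<Omega> d p [] [j, l]))"
      unfolding sum_distrib_left[symmetric] 1 ..
    also have "\<dots> = (\<Sum>i\<in>UNIV. \<Sum>j\<in>UNIV. \<Sum>l\<in>UNIV. ?J a i * ?K l e * (\<omega> d p i j * \<Omega> d p [] [j, l]))"
      by (simp add: sum_distrib_left ac_simps)
    also have "\<dots> = (\<Sum>i\<in>UNIV. \<Sum>l\<in>UNIV. \<Sum>j\<in>UNIV. ?J a i * ?K l e * (\<omega> d p i j * \<Omega> d p [] [j, l]))"
      by (rule sum.cong[OF refl], rule sum.swap)
    also have "\<dots> = (\<Sum>i\<in>UNIV. \<Sum>l\<in>UNIV. ?J a i * ?K l e * (if i = l then - 1 else 0))"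
      unfolding sum_distrib_left[symmetric] \<omega>\<Omega>[OF cd(2,4)] ..
    also have "\<dots> = - (\<Sum>i\<in>UNIV. ?J a i * ?K i e)" by (simp add: sum_delta_mult sum_negf)
    finally show ?thesis unfolding JK by simp
  qed
  from \<omega>_unique[OF cd(1,3), of ?X, OF this] show ?thesis by simp
qed

lemma tensor_field_ctr:
  assumes T: "tensor_field A 0 (Suc (Suc k)) T"
  shows "tensor_field A 0 k (ctr \<Omega> T)"
proof (rule tensor_fieldI)
  show "smf c (cdom c) (\<lambda>p. ctr \<Omega> T c p [] ls)" if c: "c \<in> A" and ls: "ls \<in> idx k" for c ls
  proof -
    interpret C: chart_domain c "cdom c" using chart_domain_cdom c by blast
    show ?thesis unfolding ctr_def using tensor_field_smf[OF T c] ls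
      by (intro C.smf_sum C.smf_mult \<omega>_smf c) auto
  qed
  show "ctr \<Omega> T d p [] ls = tr (jac c d p) k (ctr \<Omega> T c p []) ls"
    if cd: "c \<in> A" "d \<in> A" "p \<in> cdom c" "p \<in> cdom d" and ls: "ls \<in> idx k" for c d p ls
  proof -
    let ?J = "jac c d p"
    let ?t = "\<lambda>e f. tr ?J k (\<lambda>ms. T c p [] (e # f # ms)) ls"
    have "ctr \<Omega> T d p [] ls = (\<Sum>i\<in>UNIV. \<Sum>a\<in>UNIV. \<omega> d p i a * (\<Sum>e\<in>UNIV. ?J e a * (\<Sum>f\<in>UNIV. ?J f i * ?t e f)))"
      unfolding ctr_def using tensor_field_tr[OF T cd] ls by (simp add: tr_Suc)
    also have "\<dots> = (\<Sum>i\<in>UNIV. \<Sum>a\<in>UNIV. \<Sum>e\<in>UNIV. \<Sum>f\<in>UNIV. (?J f i * \<omega> d p i a * ?J e a) * ?t e f)"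
      by (simp add: sum_distrib_left ac_simps)
    also have "\<dots> = (\<Sum>i\<in>UNIV. \<Sum>a\<in>UNIV. \<Sum>f\<in>UNIV. \<Sum>e\<in>UNIV. (?J f i * \<omega> d p i a * ?J e a) * ?t e f)"
      by (rule sum.cong[OF refl], rule sum.cong[OF refl], rule sum.swap)
    also have "\<dots> = (\<Sum>i\<in>UNIV. \<Sum>f\<in>UNIV. \<Sum>a\<in>UNIV. \<Sum>e\<in>UNIV. (?J f i * \<omega> d p i a * ?J e a) * ?t e f)"
      by (rule sum.cong[OF refl], rule sum.swap)
    also have "\<dots> = (\<Sum>f\<in>UNIV. \<Sum>i\<in>UNIV. \<Sum>a\<in>UNIV. \<Sum>e\<in>UNIV. (?J f i * \<omega> d p i a * ?J e a) * ?t e f)"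
      by (rule sum.swap)
    also have "\<dots> = (\<Sum>f\<in>UNIV. \<Sum>i\<in>UNIV. \<Sum>e\<in>UNIV. \<Sum>a\<in>UNIV. (?J f i * \<omega> d p i a * ?J e a) * ?t e f)"
      by (rule sum.cong[OF refl], rule sum.cong[OF refl], rule sum.swap)
    also have "\<dots> = (\<Sum>f\<in>UNIV. \<Sum>e\<in>UNIV. \<Sum>i\<in>UNIV. \<Sum>a\<in>UNIV. (?J f i * \<omega> d p i a * ?J e a) * ?t e f)"
      by (rule sum.cong[OF refl], rule sum.swap)
    also have "\<dots> = (\<Sum>f\<in>UNIV. \<Sum>e\<in>UNIV. \<omega> c p f e * ?t e f)"
      unfolding \<omega>_transform[OF cd] by (simp add: sum_distrib_right)
    also have "\<dots> = tr ?J k (ctr \<Omega> T c p []) ls"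
      unfolding ctr_def
      using tr_sum[of ?J k "\<lambda>_. 1" "\<lambda>i ls. \<Sum>a\<in>UNIV. \<omega> c p i a * T c p [] (a # i # ls)" UNIV ls]
      by (simp add: tr_sum)
    finally show ?thesis .
  qed
qed

lemma tensor_field_hook:
  assumes \<alpha>: "tensor_field A 0 k \<alpha>" and \<beta>: "tensor_field A 0 (Suc k) \<beta>"
  shows "tensor_field A 0 (Suc 0) (hook \<Omega> k \<alpha> \<beta>)"
proof (rule tensor_fieldI)
  show "smf c (cdom c) (\<lambda>p. hook \<Omega> k \<alpha> \<beta> c p [] ls)" if c: "c \<in> A" and ls: "ls \<in> idx (Suc 0)" for c ls
    unfolding hook_def using tensor_field_smf[OF \<alpha> c] tensor_field_smf[OF \<beta> c]
    by (intro chart_domain.smf_fcf[OF chart_domain_cdom[OF c]] \<omega>_smf c) auto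
  show "hook \<Omega> k \<alpha> \<beta> d p [] ls = tr (jac c d p) (Suc 0) (hook \<Omega> k \<alpha> \<beta> c p []) ls"
    if cd: "c \<in> A" "d \<in> A" "p \<in> cdom c" "p \<in> cdom d" and ls: "ls \<in> idx (Suc 0)" for c d p ls
  proof -
    let ?J = "jac c d p"
    obtain i where i: "ls = [i]" using ls by (auto elim: idx_Suc_cases)
    have "hook \<Omega> k \<alpha> \<beta> d p [] ls = fcf (\<omega> d p) k (tr ?J k (\<alpha> c p []))
        (\<lambda>ms. \<Sum>a\<in>UNIV. ?J a i * tr ?J k (\<lambda>ms. \<beta> c p [] (a # ms)) ms)"
      unfolding hook_def i using tensor_field_tr[OF \<alpha> cd] tensor_field_tr[OF \<beta> cd]
      by (intro fcf_cong) (auto simp: tr_Suc)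
    also have "\<dots> = (\<Sum>a\<in>UNIV. ?J a i * fcf (\<omega> c p) k (\<alpha> c p []) (\<lambda>ms. \<beta> c p [] (a # ms)))"
      unfolding fcf_sum_right fcf_tr[OF \<omega>_transform[OF cd]] ..
    finally show ?thesis by (simp add: i tr_Suc hook_def)
  qed
qed

lemma tensor_field_full_contraction:
  assumes \<alpha>: "tensor_field A 0 k \<alpha>" and \<beta>: "tensor_field A 0 k \<beta>"
  shows "tensor_field A 0 0 (full_contraction \<Omega> k \<alpha> \<beta>)"
proof (rule tensor_fieldI)
  show "smf c (cdom c) (\<lambda>p. full_contraction \<Omega> k \<alpha> \<beta> c p [] ls)" if c: "c \<in> A" for c ls
    unfolding full_contraction_fcf using tensor_field_smf[OF \<alpha> c] tensor_field_smf[OF \<beta> c]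
    by (intro chart_domain.smf_fcf[OF chart_domain_cdom[OF c]] \<omega>_smf c) auto
  show "full_contraction \<Omega> k \<alpha> \<beta> d p [] ls = tr (jac c d p) 0 (full_contraction \<Omega> k \<alpha> \<beta> c p []) ls"
    if cd: "c \<in> A" "d \<in> A" "p \<in> cdom c" "p \<in> cdom d" for c d p ls
  proof -
    have "fcf (\<omega> d p) k (\<alpha> d p []) (\<beta> d p [])
        = fcf (\<omega> d p) k (tr (jac c d p) k (\<alpha> c p [])) (tr (jac c d p) k (\<beta> c p []))"
      using tensor_field_tr[OF \<alpha> cd] tensor_field_tr[OF \<beta> cd] by (intro fcf_cong) auto
    then show ?thesis by (simp add: full_contraction_fcf fcf_tr[OF \<omega>_transform[OF cd]])
  qed
qed

end

section \<open>Curvature of a symplectic connection\<close>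

lemma dop_generator_diff: "dop (\<lambda>i l. G i l - H i l) T ls = dop G T ls - dop H T ls"
  unfolding dop_def by (simp add: sum_subtractf algebra_simps)

lemma dop_diff: "dop G (\<lambda>ls. S ls - T ls) ls = dop G S ls - dop G T ls"
  unfolding dop_def by (simp add: sum_subtractf algebra_simps)

lemma dop_commutator:
  "dop G (dop H T) ls - dop H (dop G T) ls
     = dop (\<lambda>i l. (\<Sum>m\<in>UNIV. G i m * H m l) - (\<Sum>m\<in>UNIV. H i m * G m l)) T ls"
proof (induction ls arbitrary: T)
  case (Cons j ls)
  have split: "dop G (dop H T) (j # ls) = (\<Sum>l\<in>UNIV. (\<Sum>m\<in>UNIV. G j m * H m l) * T (l # ls))
      + (\<Sum>l\<in>UNIV. G j l * dop H (\<lambda>ls. T (l # ls)) ls) + (\<Sum>l\<in>UNIV. H j l * dop G (\<lambda>ls. T (l # ls)) ls)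
      + dop G (dop H (\<lambda>ls. T (j # ls))) ls" for G H
  proof -
    have "(\<Sum>l\<in>UNIV. G j l * (\<Sum>m\<in>UNIV. H l m * T (m # ls)))
       = (\<Sum>l\<in>UNIV. (\<Sum>m\<in>UNIV. G j m * H m l) * T (l # ls))"
      by (simp add: sum_distrib_left sum_distrib_right mult.assoc) (rule sum.swap)
    moreover have "dop G (\<lambda>ls. dop H T (j # ls)) ls
       = (\<Sum>l\<in>UNIV. H j l * dop G (\<lambda>ls. T (l # ls)) ls) + dop G (dop H (\<lambda>ls. T (j # ls))) ls"
      unfolding dop_Cons dop_add dop_sum ..
    ultimately show ?thesis
      by (simp add: sum.distrib algebra_simps)
  qed
  show ?case
    unfolding split[of G H] split[of H G]
    unfolding dop_Cons Cons.IH[symmetric]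
    by (simp add: sum_subtractf algebra_simps)
qed simp

context chart_domain
begin

lemma chart_pd_dop:
  assumes "\<And>i j. smf c W (\<lambda>p. G p i j)" "\<And>ls. ls \<in> idx k \<Longrightarrow> smf c W (\<lambda>p. T p ls)" "p \<in> W" "ls \<in> idx k"
  shows "chart_pd c a (\<lambda>p. dop (G p) (T p) ls) p
    = dop (\<lambda>i l. chart_pd c a (\<lambda>p. G p i l) p) (T p) ls + dop (G p) (\<lambda>ls. chart_pd c a (\<lambda>p. T p ls) p) ls"
proof -
  have *: "smf c W (\<lambda>p. G p (ls ! m) l)" "smf c W (\<lambda>p. T p (ls[m := l]))" for m l
    using assms by (auto simp: idx_def)
  have "chart_pd c a (\<lambda>p. dop (G p) (T p) ls) p
     = (\<Sum>m<length ls. \<Sum>l\<in>UNIV. chart_pd c a (\<lambda>p. G p (ls ! m) l * T p (ls[m := l])) p)"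
    unfolding dop_def using * assms(3)
    by (subst chart_pd_sum, intro smf_sum smf_mult *, simp, subst chart_pd_sum, intro smf_mult *, simp_all)
  then show ?thesis
    using * assms(3) unfolding dop_def by (simp add: chart_pd_mult sum.distrib)
qed

end

text \<open>A torsion free connection in a chart. \<open>E i\<close> is the \<open>i\<close>-th partial covariant derivative, acting on
  the components with a fixed number of indices; its commutators are the curvature.\<close>

locale chart_conn = chart_domain c W for c :: "('m::topological_space, 'n::finite) chart" and W +
  fixes \<Gamma> :: "('m, 'n) conn"
  assumes \<Gamma>_smf: "smf c W (\<lambda>p. \<Gamma> c p i j k)"
    and \<Gamma>_sym: "p \<in> W \<Longrightarrow> \<Gamma> c p i j k = \<Gamma> c p j i k"
begin

lemma curv_eq:
  assumes p: "p \<in> W"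
  shows "curv \<Gamma> c p i j l k = chart_pd c i (\<lambda>p. \<Gamma> c p j l k) p - chart_pd c j (\<lambda>p. \<Gamma> c p i l k) p
    - ((\<Sum>m\<in>UNIV. \<Gamma> c p i l m * \<Gamma> c p j m k) - (\<Sum>m\<in>UNIV. \<Gamma> c p j l m * \<Gamma> c p i m k))"
proof -
  have 1: "cov \<Gamma> (coordinate_field l) c q [k] [j] = \<Gamma> c q j l k" for j k q
    by (simp add: cov_def coordinate_field_def sum_delta_mult)
  have "cov \<Gamma> (cov \<Gamma> (coordinate_field l)) c p [k] [i, j]
     = chart_pd c i (\<lambda>p. \<Gamma> c p j l k) p + (\<Sum>m\<in>UNIV. \<Gamma> c p i m k * \<Gamma> c p j l m)
       - (\<Sum>m\<in>UNIV. \<Gamma> c p i j m * \<Gamma> c p m l k)" for i j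
    by (subst cov_def) (simp add: 1)
  then show ?thesis unfolding curv_def by (simp add: \<Gamma>_sym[OF p, of i j] ac_simps)
qed

lemma curv_smf: "smf c W (\<lambda>p. curv \<Gamma> c p i j l k)"
proof -
  have "smf c W (\<lambda>p. chart_pd c i (\<lambda>p. \<Gamma> c p j l k) p - chart_pd c j (\<lambda>p. \<Gamma> c p i l k) p
    - ((\<Sum>m\<in>UNIV. \<Gamma> c p i l m * \<Gamma> c p j m k) - (\<Sum>m\<in>UNIV. \<Gamma> c p j l m * \<Gamma> c p i m k)))"
    by (intro smf_diff smf_sum smf_mult smf_chart_pd \<Gamma>_smf)
  then show ?thesis by (rule smf_cong) (simp add: curv_eq)
qed

lemma bianchi1: "p \<in> W \<Longrightarrow> curv \<Gamma> c p i j l k + curv \<Gamma> c p j l i k + curv \<Gamma> c p l i j k = 0"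
proof -
  assume p: "p \<in> W"
  have s: "chart_pd c i (\<lambda>p. \<Gamma> c p j l k) p = chart_pd c i (\<lambda>p. \<Gamma> c p l j k) p" for i j l
    using \<Gamma>_sym by (intro chart_pd_cong p) auto
  show ?thesis
    unfolding curv_eq[OF p] s[of i j l] s[of j i l] s[of l i j]
    by (simp add: \<Gamma>_sym[OF p, of i j] \<Gamma>_sym[OF p, of j l] \<Gamma>_sym[OF p, of i l])
qed

definition E :: "'n \<Rightarrow> ('m \<Rightarrow> 'n list \<Rightarrow> real) \<Rightarrow> 'm \<Rightarrow> 'n list \<Rightarrow> real" where
  "E i T p ls = chart_pd c i (\<lambda>p. T p ls) p - dop (\<Gamma> c p i) (T p) ls"

lemma E_smf:
  "(\<And>ls. ls \<in> idx k \<Longrightarrow> smf c W (\<lambda>p. T p ls)) \<Longrightarrow> ls \<in> idx k \<Longrightarrow> smf c W (\<lambda>p. E i T p ls)"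
  unfolding E_def by (intro smf_diff smf_chart_pd smf_dop[of _ k] \<Gamma>_smf) auto

lemma E_diff:
  assumes "\<And>ls. ls \<in> idx k \<Longrightarrow> smf c W (\<lambda>p. S p ls)" "\<And>ls. ls \<in> idx k \<Longrightarrow> smf c W (\<lambda>p. T p ls)"
    and "p \<in> W" "ls \<in> idx k"
  shows "E i (\<lambda>p ls. S p ls - T p ls) p ls = E i S p ls - E i T p ls"
  unfolding E_def using assms by (simp add: chart_pd_diff dop_diff)

lemma E_cong:
  assumes "\<And>p ls. p \<in> W \<Longrightarrow> ls \<in> idx k \<Longrightarrow> S p ls = T p ls" and "p \<in> W" "ls \<in> idx k"
  shows "E i S p ls = E i T p ls"
  unfolding E_def using assms chart_pd_cong[of p "\<lambda>p. S p ls" "\<lambda>p. T p ls" i] dop_cong[of ls k "S p" "T p"] by auto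

lemma E_commutator:
  assumes T: "\<And>ls. ls \<in> idx k \<Longrightarrow> smf c W (\<lambda>p. T p ls)" and p: "p \<in> W" and ls: "ls \<in> idx k"
  shows "E i (E j T) p ls - E j (E i T) p ls = - dop (curv \<Gamma> c p i j) (T p) ls"
proof -
  have EE: "E i (E j T) p ls = chart_pd c i (chart_pd c j (\<lambda>p. T p ls)) p
      - dop (\<lambda>l k. chart_pd c i (\<lambda>p. \<Gamma> c p j l k) p) (T p) ls
      - dop (\<Gamma> c p j) (\<lambda>ls. chart_pd c i (\<lambda>p. T p ls) p) ls
      - dop (\<Gamma> c p i) (\<lambda>ls. chart_pd c j (\<lambda>p. T p ls) p) ls
      + dop (\<Gamma> c p i) (dop (\<Gamma> c p j) (T p)) ls" for i j
  proof -
    have "chart_pd c i (\<lambda>p. E j T p ls) p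
       = chart_pd c i (\<lambda>p. chart_pd c j (\<lambda>p. T p ls) p) p - chart_pd c i (\<lambda>p. dop (\<Gamma> c p j) (T p) ls) p"
      unfolding E_def using T ls p \<Gamma>_smf
      by (intro chart_pd_diff smf_chart_pd smf_dop[of _ k]) auto
    moreover have "chart_pd c i (\<lambda>p. dop (\<Gamma> c p j) (T p) ls) p
      = dop (\<lambda>l k. chart_pd c i (\<lambda>p. \<Gamma> c p j l k) p) (T p) ls
       + dop (\<Gamma> c p j) (\<lambda>ls. chart_pd c i (\<lambda>p. T p ls) p) ls"
      by (rule chart_pd_dop[OF \<Gamma>_smf T p ls])
    moreover have "dop (\<Gamma> c p i) (E j T p) ls
      = dop (\<Gamma> c p i) (\<lambda>ls. chart_pd c j (\<lambda>p. T p ls) p) ls - dop (\<Gamma> c p i) (dop (\<Gamma> c p j) (T p)) ls"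
      unfolding E_def[abs_def] by (rule dop_diff)
    ultimately show ?thesis by (simp add: E_def[of i "E j T"])
  qed
  have "dop (curv \<Gamma> c p i j) (T p) ls
     = dop (\<lambda>l k. (chart_pd c i (\<lambda>p. \<Gamma> c p j l k) p - chart_pd c j (\<lambda>p. \<Gamma> c p i l k) p)
    - ((\<Sum>m\<in>UNIV. \<Gamma> c p i l m * \<Gamma> c p j m k) - (\<Sum>m\<in>UNIV. \<Gamma> c p j l m * \<Gamma> c p i m k))) (T p) ls"
    unfolding dop_def curv_eq[OF p] ..
  also have "\<dots> = dop (\<lambda>l k. chart_pd c i (\<lambda>p. \<Gamma> c p j l k) p) (T p) ls
      - dop (\<lambda>l k. chart_pd c j (\<lambda>p. \<Gamma> c p i l k) p) (T p) ls
      - (dop (\<Gamma> c p i) (dop (\<Gamma> c p j) (T p)) ls - dop (\<Gamma> c p j) (dop (\<Gamma> c p i) (T p)) ls)"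
    unfolding dop_commutator[of "\<Gamma> c p i" "\<Gamma> c p j"]
    unfolding dop_generator_diff[of "\<lambda>l k. chart_pd c i (\<lambda>p. \<Gamma> c p j l k) p - chart_pd c j (\<lambda>p. \<Gamma> c p i l k) p"]
    unfolding dop_generator_diff[of "\<lambda>l k. chart_pd c i (\<lambda>p. \<Gamma> c p j l k) p"] ..
  finally show ?thesis
    unfolding EE using chart_pd_commute[OF T[OF ls] p, of i j] by simp
qed

lemma cov_cov:
  "cov \<Gamma> (cov \<Gamma> T) c p [] (i # j # ls)
    = E i (E j (\<lambda>p. T c p [])) p ls - (\<Sum>m\<in>UNIV. \<Gamma> c p i j m * E m (\<lambda>p. T c p []) p ls)"
  by (simp add: cov_Cons E_def[abs_def])

lemma ricci_identity:
  assumes T: "\<And>ls. ls \<in> idx k \<Longrightarrow> smf c W (\<lambda>p. T c p [] ls)" and p: "p \<in> W" and ls: "ls \<in> idx k"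
  shows "cov \<Gamma> (cov \<Gamma> T) c p [] (i # j # ls) - cov \<Gamma> (cov \<Gamma> T) c p [] (j # i # ls)
    = - dop (curv \<Gamma> c p i j) (T c p []) ls"
  unfolding cov_cov using E_commutator[OF T p ls, where i = i and j = j] \<Gamma>_sym[OF p, of i j] by simp

text \<open>The second Bianchi identity for the endomorphism-valued part is the Jacobi identity for the
  operators \<open>E i\<close>.\<close>

lemma bianchi2_operator:
  assumes p: "p \<in> W"
  defines "S \<equiv> \<lambda>i j k l m. chart_pd c i (\<lambda>p. curv \<Gamma> c p j k l m) p
      - ((\<Sum>e\<in>UNIV. \<Gamma> c p i l e * curv \<Gamma> c p j k e m) - (\<Sum>e\<in>UNIV. curv \<Gamma> c p j k l e * \<Gamma> c p i e m))"
  shows "S i j k l m + S j k i l m + S k i j l m = 0"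
proof -
  define T where "T = (\<lambda>(p::'m) ls. if ls = [m] then 1 else (0::real))"
  have T: "smf c W (\<lambda>p. T p ls)" if "ls \<in> idx 1" for ls by (simp add: T_def)
  let ?R = "\<lambda>j k T p ls. dop (curv \<Gamma> c p j k) (T p) ls"
  have l: "[l] \<in> idx 1" by (simp add: idx_def)
  have R: "smf c W (\<lambda>p. ?R j k T p ls)" if "ls \<in> idx 1" for j k ls
    by (rule smf_dop[OF curv_smf T that])
  have ER: "E i (?R j k T) p [l] = ?R j k (E i T) p [l] + S i j k l m" for i j k
  proof -
    have "E i (?R j k T) p [l] = dop (\<lambda>l m. chart_pd c i (\<lambda>p. curv \<Gamma> c p j k l m) p) (T p) [l]
        + dop (curv \<Gamma> c p j k) (\<lambda>ls. chart_pd c i (\<lambda>p. T p ls) p) [l]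
        - dop (\<Gamma> c p i) (dop (curv \<Gamma> c p j k) (T p)) [l]"
      unfolding E_def using chart_pd_dop[of "\<lambda>p. curv \<Gamma> c p j k" 1 T p "[l]", OF curv_smf T p l] by simp
    moreover have "?R j k (E i T) p [l] = dop (curv \<Gamma> c p j k) (\<lambda>ls. chart_pd c i (\<lambda>p. T p ls) p) [l]
        - dop (curv \<Gamma> c p j k) (dop (\<Gamma> c p i) (T p)) [l]"
      unfolding E_def[abs_def] by (rule dop_diff)
    moreover have "dop (\<Gamma> c p i) (dop (curv \<Gamma> c p j k) (T p)) [l] - dop (curv \<Gamma> c p j k) (dop (\<Gamma> c p i) (T p)) [l]
       = (\<Sum>e\<in>UNIV. \<Gamma> c p i l e * curv \<Gamma> c p j k e m) - (\<Sum>e\<in>UNIV. curv \<Gamma> c p j k l e * \<Gamma> c p i e m)"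
      unfolding dop_commutator by (simp add: T_def sum_delta_mult)
    moreover have "dop (\<lambda>l m. chart_pd c i (\<lambda>p. curv \<Gamma> c p j k l m) p) (T p) [l]
        = chart_pd c i (\<lambda>p. curv \<Gamma> c p j k l m) p"
      by (simp add: T_def sum_delta_mult)
    ultimately show ?thesis by (simp add: S_def)
  qed
  have ET: "smf c W (\<lambda>p. E i T p ls)" if "ls \<in> idx 1" for i ls by (rule E_smf[OF T that])
  have EET: "smf c W (\<lambda>p. E i (E j T) p ls)" if "ls \<in> idx 1" for i j ls by (rule E_smf[OF ET that])
  have 1: "E i (?R j k T) p [l] = E i (E k (E j T)) p [l] - E i (E j (E k T)) p [l]" for i j k
  proof -
    have "E i (?R j k T) p [l] = E i (\<lambda>p ls. E k (E j T) p ls - E j (E k T) p ls) p [l]"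
      using E_commutator[OF T, where i = j and j = k] by (intro E_cong[of 1] p l) (simp add: algebra_simps)
    also have "\<dots> = E i (E k (E j T)) p [l] - E i (E j (E k T)) p [l]"
      by (rule E_diff[OF EET EET p l])
    finally show ?thesis .
  qed
  have 2: "?R j k (E i T) p [l] = E k (E j (E i T)) p [l] - E j (E k (E i T)) p [l]" for i j k
    using E_commutator[where T = "E i T" and i = j and j = k, OF ET p l] by simp
  show ?thesis
    using ER[of i j k] ER[of j k i] ER[of k i j] unfolding 1 2 by simp
qed

end

locale symplectic_connection = symplectic A \<Omega> n
  for A :: "('m::t2_space, 'n::finite) chart set" and \<Omega> n +
  fixes \<Gamma> :: "('m, 'n) conn"
  assumes SConn: "\<Gamma> \<in> SConn A \<Omega>"
begin

lemma aff: "affine_connection A \<Gamma>"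
  and torsion_free: "c \<in> A \<Longrightarrow> p \<in> cdom c \<Longrightarrow> \<Gamma> c p i j k = \<Gamma> c p j i k"
  and parallel: "vanishes A 3 (cov \<Gamma> \<Omega>)"
  using SConn unfolding SConn_def by blast+

lemma chart_connI: "c \<in> A \<Longrightarrow> open W \<Longrightarrow> W \<subseteq> cdom c \<Longrightarrow> chart_conn c W \<Gamma>"
proof -
  assume c: "c \<in> A" "open W" "W \<subseteq> cdom c"
  interpret C0: chart_domain c "cdom c" using chart_domain_cdom c by blast
  show ?thesis
    using c torsion_free[OF c(1)] C0.smf_subset[OF conn_smf[OF aff c(1)] c(3)]
    by (intro chart_conn.intro chart_domainI chart_conn_axioms.intro) blast+
qed

lemma chart_conn_cdom: "c \<in> A \<Longrightarrow> chart_conn c (cdom c) \<Gamma>"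
  using chart_connI open_cdom by blast

lemma cov_\<Omega>: "c \<in> A \<Longrightarrow> p \<in> cdom c \<Longrightarrow> cov \<Gamma> \<Omega> c p [] [i, j, k] = 0"
  using parallel unfolding vanishes_def by (simp add: idx_def)

lemma pd_\<Omega>:
  assumes "c \<in> A" "p \<in> cdom c"
  shows "chart_pd c a (\<lambda>p. \<Omega> c p [] [j, k]) p
    = (\<Sum>l\<in>UNIV. \<Gamma> c p a j l * \<Omega> c p [] [l, k]) + (\<Sum>l\<in>UNIV. \<Gamma> c p a k l * \<Omega> c p [] [j, l])"
  using cov_\<Omega>[OF assms, of a j k] by (simp add: cov_Cons)

lemma pd_\<omega>:
  assumes cp: "c \<in> A" "p \<in> cdom c"
  shows "chart_pd c a (\<lambda>p. \<omega> c p i j) p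
    = - (\<Sum>l\<in>UNIV. \<Gamma> c p a l i * \<omega> c p l j) - (\<Sum>l\<in>UNIV. \<Gamma> c p a l j * \<omega> c p i l)"
proof -
  interpret C: chart_domain c "cdom c" using chart_domain_cdom cp by blast
  let ?D = "\<lambda>i k. chart_pd c a (\<lambda>p. \<omega> c p i k) p"
  have 1: "(\<Sum>k\<in>UNIV. ?D i k * \<Omega> c p [] [k, m])
      = (\<Sum>l\<in>UNIV. \<Gamma> c p a m l * (if i = l then 1 else 0)) - (\<Sum>k\<in>UNIV. \<Sum>l\<in>UNIV. \<omega> c p i k * \<Gamma> c p a k l * \<Omega> c p [] [l, m])" for m
  proof -
    have "chart_pd c a (\<lambda>p. \<Sum>k\<in>UNIV. \<omega> c p i k * \<Omega> c p [] [k, m]) p = chart_pd c a (\<lambda>p. if i = m then - 1 else 0) p"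
      using cp \<omega>\<Omega> by (intro C.chart_pd_cong) auto
    then have "0 = chart_pd c a (\<lambda>p. \<Sum>k\<in>UNIV. \<omega> c p i k * \<Omega> c p [] [k, m]) p" by simp
    also have "\<dots> = (\<Sum>k\<in>UNIV. ?D i k * \<Omega> c p [] [k, m] + \<omega> c p i k * chart_pd c a (\<lambda>p. \<Omega> c p [] [k, m]) p)"
      using cp by (subst C.chart_pd_sum) (auto intro!: C.smf_mult \<omega>_smf \<Omega>_smf sum.cong C.chart_pd_mult)
    finally have "(\<Sum>k\<in>UNIV. ?D i k * \<Omega> c p [] [k, m]) = - (\<Sum>k\<in>UNIV. \<omega> c p i k * chart_pd c a (\<lambda>p. \<Omega> c p [] [k, m]) p)"
      by (simp add: sum.distrib)
    also have "(\<Sum>k\<in>UNIV. \<omega> c p i k * chart_pd c a (\<lambda>p. \<Omega> c p [] [k, m]) p)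
        = (\<Sum>k\<in>UNIV. \<Sum>l\<in>UNIV. \<omega> c p i k * \<Gamma> c p a k l * \<Omega> c p [] [l, m])
         + (\<Sum>k\<in>UNIV. \<Sum>l\<in>UNIV. \<Gamma> c p a m l * (\<omega> c p i k * \<Omega> c p [] [k, l]))"
      unfolding pd_\<Omega>[OF cp] by (simp add: sum_distrib_left sum.distrib algebra_simps)
    also have "(\<Sum>k\<in>UNIV. \<Sum>l\<in>UNIV. \<Gamma> c p a m l * (\<omega> c p i k * \<Omega> c p [] [k, l]))
        = (\<Sum>l\<in>UNIV. \<Gamma> c p a m l * (if i = l then - 1 else 0))"
      unfolding \<omega>\<Omega>[OF cp, symmetric] sum_distrib_left by (rule sum.swap)
    finally show ?thesis by (simp add: sum_delta_mult)
  qed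
  have "- ?D i j = (\<Sum>m\<in>UNIV. (\<Sum>k\<in>UNIV. ?D i k * \<Omega> c p [] [k, m]) * \<omega> c p m j)"
  proof -
    have "(\<Sum>m\<in>UNIV. (\<Sum>k\<in>UNIV. ?D i k * \<Omega> c p [] [k, m]) * \<omega> c p m j)
        = (\<Sum>k\<in>UNIV. ?D i k * (\<Sum>m\<in>UNIV. \<Omega> c p [] [k, m] * \<omega> c p m j))"
      by (simp add: sum_distrib_left sum_distrib_right mult.assoc) (rule sum.swap)
    then show ?thesis unfolding \<Omega>\<omega>[OF cp] by (simp add: sum_delta_mult)
  qed
  also have "\<dots> = (\<Sum>m\<in>UNIV. \<Gamma> c p a m i * \<omega> c p m j)
      - (\<Sum>m\<in>UNIV. (\<Sum>k\<in>UNIV. \<Sum>l\<in>UNIV. \<omega> c p i k * \<Gamma> c p a k l * \<Omega> c p [] [l, m]) * \<omega> c p m j)"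
    unfolding 1 by (simp add: sum_delta_mult left_diff_distrib sum_subtractf)
  also have "(\<Sum>m\<in>UNIV. (\<Sum>k\<in>UNIV. \<Sum>l\<in>UNIV. \<omega> c p i k * \<Gamma> c p a k l * \<Omega> c p [] [l, m]) * \<omega> c p m j)
      = (\<Sum>m\<in>UNIV. \<Sum>k\<in>UNIV. \<Sum>l\<in>UNIV. \<omega> c p i k * \<Gamma> c p a k l * (\<Omega> c p [] [l, m] * \<omega> c p m j))"
    by (simp add: sum_distrib_right mult.assoc)
  also have "\<dots> = (\<Sum>k\<in>UNIV. \<Sum>m\<in>UNIV. \<Sum>l\<in>UNIV. \<omega> c p i k * \<Gamma> c p a k l * (\<Omega> c p [] [l, m] * \<omega> c p m j))"
    by (rule sum.swap)
  also have "\<dots> = (\<Sum>k\<in>UNIV. \<Sum>l\<in>UNIV. \<Sum>m\<in>UNIV. \<omega> c p i k * \<Gamma> c p a k l * (\<Omega> c p [] [l, m] * \<omega> c p m j))"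
    by (rule sum.cong[OF refl], rule sum.swap)
  also have "\<dots> = (\<Sum>k\<in>UNIV. \<Sum>l\<in>UNIV. \<omega> c p i k * \<Gamma> c p a k l * (if l = j then - 1 else 0))"
    unfolding sum_distrib_left[symmetric] \<Omega>\<omega>[OF cp] ..
  also have "\<dots> = - (\<Sum>l\<in>UNIV. \<Gamma> c p a l j * \<omega> c p i l)"
    by (simp add: sum_delta_mult sum_negf mult.commute)
  finally show ?thesis by simp
qed

abbreviation "Riem \<equiv> curv_low \<Omega> \<Gamma>"

lemma Riem_eq: "Riem c p us [i, j, k, l] = (\<Sum>q\<in>UNIV. curv \<Gamma> c p i j k q * \<Omega> c p [] [q, l])"
  by (simp add: curv_low_def)

lemma Riem_smf: "c \<in> A \<Longrightarrow> smf c (cdom c) (\<lambda>p. Riem c p [] [i, j, k, l])"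
  unfolding Riem_eq
  by (intro chart_domain.smf_sum[OF chart_domain_cdom] chart_domain.smf_mult[OF chart_domain_cdom]
      chart_conn.curv_smf chart_conn_cdom \<Omega>_smf)

lemma Riem_skew: "Riem c p us [i, j, k, l] = - Riem c p us [j, i, k, l]"
  unfolding Riem_eq by (simp add: curv_def sum_negf[symmetric] algebra_simps)

lemma Riem_bianchi1:
  assumes "c \<in> A" "p \<in> cdom c"
  shows "Riem c p us [i, j, k, l] + Riem c p us [j, k, i, l] + Riem c p us [k, i, j, l] = 0"
  unfolding Riem_eq sum.distrib[symmetric] distrib_right[symmetric]
  using chart_conn.bianchi1[OF chart_conn_cdom[OF assms(1)] assms(2)] by simp

text \<open>Because \<open>\<Omega>\<close> is parallel, the Ricci identity makes the curvature take values in the symplectic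
  Lie algebra.\<close>

lemma Riem_sym:
  assumes cp: "c \<in> A" "p \<in> cdom c"
  shows "Riem c p us [i, j, k, l] = Riem c p us [i, j, l, k]"
proof -
  interpret C: chart_conn c "cdom c" \<Gamma> using chart_conn_cdom cp by blast
  have "cov \<Gamma> (cov \<Gamma> \<Omega>) c p [] [i, j, k, l] = 0" for i j
  proof -
    have "chart_pd c i (\<lambda>q. cov \<Gamma> \<Omega> c q [] [j, k, l]) p = chart_pd c i (\<lambda>q. 0) p"
      using cp cov_\<Omega> by (intro C.chart_pd_cong) auto
    then show ?thesis using cov_\<Omega>[OF cp] by (simp add: cov_Cons[of _ "cov \<Gamma> \<Omega>"])
  qed
  then have "dop (curv \<Gamma> c p i j) (\<Omega> c p []) [k, l] = 0"
    using C.ricci_identity[of 2 \<Omega> p "[k, l]" i j] tensor_field_smf[OF \<Omega>_tensor cp(1)] cp(2)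
    by (auto simp: idx_def)
  then have "Riem c p us [i, j, k, l] + (\<Sum>q\<in>UNIV. curv \<Gamma> c p i j l q * \<Omega> c p [] [k, q]) = 0"
    by (simp add: Riem_eq)
  moreover have "(\<Sum>q\<in>UNIV. curv \<Gamma> c p i j l q * \<Omega> c p [] [k, q]) = - Riem c p us [i, j, l, k]"
    unfolding Riem_eq sum_negf[symmetric] by (intro sum.cong refl) (subst \<Omega>_skew[OF cp], simp)
  ultimately show ?thesis by simp
qed

text \<open>The Ricci identity for the differential of a coordinate function \<open>x\<^sup>k\<close> of \<open>c\<close> expresses the curvature
  by the skew part of \<open>\<nabla>\<nabla>\<nabla>x\<^sup>k\<close>, which is a tensor on the overlap.\<close>

lemma curv_transform:
  assumes cd: "c \<in> A" "d \<in> A" "p \<in> cdom c" "p \<in> cdom d"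
  shows "(\<Sum>m\<in>UNIV. curv \<Gamma> d p i j l m * jac c d p k m)
    = tr (jac c d p) 3 (\<lambda>ls. curv \<Gamma> c p (ls ! 0) (ls ! 1) (ls ! 2) k) [i, j, l]"
proof -
  let ?W = "cdom c \<inter> cdom d"
  have W: "open ?W" "?W \<subseteq> cdom c \<inter> cdom d" using open_cdom[OF cd(1)] open_cdom[OF cd(2)] by auto
  interpret C: chart_conn c ?W \<Gamma> using cd W by (intro chart_connI) auto
  interpret D: chart_conn d ?W \<Gamma> using cd W by (intro chart_connI) auto
  define F :: "('m, 'n) tensor" where "F = (\<lambda>e q us ls. coords c q $ k)"
  have p: "p \<in> ?W" using cd by simp
  have F0: "ltf c d ?W 0 F"
    unfolding ltf_def F_def using smf_coords[OF cd(1,1), of ?W k] by auto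
  have F1: "ltf c d ?W 1 (cov \<Gamma> F)" using ltf_cov[OF aff cd(1,2) W F0] by simp
  have F3: "ltf c d ?W 3 (cov \<Gamma> (cov \<Gamma> (cov \<Gamma> F)))"
    using ltf_cov[OF aff cd(1,2) W ltf_cov[OF aff cd(1,2) W F1]] by (simp add: numeral_3_eq_3)
  have sc: "smf c ?W (\<lambda>p. cov \<Gamma> F c p [] ls)" if "ls \<in> idx 1" for ls
    using F1 that unfolding ltf_def by blast
  have sd: "smf d ?W (\<lambda>p. cov \<Gamma> F d p [] ls)" if "ls \<in> idx 1" for ls
  proof -
    have "smf d ?W (\<lambda>p. F d p [] ls)" if "ls \<in> idx 0" for ls
      unfolding F_def using smf_coords[OF cd(1,2), of ?W k] by auto
    from smf_cov[OF aff cd(2), of ?W 0 F ls, OF _ _ this] that W show ?thesis by auto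
  qed
  let ?D3 = "\<lambda>e. cov \<Gamma> (cov \<Gamma> (cov \<Gamma> F)) e p []"
  have Rc: "?D3 c [i, j, l] - ?D3 c [j, i, l] = - curv \<Gamma> c p i j l k" for i j l
  proof -
    have "?D3 c [i, j, l] - ?D3 c [j, i, l] = - (\<Sum>m\<in>UNIV. curv \<Gamma> c p i j l m * cov \<Gamma> F c p [] [m])"
      using C.ricci_identity[where T = "cov \<Gamma> F" and k = 1 and ls = "[l]" and i = i and j = j, OF sc p] by (simp add: idx_def)
    moreover have "cov \<Gamma> F c p [] [m] = (if k = m then 1 else 0)" for m
      using chart_pd_coord[OF cd(1,3), of m k] by (simp add: cov_Cons F_def)
    ultimately show ?thesis by (simp add: sum_delta_mult)
  qed
  have Rd: "?D3 d [i, j, l] - ?D3 d [j, i, l] = - (\<Sum>m\<in>UNIV. curv \<Gamma> d p i j l m * jac c d p k m)"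
    using D.ricci_identity[where T = "cov \<Gamma> F" and k = 1 and ls = "[l]" and i = i and j = j, OF sd p] by (simp add: idx_def cov_Cons F_def jac_def)
  have t: "?D3 d ls = tr (jac c d p) 3 (?D3 c) ls" if "ls \<in> idx 3" for ls
    using F3 p that unfolding ltf_def by blast
  have swap: "tr J 3 T [j, i, l] = tr J 3 (\<lambda>ls. T [ls ! 1, ls ! 0, ls ! 2]) [i, j, l]" for J and T :: "'n list \<Rightarrow> real"
    unfolding numeral_3_eq_3 tr_Suc
    by (simp add: sum_distrib_left numeral_2_eq_2) (subst sum.swap, intro sum.cong refl, simp)
  have "- (\<Sum>m\<in>UNIV. curv \<Gamma> d p i j l m * jac c d p k m)
      = tr (jac c d p) 3 (?D3 c) [i, j, l] - tr (jac c d p) 3 (\<lambda>ls. ?D3 c [ls ! 1, ls ! 0, ls ! 2]) [i, j, l]"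
    unfolding Rd[symmetric] swap[symmetric] using t by (simp add: idx_def)
  also have "\<dots> = tr (jac c d p) 3 (\<lambda>ls. - 1 * curv \<Gamma> c p (ls ! 0) (ls ! 1) (ls ! 2) k) [i, j, l]"
    unfolding tr_diff[symmetric]
  proof (rule tr_cong)
    fix ms :: "'n list" assume "ms \<in> idx 3"
    then obtain a b e where "ms = [a, b, e]"
      by (auto simp: idx_def length_Suc_conv numeral_3_eq_3)
    then show "?D3 c ms - ?D3 c [ms ! 1, ms ! 0, ms ! 2] = - 1 * curv \<Gamma> c p (ms ! 0) (ms ! 1) (ms ! 2) k"
      using Rc[of a b e] by (simp add: numeral_2_eq_2)
  qed
  finally show ?thesis unfolding tr_cmult by simp
qed

lemma idx4_cases:
  assumes "ls \<in> idx 4" obtains i j k l where "ls = [i, j, k, l]"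
  using assms by (auto simp: idx_def length_Suc_conv eval_nat_numeral)

lemma Riem_tensor: "tensor_field A 0 4 Riem"
proof (rule tensor_fieldI)
  show "smf c (cdom c) (\<lambda>p. Riem c p [] ls)" if "c \<in> A" "ls \<in> idx 4" for c and ls :: "'n list"
    using Riem_smf[OF that(1)] idx4_cases[OF that(2)] by metis
  fix c d p and ls :: "'n list"
  assume cd: "c \<in> A" "d \<in> A" "p \<in> cdom c" "p \<in> cdom d" and "ls \<in> idx 4"
  then obtain i j l h where ls: "ls = [i, j, l, h]" using idx4_cases by blast
  let ?J = "jac c d p"
  have "Riem d p [] [i, j, l, h]
      = (\<Sum>m\<in>UNIV. \<Sum>k\<in>UNIV. \<Sum>g\<in>UNIV. curv \<Gamma> d p i j l m * ?J k m * (?J g h * \<Omega> c p [] [k, g]))"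
    unfolding Riem_eq \<Omega>_transform[OF cd] by (simp add: sum_distrib_left ac_simps)
  also have "\<dots> = (\<Sum>k\<in>UNIV. \<Sum>m\<in>UNIV. \<Sum>g\<in>UNIV. curv \<Gamma> d p i j l m * ?J k m * (?J g h * \<Omega> c p [] [k, g]))"
    by (rule sum.swap)
  also have "\<dots> = (\<Sum>k\<in>UNIV. (\<Sum>m\<in>UNIV. curv \<Gamma> d p i j l m * ?J k m) * (\<Sum>g\<in>UNIV. ?J g h * \<Omega> c p [] [k, g]))"
    by (simp add: sum_product)
  also have "\<dots> = (\<Sum>k\<in>UNIV. (\<Sum>g\<in>UNIV. ?J g h * \<Omega> c p [] [k, g]) *
      tr ?J 3 (\<lambda>ls. curv \<Gamma> c p (ls ! 0) (ls ! 1) (ls ! 2) k) [i, j, l])"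
    unfolding curv_transform[OF cd] by (simp add: mult.commute)
  also have "\<dots> = tr ?J 3 (\<lambda>ls. \<Sum>k\<in>UNIV. (\<Sum>g\<in>UNIV. ?J g h * \<Omega> c p [] [k, g]) *
      curv \<Gamma> c p (ls ! 0) (ls ! 1) (ls ! 2) k) [i, j, l]"
    by (rule tr_sum[symmetric])
  also have "\<dots> = tr ?J 3 (\<lambda>ls. \<Sum>g\<in>UNIV. ?J g h * Riem c p [] [ls ! 0, ls ! 1, ls ! 2, g]) [i, j, l]"
  proof (rule tr_cong)
    show "(\<Sum>k\<in>UNIV. (\<Sum>g\<in>UNIV. ?J g h * \<Omega> c p [] [k, g]) * curv \<Gamma> c p (ls ! 0) (ls ! 1) (ls ! 2) k)
      = (\<Sum>g\<in>UNIV. ?J g h * Riem c p [] [ls ! 0, ls ! 1, ls ! 2, g])" for ls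
      unfolding Riem_eq by (simp add: sum_distrib_left sum_distrib_right ac_simps) (rule sum.swap)
  qed
  also have "\<dots> = tr ?J 4 (Riem c p []) ls"
    unfolding ls by (simp add: eval_nat_numeral tr_Suc)
  finally show "Riem d p [] ls = tr ?J 4 (Riem c p []) ls" unfolding ls .
qed

text \<open>The first Bianchi identity splits the trace over the first pair into two traces over an index of
  each pair; by skewness in the first and symmetry in the second pair, both are Ricci tensors.\<close>

lemma ctr_Riem:
  assumes cp: "c \<in> A" "p \<in> cdom c"
  shows "ctr \<Omega> Riem c p us [k, l] = - 2 * Ric \<Gamma> c p us [k, l]"
proof -
  have 1: "(\<Sum>i\<in>UNIV. \<Sum>a\<in>UNIV. \<omega> c p i a * Riem c p us [k, a, i, l])
      = (\<Sum>i\<in>UNIV. \<Sum>a\<in>UNIV. \<omega> c p i a * Riem c p us [i, k, a, l])"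
  proof -
    have "(\<Sum>i\<in>UNIV. \<Sum>a\<in>UNIV. \<omega> c p i a * Riem c p us [k, a, i, l])
      = (\<Sum>i\<in>UNIV. \<Sum>a\<in>UNIV. \<omega> c p a i * Riem c p us [a, k, i, l])"
      by (intro sum.cong refl) (subst \<omega>_skew[OF cp], subst Riem_skew, simp)
    then show ?thesis by (subst (asm) (2) sum.swap) simp
  qed
  have 2: "(\<Sum>i\<in>UNIV. \<Sum>a\<in>UNIV. \<omega> c p i a * Riem c p us [i, k, a, l]) = Ric \<Gamma> c p us [k, l]"
  proof -
    have "(\<Sum>i\<in>UNIV. \<Sum>a\<in>UNIV. \<omega> c p i a * Riem c p us [i, k, a, l])
      = (\<Sum>i\<in>UNIV. \<Sum>a\<in>UNIV. \<Sum>q\<in>UNIV. curv \<Gamma> c p i k l q * (- (\<omega> c p i a * \<Omega> c p [] [a, q])))"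
    proof (intro sum.cong refl)
      fix i a
      have "\<omega> c p i a * Riem c p us [i, k, a, l] = \<omega> c p i a * Riem c p us [i, k, l, a]"
        using Riem_sym[OF cp, of us i k a l] by simp
      also have "\<dots> = (\<Sum>q\<in>UNIV. curv \<Gamma> c p i k l q * (- (\<omega> c p i a * \<Omega> c p [] [a, q])))"
        unfolding Riem_eq sum_distrib_left
      proof (intro sum.cong refl)
        show "\<omega> c p i a * (curv \<Gamma> c p i k l q * \<Omega> c p [] [q, a])
            = curv \<Gamma> c p i k l q * (- (\<omega> c p i a * \<Omega> c p [] [a, q]))" for q
          using \<Omega>_skew[OF cp, of q a] by simp
      qed
      finally show "\<omega> c p i a * Riem c p us [i, k, a, l]
         = (\<Sum>q\<in>UNIV. curv \<Gamma> c p i k l q * (- (\<omega> c p i a * \<Omega> c p [] [a, q])))" .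
    qed
    also have "\<dots> = (\<Sum>i\<in>UNIV. \<Sum>q\<in>UNIV. \<Sum>a\<in>UNIV. curv \<Gamma> c p i k l q * (- (\<omega> c p i a * \<Omega> c p [] [a, q])))"
      by (rule sum.cong[OF refl], rule sum.swap)
    also have "\<dots> = (\<Sum>i\<in>UNIV. \<Sum>q\<in>UNIV. curv \<Gamma> c p i k l q * (- (if i = q then - 1 else 0)))"
      unfolding sum_distrib_left[symmetric] sum_negf \<omega>\<Omega>[OF cp] ..
    also have "\<dots> = (\<Sum>i\<in>UNIV. \<Sum>q\<in>UNIV. curv \<Gamma> c p i k l q * (if i = q then 1 else 0))"
      by (intro sum.cong) auto
    also have "\<dots> = Ric \<Gamma> c p us [k, l]" by (simp add: sum_delta_mult Ric_def)
    finally show ?thesis .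
  qed
  have "ctr \<Omega> Riem c p us [k, l]
     = (\<Sum>i\<in>UNIV. \<Sum>a\<in>UNIV. - (\<omega> c p i a * Riem c p us [i, k, a, l]) - \<omega> c p i a * Riem c p us [k, a, i, l])"
    unfolding ctr_def
  proof (intro sum.cong refl)
    fix i a
    show "\<omega> c p i a * Riem c p us [a, i, k, l]
        = - (\<omega> c p i a * Riem c p us [i, k, a, l]) - \<omega> c p i a * Riem c p us [k, a, i, l]"
      using Riem_bianchi1[OF cp, of us a i k l] by (simp add: algebra_simps eq_neg_iff_add_eq_0)
         (metis (no_types, opaque_lifting) add.commute add.left_commute distrib_left mult_zero_right)
  qed
  then show ?thesis using 1 2 by (simp add: sum_subtractf sum_negf)
qed

lemma idx2_cases:
  assumes "ls \<in> idx 2" obtains i j where "ls = [i, j]"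
  using assms by (auto simp: idx_def length_Suc_conv eval_nat_numeral)

lemma Ric_eq_ctr: "c \<in> A \<Longrightarrow> p \<in> cdom c \<Longrightarrow> ls \<in> idx 2 \<Longrightarrow> Ric \<Gamma> c p us ls = tscale (- 1 / 2) (ctr \<Omega> Riem) c p us ls"
  by (erule idx2_cases) (simp add: tscale_def ctr_Riem)

lemma Ric_tensor: "tensor_field A 0 2 (Ric \<Gamma>)"
proof (rule tensor_field_cong)
  have "tensor_field A 0 (Suc (Suc 2)) Riem" using Riem_tensor by (simp add: eval_nat_numeral)
  then show "tensor_field A 0 2 (tscale (- 1 / 2) (ctr \<Omega> Riem))"
    by (intro tensor_field_tscale tensor_field_ctr)
qed (simp add: Ric_eq_ctr)

lemma Ric_sym:
  assumes "c \<in> A" "p \<in> cdom c"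
  shows "Ric \<Gamma> c p us [k, l] = Ric \<Gamma> c p us [l, k]"
proof -
  have "ctr \<Omega> Riem c p us [k, l] = ctr \<Omega> Riem c p us [l, k]"
    unfolding ctr_def using Riem_sym[OF assms] by simp
  then show ?thesis using ctr_Riem[OF assms] by simp
qed

text \<open>Covariant differentiation commutes with contraction, as \<open>\<omega>\<close> is parallel.\<close>

lemma cov_ctr:
  assumes T: "\<And>ls. ls \<in> idx (Suc (Suc k)) \<Longrightarrow> smf c (cdom c) (\<lambda>p. T c p [] ls)"
    and cp: "c \<in> A" "p \<in> cdom c" and ls: "ls \<in> idx k"
  shows "cov \<Gamma> (ctr \<Omega> T) c p [] (j # ls) = (\<Sum>i\<in>UNIV. \<Sum>a\<in>UNIV. \<omega> c p i a * cov \<Gamma> T c p [] (j # a # i # ls))"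
proof -
  interpret C: chart_conn c "cdom c" \<Gamma> using chart_conn_cdom cp by blast
  let ?T = "\<lambda>a i. T c p [] (a # i # ls)"
  have Ts: "smf c (cdom c) (\<lambda>p. T c p [] (a # i # ls))" for a i using T ls by simp
  have "chart_pd c j (\<lambda>p. ctr \<Omega> T c p [] ls) p
      = (\<Sum>i\<in>UNIV. \<Sum>a\<in>UNIV. chart_pd c j (\<lambda>p. \<omega> c p i a * T c p [] (a # i # ls)) p)"
    unfolding ctr_def using cp
    by (subst C.chart_pd_sum, intro C.smf_sum C.smf_mult \<omega>_smf Ts, simp_all,
        subst C.chart_pd_sum, intro C.smf_mult \<omega>_smf Ts, simp_all)
  also have "\<dots> = (\<Sum>i\<in>UNIV. \<Sum>a\<in>UNIV. \<omega> c p i a * chart_pd c j (\<lambda>p. T c p [] (a # i # ls)) p)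
      + (\<Sum>i\<in>UNIV. \<Sum>a\<in>UNIV. chart_pd c j (\<lambda>p. \<omega> c p i a) p * ?T a i)"
    using cp by (simp add: C.chart_pd_mult[OF \<omega>_smf Ts] sum.distrib add.commute)
  also have "(\<Sum>i\<in>UNIV. \<Sum>a\<in>UNIV. chart_pd c j (\<lambda>p. \<omega> c p i a) p * ?T a i)
     = - (\<Sum>i\<in>UNIV. \<Sum>a\<in>UNIV. (\<Sum>l\<in>UNIV. \<Gamma> c p j l i * \<omega> c p l a) * ?T a i)
       - (\<Sum>i\<in>UNIV. \<Sum>a\<in>UNIV. (\<Sum>l\<in>UNIV. \<Gamma> c p j l a * \<omega> c p i l) * ?T a i)"
    unfolding pd_\<omega>[OF cp] by (simp add: left_diff_distrib sum_subtractf sum_negf)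
  also have "(\<Sum>i\<in>UNIV. \<Sum>a\<in>UNIV. (\<Sum>l\<in>UNIV. \<Gamma> c p j l i * \<omega> c p l a) * ?T a i)
     = (\<Sum>i\<in>UNIV. \<Sum>a\<in>UNIV. \<omega> c p i a * (\<Sum>l\<in>UNIV. \<Gamma> c p j i l * ?T a l))"
  proof -
    have "(\<Sum>i\<in>UNIV. \<Sum>a\<in>UNIV. (\<Sum>l\<in>UNIV. \<Gamma> c p j l i * \<omega> c p l a) * ?T a i)
      = (\<Sum>i\<in>UNIV. \<Sum>l\<in>UNIV. \<Sum>a\<in>UNIV. \<Gamma> c p j l i * \<omega> c p l a * ?T a i)"
      by (simp add: sum_distrib_right) (rule sum.cong[OF refl], rule sum.swap)
    also have "\<dots> = (\<Sum>l\<in>UNIV. \<Sum>i\<in>UNIV. \<Sum>a\<in>UNIV. \<Gamma> c p j l i * \<omega> c p l a * ?T a i)"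
      by (rule sum.swap)
    also have "\<dots> = (\<Sum>l\<in>UNIV. \<Sum>a\<in>UNIV. \<Sum>i\<in>UNIV. \<Gamma> c p j l i * \<omega> c p l a * ?T a i)"
      by (rule sum.cong[OF refl], rule sum.swap)
    finally show ?thesis by (simp add: sum_distrib_left ac_simps)
  qed
  also have "(\<Sum>i\<in>UNIV. \<Sum>a\<in>UNIV. (\<Sum>l\<in>UNIV. \<Gamma> c p j l a * \<omega> c p i l) * ?T a i)
     = (\<Sum>i\<in>UNIV. \<Sum>a\<in>UNIV. \<omega> c p i a * (\<Sum>l\<in>UNIV. \<Gamma> c p j a l * ?T l i))"
    by (simp add: sum_distrib_left sum_distrib_right ac_simps) (rule sum.cong[OF refl], rule sum.swap)
  moreover have "dop (\<Gamma> c p j) (ctr \<Omega> T c p []) ls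
    = (\<Sum>i\<in>UNIV. \<Sum>a\<in>UNIV. \<omega> c p i a * dop (\<Gamma> c p j) (\<lambda>ls. T c p [] (a # i # ls)) ls)"
    unfolding ctr_def
    using dop_sum[of "\<Gamma> c p j" "\<lambda>_. 1" "\<lambda>i ls. \<Sum>a\<in>UNIV. \<omega> c p i a * T c p [] (a # i # ls)" UNIV ls]
    by (simp add: dop_sum)
  ultimately show ?thesis
    by (simp add: cov_Cons algebra_simps sum.distrib sum_subtractf)
qed

lemma bianchi2:
  assumes cp: "c \<in> A" "p \<in> cdom c"
  shows "cov \<Gamma> Riem c p [] [i, j, k, l, m] + cov \<Gamma> Riem c p [] [j, k, i, l, m] + cov \<Gamma> Riem c p [] [k, i, j, l, m] = 0"
proof -
  interpret C: chart_conn c "cdom c" \<Gamma> using chart_conn_cdom cp by blast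
  let ?O = "\<lambda>q m. \<Omega> c p [] [q, m]" and ?R = "\<lambda>j k l q. curv \<Gamma> c p j k l q" and ?G = "\<lambda>i j k. \<Gamma> c p i j k"
  let ?dR = "\<lambda>i j k l q. chart_pd c i (\<lambda>p. curv \<Gamma> c p j k l q) p"
  define S where "S = (\<lambda>i j k l m. ?dR i j k l m
      - ((\<Sum>e\<in>UNIV. ?G i l e * ?R j k e m) - (\<Sum>e\<in>UNIV. ?R j k l e * ?G i e m)))"
  have eq: "cov \<Gamma> Riem c p [] [i, j, k, l, m] = (\<Sum>q\<in>UNIV. S i j k l q * ?O q m)
      - (\<Sum>a\<in>UNIV. ?G i j a * Riem c p [] [a, k, l, m]) - (\<Sum>a\<in>UNIV. ?G i k a * Riem c p [] [j, a, l, m])" for i j k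
  proof -
    have "chart_pd c i (\<lambda>p. Riem c p [] [j, k, l, m]) p
       = (\<Sum>q\<in>UNIV. ?dR i j k l q * ?O q m + ?R j k l q * chart_pd c i (\<lambda>p. \<Omega> c p [] [q, m]) p)"
      unfolding Riem_eq using cp
      by (subst C.chart_pd_sum) (auto intro!: C.smf_mult C.curv_smf \<Omega>_smf sum.cong C.chart_pd_mult)
    also have "\<dots> = (\<Sum>q\<in>UNIV. ?dR i j k l q * ?O q m) + (\<Sum>q\<in>UNIV. \<Sum>e\<in>UNIV. ?R j k l q * ?G i q e * ?O e m)
       + (\<Sum>q\<in>UNIV. \<Sum>e\<in>UNIV. ?R j k l q * ?G i m e * ?O q e)"
      unfolding pd_\<Omega>[OF cp] by (simp add: sum.distrib sum_distrib_left algebra_simps)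
    also have "(\<Sum>q\<in>UNIV. \<Sum>e\<in>UNIV. ?R j k l q * ?G i q e * ?O e m) = (\<Sum>q\<in>UNIV. (\<Sum>e\<in>UNIV. ?R j k l e * ?G i e q) * ?O q m)"
      by (simp add: sum_distrib_right) (rule sum.swap)
    also have "(\<Sum>q\<in>UNIV. \<Sum>e\<in>UNIV. ?R j k l q * ?G i m e * ?O q e) = (\<Sum>e\<in>UNIV. ?G i m e * Riem c p [] [j, k, l, e])"
      unfolding Riem_eq sum_distrib_left by (subst sum.swap) (simp add: ac_simps)
    finally have 1: "chart_pd c i (\<lambda>p. Riem c p [] [j, k, l, m]) p = (\<Sum>q\<in>UNIV. ?dR i j k l q * ?O q m)
       + (\<Sum>q\<in>UNIV. (\<Sum>e\<in>UNIV. ?R j k l e * ?G i e q) * ?O q m) + (\<Sum>e\<in>UNIV. ?G i m e * Riem c p [] [j, k, l, e])" .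
    have 2: "(\<Sum>e\<in>UNIV. ?G i l e * Riem c p [] [j, k, e, m]) = (\<Sum>q\<in>UNIV. (\<Sum>e\<in>UNIV. ?G i l e * ?R j k e q) * ?O q m)"
      unfolding Riem_eq by (simp add: sum_distrib_left sum_distrib_right mult.assoc) (rule sum.swap)
    show ?thesis
      unfolding cov_Cons 1 dop_Cons dop_Nil 2 S_def
      by (simp add: algebra_simps sum.distrib sum_subtractf)
  qed
  have "S i j k l q + S j k i l q + S k i j l q = 0" for q
    unfolding S_def by (rule C.bianchi2_operator[OF cp(2)])
  then have "(\<Sum>q\<in>UNIV. S i j k l q * ?O q m) + (\<Sum>q\<in>UNIV. S j k i l q * ?O q m) + (\<Sum>q\<in>UNIV. S k i j l q * ?O q m) = 0"
    unfolding sum.distrib[symmetric] distrib_right[symmetric] by simp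
  moreover have "(\<Sum>a\<in>UNIV. ?G i j a * Riem c p [] [k, a, l, m]) = - (\<Sum>a\<in>UNIV. ?G i j a * Riem c p [] [a, k, l, m])" for i j k
    unfolding sum_negf[symmetric] by (intro sum.cong refl) (subst Riem_skew, simp)
  ultimately show ?thesis
    unfolding eq using torsion_free[OF cp] by (simp add: torsion_free[OF cp, of j i] torsion_free[OF cp, of k i] torsion_free[OF cp, of k j])
qed

text \<open>The contracted second Bianchi identity. For a symplectic connection the divergence on the first
  index is \<open>\<nabla> Ric\<close> itself, rather than a skew part of it, since the trace of the curvature over the
  first pair of indices is \<open>- 2 Ric\<close>.\<close>

lemma div_Riem:
  assumes cp: "c \<in> A" "p \<in> cdom c"
  shows "diverg \<Omega> \<Gamma> Riem c p [] [j, k, l] = cov \<Gamma> (Ric \<Gamma>) c p [] [j, k, l]"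
proof -
  interpret C: chart_conn c "cdom c" \<Gamma> using chart_conn_cdom cp by blast
  let ?D = "\<lambda>i j k. cov \<Gamma> Riem c p [] [i, j, k, l, m]"
  have skew: "cov \<Gamma> Riem c p [] [i, j, k, l, m] = - cov \<Gamma> Riem c p [] [i, k, j, l, m]" for i j k l m
  proof -
    have "chart_pd c i (\<lambda>p. Riem c p [] [j, k, l, m]) p = chart_pd c i (\<lambda>p. - Riem c p [] [k, j, l, m]) p"
      using Riem_skew[of c _ "[]" j k l m] by simp
    also have "\<dots> = - chart_pd c i (\<lambda>p. Riem c p [] [k, j, l, m]) p"
      using cp Riem_smf by (intro C.chart_pd_uminus) auto
    finally have "chart_pd c i (\<lambda>p. Riem c p [] [j, k, l, m]) p = \<dots>" .
    moreover have "(\<Sum>a\<in>UNIV. G a * Riem c p [] [a, k, l, m]) = - (\<Sum>a\<in>UNIV. G a * Riem c p [] [k, a, l, m])" for G k l m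
      unfolding sum_negf[symmetric] by (intro sum.cong refl) (subst Riem_skew, simp)
    moreover have "(\<Sum>a\<in>UNIV. G a * Riem c p [] [j, k, a, m]) = - (\<Sum>a\<in>UNIV. G a * Riem c p [] [k, j, a, m])" for G m
      unfolding sum_negf[symmetric] by (intro sum.cong refl) (subst Riem_skew, simp)
    moreover have "(\<Sum>a\<in>UNIV. G a * Riem c p [] [j, k, l, a]) = - (\<Sum>a\<in>UNIV. G a * Riem c p [] [k, j, l, a])" for G
      unfolding sum_negf[symmetric] by (intro sum.cong refl) (subst Riem_skew, simp)
    ultimately show ?thesis unfolding cov_Cons dop_Cons dop_Nil by simp
  qed
  have Rs: "smf c (cdom c) (\<lambda>p. Riem c p [] ls)" if "ls \<in> idx (Suc (Suc 2))" for ls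
    using tensor_field_smf[OF Riem_tensor cp(1), of ls] that by (simp add: eval_nat_numeral)
  have d1: "diverg \<Omega> \<Gamma> Riem c p [] [j, k, l] = (\<Sum>i\<in>UNIV. \<Sum>a\<in>UNIV. \<omega> c p i a * cov \<Gamma> Riem c p [] [a, i, j, k, l])"
    by (simp add: diverg_def ctr_def)
  have d2: "(\<Sum>i\<in>UNIV. \<Sum>a\<in>UNIV. \<omega> c p i a * cov \<Gamma> Riem c p [] [i, j, a, k, l]) = diverg \<Omega> \<Gamma> Riem c p [] [j, k, l]"
  proof -
    have "(\<Sum>i\<in>UNIV. \<Sum>a\<in>UNIV. \<omega> c p i a * cov \<Gamma> Riem c p [] [i, j, a, k, l])
      = (\<Sum>i\<in>UNIV. \<Sum>a\<in>UNIV. \<omega> c p a i * cov \<Gamma> Riem c p [] [i, a, j, k, l])"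
      by (intro sum.cong refl) (subst skew, subst \<omega>_skew[OF cp], simp)
    then show ?thesis unfolding d1 by (subst (asm) (2) sum.swap)
  qed
  have d3: "(\<Sum>i\<in>UNIV. \<Sum>a\<in>UNIV. \<omega> c p i a * cov \<Gamma> Riem c p [] [j, a, i, k, l]) = - 2 * cov \<Gamma> (Ric \<Gamma>) c p [] [j, k, l]"
  proof -
    have "(\<Sum>i\<in>UNIV. \<Sum>a\<in>UNIV. \<omega> c p i a * cov \<Gamma> Riem c p [] [j, a, i, k, l]) = cov \<Gamma> (ctr \<Omega> Riem) c p [] [j, k, l]"
      using cov_ctr[where T = Riem and k = 2 and ls = "[k, l]" and j = j, OF Rs cp] by (simp add: idx_def)
    also have "\<dots> = - 2 * cov \<Gamma> (Ric \<Gamma>) c p [] [j, k, l]"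
    proof -
      have "chart_pd c j (\<lambda>p. ctr \<Omega> Riem c p [] [k, l]) p = chart_pd c j (\<lambda>p. - 2 * Ric \<Gamma> c p [] [k, l]) p"
        using cp ctr_Riem by (intro C.chart_pd_cong) auto
      also have "\<dots> = - 2 * chart_pd c j (\<lambda>p. Ric \<Gamma> c p [] [k, l]) p"
        using tensor_field_smf[OF Ric_tensor cp(1)] cp by (intro C.chart_pd_cmult) (auto simp: idx_def)
      finally show ?thesis
        unfolding cov_Cons dop_Cons dop_Nil ctr_Riem[OF cp]
        by (simp add: algebra_simps sum_distrib_left)
    qed
    finally show ?thesis .
  qed
  have "(\<Sum>i\<in>UNIV. \<Sum>a\<in>UNIV. \<omega> c p i a * (cov \<Gamma> Riem c p [] [a, i, j, k, l] + cov \<Gamma> Riem c p [] [i, j, a, k, l]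
      + cov \<Gamma> Riem c p [] [j, a, i, k, l])) = 0"
    using bianchi2[OF cp] by simp
  then show ?thesis
    using d1 d2 d3 by (simp add: distrib_left sum.distrib)
qed

end

section \<open>Divergences and Hamiltonian vector fields\<close>

lemma idx3_cases:
  assumes "ls \<in> idx 3" obtains i j k where "ls = [i, j, k]"
  using assms by (auto simp: idx_def length_Suc_conv eval_nat_numeral)

context symplectic_connection
begin

text \<open>The sign in the second term comes from interchanging the slots of \<open>\<omega>\<close>.\<close>

lemma div_hook:
  assumes \<alpha>: "\<And>ls. ls \<in> idx k \<Longrightarrow> smf c (cdom c) (\<lambda>p. \<alpha> c p [] ls)"
    and \<beta>: "\<And>ls. ls \<in> idx (Suc k) \<Longrightarrow> smf c (cdom c) (\<lambda>p. \<beta> c p [] ls)"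
    and cp: "c \<in> A" "p \<in> cdom c"
  shows "diverg \<Omega> \<Gamma> (hook \<Omega> k \<alpha> \<beta>) c p [] []
    = full_contraction \<Omega> k \<alpha> (diverg \<Omega> \<Gamma> \<beta>) c p [] [] - full_contraction \<Omega> (Suc k) (cov \<Gamma> \<alpha>) \<beta> c p [] []"
proof -
  interpret C: chart_conn c "cdom c" \<Gamma> using chart_conn_cdom cp by blast
  let ?a = "\<alpha> c p []" and ?b = "\<beta> c p []"
  have \<beta>': "smf c (cdom c) (\<lambda>p. \<beta> c p [] (i # ls))" if "ls \<in> idx k" for i ls using \<beta> that by simp
  have cov_hook: "cov \<Gamma> (hook \<Omega> k \<alpha> \<beta>) c p [] [a, i]
      = fcf (\<omega> c p) k (\<lambda>ls. cov \<Gamma> \<alpha> c p [] (a # ls)) (\<lambda>ls. ?b (i # ls))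
        + fcf (\<omega> c p) k ?a (\<lambda>ls. cov \<Gamma> \<beta> c p [] (a # i # ls))" for a i
  proof -
    have "chart_pd c a (\<lambda>p. fcf (\<omega> c p) k (\<alpha> c p []) (\<lambda>ls. \<beta> c p [] (i # ls))) p
      = fcf (\<omega> c p) k (\<lambda>ls. chart_pd c a (\<lambda>p. \<alpha> c p [] ls) p - dop (\<Gamma> c p a) ?a ls) (\<lambda>ls. ?b (i # ls))
      + fcf (\<omega> c p) k ?a (\<lambda>ls. chart_pd c a (\<lambda>p. \<beta> c p [] (i # ls)) p - dop (\<Gamma> c p a) (\<lambda>ls. ?b (i # ls)) ls)"
      using C.fcf_derivation[where M = "\<omega> c" and \<alpha> = "\<lambda>p. \<alpha> c p []" and \<beta> = "\<lambda>p ls. \<beta> c p [] (i # ls)"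
          and G = "\<Gamma> c p a" and a = a, OF \<omega>_smf[OF cp(1)] \<alpha> \<beta>' cp(2) pd_\<omega>[OF cp]] by simp
    moreover have "fcf (\<omega> c p) k ?a (\<lambda>ls. cov \<Gamma> \<beta> c p [] (a # i # ls))
      = fcf (\<omega> c p) k ?a (\<lambda>ls. chart_pd c a (\<lambda>p. \<beta> c p [] (i # ls)) p - dop (\<Gamma> c p a) (\<lambda>ls. ?b (i # ls)) ls)
        - (\<Sum>l\<in>UNIV. \<Gamma> c p a i l * fcf (\<omega> c p) k ?a (\<lambda>ls. ?b (l # ls)))"
      unfolding fcf_sum_right[symmetric] fcf_diff_right[symmetric] by (simp add: cov_Cons algebra_simps)
    ultimately show ?thesis
      unfolding cov_Cons[of _ "hook \<Omega> k \<alpha> \<beta>"] dop_Cons dop_Nil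
      unfolding hook_def by (simp add: cov_Cons[symmetric])
  qed
  have "diverg \<Omega> \<Gamma> (hook \<Omega> k \<alpha> \<beta>) c p [] []
     = (\<Sum>i\<in>UNIV. \<Sum>a\<in>UNIV. \<omega> c p i a * fcf (\<omega> c p) k (\<lambda>ls. cov \<Gamma> \<alpha> c p [] (a # ls)) (\<lambda>ls. ?b (i # ls)))
     + (\<Sum>i\<in>UNIV. \<Sum>a\<in>UNIV. \<omega> c p i a * fcf (\<omega> c p) k ?a (\<lambda>ls. cov \<Gamma> \<beta> c p [] (a # i # ls)))"
    by (simp add: diverg_def ctr_def cov_hook distrib_left sum.distrib)
  also have "(\<Sum>i\<in>UNIV. \<Sum>a\<in>UNIV. \<omega> c p i a * fcf (\<omega> c p) k (\<lambda>ls. cov \<Gamma> \<alpha> c p [] (a # ls)) (\<lambda>ls. ?b (i # ls)))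
     = - fcf (\<omega> c p) (Suc k) (cov \<Gamma> \<alpha> c p []) ?b"
    unfolding fcf_Suc sum_negf[symmetric]
    by (subst sum.swap, intro sum.cong refl) (subst \<omega>_skew[OF cp], simp)
  also have "(\<Sum>i\<in>UNIV. \<Sum>a\<in>UNIV. \<omega> c p i a * fcf (\<omega> c p) k ?a (\<lambda>ls. cov \<Gamma> \<beta> c p [] (a # i # ls)))
     = fcf (\<omega> c p) k ?a (diverg \<Omega> \<Gamma> \<beta> c p [])"
    unfolding diverg_def ctr_def
    using fcf_sum_right[of "\<omega> c p" k ?a "\<lambda>_. 1" "\<lambda>i ls. \<Sum>a\<in>UNIV. \<omega> c p i a * cov \<Gamma> \<beta> c p [] (a # i # ls)" UNIV]
    by (simp add: fcf_sum_right)
  finally show ?thesis by (simp add: full_contraction_fcf)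
qed

lemma cov_tmul:
  assumes f: "smf c (cdom c) (\<lambda>p. f c p [] [])" and T: "smf c (cdom c) (\<lambda>p. T c p [] ls)"
    and cp: "c \<in> A" "p \<in> cdom c"
  shows "cov \<Gamma> (tmul f T) c p [] (i # ls)
    = chart_pd c i (\<lambda>p. f c p [] []) p * T c p [] ls + f c p [] [] * cov \<Gamma> T c p [] (i # ls)"
proof -
  interpret C: chart_conn c "cdom c" \<Gamma> using chart_conn_cdom cp by blast
  show ?thesis unfolding cov_Cons tmul_def dop_cmult C.chart_pd_mult[OF f T cp(2)]
    by (simp add: algebra_simps)
qed

lemma lower_derivative:
  assumes Z: "\<And>q. smf c (cdom c) (Z q)" and cp: "c \<in> A" "p \<in> cdom c"
  shows "(\<Sum>q\<in>UNIV. (chart_pd c j (Z q) p + (\<Sum>m\<in>UNIV. \<Gamma> c p j m q * Z m p)) * \<Omega> c p [] [q, l])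
    = chart_pd c j (\<lambda>p. \<Sum>q\<in>UNIV. Z q p * \<Omega> c p [] [q, l]) p
      - (\<Sum>m\<in>UNIV. \<Gamma> c p j l m * (\<Sum>q\<in>UNIV. Z q p * \<Omega> c p [] [q, m]))"
proof -
  interpret C: chart_conn c "cdom c" \<Gamma> using chart_conn_cdom cp by blast
  have "chart_pd c j (\<lambda>p. \<Sum>q\<in>UNIV. Z q p * \<Omega> c p [] [q, l]) p
     = (\<Sum>q\<in>UNIV. chart_pd c j (Z q) p * \<Omega> c p [] [q, l] + Z q p * chart_pd c j (\<lambda>p. \<Omega> c p [] [q, l]) p)"
    using cp by (subst C.chart_pd_sum) (auto intro!: C.smf_mult Z \<Omega>_smf sum.cong C.chart_pd_mult)
  also have "\<dots> = (\<Sum>q\<in>UNIV. chart_pd c j (Z q) p * \<Omega> c p [] [q, l])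
     + (\<Sum>q\<in>UNIV. \<Sum>m\<in>UNIV. Z q p * \<Gamma> c p j q m * \<Omega> c p [] [m, l])
     + (\<Sum>q\<in>UNIV. \<Sum>m\<in>UNIV. Z q p * \<Gamma> c p j l m * \<Omega> c p [] [q, m])"
    unfolding pd_\<Omega>[OF cp] by (simp add: sum.distrib sum_distrib_left algebra_simps)
  also have "(\<Sum>q\<in>UNIV. \<Sum>m\<in>UNIV. Z q p * \<Gamma> c p j q m * \<Omega> c p [] [m, l])
     = (\<Sum>q\<in>UNIV. (\<Sum>m\<in>UNIV. \<Gamma> c p j m q * Z m p) * \<Omega> c p [] [q, l])"
    by (subst sum.swap) (simp add: sum_distrib_left sum_distrib_right ac_simps)
  also have "(\<Sum>q\<in>UNIV. \<Sum>m\<in>UNIV. Z q p * \<Gamma> c p j l m * \<Omega> c p [] [q, m])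
     = (\<Sum>m\<in>UNIV. \<Gamma> c p j l m * (\<Sum>q\<in>UNIV. Z q p * \<Omega> c p [] [q, m]))"
    by (subst sum.swap) (simp add: sum_distrib_left ac_simps)
  finally show ?thesis by (simp add: distrib_right sum.distrib)
qed

lemma cov_function: "cov \<Gamma> f c p [] [i] = chart_pd c i (\<lambda>p. f c p [] []) p"
  by (simp add: cov_Cons)

text \<open>Lowering the index of \<open>H\<^sub>f\<close> gives \<open>- df\<close>, and lowering commutes with \<open>\<nabla>\<close>.\<close>

lemma \<H>_eq:
  assumes f: "smf c (cdom c) (\<lambda>p. f c p [] [])" and cp: "c \<in> A" "p \<in> cdom c"
  shows "\<H> \<Omega> \<Gamma> f c p us [i, j, k] = - cov \<Gamma> (cov \<Gamma> (cov \<Gamma> f)) c p [] [i, j, k]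
     + (\<Sum>q\<in>UNIV. (\<Sum>r\<in>UNIV. \<omega> c p r q * cov \<Gamma> f c p [] [r]) * Riem c p [] [q, i, j, k])"
proof -
  interpret C: chart_conn c "cdom c" \<Gamma> using chart_conn_cdom cp by blast
  let ?f = "\<lambda>p. f c p [] []"
  define X where "X = (\<lambda>q p. \<Sum>r\<in>UNIV. \<omega> c p r q * chart_pd c r ?f p)"
  let ?X = "hamiltonian_field \<Omega> f"
  have Xs: "smf c (cdom c) (X q)" for q
    unfolding X_def by (intro C.smf_sum C.smf_mult \<omega>_smf cp C.smf_chart_pd f)
  have X: "?X c p [q] ls = X q p" for q p ls by (simp add: hamiltonian_field_def X_def)
  have low: "(\<Sum>q\<in>UNIV. X q p * \<Omega> c p [] [q, l]) = - chart_pd c l ?f p" if p: "p \<in> cdom c" for p l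
  proof -
    have "(\<Sum>q\<in>UNIV. X q p * \<Omega> c p [] [q, l])
        = (\<Sum>r\<in>UNIV. chart_pd c r ?f p * (\<Sum>q\<in>UNIV. \<omega> c p r q * \<Omega> c p [] [q, l]))"
      unfolding X_def sum_distrib_left sum_distrib_right by (subst sum.swap) (simp add: ac_simps)
    then show ?thesis unfolding \<omega>\<Omega>[OF cp(1) p] by (simp add: sum_delta_mult)
  qed
  define Y where "Y = (\<lambda>j q p. chart_pd c j (X q) p + (\<Sum>m\<in>UNIV. \<Gamma> c p j m q * X m p))"
  have Ys: "smf c (cdom c) (Y j q)" for j q
    unfolding Y_def by (intro C.smf_sum C.smf_add C.smf_mult C.\<Gamma>_smf C.smf_chart_pd Xs)
  have Y: "cov \<Gamma> ?X c p [q] [j] = Y j q p" for j q p by (simp add: cov_def X Y_def)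
  have lowY: "(\<Sum>q\<in>UNIV. Y j q p * \<Omega> c p [] [q, l]) = - cov \<Gamma> (cov \<Gamma> f) c p [] [j, l]" if p: "p \<in> cdom c" for p j l
  proof -
    have "chart_pd c j (\<lambda>p. \<Sum>q\<in>UNIV. X q p * \<Omega> c p [] [q, l]) p = chart_pd c j (\<lambda>p. - chart_pd c l ?f p) p"
      using low by (intro C.chart_pd_cong p) auto
    also have "\<dots> = - chart_pd c j (chart_pd c l ?f) p"
      by (rule C.chart_pd_uminus[OF C.smf_chart_pd[OF f] p])
    finally show ?thesis
      unfolding Y_def lower_derivative[OF Xs cp(1) p] low[OF p] cov_Cons[of _ "cov \<Gamma> f"] dop_Cons dop_Nil cov_function
      by (simp add: sum_negf)
  qed
  have "\<H> \<Omega> \<Gamma> f c p us [i, j, k] = (\<Sum>q\<in>UNIV. cov \<Gamma> (cov \<Gamma> ?X) c p [q] [i, j] * \<Omega> c p [] [q, k])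
     + (\<Sum>q\<in>UNIV. (\<Sum>m\<in>UNIV. X m p * curv \<Gamma> c p m i j q) * \<Omega> c p [] [q, k])"
    by (simp add: \<H>_def lie_conn_def X distrib_right sum.distrib)
  also have "(\<Sum>q\<in>UNIV. cov \<Gamma> (cov \<Gamma> ?X) c p [q] [i, j] * \<Omega> c p [] [q, k])
     = (\<Sum>q\<in>UNIV. (chart_pd c i (Y j q) p + (\<Sum>m\<in>UNIV. \<Gamma> c p i m q * Y j m p)) * \<Omega> c p [] [q, k])
       - (\<Sum>q\<in>UNIV. (\<Sum>m\<in>UNIV. \<Gamma> c p i j m * Y m q p) * \<Omega> c p [] [q, k])"
    by (subst cov_def) (simp add: Y left_diff_distrib sum_subtractf)
  also have "(\<Sum>q\<in>UNIV. (\<Sum>m\<in>UNIV. \<Gamma> c p i j m * Y m q p) * \<Omega> c p [] [q, k])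
     = - (\<Sum>m\<in>UNIV. \<Gamma> c p i j m * cov \<Gamma> (cov \<Gamma> f) c p [] [m, k])"
  proof -
    have "(\<Sum>q\<in>UNIV. (\<Sum>m\<in>UNIV. \<Gamma> c p i j m * Y m q p) * \<Omega> c p [] [q, k])
      = (\<Sum>m\<in>UNIV. \<Gamma> c p i j m * (\<Sum>q\<in>UNIV. Y m q p * \<Omega> c p [] [q, k]))"
      by (simp add: sum_distrib_left sum_distrib_right mult.assoc) (rule sum.swap)
    then show ?thesis unfolding lowY[OF cp(2)] by (simp add: sum_negf)
  qed
  also have "(\<Sum>q\<in>UNIV. (chart_pd c i (Y j q) p + (\<Sum>m\<in>UNIV. \<Gamma> c p i m q * Y j m p)) * \<Omega> c p [] [q, k])
     = - chart_pd c i (\<lambda>p. cov \<Gamma> (cov \<Gamma> f) c p [] [j, k]) p + (\<Sum>m\<in>UNIV. \<Gamma> c p i k m * cov \<Gamma> (cov \<Gamma> f) c p [] [j, m])"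
  proof -
    have s: "smf c (cdom c) (\<lambda>p. cov \<Gamma> (cov \<Gamma> f) c p [] [j, k])"
    proof -
      have "smf c (cdom c) (\<lambda>p. - (\<Sum>q\<in>UNIV. Y j q p * \<Omega> c p [] [q, k]))"
        by (intro C.smf_uminus C.smf_sum C.smf_mult Ys \<Omega>_smf cp)
      then show ?thesis by (rule C.smf_cong) (simp add: lowY)
    qed
    have "chart_pd c i (\<lambda>p. \<Sum>q\<in>UNIV. Y j q p * \<Omega> c p [] [q, k]) p
        = chart_pd c i (\<lambda>p. - cov \<Gamma> (cov \<Gamma> f) c p [] [j, k]) p"
      using lowY by (intro C.chart_pd_cong cp) auto
    also have "\<dots> = - chart_pd c i (\<lambda>p. cov \<Gamma> (cov \<Gamma> f) c p [] [j, k]) p"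
      by (rule C.chart_pd_uminus[OF s cp(2)])
    finally show ?thesis
      unfolding lower_derivative[OF Ys cp] lowY[OF cp(2)] by (simp add: sum_negf)
  qed
  also have "(\<Sum>q\<in>UNIV. (\<Sum>m\<in>UNIV. X m p * curv \<Gamma> c p m i j q) * \<Omega> c p [] [q, k])
     = (\<Sum>m\<in>UNIV. X m p * Riem c p [] [m, i, j, k])"
    unfolding Riem_eq by (simp add: sum_distrib_left sum_distrib_right mult.assoc) (rule sum.swap)
  finally show ?thesis
    unfolding cov_Cons[of _ "cov \<Gamma> (cov \<Gamma> f)"] dop_Cons dop_Nil cov_function X_def by simp
qed

lemma cov_sym_last:
  assumes "\<And>p j k. p \<in> cdom c \<Longrightarrow> T c p [] [j, k] = T c p [] [k, j]" and cp: "c \<in> A" "p \<in> cdom c"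
  shows "cov \<Gamma> T c p [] [i, j, k] = cov \<Gamma> T c p [] [i, k, j]"
proof -
  interpret C: chart_conn c "cdom c" \<Gamma> using chart_conn_cdom cp by blast
  have "chart_pd c i (\<lambda>p. T c p [] [j, k]) p = chart_pd c i (\<lambda>p. T c p [] [k, j]) p"
    using assms(1) by (intro C.chart_pd_cong cp) auto
  moreover have "(\<Sum>l\<in>UNIV. G l * T c p [] [l, k]) = (\<Sum>l\<in>UNIV. G l * T c p [] [k, l])" for G k
    using assms(1)[OF cp(2)] by (intro sum.cong) auto
  ultimately show ?thesis unfolding cov_Cons dop_Cons dop_Nil by simp
qed

lemma hessian_sym:
  assumes f: "smf c (cdom c) (\<lambda>p. f c p [] [])" and cp: "c \<in> A" "p \<in> cdom c"
  shows "cov \<Gamma> (cov \<Gamma> f) c p [] [j, k] = cov \<Gamma> (cov \<Gamma> f) c p [] [k, j]"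
proof -
  interpret C: chart_conn c "cdom c" \<Gamma> using chart_conn_cdom cp by blast
  show ?thesis
    unfolding cov_Cons dop_Cons dop_Nil
    using C.chart_pd_commute[OF f cp(2), of j k] torsion_free[OF cp, of j k] by simp
qed

text \<open>The last two indices may be exchanged in the Hessian and in the curvature. Exchanging the first two
  produces curvature terms in \<open>\<nabla>\<nabla>\<nabla>f\<close>, by the Ricci identity for \<open>df\<close>, and in the second summand, by
  the first Bianchi identity; these cancel.\<close>

lemma \<H>_sym:
  assumes f: "smf c (cdom c) (\<lambda>p. f c p [] [])" and cp: "c \<in> A" "p \<in> cdom c"
  shows "\<H> \<Omega> \<Gamma> f c p us [i, j, k] = \<H> \<Omega> \<Gamma> f c p us [i, k, j]"
    and "\<H> \<Omega> \<Gamma> f c p us [i, j, k] = \<H> \<Omega> \<Gamma> f c p us [j, i, k]"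
proof -
  interpret C: chart_conn c "cdom c" \<Gamma> using chart_conn_cdom cp by blast
  show "\<H> \<Omega> \<Gamma> f c p us [i, j, k] = \<H> \<Omega> \<Gamma> f c p us [i, k, j]"
    unfolding \<H>_eq[where f = f, OF assms]
    using cov_sym_last[of c "cov \<Gamma> (cov \<Gamma> f)" p i j k] hessian_sym[where f = f, OF f cp(1)] cp Riem_sym[OF cp, of "[]" _ i j k] by simp
  let ?X = "\<lambda>q. \<Sum>r\<in>UNIV. \<omega> c p r q * cov \<Gamma> f c p [] [r]"
  have s: "smf c (cdom c) (\<lambda>p. cov \<Gamma> f c p [] ls)" if "ls \<in> idx 1" for ls
    using smf_cov[where T = f and k = 0 and c = c and W = "cdom c", OF aff cp(1) open_cdom[OF cp(1)] subset_refl] f that by simp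
  have 1: "cov \<Gamma> (cov \<Gamma> (cov \<Gamma> f)) c p [] [i, j, k] - cov \<Gamma> (cov \<Gamma> (cov \<Gamma> f)) c p [] [j, i, k]
      = - (\<Sum>m\<in>UNIV. curv \<Gamma> c p i j k m * cov \<Gamma> f c p [] [m])"
    using C.ricci_identity[where T = "cov \<Gamma> f" and k = 1 and ls = "[k]" and i = i and j = j, OF s cp(2)]
    by (simp add: idx_def)
  have "(\<Sum>q\<in>UNIV. ?X q * Riem c p [] [q, i, j, k]) - (\<Sum>q\<in>UNIV. ?X q * Riem c p [] [q, j, i, k])
      = - (\<Sum>q\<in>UNIV. ?X q * Riem c p [] [i, j, k, q])"
    unfolding sum_subtractf[symmetric] sum_negf[symmetric]
  proof (intro sum.cong refl)
    fix q
    have "Riem c p [] [q, i, j, k] - Riem c p [] [q, j, i, k] = - Riem c p [] [i, j, k, q]"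
      using Riem_bianchi1[OF cp, of "[]" q i j k] Riem_skew[of c p "[]" j q i k] Riem_sym[OF cp, of "[]" i j q k] by linarith
    then show "?X q * Riem c p [] [q, i, j, k] - ?X q * Riem c p [] [q, j, i, k] = - (?X q * Riem c p [] [i, j, k, q])"
      unfolding right_diff_distrib[symmetric] by simp
  qed
  also have "(\<Sum>q\<in>UNIV. ?X q * Riem c p [] [i, j, k, q])
      = (\<Sum>q\<in>UNIV. \<Sum>r\<in>UNIV. \<Sum>m\<in>UNIV. curv \<Gamma> c p i j k m * cov \<Gamma> f c p [] [r] * (\<Omega> c p [] [m, q] * \<omega> c p r q))"
    unfolding Riem_eq sum_product by (simp add: ac_simps)
  also have "\<dots> = (\<Sum>r\<in>UNIV. \<Sum>q\<in>UNIV. \<Sum>m\<in>UNIV. curv \<Gamma> c p i j k m * cov \<Gamma> f c p [] [r] * (\<Omega> c p [] [m, q] * \<omega> c p r q))"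
    by (rule sum.swap)
  also have "\<dots> = (\<Sum>r\<in>UNIV. \<Sum>m\<in>UNIV. \<Sum>q\<in>UNIV. curv \<Gamma> c p i j k m * cov \<Gamma> f c p [] [r] * (\<Omega> c p [] [m, q] * \<omega> c p r q))"
    by (rule sum.cong[OF refl], rule sum.swap)
  also have "\<dots> = (\<Sum>r\<in>UNIV. \<Sum>m\<in>UNIV. curv \<Gamma> c p i j k m * cov \<Gamma> f c p [] [r] * (if m = r then 1 else 0))"
  proof -
    have "(\<Sum>q\<in>UNIV. \<Omega> c p [] [m, q] * \<omega> c p r q) = - (\<Sum>q\<in>UNIV. \<Omega> c p [] [m, q] * \<omega> c p q r)" for m r
      unfolding sum_negf[symmetric] by (intro sum.cong refl) (subst \<omega>_skew[OF cp], simp)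
    then have "(\<Sum>q\<in>UNIV. \<Omega> c p [] [m, q] * \<omega> c p r q) = (if m = r then 1 else 0)" for m r
      using \<Omega>\<omega>[OF cp] by simp
    then show ?thesis unfolding sum_distrib_left[symmetric] by simp
  qed
  also have "\<dots> = (\<Sum>m\<in>UNIV. curv \<Gamma> c p i j k m * cov \<Gamma> f c p [] [m])"
    by (simp add: sum_delta_mult)
  finally show "\<H> \<Omega> \<Gamma> f c p us [i, j, k] = \<H> \<Omega> \<Gamma> f c p us [j, i, k]"
    unfolding \<H>_eq[where f = f, OF assms] using 1 by simp
qed

end

section \<open>Symmetrization\<close>

lemma Sk_swap:
  assumes "P \<in> Sk A 3" "c \<in> A" "p \<in> cdom c"
  shows "P c p [] [i, j, k] = P c p [] [j, i, k]" "P c p [] [i, j, k] = P c p [] [i, k, j]"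
proof -
  have P: "P c p [] (permute_list \<sigma> [i, j, k]) = P c p [] [i, j, k]" if "\<sigma> permutes {..<3}" for \<sigma>
    using assms that unfolding Sk_def by (auto simp: idx_def)
  have "Transposition.transpose 0 (Suc 0) permutes {..<3}" "Transposition.transpose (Suc 0) 2 permutes {..<3::nat}"
    by (auto intro!: permutes_swap_id)
  from P[OF this(1)] P[OF this(2)]
  show "P c p [] [i, j, k] = P c p [] [j, i, k]" "P c p [] [i, j, k] = P c p [] [i, k, j]"
    by (simp_all add: permute_list_def upt_conv_Cons Transposition.transpose_def)
qed

lemma sum_idx_permute:
  assumes \<sigma>: "\<sigma> permutes {..<k}"
  shows "(\<Sum>is\<in>(idx k :: 'n::finite list set). h (permute_list \<sigma> is)) = (\<Sum>is\<in>idx k. h is)"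
proof (rule sum.reindex_bij_betw, rule bij_betw_byWitness[of _ "permute_list (inv \<sigma>)"])
  show "\<forall>a\<in>idx k. permute_list (inv \<sigma>) (permute_list \<sigma> a) = (a :: 'n list)"
  proof
    fix a :: "'n list" assume "a \<in> idx k"
    then have "inv \<sigma> permutes {..<length a}" using permutes_inv[OF \<sigma>] by (simp add: idx_def)
    from permute_list_compose[OF this, of \<sigma>] show "permute_list (inv \<sigma>) (permute_list \<sigma> a) = a"
      using permutes_inv_o[OF \<sigma>] by simp
  qed
  show "\<forall>a\<in>idx k. permute_list \<sigma> (permute_list (inv \<sigma>) a) = (a :: 'n list)"
  proof
    fix a :: "'n list" assume "a \<in> idx k"
    then have "\<sigma> permutes {..<length a}" using \<sigma> by (simp add: idx_def)
    from permute_list_compose[OF this, of "inv \<sigma>"] show "permute_list \<sigma> (permute_list (inv \<sigma>) a) = a"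
      using permutes_inv_o[OF \<sigma>] by simp
  qed
qed (use \<sigma> permutes_inv[OF \<sigma>] in \<open>auto simp: idx_def\<close>)

lemma kp_permute:
  assumes \<sigma>: "\<sigma> permutes {..<k}" and "is \<in> idx k" "js \<in> idx k"
  shows "kp M (permute_list \<sigma> is) (permute_list \<sigma> js) = kp M is js"
proof -
  have "(\<Prod>m<k. M (is ! \<sigma> m) (js ! \<sigma> m)) = (\<Prod>m<k. M (is ! m) (js ! m))"
    using prod.permute[OF \<sigma>, of "\<lambda>m. M (is ! m) (js ! m)"] by (simp add: o_def)
  then show ?thesis using assms unfolding kp_def by (auto simp: idx_def permute_list_nth)
qed

lemma tr_permute:
  assumes \<sigma>: "\<sigma> permutes {..<k}" and ls: "ls \<in> idx k"
  shows "tr J k (\<lambda>ms. T (permute_list \<sigma> ms)) ls = tr J k T (permute_list \<sigma> ls)"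
proof -
  have "tr J k T (permute_list \<sigma> ls) = (\<Sum>ms\<in>idx k. kp J (permute_list \<sigma> ms) (permute_list \<sigma> ls) * T (permute_list \<sigma> ms))"
    unfolding tr_def by (rule sum_idx_permute[OF \<sigma>, symmetric])
  then show ?thesis unfolding tr_def by (simp add: kp_permute[OF \<sigma> _ ls])
qed

lemma fcf_permute:
  fixes S T :: "'n::finite list \<Rightarrow> real"
  assumes \<sigma>: "\<sigma> permutes {..<k}"
  shows "fcf M k (\<lambda>ls. T (permute_list \<sigma> ls)) (\<lambda>ls. S (permute_list \<sigma> ls)) = fcf M k T S"
proof -
  have "fcf M k T S = (\<Sum>is\<in>idx k. \<Sum>js\<in>idx k. T (permute_list \<sigma> is) * kp M (permute_list \<sigma> is) (permute_list \<sigma> js) * S (permute_list \<sigma> js))"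
    unfolding fcf_def
    by (rule trans[OF sum_idx_permute[OF \<sigma>, symmetric]], rule sum.cong[OF refl], rule sum_idx_permute[OF \<sigma>, symmetric])
  also have "\<dots> = fcf M k (\<lambda>ls. T (permute_list \<sigma> ls)) (\<lambda>ls. S (permute_list \<sigma> ls))"
    unfolding fcf_def by (simp add: kp_permute[OF \<sigma>])
  finally show ?thesis ..
qed

text \<open>A permutation applied to one factor can be moved to the other.\<close>

lemma fcf_symmetrize:
  fixes S :: "'n::finite list \<Rightarrow> real"
  assumes "\<And>\<sigma> ls. \<sigma> permutes {..<k} \<Longrightarrow> ls \<in> idx k \<Longrightarrow> S (permute_list \<sigma> ls) = S ls"
  shows "fcf M k (symmetrize T c p us) S = fcf M k (T c p us) S"
proof -
  have "fcf M k (symmetrize T c p us) S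
      = fcf M k (\<lambda>ls. \<Sum>\<sigma> | \<sigma> permutes {..<k}. (1 / fact k) * T c p us (permute_list \<sigma> ls)) S"
    by (rule fcf_cong) (auto simp: symmetrize_def idx_def sum_distrib_left)
  also have "\<dots> = (\<Sum>\<sigma> | \<sigma> permutes {..<k}. (1 / fact k) * fcf M k (T c p us) S)"
  proof -
    have "fcf M k (\<lambda>ls. T c p us (permute_list \<sigma> ls)) S = fcf M k (T c p us) S" if "\<sigma> permutes {..<k}" for \<sigma>
    proof -
      have "fcf M k (\<lambda>ls. T c p us (permute_list \<sigma> ls)) S
          = fcf M k (\<lambda>ls. T c p us (permute_list \<sigma> ls)) (\<lambda>ls. S (permute_list \<sigma> ls))"
        using assms[OF that] by (intro fcf_cong) auto
      then show ?thesis unfolding fcf_permute[OF that] .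
    qed
    then show ?thesis unfolding fcf_sum_left by simp
  qed
  also have "\<dots> = fcf M k (T c p us) S"
    by (simp add: card_permutations)
  finally show ?thesis .
qed

section \<open>Polynomial families and the variation of the connection\<close>

text \<open>Everything built from \<open>\<Gamma> + \<epsilon> \<Pi>\<close> is a polynomial in \<open>\<epsilon>\<close> of bounded degree with smooth coefficients.
  For such families, differentiation at \<open>\<epsilon> = 0\<close> extracts the linear coefficient, hence commutes
  with coordinate derivatives and with integrals.\<close>

definition polyf :: "('m, 'n::finite) chart \<Rightarrow> 'm set \<Rightarrow> (real \<Rightarrow> 'm \<Rightarrow> real) \<Rightarrow> bool" where
  "polyf c W F \<longleftrightarrow> (\<exists>N G. (\<forall>m. smf c W (G m)) \<and> (\<forall>m>N. G m = (\<lambda>p. 0)) \<and>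
     (\<forall>\<epsilon>. \<forall>p\<in>W. F \<epsilon> p = (\<Sum>m\<le>N. G m p * \<epsilon> ^ m)))"

context chart_domain
begin

lemma polyfI:
  assumes "\<And>m. smf c W (G m)" "\<And>\<epsilon> p. p \<in> W \<Longrightarrow> F \<epsilon> p = (\<Sum>m\<le>N. G m p * \<epsilon> ^ m)"
  shows "polyf c W F"
  unfolding polyf_def
proof (intro exI[of _ N] exI[of _ "\<lambda>m. if m \<le> N then G m else (\<lambda>p. 0)"] conjI allI ballI impI)
  show "smf c W (if m \<le> N then G m else (\<lambda>p. 0))" for m using assms(1) by simp
  show "F \<epsilon> p = (\<Sum>m\<le>N. (if m \<le> N then G m else (\<lambda>p. 0)) p * \<epsilon> ^ m)" if "p \<in> W" for \<epsilon> p
    using assms(2)[OF that] by simp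
qed simp

lemma polyf_smf: "smf c W F \<Longrightarrow> polyf c W (\<lambda>\<epsilon>. F)"
  by (rule polyfI[of "\<lambda>m. F" _ 0]) auto

lemma polyf_parameter: "polyf c W (\<lambda>\<epsilon> p. \<epsilon>)"
proof (rule polyfI[of "\<lambda>m p. if m = 1 then 1 else 0" _ 1])
  show "smf c W (\<lambda>p. if m = 1 then 1 else 0)" for m :: nat by simp
qed simp

lemma polyf_cong: "polyf c W F \<Longrightarrow> (\<And>\<epsilon> p. p \<in> W \<Longrightarrow> F \<epsilon> p = G \<epsilon> p) \<Longrightarrow> polyf c W G"
  unfolding polyf_def by (elim exE conjE, intro exI conjI) auto

lemma polyf_obtain:
  assumes "polyf c W F"
  obtains N G where "\<And>m. smf c W (G m)" "\<And>m. m > N \<Longrightarrow> G m = (\<lambda>p. 0)"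
    "\<And>M \<epsilon> p. M \<ge> N \<Longrightarrow> p \<in> W \<Longrightarrow> F \<epsilon> p = (\<Sum>m\<le>M. G m p * \<epsilon> ^ m)"
proof -
  from assms obtain N G where NG: "\<forall>m. smf c W (G m)" "\<forall>m>N. G m = (\<lambda>p. 0)"
    "\<forall>\<epsilon>. \<forall>p\<in>W. F \<epsilon> p = (\<Sum>m\<le>N. G m p * \<epsilon> ^ m)" unfolding polyf_def by blast
  show thesis
  proof (rule that[of G N])
    fix M \<epsilon> p assume M: "M \<ge> N" and p: "p \<in> W"
    have "(\<Sum>m\<le>N. G m p * \<epsilon> ^ m) = (\<Sum>m\<le>M. G m p * \<epsilon> ^ m)"
      using M NG(2) by (intro sum.mono_neutral_left) auto
    then show "F \<epsilon> p = (\<Sum>m\<le>M. G m p * \<epsilon> ^ m)" using NG(3) p by simp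
  qed (use NG in auto)
qed

lemma polyf_add:
  assumes "polyf c W F" "polyf c W G"
  shows "polyf c W (\<lambda>\<epsilon> p. F \<epsilon> p + G \<epsilon> p)"
proof -
  obtain N F' where F: "\<And>m. smf c W (F' m)"
    "\<And>M \<epsilon> p. M \<ge> N \<Longrightarrow> p \<in> W \<Longrightarrow> F \<epsilon> p = (\<Sum>m\<le>M. F' m p * \<epsilon> ^ m)" using polyf_obtain[OF assms(1)] by metis
  obtain K G' where G: "\<And>m. smf c W (G' m)"
    "\<And>M \<epsilon> p. M \<ge> K \<Longrightarrow> p \<in> W \<Longrightarrow> G \<epsilon> p = (\<Sum>m\<le>M. G' m p * \<epsilon> ^ m)" using polyf_obtain[OF assms(2)] by metis
  show ?thesis
  proof (rule polyfI[of "\<lambda>m p. F' m p + G' m p" _ "max N K"])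
    show "smf c W (\<lambda>p. F' m p + G' m p)" for m using F(1) G(1) by (rule smf_add)
    show "F \<epsilon> p + G \<epsilon> p = (\<Sum>m\<le>max N K. (F' m p + G' m p) * \<epsilon> ^ m)" if "p \<in> W" for \<epsilon> p
      using F(2)[OF _ that, of "max N K"] G(2)[OF _ that, of "max N K"] by (simp add: distrib_right sum.distrib)
  qed
qed

lemma polyf_mult:
  assumes "polyf c W F" "polyf c W G"
  shows "polyf c W (\<lambda>\<epsilon> p. F \<epsilon> p * G \<epsilon> p)"
proof -
  obtain N F' where F: "\<And>m. smf c W (F' m)" "\<And>m. m > N \<Longrightarrow> F' m = (\<lambda>p. 0)"
    "\<And>M \<epsilon> p. M \<ge> N \<Longrightarrow> p \<in> W \<Longrightarrow> F \<epsilon> p = (\<Sum>m\<le>M. F' m p * \<epsilon> ^ m)" using polyf_obtain[OF assms(1)] by metis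
  obtain K G' where G: "\<And>m. smf c W (G' m)" "\<And>m. m > K \<Longrightarrow> G' m = (\<lambda>p. 0)"
    "\<And>M \<epsilon> p. M \<ge> K \<Longrightarrow> p \<in> W \<Longrightarrow> G \<epsilon> p = (\<Sum>m\<le>M. G' m p * \<epsilon> ^ m)" using polyf_obtain[OF assms(2)] by metis
  show ?thesis
  proof (rule polyfI[of "\<lambda>r p. \<Sum>k\<le>r. F' k p * G' (r - k) p" _ "N + K"])
    show "smf c W (\<lambda>p. \<Sum>k\<le>r. F' k p * G' (r - k) p)" for r using F(1) G(1) by (intro smf_sum smf_mult)
    show "F \<epsilon> p * G \<epsilon> p = (\<Sum>r\<le>N + K. (\<Sum>k\<le>r. F' k p * G' (r - k) p) * \<epsilon> ^ r)" if p: "p \<in> W" for \<epsilon> p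
      unfolding F(3)[OF order_refl p] G(3)[OF order_refl p]
      by (rule polynomial_product) (simp_all add: F(2) G(2))
  qed
qed

lemma polyf_sum: "(\<And>i. i \<in> I \<Longrightarrow> polyf c W (F i)) \<Longrightarrow> polyf c W (\<lambda>\<epsilon> p. \<Sum>i\<in>I. F i \<epsilon> p)"
  by (induction I rule: infinite_finite_induct) (auto intro: polyf_add polyf_smf)

lemma polyf_uminus: "polyf c W F \<Longrightarrow> polyf c W (\<lambda>\<epsilon> p. - F \<epsilon> p)"
  using polyf_mult[OF polyf_smf[OF smf_const[of "-1"]], of F] by simp

lemma polyf_diff: "polyf c W F \<Longrightarrow> polyf c W G \<Longrightarrow> polyf c W (\<lambda>\<epsilon> p. F \<epsilon> p - G \<epsilon> p)"
  using polyf_add[OF _ polyf_uminus, of F G] by simp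

lemma polyf_chart_pd:
  assumes "polyf c W F"
  shows "polyf c W (\<lambda>\<epsilon>. chart_pd c i (F \<epsilon>))"
proof -
  obtain N G where G: "\<And>m. smf c W (G m)" "\<And>\<epsilon> p. p \<in> W \<Longrightarrow> F \<epsilon> p = (\<Sum>m\<le>N. G m p * \<epsilon> ^ m)"
    using polyf_obtain[OF assms] by (metis order_refl)
  show ?thesis
  proof (rule polyfI[of "\<lambda>m. chart_pd c i (G m)" _ N])
    show "smf c W (chart_pd c i (G m))" for m using G(1) by (rule smf_chart_pd)
    fix \<epsilon> p assume p: "p \<in> W"
    have "chart_pd c i (F \<epsilon>) p = chart_pd c i (\<lambda>p. \<Sum>m\<le>N. \<epsilon> ^ m * G m p) p"
      using G(2) by (intro chart_pd_cong p) (simp add: mult.commute)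
    also have "\<dots> = (\<Sum>m\<le>N. chart_pd c i (G m) p * \<epsilon> ^ m)"
      using G(1) p by (subst chart_pd_sum) (auto intro!: smf_mult sum.cong simp: chart_pd_cmult)
    finally show "chart_pd c i (F \<epsilon>) p = (\<Sum>m\<le>N. chart_pd c i (G m) p * \<epsilon> ^ m)" .
  qed
qed

lemma polyf_dop:
  "(\<And>i j. polyf c W (\<lambda>\<epsilon> p. G \<epsilon> p i j)) \<Longrightarrow> (\<And>ls. ls \<in> idx k \<Longrightarrow> polyf c W (\<lambda>\<epsilon> p. T \<epsilon> p ls)) \<Longrightarrow> ls \<in> idx k \<Longrightarrow>
    polyf c W (\<lambda>\<epsilon> p. dop (G \<epsilon> p) (T \<epsilon> p) ls)"
  unfolding dop_def by (intro polyf_sum polyf_mult) (auto simp: idx_def)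

lemma polyf_fcf:
  "(\<And>i j. smf c W (\<lambda>p. M p i j)) \<Longrightarrow> (\<And>ls. ls \<in> idx k \<Longrightarrow> polyf c W (\<lambda>\<epsilon> p. \<alpha> \<epsilon> p ls)) \<Longrightarrow>
   (\<And>ls. ls \<in> idx k \<Longrightarrow> polyf c W (\<lambda>\<epsilon> p. \<beta> \<epsilon> p ls)) \<Longrightarrow> polyf c W (\<lambda>\<epsilon> p. fcf (M p) k (\<alpha> \<epsilon> p) (\<beta> \<epsilon> p))"
  unfolding fcf_def by (intro polyf_sum polyf_mult polyf_smf smf_kp)

lemma polynomial_derivative_0:
  fixes a :: "nat \<Rightarrow> real"
  shows "((\<lambda>\<epsilon>. \<Sum>m\<le>Suc N. a m * \<epsilon> ^ m) has_real_derivative a 1) (at 0)"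
proof -
  have "((\<lambda>\<epsilon>. \<Sum>m\<le>Suc N. a m * \<epsilon> ^ m) has_real_derivative (\<Sum>m\<le>Suc N. a m * (real m * 0 ^ (m - 1)))) (at 0)"
    by (auto intro!: derivative_eq_intros simp: mult.commute)
  moreover have "(\<Sum>m\<le>Suc N. a m * (real m * 0 ^ (m - 1))) = a 1"
  proof -
    have "(\<Sum>m\<le>Suc N. a m * (real m * 0 ^ (m - 1))) = (\<Sum>m\<le>Suc N. if m = 1 then a 1 else 0)"
      by (intro sum.cong) (auto simp: power_0_left)
    then show ?thesis by simp
  qed
  ultimately show ?thesis by (rule DERIV_cong)
qed

lemma polyf_derivative:
  assumes "polyf c W F"
  obtains D where "smf c W D" "\<And>p. p \<in> W \<Longrightarrow> ((\<lambda>\<epsilon>. F \<epsilon> p) has_real_derivative D p) (at 0)"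
proof -
  obtain N G where G: "\<And>m. smf c W (G m)"
    "\<And>M \<epsilon> p. M \<ge> N \<Longrightarrow> p \<in> W \<Longrightarrow> F \<epsilon> p = (\<Sum>m\<le>M. G m p * \<epsilon> ^ m)"
    using polyf_obtain[OF assms] by metis
  show thesis
  proof (rule that[of "G 1"])
    fix p assume p: "p \<in> W"
    have "((\<lambda>\<epsilon>. \<Sum>m\<le>Suc N. G m p * \<epsilon> ^ m) has_real_derivative G 1 p) (at 0)"
      by (rule polynomial_derivative_0)
    moreover have "(\<lambda>\<epsilon>. F \<epsilon> p) = (\<lambda>\<epsilon>. \<Sum>m\<le>Suc N. G m p * \<epsilon> ^ m)"
      using G(2)[OF _ p, of "Suc N"] by auto
    ultimately show "((\<lambda>\<epsilon>. F \<epsilon> p) has_real_derivative G 1 p) (at 0)" by (simp only:)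
  qed (rule G(1))
qed

end

lemma fcf_has_derivative:
  assumes "\<And>ls. ls \<in> idx k \<Longrightarrow> ((\<lambda>\<epsilon>. \<alpha> \<epsilon> ls) has_real_derivative \<alpha>' ls) (at x)"
    and "\<And>ls. ls \<in> idx k \<Longrightarrow> ((\<lambda>\<epsilon>. \<beta> \<epsilon> ls) has_real_derivative \<beta>' ls) (at x)"
  shows "((\<lambda>\<epsilon>. fcf M k (\<alpha> \<epsilon>) (\<beta> \<epsilon>)) has_real_derivative fcf M k \<alpha>' (\<beta> x) + fcf M k (\<alpha> x) \<beta>') (at x)"
proof -
  have "((\<lambda>\<epsilon>. \<Sum>is\<in>idx k. \<Sum>js\<in>idx k. \<alpha> \<epsilon> is * kp M is js * \<beta> \<epsilon> js) has_real_derivative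
      (\<Sum>is\<in>idx k. \<Sum>js\<in>idx k. \<alpha>' is * kp M is js * \<beta> x js + \<alpha> x is * kp M is js * \<beta>' js)) (at x)"
    by (intro DERIV_sum) (auto intro!: derivative_eq_intros assms)
  then show ?thesis unfolding fcf_def by (simp add: sum.distrib)
qed

context symplectic
begin

text \<open>If \<open>P\<close> is \<open>\<Pi>\<^sub>i\<^sub>j\<^sub>k\<close>, this is \<open>\<Pi>\<^sub>i\<^sub>j\<^sup>k\<close>.\<close>

definition raise3 :: "('m, 'n) tensor \<Rightarrow> ('m, 'n) conn" where
  "raise3 P c p i j k = (\<Sum>q\<in>UNIV. \<omega> c p k q * P c p [] [i, j, q])"

lemma conn_add_eq: "conn_add \<Omega> \<Gamma> (tscale \<epsilon> P) c p i j k = \<Gamma> c p i j k + \<epsilon> * raise3 P c p i j k"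
  by (simp add: conn_add_def tscale_def raise3_def sum_distrib_left ac_simps)

lemma Sk_tensor: "P \<in> Sk A k \<Longrightarrow> tensor_field A 0 k P"
  by (simp add: Sk_def)

lemma Sk_tscale: "P \<in> Sk A k \<Longrightarrow> tscale r P \<in> Sk A k"
  unfolding Sk_def using tensor_field_tscale by (auto simp: tscale_def)

lemma Sk3_smf: "P \<in> Sk A 3 \<Longrightarrow> c \<in> A \<Longrightarrow> smf c (cdom c) (\<lambda>p. P c p [] [i, j, k])"
  using tensor_field_smf[OF Sk_tensor] by (auto simp: idx_def)

lemma raise3_smf: "P \<in> Sk A 3 \<Longrightarrow> c \<in> A \<Longrightarrow> smf c (cdom c) (\<lambda>p. raise3 P c p i j k)"
  unfolding raise3_def
  by (intro chart_domain.smf_sum[OF chart_domain_cdom] chart_domain.smf_mult[OF chart_domain_cdom] \<omega>_smf Sk3_smf)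

lemma raise3_lower:
  assumes cp: "c \<in> A" "p \<in> cdom c"
  shows "(\<Sum>l\<in>UNIV. raise3 P c p i j l * \<Omega> c p [] [l, k]) = P c p [] [i, j, k]"
proof -
  have "(\<Sum>l\<in>UNIV. raise3 P c p i j l * \<Omega> c p [] [l, k])
     = (\<Sum>q\<in>UNIV. P c p [] [i, j, q] * (\<Sum>l\<in>UNIV. \<omega> c p l q * \<Omega> c p [] [l, k]))"
    unfolding raise3_def sum_distrib_left sum_distrib_right by (subst sum.swap) (simp add: ac_simps)
  moreover have "(\<Sum>l\<in>UNIV. \<omega> c p l q * \<Omega> c p [] [l, k]) = (if q = k then 1 else 0)" for q
  proof -
    have "(\<Sum>l\<in>UNIV. \<omega> c p l q * \<Omega> c p [] [l, k]) = - (\<Sum>l\<in>UNIV. \<omega> c p q l * \<Omega> c p [] [l, k])"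
      unfolding sum_negf[symmetric] by (intro sum.cong refl) (subst \<omega>_skew[OF cp], simp)
    then show ?thesis using \<omega>\<Omega>[OF cp] by simp
  qed
  ultimately show ?thesis by (simp add: sum_delta_mult)
qed

lemma raise3_transform:
  assumes P: "P \<in> Sk A 3" and cd: "c \<in> A" "d \<in> A" "p \<in> cdom c" "p \<in> cdom d"
  shows "raise3 P d p i j k = (\<Sum>e\<in>UNIV. jac d c p k e *
     (\<Sum>a\<in>UNIV. \<Sum>b\<in>UNIV. jac c d p a i * jac c d p b j * raise3 P c p a b e))"
proof -
  let ?J = "jac c d p" and ?K = "jac d c p"
  let ?S = "\<lambda>g. \<Sum>a\<in>UNIV. \<Sum>b\<in>UNIV. ?J a i * ?J b j * P c p [] [a, b, g]"
  have KJ: "(\<Sum>q\<in>UNIV. ?J g q * ?K q f) = (if g = f then 1 else 0)" for g f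
    using jac_inverse[OF cd(2,1,4,3)] .
  have Pd: "P d p [] [i, j, q] = (\<Sum>g\<in>UNIV. ?J g q * ?S g)" for q
  proof -
    have "[i, j, q] \<in> idx 3" by (simp add: idx_def)
    from tensor_field_tr[OF Sk_tensor[OF P] cd this]
    have "P d p [] [i, j, q] = (\<Sum>a\<in>UNIV. \<Sum>b\<in>UNIV. \<Sum>g\<in>UNIV. ?J g q * (?J a i * ?J b j * P c p [] [a, b, g]))"
      by (simp add: numeral_3_eq_3 tr_Suc sum_distrib_left ac_simps)
    also have "\<dots> = (\<Sum>a\<in>UNIV. \<Sum>g\<in>UNIV. \<Sum>b\<in>UNIV. ?J g q * (?J a i * ?J b j * P c p [] [a, b, g]))"
      by (rule sum.cong[OF refl], rule sum.swap)
    also have "\<dots> = (\<Sum>g\<in>UNIV. \<Sum>a\<in>UNIV. \<Sum>b\<in>UNIV. ?J g q * (?J a i * ?J b j * P c p [] [a, b, g]))"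
      by (rule sum.swap)
    finally show ?thesis by (simp add: sum_distrib_left)
  qed
  have "raise3 P d p i j k = (\<Sum>q\<in>UNIV. \<Sum>e\<in>UNIV. \<Sum>f\<in>UNIV. \<Sum>g\<in>UNIV. ?K k e * \<omega> c p e f * ?S g * (?J g q * ?K q f))"
    unfolding raise3_def \<omega>_transform[OF cd(2,1,4,3)] Pd sum_distrib_right
    by (intro sum.cong refl) (simp add: sum_distrib_left sum_distrib_right ac_simps)
  also have "\<dots> = (\<Sum>e\<in>UNIV. \<Sum>q\<in>UNIV. \<Sum>f\<in>UNIV. \<Sum>g\<in>UNIV. ?K k e * \<omega> c p e f * ?S g * (?J g q * ?K q f))"
    by (rule sum.swap)
  also have "\<dots> = (\<Sum>e\<in>UNIV. \<Sum>f\<in>UNIV. \<Sum>q\<in>UNIV. \<Sum>g\<in>UNIV. ?K k e * \<omega> c p e f * ?S g * (?J g q * ?K q f))"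
    by (rule sum.cong[OF refl], rule sum.swap)
  also have "\<dots> = (\<Sum>e\<in>UNIV. \<Sum>f\<in>UNIV. \<Sum>g\<in>UNIV. \<Sum>q\<in>UNIV. ?K k e * \<omega> c p e f * ?S g * (?J g q * ?K q f))"
    by (rule sum.cong[OF refl], rule sum.cong[OF refl], rule sum.swap)
  also have "\<dots> = (\<Sum>e\<in>UNIV. \<Sum>f\<in>UNIV. \<Sum>g\<in>UNIV. ?K k e * \<omega> c p e f * ?S g * (if g = f then 1 else 0))"
    unfolding sum_distrib_left[symmetric] KJ ..
  also have "\<dots> = (\<Sum>e\<in>UNIV. ?K k e * (\<Sum>f\<in>UNIV. \<omega> c p e f * ?S f))"
    by (simp add: sum_delta_mult sum_distrib_left mult.assoc)
  finally have "raise3 P d p i j k = (\<Sum>e\<in>UNIV. ?K k e * (\<Sum>f\<in>UNIV. \<omega> c p e f * ?S f))" .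
  moreover have "(\<Sum>f\<in>UNIV. \<omega> c p e f * ?S f) = (\<Sum>a\<in>UNIV. \<Sum>b\<in>UNIV. ?J a i * ?J b j * raise3 P c p a b e)" for e
  proof -
    have "(\<Sum>f\<in>UNIV. \<omega> c p e f * ?S f) = (\<Sum>f\<in>UNIV. \<Sum>a\<in>UNIV. \<Sum>b\<in>UNIV. ?J a i * ?J b j * (\<omega> c p e f * P c p [] [a, b, f]))"
      by (simp add: sum_distrib_left ac_simps)
    also have "\<dots> = (\<Sum>a\<in>UNIV. \<Sum>f\<in>UNIV. \<Sum>b\<in>UNIV. ?J a i * ?J b j * (\<omega> c p e f * P c p [] [a, b, f]))"
      by (rule sum.swap)
    also have "\<dots> = (\<Sum>a\<in>UNIV. \<Sum>b\<in>UNIV. \<Sum>f\<in>UNIV. ?J a i * ?J b j * (\<omega> c p e f * P c p [] [a, b, f]))"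
      by (rule sum.cong[OF refl], rule sum.swap)
    finally show ?thesis by (simp add: raise3_def sum_distrib_left)
  qed
  ultimately show ?thesis by simp
qed

end

locale variation = symplectic_connection A \<Omega> n \<Gamma>
  for A :: "('m::t2_space, 'n::finite) chart set" and \<Omega> n \<Gamma> +
  fixes P :: "('m, 'n) tensor"
  assumes P: "P \<in> Sk A 3"
begin

definition \<Gamma>v :: "real \<Rightarrow> ('m, 'n) conn" where
  "\<Gamma>v \<epsilon> = conn_add \<Omega> \<Gamma> (tscale \<epsilon> P)"

lemma \<Gamma>v_eq: "\<Gamma>v \<epsilon> c p i j k = \<Gamma> c p i j k + \<epsilon> * raise3 P c p i j k"
  by (simp add: \<Gamma>v_def conn_add_eq)

lemma \<Gamma>v_0 [simp]: "\<Gamma>v 0 = \<Gamma>"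
  by (intro ext) (simp add: \<Gamma>v_eq)

lemma raise3_sym: "c \<in> A \<Longrightarrow> p \<in> cdom c \<Longrightarrow> raise3 P c p i j k = raise3 P c p j i k"
  unfolding raise3_def using Sk_swap(1)[OF P] by (intro sum.cong) auto

text \<open>Symmetry of \<open>\<Pi>\<close> in the first two indices preserves the torsion, symmetry in the last two keeps \<open>\<Omega>\<close>
  parallel.\<close>

lemma \<Gamma>v_SConn: "\<Gamma>v \<epsilon> \<in> SConn A \<Omega>"
proof -
  have "affine_connection A (\<Gamma>v \<epsilon>)"
    unfolding affine_connection_def
  proof (intro conjI ballI allI)
    fix c i j k assume c: "c \<in> A"
    interpret C: chart_domain c "cdom c" using chart_domain_cdom c by blast
    have "smf c (cdom c) (\<lambda>p. \<Gamma> c p i j k + \<epsilon> * raise3 P c p i j k)"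
      by (intro C.smf_add C.smf_mult C.smf_const conn_smf[OF aff c] raise3_smf P c)
    then show "smooth_on (cimage c) (in_chart c (\<lambda>p. \<Gamma>v \<epsilon> c p i j k))"
      by (simp add: smf_def \<Gamma>v_eq)
  next
    fix c d p i j k assume cd: "c \<in> A" "d \<in> A" "p \<in> cdom c \<inter> cdom d"
    let ?J = "jac c d p" and ?K = "jac d c p"
    have "\<Gamma> d p i j k = (\<Sum>e\<in>UNIV. ?K k e * (chart_pd d i (\<lambda>q. jac c d q e j) p +
         (\<Sum>a\<in>UNIV. \<Sum>b\<in>UNIV. ?J a i * ?J b j * \<Gamma> c p a b e)))"
      using aff cd unfolding affine_connection_def by blast
    moreover have "raise3 P d p i j k = (\<Sum>e\<in>UNIV. ?K k e * (\<Sum>a\<in>UNIV. \<Sum>b\<in>UNIV. ?J a i * ?J b j * raise3 P c p a b e))"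
      using cd by (intro raise3_transform[OF P]) auto
    ultimately show "\<Gamma>v \<epsilon> d p i j k = (\<Sum>e\<in>UNIV. ?K k e * (chart_pd d i (\<lambda>q. jac c d q e j) p +
         (\<Sum>a\<in>UNIV. \<Sum>b\<in>UNIV. ?J a i * ?J b j * \<Gamma>v \<epsilon> c p a b e)))"
      unfolding \<Gamma>v_eq by (simp add: distrib_left sum.distrib sum_distrib_left ac_simps)
  qed
  moreover have "\<Gamma>v \<epsilon> c p i j k = \<Gamma>v \<epsilon> c p j i k" if "c \<in> A" "p \<in> cdom c" for c p i j k
    unfolding \<Gamma>v_eq using torsion_free[OF that, of i j] raise3_sym[OF that, of i j] by simp
  moreover have "vanishes A 3 (cov (\<Gamma>v \<epsilon>) \<Omega>)"
    unfolding vanishes_def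
  proof (intro ballI)
    fix c p and ls :: "'n list" assume cp: "c \<in> A" "p \<in> cdom c" and "ls \<in> idx 3"
    then obtain i j k where ls: "ls = [i, j, k]" using idx3_cases by blast
    have "cov (\<Gamma>v \<epsilon>) \<Omega> c p [] [i, j, k] = cov \<Gamma> \<Omega> c p [] [i, j, k]
       - \<epsilon> * ((\<Sum>l\<in>UNIV. raise3 P c p i j l * \<Omega> c p [] [l, k]) + (\<Sum>l\<in>UNIV. raise3 P c p i k l * \<Omega> c p [] [j, l]))"
      unfolding cov_Cons dop_Cons dop_Nil \<Gamma>v_eq
      by (simp add: distrib_right distrib_left sum.distrib sum_distrib_left mult.assoc)
    also have "(\<Sum>l\<in>UNIV. raise3 P c p i k l * \<Omega> c p [] [j, l]) = - (\<Sum>l\<in>UNIV. raise3 P c p i k l * \<Omega> c p [] [l, j])"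
      unfolding sum_negf[symmetric] by (intro sum.cong refl) (subst \<Omega>_skew[OF cp], simp)
    finally show "cov (\<Gamma>v \<epsilon>) \<Omega> c p [] ls = 0"
      unfolding raise3_lower[OF cp] cov_\<Omega>[OF cp] ls using Sk_swap(2)[OF P cp, of i j k] by simp
  qed
  ultimately show ?thesis unfolding SConn_def by blast
qed

sublocale V: symplectic_connection A \<Omega> n "\<Gamma>v \<epsilon>" for \<epsilon>
  by unfold_locales (rule \<Gamma>v_SConn)

lemma polyf_\<Gamma>v: "c \<in> A \<Longrightarrow> polyf c (cdom c) (\<lambda>\<epsilon> p. \<Gamma>v \<epsilon> c p i j k)"
  unfolding \<Gamma>v_eq
  by (intro chart_domain.polyf_add[OF chart_domain_cdom] chart_domain.polyf_mult[OF chart_domain_cdom]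
      chart_domain.polyf_smf[OF chart_domain_cdom] chart_domain.polyf_parameter[OF chart_domain_cdom]
      conn_smf[OF aff] raise3_smf[OF P])

lemma polyf_cov:
  assumes c: "c \<in> A" and T: "\<And>ls. ls \<in> idx k \<Longrightarrow> polyf c (cdom c) (\<lambda>\<epsilon> p. T \<epsilon> c p [] ls)" and ls: "ls \<in> idx (Suc k)"
  shows "polyf c (cdom c) (\<lambda>\<epsilon> p. cov (\<Gamma>v \<epsilon>) (T \<epsilon>) c p [] ls)"
proof -
  interpret C: chart_domain c "cdom c" using chart_domain_cdom c by blast
  from ls obtain i js where js: "ls = i # js" "js \<in> idx k" by (rule idx_Suc_cases)
  show ?thesis unfolding js cov_Cons
    by (intro C.polyf_diff C.polyf_chart_pd C.polyf_dop[of _ k] polyf_\<Gamma>v c T js) auto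
qed

lemma polyf_curv:
  assumes c: "c \<in> A"
  shows "polyf c (cdom c) (\<lambda>\<epsilon> p. curv (\<Gamma>v \<epsilon>) c p i j l k)"
proof -
  interpret C: chart_domain c "cdom c" using chart_domain_cdom c by blast
  have "polyf c (cdom c) (\<lambda>\<epsilon> p. chart_pd c i (\<lambda>p. \<Gamma>v \<epsilon> c p j l k) p - chart_pd c j (\<lambda>p. \<Gamma>v \<epsilon> c p i l k) p
    - ((\<Sum>m\<in>UNIV. \<Gamma>v \<epsilon> c p i l m * \<Gamma>v \<epsilon> c p j m k) - (\<Sum>m\<in>UNIV. \<Gamma>v \<epsilon> c p j l m * \<Gamma>v \<epsilon> c p i m k)))"
    by (intro C.polyf_diff C.polyf_sum C.polyf_mult C.polyf_chart_pd polyf_\<Gamma>v c)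
  then show ?thesis
    by (rule C.polyf_cong) (simp add: chart_conn.curv_eq[OF V.chart_conn_cdom[OF c]])
qed

lemma polyf_Riem: "c \<in> A \<Longrightarrow> ls \<in> idx 4 \<Longrightarrow> polyf c (cdom c) (\<lambda>\<epsilon> p. curv_low \<Omega> (\<Gamma>v \<epsilon>) c p us ls)"
  unfolding curv_low_def
  by (intro chart_domain.polyf_sum[OF chart_domain_cdom] chart_domain.polyf_mult[OF chart_domain_cdom]
      chart_domain.polyf_smf[OF chart_domain_cdom] polyf_curv \<Omega>_smf)

lemma polyf_Ric: "c \<in> A \<Longrightarrow> polyf c (cdom c) (\<lambda>\<epsilon> p. Ric (\<Gamma>v \<epsilon>) c p us ls)"
  unfolding Ric_def by (intro chart_domain.polyf_sum[OF chart_domain_cdom] polyf_curv)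

lemma polyf_contraction:
  assumes c: "c \<in> A" and "\<And>ls. ls \<in> idx k \<Longrightarrow> polyf c (cdom c) (\<lambda>\<epsilon> p. S \<epsilon> c p [] ls)"
    "\<And>ls. ls \<in> idx k \<Longrightarrow> polyf c (cdom c) (\<lambda>\<epsilon> p. T \<epsilon> c p [] ls)"
  shows "polyf c (cdom c) (\<lambda>\<epsilon> p. full_contraction \<Omega> k (S \<epsilon>) (T \<epsilon>) c p us ls)"
  unfolding full_contraction_fcf
  by (rule chart_domain.polyf_fcf[OF chart_domain_cdom[OF c]]) (use assms \<omega>_smf in auto)

lemma polyf_\<K>:
  assumes c: "c \<in> A"
  shows "polyf c (cdom c) (\<lambda>\<epsilon> p. \<K> \<Omega> (\<Gamma>v \<epsilon>) c p us ls)"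
proof -
  interpret C: chart_domain c "cdom c" using chart_domain_cdom c by blast
  have RR: "polyf c (cdom c) (\<lambda>\<epsilon> p. cov (\<Gamma>v \<epsilon>) (cov (\<Gamma>v \<epsilon>) (Ric (\<Gamma>v \<epsilon>))) c p [] [a, b, i, j])" for a b i j
  proof -
    have 1: "polyf c (cdom c) (\<lambda>\<epsilon> p. Ric (\<Gamma>v \<epsilon>) c p [] ls)" if "ls \<in> idx 2" for ls by (rule polyf_Ric[OF c])
    have 2: "polyf c (cdom c) (\<lambda>\<epsilon> p. cov (\<Gamma>v \<epsilon>) (Ric (\<Gamma>v \<epsilon>)) c p [] ls)" if "ls \<in> idx (Suc 2)" for ls
      by (rule polyf_cov[where T = "\<lambda>\<epsilon>. Ric (\<Gamma>v \<epsilon>)", OF c 1 that])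
    show ?thesis
      by (rule polyf_cov[where T = "\<lambda>\<epsilon>. cov (\<Gamma>v \<epsilon>) (Ric (\<Gamma>v \<epsilon>))" and k = "Suc 2", OF c 2]) (auto simp: idx_def)
  qed
  have F2: "polyf c (cdom c) (\<lambda>\<epsilon> p. full_contraction \<Omega> 2 (Ric (\<Gamma>v \<epsilon>)) (Ric (\<Gamma>v \<epsilon>)) c p us ls)"
    by (rule polyf_contraction[OF c]) (rule polyf_Ric[OF c])+
  have F4: "polyf c (cdom c) (\<lambda>\<epsilon> p. full_contraction \<Omega> 4 (curv_low \<Omega> (\<Gamma>v \<epsilon>)) (curv_low \<Omega> (\<Gamma>v \<epsilon>)) c p us ls)"
    by (rule polyf_contraction[OF c]; rule polyf_Riem[OF c])
  show ?thesis unfolding \<K>_def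
    by (intro C.polyf_add C.polyf_diff C.polyf_sum C.polyf_mult C.polyf_smf C.smf_const C.smf_mult \<omega>_smf c RR F2 F4)
qed

subsection \<open>First variations of the geometric objects\<close>

lemma \<Gamma>v_deriv: "((\<lambda>\<epsilon>. \<Gamma>v \<epsilon> c p i j k) has_real_derivative raise3 P c p i j k) (at 0)"
  unfolding \<Gamma>v_eq by (auto intro!: derivative_eq_intros)

text \<open>The linear part in \<open>\<Pi>\<close> of \<open>d\<Gamma> + \<Gamma> \<and> \<Gamma>\<close> is the exterior covariant derivative of \<open>\<Pi>\<close>; its
  connection terms in the skew pair of indices cancel because the torsion vanishes.\<close>

lemma Riem_deriv:
  assumes cp: "c \<in> A" "p \<in> cdom c"
  shows "((\<lambda>\<epsilon>. curv_low \<Omega> (\<Gamma>v \<epsilon>) c p us [i, j, k, l]) has_real_derivative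
    cov \<Gamma> P c p [] [i, j, k, l] - cov \<Gamma> P c p [] [j, i, k, l]) (at 0)"
proof -
  interpret C: chart_domain c "cdom c" using chart_domain_cdom cp by blast
  let ?R = "raise3 P c p" and ?G = "\<Gamma> c p"
  define Z where "Z = (\<lambda>i j k q. chart_pd c i (\<lambda>p. raise3 P c p j k q) p + (\<Sum>m\<in>UNIV. ?G i m q * ?R j k m)
      - (\<Sum>m\<in>UNIV. ?G i k m * ?R j m q))"
  have dG: "((\<lambda>\<epsilon>. chart_pd c i (\<lambda>p. \<Gamma>v \<epsilon> c p j l k) p) has_real_derivative chart_pd c i (\<lambda>p. raise3 P c p j l k) p) (at 0)" for i j l k
  proof -
    have "chart_pd c i (\<lambda>p. \<Gamma>v \<epsilon> c p j l k) p
       = chart_pd c i (\<lambda>p. \<Gamma> c p j l k) p + \<epsilon> * chart_pd c i (\<lambda>p. raise3 P c p j l k) p" for \<epsilon>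
      unfolding \<Gamma>v_eq using cp conn_smf[OF aff cp(1)] raise3_smf[OF P cp(1)]
      by (subst C.chart_pd_add) (auto intro!: C.smf_mult simp: C.chart_pd_cmult)
    then show ?thesis by (auto intro!: derivative_eq_intros)
  qed
  have "((\<lambda>\<epsilon>. curv (\<Gamma>v \<epsilon>) c p i j k q) has_real_derivative Z i j k q - Z j i k q) (at 0)" for q
  proof -
    have "((\<lambda>\<epsilon>. chart_pd c i (\<lambda>p. \<Gamma>v \<epsilon> c p j k q) p - chart_pd c j (\<lambda>p. \<Gamma>v \<epsilon> c p i k q) p
      - ((\<Sum>m\<in>UNIV. \<Gamma>v \<epsilon> c p i k m * \<Gamma>v \<epsilon> c p j m q) - (\<Sum>m\<in>UNIV. \<Gamma>v \<epsilon> c p j k m * \<Gamma>v \<epsilon> c p i m q)))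
      has_real_derivative chart_pd c i (\<lambda>p. raise3 P c p j k q) p - chart_pd c j (\<lambda>p. raise3 P c p i k q) p
      - ((\<Sum>m\<in>UNIV. ?R i k m * \<Gamma>v 0 c p j m q + ?R j m q * \<Gamma>v 0 c p i k m)
        - (\<Sum>m\<in>UNIV. ?R j k m * \<Gamma>v 0 c p i m q + ?R i m q * \<Gamma>v 0 c p j k m))) (at 0)"
      (is "(_ has_real_derivative ?X) _")
      by (intro DERIV_diff DERIV_sum DERIV_mult dG \<Gamma>v_deriv)
    moreover have "?X = Z i j k q - Z j i k q"
      by (simp add: Z_def sum.distrib ac_simps)
    ultimately show ?thesis
      unfolding chart_conn.curv_eq[OF V.chart_conn_cdom[OF cp(1)] cp(2)]
      by (rule DERIV_cong)
  qed
  then have "((\<lambda>\<epsilon>. curv_low \<Omega> (\<Gamma>v \<epsilon>) c p us [i, j, k, l]) has_real_derivative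
      (\<Sum>q\<in>UNIV. (Z i j k q - Z j i k q) * \<Omega> c p [] [q, l])) (at 0)"
    unfolding V.Riem_eq by (intro DERIV_sum DERIV_cmult_right)
  moreover have "(\<Sum>q\<in>UNIV. Z i j k q * \<Omega> c p [] [q, l])
      = cov \<Gamma> P c p [] [i, j, k, l] + (\<Sum>m\<in>UNIV. ?G i j m * P c p [] [m, k, l])" for i j
  proof -
    have "(\<Sum>q\<in>UNIV. (\<Sum>m\<in>UNIV. ?G i k m * ?R j m q) * \<Omega> c p [] [q, l]) = (\<Sum>m\<in>UNIV. ?G i k m * P c p [] [j, m, l])"
    proof -
      have "(\<Sum>q\<in>UNIV. (\<Sum>m\<in>UNIV. ?G i k m * ?R j m q) * \<Omega> c p [] [q, l])
        = (\<Sum>m\<in>UNIV. ?G i k m * (\<Sum>q\<in>UNIV. ?R j m q * \<Omega> c p [] [q, l]))"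
        by (simp add: sum_distrib_left sum_distrib_right mult.assoc) (rule sum.swap)
      then show ?thesis unfolding raise3_lower[OF cp] .
    qed
    moreover have "(\<Sum>q\<in>UNIV. (chart_pd c i (\<lambda>p. raise3 P c p j k q) p + (\<Sum>m\<in>UNIV. ?G i m q * ?R j k m)) * \<Omega> c p [] [q, l])
       = chart_pd c i (\<lambda>p. P c p [] [j, k, l]) p - (\<Sum>m\<in>UNIV. ?G i l m * P c p [] [j, k, m])"
    proof -
      have "chart_pd c i (\<lambda>p. \<Sum>q\<in>UNIV. raise3 P c p j k q * \<Omega> c p [] [q, l]) p = chart_pd c i (\<lambda>p. P c p [] [j, k, l]) p"
        using raise3_lower[OF cp(1)] by (intro C.chart_pd_cong cp) auto
      then show ?thesis
        unfolding lower_derivative[where Z = "\<lambda>q p. raise3 P c p j k q", OF raise3_smf[OF P cp(1)] cp] raise3_lower[OF cp] by simp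
    qed
    ultimately show ?thesis
      unfolding Z_def left_diff_distrib sum_subtractf cov_Cons dop_Cons dop_Nil by simp
  qed
  ultimately show ?thesis
    using torsion_free[OF cp, of i j] by (simp add: left_diff_distrib sum_subtractf)
qed

text \<open>The trace over the first pair sees \<open>\<nabla>\<Pi>\<close> twice, by skewness, and \<open>Ric\<close> is \<open>- 1 / 2\<close> times that trace.\<close>

lemma Ric_deriv:
  assumes cp: "c \<in> A" "p \<in> cdom c"
  shows "((\<lambda>\<epsilon>. Ric (\<Gamma>v \<epsilon>) c p us [k, l]) has_real_derivative - diverg \<Omega> \<Gamma> P c p [] [k, l]) (at 0)"
proof -
  let ?D = "\<lambda>i j. cov \<Gamma> P c p [] [i, j, k, l]"
  have "Ric (\<Gamma>v \<epsilon>) c p us [k, l] = - 1 / 2 * ctr \<Omega> (curv_low \<Omega> (\<Gamma>v \<epsilon>)) c p us [k, l]" for \<epsilon>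
    using V.ctr_Riem[OF cp] by simp
  moreover have "((\<lambda>\<epsilon>. - 1 / 2 * ctr \<Omega> (curv_low \<Omega> (\<Gamma>v \<epsilon>)) c p us [k, l]) has_real_derivative
     - 1 / 2 * (\<Sum>i\<in>UNIV. \<Sum>a\<in>UNIV. \<omega> c p i a * (?D a i - ?D i a))) (at 0)"
    unfolding ctr_def by (intro DERIV_cmult DERIV_sum Riem_deriv cp)
  moreover have "(\<Sum>i\<in>UNIV. \<Sum>a\<in>UNIV. \<omega> c p i a * (?D a i - ?D i a)) = 2 * diverg \<Omega> \<Gamma> P c p [] [k, l]"
  proof -
    have "(\<Sum>i\<in>UNIV. \<Sum>a\<in>UNIV. \<omega> c p i a * ?D i a) = - (\<Sum>i\<in>UNIV. \<Sum>a\<in>UNIV. \<omega> c p i a * ?D a i)"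
    proof -
      have "(\<Sum>i\<in>UNIV. \<Sum>a\<in>UNIV. \<omega> c p i a * ?D i a) = (\<Sum>i\<in>UNIV. \<Sum>a\<in>UNIV. \<omega> c p a i * ?D a i)"
        by (rule sum.swap)
      also have "\<dots> = - (\<Sum>i\<in>UNIV. \<Sum>a\<in>UNIV. \<omega> c p i a * ?D a i)"
        unfolding sum_negf[symmetric] by (intro sum.cong refl) (subst \<omega>_skew[OF cp], simp)
      finally show ?thesis .
    qed
    then show ?thesis by (simp add: diverg_def ctr_def right_diff_distrib sum_subtractf)
  qed
  ultimately show ?thesis by simp
qed

text \<open>Only the Christoffel symbols of the outer derivative depend on \<open>\<epsilon>\<close>, as the inner one is \<open>df\<close>.\<close>

lemma hessian_deriv:
  "((\<lambda>\<epsilon>. cov (\<Gamma>v \<epsilon>) (cov (\<Gamma>v \<epsilon>) f) c p [] [i, j]) has_real_derivative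
    - (\<Sum>m\<in>UNIV. raise3 P c p i j m * cov \<Gamma> f c p [] [m])) (at 0)"
proof -
  have eq: "cov (\<Gamma>v \<epsilon>) (cov (\<Gamma>v \<epsilon>) f) c p [] [i, j]
     = chart_pd c i (\<lambda>p. chart_pd c j (\<lambda>p. f c p [] []) p) p - (\<Sum>m\<in>UNIV. \<Gamma>v \<epsilon> c p i j m * chart_pd c m (\<lambda>p. f c p [] []) p)" for \<epsilon>
    unfolding cov_Cons dop_Cons dop_Nil by simp
  have "((\<lambda>\<epsilon>. chart_pd c i (\<lambda>p. chart_pd c j (\<lambda>p. f c p [] []) p) p - (\<Sum>m\<in>UNIV. \<Gamma>v \<epsilon> c p i j m * chart_pd c m (\<lambda>p. f c p [] []) p))
     has_real_derivative 0 - (\<Sum>m\<in>UNIV. raise3 P c p i j m * chart_pd c m (\<lambda>p. f c p [] []) p)) (at 0)"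
    by (intro DERIV_diff DERIV_const DERIV_sum DERIV_cmult_right \<Gamma>v_deriv)
  then show ?thesis unfolding eq cov_function by simp
qed

end

section \<open>Integration over coordinate space\<close>

text \<open>A copy of a finite type that carries a well-order, obtained from an enumeration; the change of
  variables formula for Lebesgue integrals concerns well-ordered index types.\<close>

typedef 'a ordered = "UNIV :: 'a set" by auto

instance ordered :: (finite) finite
proof
  have "(UNIV :: 'a ordered set) \<subseteq> Abs_ordered ` UNIV"
    by (metis Abs_ordered_cases image_eqI subsetI UNIV_I)
  then show "finite (UNIV :: 'a ordered set)" by (rule finite_subset) simp
qed

instantiation ordered :: (finite) linorder
begin

definition less_eq_ordered :: "'a ordered \<Rightarrow> 'a ordered \<Rightarrow> bool" where
  "x \<le> y \<longleftrightarrow> to_nat_on (UNIV :: 'a set) (Rep_ordered x) \<le> to_nat_on (UNIV :: 'a set) (Rep_ordered y)"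

definition less_ordered :: "'a ordered \<Rightarrow> 'a ordered \<Rightarrow> bool" where
  "x < y \<longleftrightarrow> to_nat_on (UNIV :: 'a set) (Rep_ordered x) < to_nat_on (UNIV :: 'a set) (Rep_ordered y)"

instance
proof
  fix x y z :: "'a ordered"
  have inj: "inj (to_nat_on (UNIV :: 'a set))" by (rule inj_on_to_nat_on) (simp add: countable_finite)
  show "x \<le> y \<Longrightarrow> y \<le> x \<Longrightarrow> x = y"
    unfolding less_eq_ordered_def using inj by (metis Rep_ordered_inject antisym injD)
qed (auto simp: less_eq_ordered_def less_ordered_def)

end

instance ordered :: (finite) wellorder
proof (rule wf_wellorderI)
  have "{(x :: 'a ordered, y). x < y} = Wellfounded.measure (\<lambda>x. to_nat_on (UNIV :: 'a set) (Rep_ordered x))"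
    by (auto simp: less_ordered_def)
  then show "wf {(x :: 'a ordered, y). x < y}" by simp
qed intro_classes

lemma bij_Rep_ordered: "bij (Rep_ordered :: 'a ordered \<Rightarrow> 'a)"
  by (metis Abs_ordered_inverse Rep_ordered_inject UNIV_I bijI injI surjI)

text \<open>A bijection of the index types permutes the coordinates; together with the invariance of measure
  and determinant, this carries the change of variables formula over to any finite index type.\<close>

lemma prod_Basis_cart: "(\<Prod>b\<in>Basis. f b) = (\<Prod>i\<in>UNIV. f (axis i 1 :: real^'n::finite))"
proof -
  have B: "(Basis :: (real^'n) set) = range (\<lambda>i. axis i 1)" by (auto simp: Basis_vec_def)
  have inj: "inj (\<lambda>i. axis i 1 :: real^'n)" by (auto simp: inj_on_def axis_eq_axis)
  show ?thesis unfolding B by (subst prod.reindex[OF inj]) (simp add: o_def)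
qed

lemma lborel_relabel:
  fixes b :: "'b::finite \<Rightarrow> 'a::finite"
  assumes b: "bij b"
  shows "distr lborel borel (\<lambda>x :: real^'a. (\<chi> i. x $ b i) :: real^'b) = lborel"
proof (rule lborel_eqI[symmetric])
  let ?R = "\<lambda>x :: real^'a. (\<chi> i. x $ b i) :: real^'b"
  have cont: "continuous_on UNIV ?R" by (intro continuous_intros)
  then have meas: "?R \<in> borel_measurable borel" by (rule borel_measurable_continuous_onI)
  fix l u :: "real^'b" assume le: "\<And>b. b \<in> Basis \<Longrightarrow> l \<bullet> b \<le> u \<bullet> b"
  have le': "l $ i \<le> u $ i" for i
  proof -
    have "axis i 1 \<in> (Basis :: (real^'b) set)" by (auto simp: Basis_vec_def)
    from le[OF this] show ?thesis by (simp add: inner_axis)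
  qed
  let ?S = "\<lambda>y :: real^'b. (\<chi> i. y $ inv b i) :: real^'a"
  have ib: "inv b (b i) = i" "b (inv b j) = j" for i j
    using b by (simp_all add: bij_is_inj bij_is_surj surj_f_inv_f)
  have pre: "?R -` box l u = box (?S l) (?S u)"
    using ib by (auto simp: mem_box_cart) (metis ib)+
  have "emeasure (distr lborel borel ?R) (box l u) = emeasure lborel (box (?S l) (?S u))"
    using meas by (simp add: emeasure_distr pre)
  also have "\<dots> = (\<Prod>b\<in>Basis. (?S u - ?S l) \<bullet> b)"
    using le' by (intro emeasure_lborel_box) (auto simp: Basis_vec_def inner_axis)
  also have "(\<Prod>b\<in>Basis. (?S u - ?S l) \<bullet> b) = (\<Prod>i\<in>UNIV. u $ inv b i - l $ inv b i)"
    by (simp add: prod_Basis_cart inner_axis)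
  also have "\<dots> = (\<Prod>i\<in>UNIV. u $ i - l $ i)"
    using prod.reindex_bij_betw[OF bij_imp_bij_inv[OF b], of "\<lambda>i. u $ i - l $ i"] by simp
  also have "\<dots> = (\<Prod>b\<in>Basis. (u - l) \<bullet> b)"
    by (simp add: prod_Basis_cart inner_axis)
  finally show "emeasure (distr lborel borel ?R) (box l u) = (\<Prod>b\<in>Basis. (u - l) \<bullet> b)" .
qed simp

lemma sign_conjugate:
  fixes b :: "'b::finite \<Rightarrow> 'a::finite"
  assumes b: "bij b" and p: "p permutes UNIV"
  shows "sign (b \<circ> p \<circ> inv b) = sign p"
  using p finite[of UNIV]
proof (induction rule: permutes_induct)
  case id
  have "b \<circ> id \<circ> inv b = id" using b by (simp add: fun_eq_iff bij_is_surj surj_f_inv_f)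
  then show ?case by simp
next
  case (swap x y p)
  have 1: "b \<circ> (Transposition.transpose x y \<circ> p) \<circ> inv b
      = Transposition.transpose (b x) (b y) \<circ> (b \<circ> p \<circ> inv b)"
    using b by (auto simp: fun_eq_iff Transposition.transpose_def bij_is_inj inj_eq)
  have "bij (b \<circ> p \<circ> inv b)" using b swap.hyps by (intro bij_comp bij_imp_bij_inv permutes_bij)  
  then have 2: "permutation (b \<circ> p \<circ> inv b)" by (simp add: permutation)
  have 3: "permutation p" using swap by (simp add: permutation permutes_bij)
  have "b x \<noteq> b y" using b swap by (simp add: bij_is_inj inj_eq)
  then show ?case
    unfolding 1 sign_compose[OF permutation_swap_id 2] sign_compose[OF permutation_swap_id 3] sign_swap_id
    using \<open>x \<noteq> y\<close> \<open>sign (b \<circ> p \<circ> inv b) = sign p\<close> by simp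
qed

lemma det_relabel:
  fixes b :: "'b::finite \<Rightarrow> 'a::finite" and M :: "real^'a^'a"
  assumes b: "bij b"
  shows "det (\<chi> i j. M $ b i $ b j) = det M"
proof -
  have ib: "inv b (b i) = i" "b (inv b j) = j" for i j
    using b by (simp_all add: bij_is_inj bij_is_surj surj_f_inv_f)
  have cl: "b \<circ> p \<circ> inv b permutes UNIV" if "p permutes UNIV" for p
    using that b by (intro bij_imp_permutes) (auto intro!: bij_comp bij_imp_bij_inv dest: permutes_bij)
  have cl': "inv b \<circ> p \<circ> b permutes UNIV" if "p permutes UNIV" for p
    using that b by (intro bij_imp_permutes) (auto intro!: bij_comp bij_imp_bij_inv dest: permutes_bij)
  have "(\<Sum>p | p permutes UNIV. of_int (sign p) * (\<Prod>i\<in>UNIV. M $ b i $ b (p i)))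
     = (\<Sum>q | q permutes UNIV. of_int (sign q) * (\<Prod>i\<in>UNIV. M $ i $ q i))"
  proof (rule sum.reindex_bij_witness[of _ "\<lambda>q. inv b \<circ> q \<circ> b" "\<lambda>p. b \<circ> p \<circ> inv b"])
    fix p :: "'b \<Rightarrow> 'b" assume p: "p \<in> {p. p permutes UNIV}"
    have "(\<Prod>i\<in>UNIV. M $ i $ (b \<circ> p \<circ> inv b) i) = (\<Prod>i\<in>UNIV. M $ b i $ b (p i))"
      using prod.reindex_bij_betw[OF b, of "\<lambda>i. M $ i $ (b \<circ> p \<circ> inv b) i"] by (simp add: ib)
    then show "of_int (sign (b \<circ> p \<circ> inv b)) * (\<Prod>i\<in>UNIV. M $ i $ (b \<circ> p \<circ> inv b) i)
      = of_int (sign p) * (\<Prod>i\<in>UNIV. M $ b i $ b (p i))"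
      using sign_conjugate[OF b] p by simp
  qed (use cl cl' in \<open>auto simp: fun_eq_iff ib\<close>)
  then show ?thesis by (simp add: det_def)
qed

lemma set_integrable_lebesgueI:
  fixes f :: "'a::euclidean_space \<Rightarrow> real"
  shows "set_integrable lborel S f \<Longrightarrow> set_integrable lebesgue S f"
  unfolding set_integrable_def
proof -
  assume f: "integrable lborel (\<lambda>x. indicator S x *\<^sub>R f x)"
  from integrable_completion[OF borel_measurable_integrable[OF f]] f
  show "integrable lebesgue (\<lambda>x. indicator S x *\<^sub>R f x)" by simp
qed

lemma integral_change_of_variables_wellorder:
  fixes \<phi> :: "real^'m::{finite,wellorder} \<Rightarrow> real^'m::_" and h :: "real^'m::_ \<Rightarrow> real"
  assumes U: "open U" and der: "\<And>x. x \<in> U \<Longrightarrow> (\<phi> has_derivative \<phi>' x) (at x)" and inj: "inj_on \<phi> U"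
    and h: "set_integrable lborel (\<phi> ` U) h" and g: "set_integrable lborel U (\<lambda>x. \<bar>det (matrix (\<phi>' x))\<bar> * h (\<phi> x))"
  shows "(LINT y:\<phi> ` U|lborel. h y) = (LINT x:U|lborel. \<bar>det (matrix (\<phi>' x))\<bar> * h (\<phi> x))"
proof -
  let ?e = "1 :: real^1"
  have h': "(\<lambda>y. h y *\<^sub>R ?e) absolutely_integrable_on \<phi> ` U"
    using set_integrable_lebesgueI[OF h] by (intro set_integrable_scaleR_left)
  have g': "(\<lambda>x. (\<bar>det (matrix (\<phi>' x))\<bar> * h (\<phi> x)) *\<^sub>R ?e) absolutely_integrable_on U"
    using set_integrable_lebesgueI[OF g] by (intro set_integrable_scaleR_left)
  have "integral (\<phi> ` U) (\<lambda>y. h y *\<^sub>R ?e) = integral U (\<lambda>x. \<bar>det (matrix (\<phi>' x))\<bar> *\<^sub>R (h (\<phi> x) *\<^sub>R ?e))"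
    using U h' der inj
    by (intro integral_change_of_variables) (auto intro: has_derivative_at_withinI)
  then have "integral (\<phi> ` U) (\<lambda>y. h y *\<^sub>R ?e) $ 1 = integral U (\<lambda>x. (\<bar>det (matrix (\<phi>' x))\<bar> * h (\<phi> x)) *\<^sub>R ?e) $ 1"
    by simp
  then have "integral (\<phi> ` U) h = integral U (\<lambda>x. \<bar>det (matrix (\<phi>' x))\<bar> * h (\<phi> x))"
    using integral_component_eq_cart[of "\<lambda>y. h y *\<^sub>R ?e" "\<phi> ` U" 1]
      integral_component_eq_cart[of "\<lambda>x. (\<bar>det (matrix (\<phi>' x))\<bar> * h (\<phi> x)) *\<^sub>R ?e" U 1]
      set_lebesgue_integral_eq_integral(1)[OF h'] set_lebesgue_integral_eq_integral(1)[OF g'] by simp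
  then show ?thesis
    using set_borel_integral_eq_integral(2)[OF h] set_borel_integral_eq_integral(2)[OF g] by simp
qed

lemma integral_transformation:
  fixes \<phi> :: "real^'n::finite \<Rightarrow> real^'n" and h :: "real^'n \<Rightarrow> real"
  assumes U: "open U" and der: "\<And>x. x \<in> U \<Longrightarrow> (\<phi> has_derivative \<phi>' x) (at x)" and inj: "inj_on \<phi> U"
    and h: "set_integrable lborel (\<phi> ` U) h" and g: "set_integrable lborel U (\<lambda>x. \<bar>det (matrix (\<phi>' x))\<bar> * h (\<phi> x))"
  shows "(LINT y:\<phi> ` U|lborel. h y) = (LINT x:U|lborel. \<bar>det (matrix (\<phi>' x))\<bar> * h (\<phi> x))"
proof -
  let ?b = "Rep_ordered :: 'n ordered \<Rightarrow> 'n" and ?b' = "Abs_ordered :: 'n \<Rightarrow> 'n ordered"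
  define R where "R = (\<lambda>x :: real^'n. (\<chi> i. x $ ?b i))"
  define S where "S = (\<lambda>y :: real^'n ordered. (\<chi> i. y $ ?b' i))"
  have bb: "?b (?b' i) = i" "?b' (?b j) = j" for i j by (simp_all add: Abs_ordered_inverse Rep_ordered_inverse)
  have b': "bij ?b'" by (metis bb bijI' )
  have RS: "R (S y) = y" "S (R x) = x" for x y by (simp_all add: R_def S_def bb vec_eq_iff)
  have distr: "distr lborel borel S = lborel" unfolding S_def by (rule lborel_relabel[OF b'])
  have contS: "continuous_on UNIV S" "continuous_on UNIV R" unfolding R_def S_def by (intro continuous_intros)+
  have measS: "S \<in> borel_measurable lborel"
    using borel_measurable_continuous_onI[OF contS(1)] by simp
  have pull: "set_integrable lborel (R ` V) (\<lambda>y. f (S y))"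
    "(LINT y:R ` V|lborel. f (S y)) = (LINT x:V|lborel. f x)"
    if f: "set_integrable lborel V f" for V and f :: "real^'n \<Rightarrow> real"
  proof -
    have ind: "indicator (R ` V) y = (indicator V (S y) :: real)" for y
      using RS by (auto simp: indicator_def image_iff) (metis RS)
    have m: "(\<lambda>x. indicator V x *\<^sub>R f x) \<in> borel_measurable borel"
      using f borel_measurable_integrable unfolding set_integrable_def by fastforce
    show "(LINT y:R ` V|lborel. f (S y)) = (LINT x:V|lborel. f x)"
      unfolding set_lebesgue_integral_def ind
      using integral_distr[OF measS m] distr by simp
    show "set_integrable lborel (R ` V) (\<lambda>y. f (S y))"
      unfolding set_integrable_def ind
      using integrable_distr_eq[OF measS m] distr f[unfolded set_integrable_def] by simp
  qed
  define \<psi> where "\<psi> = R \<circ> \<phi> \<circ> S"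
  define \<psi>' where "\<psi>' = (\<lambda>y. R \<circ> \<phi>' (S y) \<circ> S)"
  have lin: "bounded_linear R" "bounded_linear S"
    unfolding R_def S_def
    by (auto intro!: linear_conv_bounded_linear[THEN iffD1] linearI simp: vec_eq_iff)
  have d: "(\<psi> has_derivative \<psi>' y) (at y)" if "y \<in> R ` U" for y
  proof -
    have "S y \<in> U" using that RS by auto
    from der[OF this] have "(\<phi> has_derivative \<phi>' (S y)) (at (S y))" .
    then have "(\<phi> \<circ> S has_derivative \<phi>' (S y) \<circ> S) (at y)"
      using diff_chain_at[OF bounded_linear_imp_has_derivative[OF lin(2)]] by blast
    from diff_chain_at[OF this bounded_linear_imp_has_derivative[OF lin(1)]]
    show ?thesis by (simp add: \<psi>_def \<psi>'_def o_assoc)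
  qed
  have det: "det (matrix (\<psi>' y)) = det (matrix (\<phi>' (S y)))" for y
  proof -
    have Sa: "S (axis j 1) = axis (?b j) 1" for j by (auto simp: S_def axis_def vec_eq_iff bb)
    have "matrix (\<psi>' y) = (\<chi> i j. matrix (\<phi>' (S y)) $ ?b i $ ?b j)"
      unfolding matrix_def \<psi>'_def o_def Sa by (simp add: R_def vec_eq_iff)
    then show ?thesis by (simp add: det_relabel[OF bij_Rep_ordered])
  qed
  have openRU: "open (R ` U)"
  proof -
    have "R ` U = S -` U" using RS by (auto simp: image_iff) (metis RS)
    then show ?thesis using contS(1) U by (metis continuous_on_open_vimage open_UNIV inf_top.right_neutral)
  qed
  have im: "\<psi> ` R ` U = R ` \<phi> ` U" by (simp add: \<psi>_def image_comp RS o_def)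
  have inj': "inj_on \<psi> (R ` U)"
    using inj RS unfolding \<psi>_def inj_on_def by (auto simp: ) (metis RS(2))
  have eq: "\<bar>det (matrix (\<psi>' y))\<bar> * h (S (\<psi> y)) = \<bar>det (matrix (\<phi>' (S y)))\<bar> * h (\<phi> (S y))" for y
    by (simp add: det \<psi>_def RS)
  have "(LINT y:\<psi> ` R ` U|lborel. h (S y)) = (LINT y:R ` U|lborel. \<bar>det (matrix (\<psi>' y))\<bar> * h (S (\<psi> y)))"
  proof (rule integral_change_of_variables_wellorder[OF openRU d inj'])
    show "set_integrable lborel (\<psi> ` R ` U) (\<lambda>y. h (S y))" unfolding im by (rule pull(1)[OF h])
    show "set_integrable lborel (R ` U) (\<lambda>y. \<bar>det (matrix (\<psi>' y))\<bar> * h (S (\<psi> y)))"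
      unfolding eq using pull(1)[OF g] .
  qed
  then show ?thesis unfolding im eq pull(2)[OF h] pull(2)[OF g] .
qed

lemma integrable_compact_support:
  fixes f :: "real^'n::finite \<Rightarrow> real"
  assumes "continuous_on UNIV f" "compact K" "\<And>x. x \<notin> K \<Longrightarrow> f x = 0"
  shows "integrable lborel f"
proof -
  have "integrable lborel (\<lambda>x. indicator K x *\<^sub>R f x)"
    using assms by (intro borel_integrable_compact) (auto intro: continuous_on_subset)
  moreover have "(\<lambda>x. indicator K x *\<^sub>R f x) = f"
    using assms(3) by (auto simp: fun_eq_iff indicator_def)
  ultimately show ?thesis by simp
qed

text \<open>A partial derivative of a compactly supported function integrates to \<open>0\<close>: the integral of each
  difference quotient vanishes by translation invariance, and dominated convergence applies.\<close>

lemma integral_pd_compact_support: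
  fixes f :: "real^'n::finite \<Rightarrow> real"
  assumes diff: "\<And>x. f differentiable (at x)" and cont: "continuous_on UNIV (pd i f)"
    and K: "compact K" and zero: "\<And>x. x \<notin> K \<Longrightarrow> f x = 0"
  shows "(\<integral>x. pd i f x \<partial>lborel) = 0"
proof -
  let ?e = "axis i 1 :: real^'n"
  have contf: "continuous_on UNIV f"
    by (meson continuous_at_imp_continuous_on diff differentiable_imp_continuous_within)
  obtain r where r: "\<And>x. x \<in> K \<Longrightarrow> norm x \<le> r" using K compact_imp_bounded bounded_iff by metis
  let ?B = "cball (0 :: real^'n) (r + 1)"
  have "compact (pd i f ` ?B)" using cont by (intro compact_continuous_image) (auto intro: continuous_on_subset)
  then obtain M where M: "\<And>x. x \<in> ?B \<Longrightarrow> \<bar>pd i f x\<bar> \<le> M"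
    using compact_imp_bounded bounded_iff by (metis image_eqI real_norm_def)
  have zero': "pd i f x = 0" if "x \<notin> K" for x
  proof -
    have "open (- K)" using K by (simp add: compact_imp_closed open_Compl)
    then have "pd i f x = pd i (\<lambda>x. 0) x" using that zero by (intro pd_cong[of "- K"]) auto
    then show ?thesis by simp
  qed
  have pdM: "\<bar>pd i f x\<bar> \<le> \<bar>M\<bar>" for x
  proof (cases "x \<in> K")
    case True
    then have "x \<in> ?B" using r[OF True] by simp
    then show ?thesis using M[of x] by linarith
  qed (simp add: zero')
  define s where "s = (\<lambda>k::nat. 1 / (real k + 1))"
  have s: "0 < s k" "s k \<le> 1" for k by (auto simp: s_def)
  define q where "q = (\<lambda>k x. (f (x + s k *\<^sub>R ?e) - f x) / s k)"
  have D: "((\<lambda>t. f (x + t *\<^sub>R ?e)) has_real_derivative pd i f (x + t *\<^sub>R ?e)) (at t)" for x t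
    by (rule DERIV_along_axis[OF diff])
  have intf: "integrable lborel f" by (rule integrable_compact_support[OF contf K zero])
  have shift: "integrable lborel (\<lambda>x. f (x + v))" "(\<integral>x. f (x + v) \<partial>lborel) = (\<integral>x. f x \<partial>lborel)" for v
  proof -
    have m: "(+) v \<in> borel_measurable lborel" "f \<in> borel_measurable borel"
      using borel_measurable_continuous_onI[OF contf] by auto
    show "(\<integral>x. f (x + v) \<partial>lborel) = (\<integral>x. f x \<partial>lborel)"
      using integral_distr[OF m] lborel_distr_plus[of v] by (simp add: add.commute)
    show "integrable lborel (\<lambda>x. f (x + v))"
      using integrable_distr_eq[OF m] lborel_distr_plus[of v] intf by (simp add: add.commute)
  qed
  have int0: "(\<integral>x. q k x \<partial>lborel) = 0" for k
    unfolding q_def using shift intf by simp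
  have "(\<lambda>k. \<integral>x. q k x \<partial>lborel) \<longlonglongrightarrow> (\<integral>x. pd i f x \<partial>lborel)"
  proof (rule integral_dominated_convergence[where w = "\<lambda>x. indicator ?B x *\<^sub>R \<bar>M\<bar>"])
    show "pd i f \<in> borel_measurable lborel" using borel_measurable_continuous_onI[OF cont] by simp
    show "q k \<in> borel_measurable lborel" for k
      unfolding q_def using shift(1)[of "s k *\<^sub>R ?e"] intf by auto
    show "integrable lborel (\<lambda>x. indicator ?B x *\<^sub>R \<bar>M\<bar>)"
      by (intro borel_integrable_compact) auto
    show "AE x in lborel. (\<lambda>k. q k x) \<longlonglongrightarrow> pd i f x"
    proof (rule AE_I2)
      fix x
      have "((\<lambda>h. (f (x + h *\<^sub>R ?e) - f x) / h) \<longlongrightarrow> pd i f x) (at 0)"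
        using D[of x 0] by (simp add: has_field_derivative_iff)
      moreover have "filterlim s (at 0) sequentially"
      proof (rule filterlim_atI)
        have "(\<lambda>k. inverse (real (Suc k))) \<longlonglongrightarrow> 0" by (rule LIMSEQ_inverse_real_of_nat)
        then show "s \<longlonglongrightarrow> 0" by (simp add: s_def divide_inverse add.commute)
        show "\<forall>\<^sub>F k in sequentially. s k \<noteq> 0" using s(1) by (simp add: less_imp_neq[symmetric])
      qed
      ultimately show "(\<lambda>k. q k x) \<longlonglongrightarrow> pd i f x"
        unfolding q_def by (rule filterlim_compose)
    qed
    show "AE x in lborel. norm (q k x) \<le> indicator ?B x *\<^sub>R \<bar>M\<bar>" for k
    proof (rule AE_I2)
      fix x
      show "norm (q k x) \<le> indicator ?B x *\<^sub>R \<bar>M\<bar>"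
      proof (cases "x \<in> ?B")
        case True
        have "\<exists>z. 0 < z \<and> z < s k \<and> f (x + s k *\<^sub>R ?e) - f (x + 0 *\<^sub>R ?e) = (s k - 0) * pd i f (x + z *\<^sub>R ?e)"
          by (rule MVT2) (use s D in auto)
        then obtain z where "f (x + s k *\<^sub>R ?e) - f x = s k * pd i f (x + z *\<^sub>R ?e)" by auto
        then have "q k x = pd i f (x + z *\<^sub>R ?e)" using s(1)[of k] by (simp add: q_def)
        then show ?thesis using True pdM[of "x + z *\<^sub>R ?e"] by simp
      next
        case False
        have n: "norm x > r + 1" using False by simp
        then have "x \<notin> K" using r[of x] by auto
        moreover have "x + s k *\<^sub>R ?e \<notin> K"
        proof
          assume "x + s k *\<^sub>R ?e \<in> K"
          then have "norm (x + s k *\<^sub>R ?e) \<le> r" by (rule r)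
          moreover have "norm x \<le> norm (x + s k *\<^sub>R ?e) + norm (s k *\<^sub>R ?e)"
            using norm_triangle_ineq4[of "x + s k *\<^sub>R ?e" "s k *\<^sub>R ?e"] by simp
          moreover have "norm (s k *\<^sub>R ?e) \<le> 1" using s[of k] by (simp add: norm_axis_1)
          ultimately show False using n by linarith
        qed
        ultimately show ?thesis using zero False by (simp add: q_def)
      qed
    qed
  qed
  then show ?thesis unfolding int0 by (simp add: LIMSEQ_const_iff)
qed

section \<open>The Liouville density as a Pfaffian\<close>

text \<open>Up to normalisation, the coefficient of \<open>\<Omega>\<^sub>n\<close>.\<close>

definition pf :: "('n::finite \<Rightarrow> 'n \<Rightarrow> real) \<Rightarrow> real" where
  "pf B = (\<Sum>\<sigma> | \<sigma> permutes UNIV. of_int (sign \<sigma>) *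
     (\<Prod>k<CARD('n) div 2. B (\<sigma> (index_enum (2 * k))) (\<sigma> (index_enum (2 * k + 1)))))"

lemma bij_index_enum: "bij_betw (index_enum :: nat \<Rightarrow> 'n::finite) {..<CARD('n)} UNIV"
  unfolding index_enum_def
  using someI_ex[OF ex_bij_betw_nat_finite[of "UNIV :: 'n set"]] by (simp add: lessThan_atLeast0)

lemma permutes_UNIV_iff: "\<sigma> permutes (UNIV :: 'n::finite set) \<longleftrightarrow> inj \<sigma>"
proof
  show "inj \<sigma>" if "\<sigma> permutes UNIV" using permutes_inj[OF that] .
  show "\<sigma> permutes UNIV" if inj: "inj \<sigma>"
  proof (rule bij_imp_permutes)
    show "bij_betw \<sigma> UNIV UNIV" using inj finite_UNIV_inj_surj[OF finite inj] by (simp add: bij_def)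
  qed simp
qed

lemma permutes_comp_transpose: "\<sigma> permutes (UNIV :: 'n::finite set) \<Longrightarrow> \<sigma> \<circ> Transposition.transpose i j permutes UNIV"
  by (rule permutes_compose[OF permutes_swap_id]) auto

lemma sign_comp_transpose:
  "\<sigma> permutes (UNIV :: 'n::finite set) \<Longrightarrow> i \<noteq> j \<Longrightarrow> sign (\<sigma> \<circ> Transposition.transpose i j) = - sign \<sigma>"
  by (subst sign_compose) (auto simp: permutation permutes_bij sign_swap_id)

lemma sum_permutations_transpose:
  fixes f :: "('n::finite \<Rightarrow> 'n) \<Rightarrow> real"
  shows "(\<Sum>\<sigma> | \<sigma> permutes UNIV. f (\<sigma> \<circ> Transposition.transpose i j)) = (\<Sum>\<sigma> | \<sigma> permutes UNIV. f \<sigma>)"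
  by (rule sum.reindex_bij_witness[of _ "\<lambda>\<sigma>. \<sigma> \<circ> Transposition.transpose i j" "\<lambda>\<sigma>. \<sigma> \<circ> Transposition.transpose i j"])
    (auto simp: comp_assoc permutes_comp_transpose)

text \<open>The indices are arranged in pairs \<open>(x k, y k)\<close>, as those of Darboux coordinates.\<close>

locale even_type =
  fixes N :: nat and ty :: "'n::finite itself"
  assumes card_type: "CARD('n) = 2 * N"
begin

definition x :: "nat \<Rightarrow> 'n" where "x k = index_enum (2 * k)"
definition y :: "nat \<Rightarrow> 'n" where "y k = index_enum (2 * k + 1)"
definition ix :: "'n \<Rightarrow> nat" where "ix = inv_into {..<CARD('n)} index_enum"

lemma ix_xy: "k < N \<Longrightarrow> ix (x k) = 2 * k" "k < N \<Longrightarrow> ix (y k) = 2 * k + 1"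
  unfolding ix_def x_def y_def using bij_betw_imp_inj_on[OF bij_index_enum[where 'n = 'n]]
  by (auto simp: card_type inv_into_f_f)

lemma xy_eq: "k < N \<Longrightarrow> l < N \<Longrightarrow> x k = x l \<longleftrightarrow> k = l" "k < N \<Longrightarrow> l < N \<Longrightarrow> y k = y l \<longleftrightarrow> k = l"
  "k < N \<Longrightarrow> l < N \<Longrightarrow> x k \<noteq> y l" "k < N \<Longrightarrow> l < N \<Longrightarrow> y k \<noteq> x l"
proof -
  assume kl: "k < N" "l < N"
  have "k = l" if "x k = x l"
    using arg_cong[OF that, of ix] ix_xy(1)[OF kl(1)] ix_xy(1)[OF kl(2)] by linarith
  then show "x k = x l \<longleftrightarrow> k = l" by blast
  have "k = l" if "y k = y l"
    using arg_cong[OF that, of ix] ix_xy(2)[OF kl(1)] ix_xy(2)[OF kl(2)] by linarith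
  then show "y k = y l \<longleftrightarrow> k = l" by blast
  show "x k \<noteq> y l"
  proof
    assume "x k = y l"
    from arg_cong[OF this, of ix] have "2 * k = 2 * l + 1"
      using ix_xy(1)[OF kl(1)] ix_xy(2)[OF kl(2)] by linarith
    then show False by presburger
  qed
  show "y k \<noteq> x l"
  proof
    assume "y k = x l"
    from arg_cong[OF this, of ix] have "2 * k + 1 = 2 * l"
      using ix_xy(2)[OF kl(1)] ix_xy(1)[OF kl(2)] by linarith
    then show False by presburger
  qed
qed

lemma xy_cases: obtains k where "k < N" "i = x k" | k where "k < N" "i = y k"
proof -
  from bij_index_enum[where 'n = 'n] have "i \<in> index_enum ` {..<CARD('n)}" by (simp add: bij_betw_def)
  then obtain m where m: "m < 2 * N" "i = index_enum m" using card_type by auto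
  show thesis
  proof (cases "even m")
    case True
    then obtain k where "m = 2 * k" by blast
    then show thesis using m that(1)[of k] by (simp add: x_def)
  next
    case False
    then obtain k where "m = 2 * k + 1" by (metis oddE)
    then show thesis using m that(2)[of k] by (simp add: y_def)
  qed
qed

lemma prod_pairs: "(\<Prod>i\<in>UNIV. (F i :: real)) = (\<Prod>k<N. F (x k) * F (y k))"
proof -
  have "(\<Prod>i\<in>UNIV. F i) = (\<Prod>m<2 * N. F (index_enum m))"
    using prod.reindex_bij_betw[OF bij_index_enum, of F] by (simp add: card_type)
  also have "\<dots> = (\<Prod>k<N. F (x k) * F (y k))"
    unfolding x_def y_def by (induction N) (auto simp: ac_simps)
  finally show ?thesis .
qed

lemma sum_pairs: "(\<Sum>i\<in>UNIV. (F i :: real)) = (\<Sum>k<N. F (x k) + F (y k))"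
proof -
  have "(\<Sum>i\<in>UNIV. F i) = (\<Sum>m<2 * N. F (index_enum m))"
    using sum.reindex_bij_betw[OF bij_index_enum, of F] by (simp add: card_type)
  also have "\<dots> = (\<Sum>k<N. F (x k) + F (y k))"
    unfolding x_def y_def by (induction N) (auto simp: ac_simps)
  finally show ?thesis .
qed

definition pfprod :: "('n \<Rightarrow> 'n \<Rightarrow> real) \<Rightarrow> ('n \<Rightarrow> 'n) \<Rightarrow> real" where
  "pfprod B f = (\<Prod>k<N. B (f (x k)) (f (y k)))"

lemma pf_eq:
  fixes B :: "'n \<Rightarrow> 'n \<Rightarrow> real"
  shows "pf B = (\<Sum>\<sigma> | \<sigma> permutes UNIV. of_int (sign \<sigma>) * pfprod B \<sigma>)"
  unfolding pf_def pfprod_def x_def y_def by (simp add: card_type)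

lemma pfprod_transform:
  "pfprod (\<lambda>i j. \<Sum>a\<in>UNIV. \<Sum>b\<in>UNIV. J a i * J b j * B a b) \<sigma> = (\<Sum>f\<in>UNIV. (\<Prod>i\<in>UNIV. J (f i) (\<sigma> i)) * pfprod B f)"
proof -
  let ?t = "\<lambda>k (a, b). J a (\<sigma> (x k)) * J b (\<sigma> (y k)) * B a b"
  have "pfprod (\<lambda>i j. \<Sum>a\<in>UNIV. \<Sum>b\<in>UNIV. J a i * J b j * B a b) \<sigma> = (\<Prod>k<N. \<Sum>ab\<in>UNIV. ?t k ab)"
    unfolding pfprod_def UNIV_Times_UNIV[symmetric] by (simp add: sum.cartesian_product)
  also have "\<dots> = (\<Sum>g\<in>PiE {..<N} (\<lambda>_. UNIV). \<Prod>k<N. ?t k (g k))"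
    by (rule prod_sum_PiE) auto
  also have "\<dots> = (\<Sum>f\<in>UNIV. \<Prod>k<N. ?t k (f (x k), f (y k)))"
  proof (rule sum.reindex_bij_witness[of _ "\<lambda>f k. if k < N then (f (x k), f (y k)) else undefined"
        "\<lambda>g i. if even (ix i) then fst (g (ix i div 2)) else snd (g (ix i div 2))"])
    fix g :: "nat \<Rightarrow> 'n \<times> 'n" assume g: "g \<in> PiE {..<N} (\<lambda>_. UNIV)"
    let ?f = "\<lambda>i. if even (ix i) then fst (g (ix i div 2)) else snd (g (ix i div 2))"
    show "(\<lambda>k. if k < N then (?f (x k), ?f (y k)) else undefined) = g"
      using g by (auto simp: fun_eq_iff ix_xy PiE_def extensional_def)
    show "(\<Prod>k<N. ?t k (?f (x k), ?f (y k))) = (\<Prod>k<N. ?t k (g k))"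
      by (intro prod.cong refl) (auto simp: ix_xy case_prod_beta)
  next
    fix f :: "'n \<Rightarrow> 'n"
    show "(\<lambda>i. if even (ix i) then fst (if ix i div 2 < N then (f (x (ix i div 2)), f (y (ix i div 2))) else undefined)
           else snd (if ix i div 2 < N then (f (x (ix i div 2)), f (y (ix i div 2))) else undefined)) = f"
    proof
      fix i show "(if even (ix i) then fst (if ix i div 2 < N then (f (x (ix i div 2)), f (y (ix i div 2))) else undefined)
           else snd (if ix i div 2 < N then (f (x (ix i div 2)), f (y (ix i div 2))) else undefined)) = f i"
        by (cases i rule: xy_cases) (auto simp: ix_xy)
    qed
  qed (auto simp: PiE_def extensional_def)
  also have "\<dots> = (\<Sum>f\<in>UNIV. (\<Prod>i\<in>UNIV. J (f i) (\<sigma> i)) * pfprod B f)"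
    unfolding prod_pairs pfprod_def by (simp add: prod.distrib)
  finally show ?thesis .
qed

text \<open>The product expands into a sum over all maps \<open>f\<close> of the index type, in which the sum over \<open>\<sigma>\<close> is the
  determinant of the matrix with rows \<open>f i\<close>. It vanishes unless \<open>f\<close> is a permutation.\<close>

lemma pf_transform:
  fixes J B :: "'n \<Rightarrow> 'n \<Rightarrow> real"
  shows "pf (\<lambda>i j. \<Sum>a\<in>UNIV. \<Sum>b\<in>UNIV. J a i * J b j * B a b) = det (\<chi> i j. J i j) * pf B"
proof -
  let ?A = "\<chi> i j. J i j"
  have "pf (\<lambda>i j. \<Sum>a\<in>UNIV. \<Sum>b\<in>UNIV. J a i * J b j * B a b)
      = (\<Sum>\<sigma> | \<sigma> permutes UNIV. \<Sum>f\<in>UNIV. of_int (sign \<sigma>) * (\<Prod>i\<in>UNIV. J (f i) (\<sigma> i)) * pfprod B f)"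
    unfolding pf_eq pfprod_transform sum_distrib_left by (simp add: mult.assoc)
  also have "\<dots> = (\<Sum>f\<in>UNIV. (\<Sum>\<sigma> | \<sigma> permutes UNIV. of_int (sign \<sigma>) * (\<Prod>i\<in>UNIV. J (f i) (\<sigma> i))) * pfprod B f)"
    by (subst sum.swap) (simp add: sum_distrib_right)
  also have "\<dots> = (\<Sum>f\<in>UNIV. det (\<chi> i. ?A $ f i) * pfprod B f)"
    by (simp add: det_def)
  also have "\<dots> = (\<Sum>f | f permutes UNIV. det (\<chi> i. ?A $ f i) * pfprod B f)"
  proof (rule sum.mono_neutral_right)
    show "\<forall>f\<in>UNIV - {f. f permutes UNIV}. det (\<chi> i. ?A $ f i) * pfprod B f = 0"
    proof
      fix f :: "'n \<Rightarrow> 'n" assume "f \<in> UNIV - {f. f permutes UNIV}"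
      then obtain i j where "i \<noteq> j" "f i = f j" unfolding permutes_UNIV_iff by (auto simp: inj_def)
      then have "det (\<chi> i. ?A $ f i) = 0"
        by (intro det_identical_rows[of i j]) (auto simp: row_def)
      then show "det (\<chi> i. ?A $ f i) * pfprod B f = 0" by simp
    qed
  qed auto
  also have "\<dots> = (\<Sum>f | f permutes UNIV. det ?A * (of_int (sign f) * pfprod B f))"
  proof (intro sum.cong refl)
    fix f assume "f \<in> {f. f permutes (UNIV :: 'n set)}"
    then have "det (\<chi> i. ?A $ f i) = of_int (sign f) * det ?A" by (intro det_permute_rows) simp
    then show "det (\<chi> i. ?A $ f i) * pfprod B f = det ?A * (of_int (sign f) * pfprod B f)"
      by (simp only: mult_ac)
  qed
  finally show ?thesis by (simp add: pf_eq sum_distrib_left)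
qed

text \<open>The infinitesimal form of the transformation law. Replacing the value at \<open>i\<close> of a permutation by
  its value at \<open>j \<noteq> i\<close> gives a function that arises from two permutations of opposite sign.\<close>

lemma pf_derivation:
  fixes B :: "'n \<Rightarrow> 'n \<Rightarrow> real"
  assumes dB: "\<And>i j. dB i j = (\<Sum>l\<in>UNIV. G i l * B l j) + (\<Sum>l\<in>UNIV. G j l * B i l)"
  shows "(\<Sum>\<sigma> | \<sigma> permutes UNIV. of_int (sign \<sigma>) *
      (\<Sum>k<N. dB (\<sigma> (x k)) (\<sigma> (y k)) * (\<Prod>l\<in>{..<N} - {k}. B (\<sigma> (x l)) (\<sigma> (y l)))))
    = (\<Sum>i\<in>UNIV. G i i) * pf B"
proof -
  \<comment> \<open>The terms in which the entry of \<open>G\<close> replaces the value at \<open>i\<close> by the value at \<open>j\<close>; the diagonal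
    terms give the trace of \<open>G\<close>, the others cancel in pairs.\<close>
  define T where "T = (\<lambda>i j. \<Sum>\<sigma> | \<sigma> permutes UNIV. of_int (sign \<sigma>) * (G (\<sigma> i) (\<sigma> j) * pfprod B (\<sigma>(i := \<sigma> j))))"
  have upd: "pfprod B (\<sigma>(x k := l)) = B l (\<sigma> (y k)) * (\<Prod>m\<in>{..<N} - {k}. B (\<sigma> (x m)) (\<sigma> (y m)))"
    "pfprod B (\<sigma>(y k := l)) = B (\<sigma> (x k)) l * (\<Prod>m\<in>{..<N} - {k}. B (\<sigma> (x m)) (\<sigma> (y m)))" if k: "k < N" for k l \<sigma>
  proof -
    have "pfprod B f = B (f (x k)) (f (y k)) * (\<Prod>m\<in>{..<N} - {k}. B (f (x m)) (f (y m)))" for f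
      unfolding pfprod_def using k by (subst prod.remove[of _ k]) auto
    moreover have "(\<Prod>m\<in>{..<N} - {k}. B ((\<sigma>(x k := l)) (x m)) ((\<sigma>(x k := l)) (y m))) = (\<Prod>m\<in>{..<N} - {k}. B (\<sigma> (x m)) (\<sigma> (y m)))"
      using k xy_eq by (intro prod.cong) auto
    moreover have "(\<Prod>m\<in>{..<N} - {k}. B ((\<sigma>(y k := l)) (x m)) ((\<sigma>(y k := l)) (y m))) = (\<Prod>m\<in>{..<N} - {k}. B (\<sigma> (x m)) (\<sigma> (y m)))"
      using k xy_eq by (intro prod.cong) auto
    ultimately show "pfprod B (\<sigma>(x k := l)) = B l (\<sigma> (y k)) * (\<Prod>m\<in>{..<N} - {k}. B (\<sigma> (x m)) (\<sigma> (y m)))"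
      "pfprod B (\<sigma>(y k := l)) = B (\<sigma> (x k)) l * (\<Prod>m\<in>{..<N} - {k}. B (\<sigma> (x m)) (\<sigma> (y m)))"
      using k xy_eq by simp_all
  qed
  have inner: "(\<Sum>k<N. dB (\<sigma> (x k)) (\<sigma> (y k)) * (\<Prod>l\<in>{..<N} - {k}. B (\<sigma> (x l)) (\<sigma> (y l))))
     = (\<Sum>i\<in>UNIV. \<Sum>j\<in>UNIV. G (\<sigma> i) (\<sigma> j) * pfprod B (\<sigma>(i := \<sigma> j)))" if \<sigma>: "\<sigma> permutes UNIV" for \<sigma>
  proof -
    have bij: "bij_betw \<sigma> UNIV UNIV" using permutes_bij[OF \<sigma>] .
    have "(\<Sum>i\<in>UNIV. \<Sum>j\<in>UNIV. G (\<sigma> i) (\<sigma> j) * pfprod B (\<sigma>(i := \<sigma> j)))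
      = (\<Sum>i\<in>UNIV. \<Sum>l\<in>UNIV. G (\<sigma> i) l * pfprod B (\<sigma>(i := l)))"
      by (intro sum.cong refl sum.reindex_bij_betw[OF bij])
    also have "\<dots> = (\<Sum>k<N. dB (\<sigma> (x k)) (\<sigma> (y k)) * (\<Prod>l\<in>{..<N} - {k}. B (\<sigma> (x l)) (\<sigma> (y l))))"
    proof (subst sum_pairs, intro sum.cong refl)
      fix k assume "k \<in> {..<N}"
      then have k: "k < N" by simp
      show "(\<Sum>l\<in>UNIV. G (\<sigma> (x k)) l * pfprod B (\<sigma>(x k := l))) + (\<Sum>l\<in>UNIV. G (\<sigma> (y k)) l * pfprod B (\<sigma>(y k := l)))
        = dB (\<sigma> (x k)) (\<sigma> (y k)) * (\<Prod>l\<in>{..<N} - {k}. B (\<sigma> (x l)) (\<sigma> (y l)))"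
        unfolding upd[OF k] dB by (simp add: distrib_right sum_distrib_right mult.assoc)
    qed
    finally show ?thesis ..
  qed
  have "(\<Sum>\<sigma> | \<sigma> permutes UNIV. of_int (sign \<sigma>) *
      (\<Sum>k<N. dB (\<sigma> (x k)) (\<sigma> (y k)) * (\<Prod>l\<in>{..<N} - {k}. B (\<sigma> (x l)) (\<sigma> (y l)))))
    = (\<Sum>\<sigma> | \<sigma> permutes UNIV. \<Sum>i\<in>UNIV. \<Sum>j\<in>UNIV. of_int (sign \<sigma>) * (G (\<sigma> i) (\<sigma> j) * pfprod B (\<sigma>(i := \<sigma> j))))"
    using inner by (simp add: sum_distrib_left)
  also have "\<dots> = (\<Sum>i\<in>UNIV. \<Sum>\<sigma> | \<sigma> permutes UNIV. \<Sum>j\<in>UNIV. of_int (sign \<sigma>) * (G (\<sigma> i) (\<sigma> j) * pfprod B (\<sigma>(i := \<sigma> j))))"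
    by (rule sum.swap)
  also have "\<dots> = (\<Sum>i\<in>UNIV. \<Sum>j\<in>UNIV. T i j)"
    unfolding T_def by (rule sum.cong[OF refl], rule sum.swap)
  also have "\<dots> = (\<Sum>i\<in>UNIV. T i i) + (\<Sum>i\<in>UNIV. \<Sum>j\<in>UNIV. if i = j then 0 else T i j)"
  proof -
    have "(\<Sum>j\<in>UNIV. T i j) = T i i + (\<Sum>j\<in>UNIV. if i = j then 0 else T i j)" for i
    proof -
      have "(\<Sum>j\<in>UNIV. T i j) = (\<Sum>j\<in>UNIV. (if i = j then T i i else 0) + (if i = j then 0 else T i j))"
        by (intro sum.cong) auto
      then show ?thesis by (simp add: sum.distrib)
    qed
    then show ?thesis by (simp add: sum.distrib)
  qed
  also have "(\<Sum>i\<in>UNIV. \<Sum>j\<in>UNIV. if i = j then 0 else T i j) = 0"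
  proof -
    have anti: "T i j = - T j i" if ij: "i \<noteq> j" for i j
    proof -
      let ?\<tau> = "Transposition.transpose i j"
      have "T i j = (\<Sum>\<sigma> | \<sigma> permutes UNIV. of_int (sign (\<sigma> \<circ> ?\<tau>)) *
          (G ((\<sigma> \<circ> ?\<tau>) i) ((\<sigma> \<circ> ?\<tau>) j) * pfprod B ((\<sigma> \<circ> ?\<tau>)(i := (\<sigma> \<circ> ?\<tau>) j))))"
        unfolding T_def by (rule sum_permutations_transpose[symmetric])
      also have "\<dots> = (\<Sum>\<sigma> | \<sigma> permutes UNIV. - (of_int (sign \<sigma>) * (G (\<sigma> j) (\<sigma> i) * pfprod B (\<sigma>(j := \<sigma> i)))))"
      proof (intro sum.cong refl)
        fix \<sigma> assume "\<sigma> \<in> {\<sigma>. \<sigma> permutes (UNIV :: 'n set)}"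
        then have s: "sign (\<sigma> \<circ> ?\<tau>) = - sign \<sigma>" using ij by (intro sign_comp_transpose) auto
        have "(\<sigma> \<circ> ?\<tau>)(i := (\<sigma> \<circ> ?\<tau>) j) = \<sigma>(j := \<sigma> i)"
          by (auto simp: fun_eq_iff Transposition.transpose_def)
        then show "of_int (sign (\<sigma> \<circ> ?\<tau>)) * (G ((\<sigma> \<circ> ?\<tau>) i) ((\<sigma> \<circ> ?\<tau>) j) * pfprod B ((\<sigma> \<circ> ?\<tau>)(i := (\<sigma> \<circ> ?\<tau>) j)))
           = - (of_int (sign \<sigma>) * (G (\<sigma> j) (\<sigma> i) * pfprod B (\<sigma>(j := \<sigma> i))))"
          unfolding s by simp
      qed
      finally show ?thesis by (simp add: T_def sum_negf)
    qed
    let ?S = "\<Sum>i\<in>UNIV. \<Sum>j\<in>UNIV. if i = j then 0 else T i j"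
    have "?S = (\<Sum>j\<in>UNIV. \<Sum>i\<in>UNIV. if i = j then 0 else T i j)" by (rule sum.swap)
    also have "\<dots> = (\<Sum>j\<in>UNIV. \<Sum>i\<in>UNIV. - (if j = i then 0 else T j i))"
    proof (intro sum.cong refl)
      fix i j show "(if i = j then 0 else T i j) = - (if j = i then 0 else T j i)"
        using anti[of i j] by (cases "i = j") simp_all
    qed
    also have "\<dots> = - ?S" by (simp add: sum_negf)
    finally show ?thesis by simp
  qed
  also have "(\<Sum>i\<in>UNIV. T i i) = (\<Sum>i\<in>UNIV. G i i) * pf B"
  proof -
    have "(\<Sum>i\<in>UNIV. T i i) = (\<Sum>\<sigma> | \<sigma> permutes UNIV. \<Sum>i\<in>UNIV. of_int (sign \<sigma>) * (G (\<sigma> i) (\<sigma> i) * pfprod B \<sigma>))"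
      unfolding T_def fun_upd_triv by (rule sum.swap)
    also have "\<dots> = (\<Sum>\<sigma> | \<sigma> permutes UNIV. (\<Sum>i\<in>UNIV. G i i) * (of_int (sign \<sigma>) * pfprod B \<sigma>))"
    proof (intro sum.cong refl)
      fix \<sigma> assume "\<sigma> \<in> {\<sigma>. \<sigma> permutes (UNIV :: 'n set)}"
      then have "bij_betw \<sigma> UNIV UNIV" using permutes_bij by auto
      then have "(\<Sum>i\<in>UNIV. G (\<sigma> i) (\<sigma> i)) = (\<Sum>i\<in>UNIV. G i i)" by (rule sum.reindex_bij_betw)
      then show "(\<Sum>i\<in>UNIV. of_int (sign \<sigma>) * (G (\<sigma> i) (\<sigma> i) * pfprod B \<sigma>))
        = (\<Sum>i\<in>UNIV. G i i) * (of_int (sign \<sigma>) * pfprod B \<sigma>)"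
        by (simp add: sum_distrib_left[symmetric] sum_distrib_right[symmetric] ac_simps)
    qed
    finally show ?thesis by (simp add: pf_eq sum_distrib_left)
  qed
  finally show ?thesis by simp
qed

subsection \<open>Nondegenerate forms have nonzero Pfaffian\<close>

text \<open>Interchanging the members of one pair is an odd permutation, so the two terms of each of the \<open>N\<close>
  factors contribute equally.\<close>

lemma pf_skew_part:
  fixes f :: "'n \<Rightarrow> 'n \<Rightarrow> real"
  shows "pf (\<lambda>i j. f i j - f j i) = 2 ^ N * pf f"
proof -
  define S where "S = (\<lambda>m. \<Sum>\<sigma> | \<sigma> permutes UNIV. of_int (sign \<sigma>) * (\<Prod>k<N. if k < m then f (\<sigma> (x k)) (\<sigma> (y k))
     else f (\<sigma> (x k)) (\<sigma> (y k)) - f (\<sigma> (y k)) (\<sigma> (x k))))"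
  have step: "S m = 2 * S (Suc m)" if m: "m < N" for m
  proof -
    let ?\<tau> = "Transposition.transpose (x m) (y m)"
    define r where "r = (\<lambda>\<sigma>. \<Prod>k\<in>{..<N} - {m}. if k < m then f (\<sigma> (x k)) (\<sigma> (y k))
     else f (\<sigma> (x k)) (\<sigma> (y k)) - f (\<sigma> (y k)) (\<sigma> (x k)))"
    let ?a = "\<Sum>\<sigma> | \<sigma> permutes UNIV. of_int (sign \<sigma>) * (f (\<sigma> (x m)) (\<sigma> (y m)) * r \<sigma>)"
    let ?b = "\<Sum>\<sigma> | \<sigma> permutes UNIV. of_int (sign \<sigma>) * (f (\<sigma> (y m)) (\<sigma> (x m)) * r \<sigma>)"
    have r\<tau>: "r (\<sigma> \<circ> ?\<tau>) = r \<sigma>" for \<sigma>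
      unfolding r_def using m xy_eq by (intro prod.cong refl) (auto simp: Transposition.transpose_def)
    have "?b = (\<Sum>\<sigma> | \<sigma> permutes UNIV. of_int (sign (\<sigma> \<circ> ?\<tau>)) * (f ((\<sigma> \<circ> ?\<tau>) (y m)) ((\<sigma> \<circ> ?\<tau>) (x m)) * r (\<sigma> \<circ> ?\<tau>)))"
      by (rule sum_permutations_transpose[symmetric])
    also have "\<dots> = (\<Sum>\<sigma> | \<sigma> permutes UNIV. - (of_int (sign \<sigma>) * (f (\<sigma> (x m)) (\<sigma> (y m)) * r \<sigma>)))"
    proof (intro sum.cong refl)
      fix \<sigma> assume "\<sigma> \<in> {\<sigma>. \<sigma> permutes (UNIV :: 'n set)}"
      then have s: "sign (\<sigma> \<circ> ?\<tau>) = - sign \<sigma>" using m xy_eq by (intro sign_comp_transpose) auto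
      show "of_int (sign (\<sigma> \<circ> ?\<tau>)) * (f ((\<sigma> \<circ> ?\<tau>) (y m)) ((\<sigma> \<circ> ?\<tau>) (x m)) * r (\<sigma> \<circ> ?\<tau>))
        = - (of_int (sign \<sigma>) * (f (\<sigma> (x m)) (\<sigma> (y m)) * r \<sigma>))"
        unfolding s r\<tau> by simp
    qed
    finally have ba: "?b = - ?a" by (simp add: sum_negf)
    have "S m = ?a - ?b"
      unfolding S_def sum_subtractf[symmetric]
    proof (intro sum.cong refl)
      fix \<sigma>
      show "of_int (sign \<sigma>) * (\<Prod>k<N. if k < m then f (\<sigma> (x k)) (\<sigma> (y k))
         else f (\<sigma> (x k)) (\<sigma> (y k)) - f (\<sigma> (y k)) (\<sigma> (x k)))
        = of_int (sign \<sigma>) * (f (\<sigma> (x m)) (\<sigma> (y m)) * r \<sigma>) - of_int (sign \<sigma>) * (f (\<sigma> (y m)) (\<sigma> (x m)) * r \<sigma>)"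
        unfolding r_def using m by (subst prod.remove[of _ m]) (auto simp: algebra_simps)
    qed
    moreover have "S (Suc m) = ?a"
      unfolding S_def
    proof (intro sum.cong refl)
      fix \<sigma>
      have "(\<Prod>k\<in>{..<N} - {m}. if k < Suc m then f (\<sigma> (x k)) (\<sigma> (y k))
         else f (\<sigma> (x k)) (\<sigma> (y k)) - f (\<sigma> (y k)) (\<sigma> (x k))) = r \<sigma>"
        unfolding r_def by (intro prod.cong refl) auto
      then show "of_int (sign \<sigma>) * (\<Prod>k<N. if k < Suc m then f (\<sigma> (x k)) (\<sigma> (y k))
         else f (\<sigma> (x k)) (\<sigma> (y k)) - f (\<sigma> (y k)) (\<sigma> (x k)))
        = of_int (sign \<sigma>) * (f (\<sigma> (x m)) (\<sigma> (y m)) * r \<sigma>)"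
        using m by (subst prod.remove[of _ m]) auto
    qed
    ultimately show ?thesis using ba by simp
  qed
  have "m \<le> N \<Longrightarrow> S 0 = 2 ^ m * S m" for m
  proof (induction m)
    case (Suc m)
    then show ?case using step[of m] by simp
  qed simp
  from this[of N] show ?thesis by (simp add: S_def pf_eq pfprod_def)
qed

text \<open>The involution that interchanges the members of each pair.\<close>

definition mate :: "'n \<Rightarrow> 'n" where
  "mate i = (if even (ix i) then y (ix i div 2) else x (ix i div 2))"

lemma mate_xy: "k < N \<Longrightarrow> mate (x k) = y k" "k < N \<Longrightarrow> mate (y k) = x k"
  by (simp_all add: mate_def ix_xy)

lemma mate_mate: "mate (mate i) = i"
  by (cases i rule: xy_cases) (simp_all add: mate_xy)

text \<open>Such a permutation is the product of its restriction to the first members and of a conjugate of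
  that restriction by \<open>mate\<close>.\<close>

lemma sign_pair_permutation:
  assumes \<sigma>: "\<sigma> permutes UNIV" and pairs: "\<And>k. k < N \<Longrightarrow> \<exists>l<N. \<sigma> (x k) = x l \<and> \<sigma> (y k) = y l"
  shows "sign \<sigma> = 1"
proof -
  define P where "P = x ` {..<N}"
  define a where "a = (\<lambda>i. if i \<in> P then \<sigma> i else i)"
  have xP: "x k \<in> P" and yP: "y k \<notin> P" if "k < N" for k
    using that xy_eq by (auto simp: P_def)
  have ax: "a (x k) = \<sigma> (x k)" and ay: "a (y k) = y k" if "k < N" for k
    using xP[OF that] yP[OF that] by (auto simp: a_def)
  have bijj: "bij mate" using mate_mate by (metis bijI injI surjI)
  have invj: "inv mate = mate" using mate_mate by (intro inv_unique_comp) (auto simp: fun_eq_iff)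
  have "inj a"
  proof (rule injI)
    fix i j assume eq: "a i = a j"
    have inj\<sigma>: "inj \<sigma>" using permutes_inj[OF \<sigma>] .
    have imP: "\<sigma> i \<in> P" if "i \<in> P" for i using that pairs xP by (auto simp: P_def)
    show "i = j" using eq imP[of i] imP[of j] inj\<sigma> by (auto simp: a_def inj_eq split: if_splits)
  qed
  then have a: "a permutes UNIV" by (simp add: permutes_UNIV_iff)
  have comp: "\<sigma> = a \<circ> (mate \<circ> a \<circ> inv mate)"
  proof
    fix i
    show "\<sigma> i = (a \<circ> (mate \<circ> a \<circ> inv mate)) i"
    proof (cases i rule: xy_cases)
      case (1 k)
      then show ?thesis by (simp add: invj mate_xy ay ax)
    next
      case (2 k)
      obtain l where "l < N" "\<sigma> (x k) = x l" "\<sigma> (y k) = y l" using pairs 2 by blast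
      then show ?thesis using 2 by (simp add: invj mate_xy ax ay)
    qed
  qed
  have c: "sign (mate \<circ> a \<circ> inv mate) = sign a" by (rule sign_conjugate[OF bijj a])
  have "bij (mate \<circ> a \<circ> inv mate)" using bijj permutes_bij[OF a] by (intro bij_comp bij_imp_bij_inv)
  then have "sign \<sigma> = sign a * sign (mate \<circ> a \<circ> inv mate)"
    unfolding comp using a by (intro sign_compose) (auto simp: permutation permutes_bij)
  then show ?thesis unfolding c by simp
qed

definition stdU :: "'n \<Rightarrow> 'n \<Rightarrow> real" where
  "stdU i j = (if \<exists>k<N. i = x k \<and> j = y k then 1 else 0)"

text \<open>Only permutations of the pairs contribute, each with a positive sign.\<close>

lemma pf_stdU: "pf stdU > 0"
proof -
  have t: "of_int (sign \<sigma>) * pfprod stdU \<sigma> = (if \<forall>k<N. \<exists>l<N. \<sigma> (x k) = x l \<and> \<sigma> (y k) = y l then 1 else (0::real))"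
    if "\<sigma> permutes UNIV" for \<sigma>
  proof (cases "\<forall>k<N. \<exists>l<N. \<sigma> (x k) = x l \<and> \<sigma> (y k) = y l")
    case True
    then have "sign \<sigma> = 1" using that by (intro sign_pair_permutation) auto
    moreover have "pfprod stdU \<sigma> = 1" using True by (simp add: pfprod_def stdU_def)
    ultimately show ?thesis using True by simp
  next
    case False
    then obtain k where "k < N" "stdU (\<sigma> (x k)) (\<sigma> (y k)) = 0" by (auto simp: stdU_def)
    then have "pfprod stdU \<sigma> = 0" unfolding pfprod_def by (intro prod_zero) auto
    then show ?thesis using False by simp
  qed
  have "pf stdU \<ge> of_int (sign (id :: 'n \<Rightarrow> 'n)) * pfprod stdU id"
    unfolding pf_eq
  proof (rule member_le_sum)
    show "id \<in> {\<sigma>. \<sigma> permutes (UNIV :: 'n set)}" by (simp add: permutes_id)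
    fix \<sigma> assume "\<sigma> \<in> {\<sigma>. \<sigma> permutes (UNIV :: 'n set)} - {id}"
    then show "0 \<le> of_int (sign \<sigma>) * pfprod stdU \<sigma>" using t[of \<sigma>] by auto
  qed simp
  moreover have "of_int (sign (id :: 'n \<Rightarrow> 'n)) * pfprod stdU id = 1"
    using t[OF permutes_id] by auto
  ultimately show ?thesis by linarith
qed

definition std :: "nat \<Rightarrow> nat \<Rightarrow> real" where
  "std i j = (if even i \<and> j = i + 1 then 1 else if odd i \<and> i = j + 1 then - 1 else 0)"

text \<open>The symplectic Gram-Schmidt process.\<close>

lemma symplectic_basis:
  fixes M :: "real^'n^'n"
  assumes inv: "invertible M" and skew: "transpose M = - M" and "k \<le> N"
  shows "\<exists>v :: nat \<Rightarrow> real^'n. \<forall>i<2 * k. \<forall>j<2 * k. v i \<bullet> (M *v v j) = std i j"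
  using \<open>k \<le> N\<close>
proof (induction k)
  case (Suc k)
  then obtain v :: "nat \<Rightarrow> real^'n" where v: "\<And>i j. i < 2 * k \<Longrightarrow> j < 2 * k \<Longrightarrow> v i \<bullet> (M *v v j) = std i j" by auto
  define b where "b = (\<lambda>u w. u \<bullet> (M *v w))"
  have b_skew: "b u w = - b w u" for u w
  proof -
    have "b u w = (transpose M *v u) \<bullet> w"
      unfolding b_def by (simp add: dot_lmul_matrix[symmetric] transpose_matrix_vector)
    also have "\<dots> = - b w u"
    proof -
      have "(- M) *v u = - (M *v u)" by (simp add: matrix_vector_mult_def vec_eq_iff sum_negf)
      then show ?thesis unfolding skew b_def by (simp add: inner_commute)
    qed
    finally show ?thesis .
  qed
  have b0: "b u u = 0" for u using b_skew[of u u] by simp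
  have b_add: "b u (w + w') = b u w + b u w'" for u w w'
    by (simp add: b_def matrix_vector_right_distrib inner_add_right)
  have b_scale: "b u (r *\<^sub>R w) = r * b u w" for u w r
    by (simp add: b_def matrix_vector_mult_scaleR)
  have b_sum: "b u (\<Sum>l\<in>I. f l) = (\<Sum>l\<in>I. b u (f l))" for u f and I :: "nat set"
    by (induction I rule: infinite_finite_induct) (auto simp: b_add, auto simp: b_def)
  have b_diff: "b u (w - w') = b u w - b u w'" for u w w'
    using b_add[of u w "(-1) *\<^sub>R w'"] b_scale[of u "-1" w'] by simp
  \<comment> \<open>The new pair consists of a vector \<open>w\<close> orthogonal to the pairs found so far, and of a vector \<open>u\<close>
    with \<open>b w u = 1\<close>, corrected to \<open>u'\<close> to be orthogonal to them as well.\<close>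
  let ?S = "(\<lambda>i. M *v v i) ` {..<2 * k}"
  have "dim ?S \<le> card ?S" by (rule dim_le_card') simp
  also have "\<dots> \<le> 2 * k" using card_image_le[of "{..<2 * k}" "\<lambda>i. M *v v i"] by simp
  also have "\<dots> < DIM(real^'n)" using Suc.prems card_type by simp
  finally obtain w where w: "w \<noteq> 0" "\<And>z. z \<in> span ?S \<Longrightarrow> orthogonal w z"
    using orthogonal_to_subspace_exists by blast
  have bw: "b w (v i) = 0" if "i < 2 * k" for i
    using w(2)[OF span_base, of "M *v v i"] that by (auto simp: b_def orthogonal_def)
  define u where "u = (1 / (w \<bullet> w)) *\<^sub>R (matrix_inv M *v w)"
  have bwu: "b w u = 1"
    unfolding u_def b_scale using matrix_inv[OF inv] w(1)
    by (simp add: b_def matrix_vector_mul_assoc)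
  define u' where "u' = u + (\<Sum>l<k. b (v (2 * l + 1)) u *\<^sub>R v (2 * l) - b (v (2 * l)) u *\<^sub>R v (2 * l + 1))"
  have bwu': "b w u' = 1"
    unfolding u'_def b_add b_sum b_diff b_scale using bwu bw by simp
  have bv: "b (v i) (v j) = std i j" if "i < 2 * k" "j < 2 * k" for i j using v that by (simp add: b_def)
  have bvu': "b (v m) u' = 0" if m: "m < 2 * k" for m
  proof -
    have "b (v m) u' = b (v m) u + (\<Sum>l<k. b (v (2 * l + 1)) u * std m (2 * l) - b (v (2 * l)) u * std m (2 * l + 1))"
      unfolding u'_def b_add b_sum b_diff b_scale using m by (simp add: bv)
    also have "(\<Sum>l<k. b (v (2 * l + 1)) u * std m (2 * l) - b (v (2 * l)) u * std m (2 * l + 1))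
       = (\<Sum>l<k. if l = m div 2 then - b (v m) u else 0)"
    proof (intro sum.cong refl)
      fix l assume "l \<in> {..<k}"
      show "b (v (2 * l + 1)) u * std m (2 * l) - b (v (2 * l)) u * std m (2 * l + 1)
        = (if l = m div 2 then - b (v m) u else 0)"
      proof (cases "even m")
        case True
        then obtain q where "m = 2 * q" by blast
        then show ?thesis by (auto simp: std_def)
      next
        case False
        then obtain q where "m = 2 * q + 1" by (metis oddE)
        then show ?thesis by (auto simp: std_def)
      qed
    qed
    also have "\<dots> = - b (v m) u" using m by simp
    finally show ?thesis by simp
  qed
  define v' where "v' = v(2 * k := w, 2 * k + 1 := u')"
  have tri: "m < 2 * k \<or> m = 2 * k \<or> m = 2 * k + 1" if "m < 2 * Suc k" for m using that by auto
  have "b (v' i) (v' j) = std i j" if ij: "i < 2 * Suc k" "j < 2 * Suc k" for i j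
  proof -
    have std0: "std i (2 * k) = 0" "std i (2 * k + 1) = 0" "std (2 * k) i = 0" "std (2 * k + 1) i = 0" if "i < 2 * k" for i
      using that by (auto simp: std_def; presburger)+
    have s1: "std (2 * k) (2 * k + 1) = 1" "std (2 * k + 1) (2 * k) = - 1" "std i i = 0" for i
      by (auto simp: std_def)
    consider "i < 2 * k" | "i = 2 * k" | "i = 2 * k + 1" using tri ij by blast
    then show ?thesis
    proof cases
      case 1
      consider "j < 2 * k" | "j = 2 * k" | "j = 2 * k + 1" using tri ij by blast
      then show ?thesis
        using 1 std0[of i] bw[of i] b_skew[of w "v i"] bvu'[of i] bv[of i j] by cases (auto simp: v'_def)
    next
      case 2
      consider "j < 2 * k" | "j = 2 * k" | "j = 2 * k + 1" using tri ij by blast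
      then show ?thesis
        using 2 std0[of j] bw[of j] b0[of w] bwu' s1 by cases (auto simp: v'_def)
    next
      case 3
      consider "j < 2 * k" | "j = 2 * k" | "j = 2 * k + 1" using tri ij by blast
      then show ?thesis
        using 3 std0[of j] b_skew[of "v j" u'] bvu'[of j] b_skew[of w u'] bwu' b0[of u'] s1 by cases (auto simp: v'_def)
    qed
  qed
  then show ?case unfolding b_def by blast
qed simp

text \<open>In a symplectic basis the form is the skew part of \<open>stdU\<close>.\<close>

lemma pf_nonzero:
  fixes B :: "'n \<Rightarrow> 'n \<Rightarrow> real"
  assumes skew: "\<And>i j. B i j = - B j i" and inv: "invertible (\<chi> i j. B i j :: real^'n^'n)"
  shows "pf B \<noteq> 0"
proof -
  let ?M = "\<chi> i j. B i j :: real^'n^'n"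
  have "transpose ?M = - ?M" by (simp add: transpose_def vec_eq_iff) (intro allI, rule skew)
  from symplectic_basis[OF inv this order_refl]
  obtain v :: "nat \<Rightarrow> real^'n" where v: "\<And>i j. i < 2 * N \<Longrightarrow> j < 2 * N \<Longrightarrow> v i \<bullet> (?M *v v j) = std i j" by auto
  have eq: "(\<Sum>a\<in>UNIV. \<Sum>b\<in>UNIV. v (ix i) $ a * v (ix j) $ b * B a b) = stdU i j - stdU j i" for i j
  proof -
    have "ix i < 2 * N" for i by (cases i rule: xy_cases) (auto simp: ix_xy)
    then have "v (ix i) \<bullet> (?M *v v (ix j)) = std (ix i) (ix j)" using v by blast
    moreover have "v (ix i) \<bullet> (?M *v v (ix j)) = (\<Sum>a\<in>UNIV. \<Sum>b\<in>UNIV. v (ix i) $ a * v (ix j) $ b * B a b)"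
      by (simp add: inner_vec_def matrix_vector_mult_def sum_distrib_left ac_simps)
    moreover have "std (ix i) (ix j) = stdU i j - stdU j i"
      by (cases i rule: xy_cases; cases j rule: xy_cases) (auto simp: std_def stdU_def ix_xy xy_eq, presburger+)
    ultimately show ?thesis by simp
  qed
  have "pf (\<lambda>i j. stdU i j - stdU j i) \<noteq> 0" unfolding pf_skew_part using pf_stdU by simp
  then show ?thesis using pf_transform[of "\<lambda>a i. v (ix i) $ a" B] unfolding eq by auto
qed

end

section \<open>Partitions of unity\<close>

context atlas
begin

lemma smf_zero_extension:
  assumes c: "c \<in> A" and d: "d \<in> A" and f: "smf c (cdom c) f" and K: "closed K" "K \<subseteq> cdom c"
    and zero: "\<And>q. q \<in> cdom c \<Longrightarrow> q \<notin> K \<Longrightarrow> f q = 0"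
  shows "smf d (cdom d) (\<lambda>q. if q \<in> cdom c then f q else 0)"
proof (rule smf_local)
  let ?g = "\<lambda>q. if q \<in> cdom c then f q else 0"
  fix p assume p: "p \<in> cdom d"
  show "\<exists>V. p \<in> V \<and> open (coords d ` V) \<and> smf d V ?g"
  proof (cases "p \<in> cdom c")
    case True
    let ?V = "cdom c \<inter> cdom d"
    have V: "open ?V" using open_cdom[OF c] open_cdom[OF d] by blast
    interpret C0: chart_domain c "cdom c" using chart_domain_cdom c by blast
    interpret D: chart_domain d ?V using chart_domain_overlap'[OF c d] .
    have "smf c ?V f" by (rule C0.smf_subset[OF f]) blast
    then have "smf d ?V f" by (rule smf_transition[OF c d V order_refl])
    then have "smf d ?V ?g" by (rule D.smf_cong) simp
    then show ?thesis using True p D.open_image by blast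
  next
    case False
    let ?V = "cdom d - K"
    have V: "open ?V" using open_cdom[OF d] K by blast
    interpret D: chart_domain d ?V using chart_domainI[OF d V] by blast
    have "smf d ?V (\<lambda>q. 0)" by (rule D.smf_const)
    then have "smf d ?V ?g" by (rule D.smf_cong) (simp add: zero)
    then show ?thesis using False p K D.open_image by blast
  qed
qed

lemma exists_bump_function:
  assumes c: "c \<in> A" "p \<in> cdom c"
  obtains \<psi> where "\<And>d. d \<in> A \<Longrightarrow> smf d (cdom d) \<psi>" "\<And>q. 0 \<le> \<psi> q"
    "\<psi> p \<noteq> 0" "open {q. \<psi> q \<noteq> 0}" "closure {q. \<psi> q \<noteq> 0} \<subseteq> cdom c"
proof -
  interpret C: chart_domain c "cdom c" using chart_domain_cdom c by blast
  let ?x = "coords c p" and ?inv = "inv_into (cdom c) (coords c)"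
  obtain r where r: "r > 0" "cball ?x r \<subseteq> cimage c"
    using open_contains_cball open_cimage[OF c(1)] c(2) by (metis imageI)
  obtain \<phi> :: "real^'n \<Rightarrow> real" where \<phi>: "smooth_on UNIV \<phi>" "\<And>x. 0 \<le> \<phi> x" "\<And>x. \<phi> x \<noteq> 0 \<longleftrightarrow> x \<in> ball ?x r"
    using exists_smooth_bump by blast
  define \<psi> where "\<psi> = (\<lambda>q. if q \<in> cdom c then \<phi> (coords c q) else 0)"
  define K where "K = ?inv ` cball ?x r"
  have K: "compact K" "K \<subseteq> cdom c"
    unfolding K_def using r(2) continuous_on_subset[OF continuous_inv_coords[OF c(1)] r(2)]
    by (auto intro!: compact_continuous_image inv_into_into)
  have in_K: "q \<in> K" if "q \<in> cdom c" "coords c q \<in> cball ?x r" for q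
    using that C.inj_coords unfolding K_def by (metis image_eqI inv_into_f_f)
  have sm: "smf c (cdom c) (\<lambda>q. \<phi> (coords c q))"
    unfolding smf_def
  proof (rule smooth_on_cong[OF C.open_image])
    show "smooth_on (cimage c) \<phi>" using \<phi>(1) by (rule smooth_on_subset) simp
    show "\<phi> x = in_chart c (\<lambda>q. \<phi> (coords c q)) x" if "x \<in> cimage c" for x using that by auto
  qed
  have supp: "{q. \<psi> q \<noteq> 0} = cdom c \<inter> coords c -` ball ?x r" by (auto simp: \<psi>_def \<phi>(3))
  show thesis
  proof (rule that[of \<psi>])
    show "smf d (cdom d) \<psi>" if "d \<in> A" for d
      unfolding \<psi>_def
    proof (rule smf_zero_extension[OF c(1) that sm compact_imp_closed[OF K(1)] K(2)])
      fix q assume q: "q \<in> cdom c" "q \<notin> K"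
      then have "coords c q \<notin> ball ?x r" using in_K[of q] ball_subset_cball by blast
      then show "\<phi> (coords c q) = 0" using \<phi>(3) by blast
    qed
    show "open {q. \<psi> q \<noteq> 0}"
      unfolding supp using continuous_coords[OF c(1)] open_cdom[OF c(1)]
      by (metis continuous_on_open_vimage open_ball inf_commute)
    have "{q. \<psi> q \<noteq> 0} \<subseteq> K" unfolding supp using in_K ball_subset_cball by blast
    then show "closure {q. \<psi> q \<noteq> 0} \<subseteq> cdom c"
      using K compact_imp_closed closure_minimal by blast
    show "\<psi> p \<noteq> 0" using c r by (simp add: \<psi>_def \<phi>(3))
  qed (use c \<phi>(2) in \<open>auto simp: \<psi>_def\<close>)
qed

text \<open>Finitely many bump functions have no common zero. They are normalised by their sum and grouped by
  charts, since the index set of the partition is a set of charts.\<close>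

lemma partition_of_unity_exists:
  assumes compact: "compact (UNIV :: 'm set)"
  shows "\<exists>C \<rho>. partition_of_unity A C \<rho>"
proof -
  have "\<forall>p. \<exists>c \<psi>. c \<in> A \<and> (\<forall>d\<in>A. smf d (cdom d) \<psi>) \<and> (\<forall>q. 0 \<le> \<psi> q) \<and> \<psi> p \<noteq> 0
      \<and> open {q. \<psi> q \<noteq> 0} \<and> closure {q. \<psi> q \<noteq> 0} \<subseteq> cdom c"
    using exists_bump_function charts_cover by metis
  then obtain ch \<psi> where ch: "\<And>p. ch p \<in> A" and sm: "\<And>p d. d \<in> A \<Longrightarrow> smf d (cdom d) (\<psi> p)"
    and nn: "\<And>p q. 0 \<le> \<psi> p q" and pos: "\<And>p. \<psi> p p \<noteq> 0" and op: "\<And>p. open {q. \<psi> p q \<noteq> 0}"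
    and cl: "\<And>p. closure {q. \<psi> p q \<noteq> 0} \<subseteq> cdom (ch p)" by metis
  obtain F where F: "finite F" "UNIV \<subseteq> (\<Union>p\<in>F. {q. \<psi> p q \<noteq> 0})"
  proof (rule compactE_image[OF compact, of UNIV "\<lambda>p. {q. \<psi> p q \<noteq> 0}"])
    show "open {q. \<psi> p q \<noteq> 0}" for p by (rule op)
    show "UNIV \<subseteq> (\<Union>p. {q. \<psi> p q \<noteq> 0})" using pos by auto
  qed blast
  define S where "S = (\<lambda>q. \<Sum>p\<in>F. \<psi> p q)"
  have S: "S q > 0" for q
  proof -
    obtain p where "p \<in> F" "\<psi> p q \<noteq> 0" using F(2) by auto
    then have "0 < \<psi> p q" "p \<in> F" using nn[of p q] by auto
    then show ?thesis unfolding S_def using F(1) nn by (intro sum_pos2) auto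
  qed
  define G where "G = (\<lambda>c. {p \<in> F. ch p = c})"
  define \<rho> where "\<rho> = (\<lambda>c q. (\<Sum>p\<in>G c. \<psi> p q) * inverse (S q))"
  have finG: "finite (G c)" for c using F(1) by (simp add: G_def)
  have "partition_of_unity A (ch ` F) \<rho>"
    unfolding partition_of_unity_def
  proof (intro conjI ballI allI)
    fix c d assume d: "d \<in> A"
    interpret D: chart_domain d "cdom d" using chart_domain_cdom d by blast
    have "smf d (cdom d) (\<rho> c)"
      unfolding \<rho>_def
    proof (intro D.smf_mult D.smf_sum D.smf_inverse)
      show "smf d (cdom d) S" unfolding S_def using sm[OF d] by (intro D.smf_sum)
    qed (use S sm[OF d] in \<open>auto simp: less_imp_neq[symmetric]\<close>)
    then show "smooth_on (cimage d) (in_chart d (\<rho> c))" by (simp add: smf_def)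
  next
    fix c
    have "{q. \<rho> c q \<noteq> 0} \<subseteq> (\<Union>p\<in>G c. {q. \<psi> p q \<noteq> 0})"
    proof
      fix q assume "q \<in> {q. \<rho> c q \<noteq> 0}"
      then have "(\<Sum>p\<in>G c. \<psi> p q) \<noteq> 0" by (auto simp: \<rho>_def)
      then obtain p where "p \<in> G c" "\<psi> p q \<noteq> 0" by (rule sum.not_neutral_contains_not_neutral)
      then show "q \<in> (\<Union>p\<in>G c. {q. \<psi> p q \<noteq> 0})" by blast
    qed
    also have "\<dots> \<subseteq> (\<Union>p\<in>G c. closure {q. \<psi> p q \<noteq> 0})"
      by (intro UN_mono subset_refl closure_subset)
    finally have "{q. \<rho> c q \<noteq> 0} \<subseteq> (\<Union>p\<in>G c. closure {q. \<psi> p q \<noteq> 0})" .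
    moreover have "closed (\<Union>p\<in>G c. closure {q. \<psi> p q \<noteq> 0})" using finG by (intro closed_UN) auto
    ultimately have "closure {q. \<rho> c q \<noteq> 0} \<subseteq> (\<Union>p\<in>G c. closure {q. \<psi> p q \<noteq> 0})"
      by (rule closure_minimal)
    also have "\<dots> \<subseteq> cdom c" using cl by (auto simp: G_def)
    finally show "closure {q. \<rho> c q \<noteq> 0} \<subseteq> cdom c" .
  next
    fix c q show "0 \<le> \<rho> c q" unfolding \<rho>_def using nn S[of q] by (intro mult_nonneg_nonneg sum_nonneg) auto
  next
    fix q
    have "(\<Sum>c\<in>ch ` F. \<Sum>p\<in>G c. \<psi> p q) = S q"
      unfolding S_def G_def by (rule sum.image_gen[OF F(1), symmetric])
    then show "(\<Sum>c\<in>ch ` F. \<rho> c q) = 1"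
      unfolding \<rho>_def sum_distrib_right[symmetric] using S[of q] by simp
  qed (use F(1) ch in auto)
  then show ?thesis by blast
qed

end

section \<open>Integration against the Liouville volume\<close>

lemma zero_extension_continuous:
  fixes h :: "'a::t2_space \<Rightarrow> real"
  assumes "open U" "continuous_on U h" "compact K" "K \<subseteq> U" "\<And>x. x \<in> U \<Longrightarrow> x \<notin> K \<Longrightarrow> h x = 0"
  shows "continuous_on UNIV (\<lambda>x. indicator U x *\<^sub>R h x)"
proof -
  have "continuous_on (U \<union> - K) (\<lambda>x. indicator U x *\<^sub>R h x)"
  proof (rule continuous_on_open_Un)
    show "open (- K)" using assms by (simp add: compact_imp_closed open_Compl)
    show "continuous_on U (\<lambda>x. indicator U x *\<^sub>R h x)"
      using assms(2) by (rule continuous_on_eq) simp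
    have "continuous_on (- K) (\<lambda>x. 0)" by (rule continuous_on_const)
    then show "continuous_on (- K) (\<lambda>x. indicator U x *\<^sub>R h x)"
      by (rule continuous_on_eq) (auto simp: indicator_def assms(5))
  qed (rule assms)
  moreover have "U \<union> - K = UNIV" using assms by blast
  ultimately show ?thesis by simp
qed

lemma zero_extension_integrable:
  fixes h :: "real^'n::finite \<Rightarrow> real"
  assumes "open U" "continuous_on U h" "compact K" "K \<subseteq> U" "\<And>x. x \<in> U \<Longrightarrow> x \<notin> K \<Longrightarrow> h x = 0"
  shows "set_integrable lborel U h"
  unfolding set_integrable_def
  by (rule integrable_compact_support[OF zero_extension_continuous[OF assms] assms(3)])
    (auto simp: indicator_def assms(5))

lemma integral_pd_zero_extension:
  fixes h :: "real^'n::finite \<Rightarrow> real"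
  assumes U: "open U" and diff: "\<And>x. x \<in> U \<Longrightarrow> h differentiable (at x)" and cont: "continuous_on U (pd i h)"
    and K: "compact K" "K \<subseteq> U" and zero: "\<And>x. x \<in> U \<Longrightarrow> x \<notin> K \<Longrightarrow> h x = 0"
  shows "(LINT x:U|lborel. pd i h x) = 0"
proof -
  let ?H = "\<lambda>x. indicator U x *\<^sub>R h x"
  have oK: "open (- K)" using K by (simp add: compact_imp_closed open_Compl)
  have H0: "?H x = 0" if "x \<in> - K" for x using that zero by (auto simp: indicator_def)
  have pd0: "pd i h x = 0" if x: "x \<in> U" "x \<notin> K" for x
  proof -
    have "pd i h x = pd i (\<lambda>x. 0) x"
      using U oK x zero by (intro pd_cong[of "U \<inter> - K"]) auto
    then show ?thesis by simp
  qed
  have pdH: "pd i ?H x = indicator U x *\<^sub>R pd i h x" for x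
  proof (cases "x \<in> U")
    case True
    then have "pd i ?H x = pd i h x" using U by (intro pd_cong[of U]) auto
    then show ?thesis using True by simp
  next
    case False
    then have "x \<in> - K" using K by auto
    then have "pd i ?H x = pd i (\<lambda>x. 0) x" using oK H0 by (intro pd_cong[of "- K"]) auto
    then show ?thesis using False by simp
  qed
  have "(\<integral>x. pd i ?H x \<partial>lborel) = 0"
  proof (rule integral_pd_compact_support[OF _ _ K(1)])
    show "?H differentiable (at x)" for x
    proof (cases "x \<in> U")
      case True
      then show ?thesis using differentiable_cong_open[OF U True, of h ?H] diff by simp
    next
      case False
      then have "x \<in> - K" using K by auto
      from differentiable_cong_open[OF oK this, of "\<lambda>x. 0" ?H] H0 show ?thesis by simp
    qed
    show "continuous_on UNIV (pd i ?H)"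
      unfolding pdH[abs_def] by (rule zero_extension_continuous[OF U cont K pd0])
    show "?H x = 0" if "x \<notin> K" for x using that H0 by blast
  qed
  then show ?thesis unfolding pdH set_lebesgue_integral_def .
qed

lemma continuous_nonneg_integral_zero:
  fixes f :: "real^'n::finite \<Rightarrow> real"
  assumes "continuous_on UNIV f" "\<And>x. 0 \<le> f x" "integrable lborel f" "(\<integral>x. f x \<partial>lborel) = 0"
  shows "f x = 0"
proof -
  have "AE x in lborel. f x = 0"
    using integral_nonneg_eq_0_iff_AE[OF assms(3)] assms(2,4) by auto
  then have ae: "AE x in lebesgue. x \<in> {x. f x = 0}" by (simp add: AE_completion)
  have cl: "closed {x. f x = 0}"
    using continuous_closed_preimage_constant[OF assms(1) closed_UNIV, of 0] by simp
  have ae': "AE x \<in> UNIV in lebesgue. x \<in> {x. f x = 0}" using ae by simp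
  have "x \<in> {x. f x = 0}" by (rule mem_closed_if_AE_lebesgue_open[OF open_UNIV cl ae' UNIV_I])
  then show ?thesis by simp
qed

context symplectic
begin

sublocale E: even_type n "TYPE('n)"
  by unfold_locales (rule card_n)

definition \<mu> :: "('m, 'n) chart \<Rightarrow> 'm \<Rightarrow> real" where
  "\<mu> c p = \<bar>\<Omega>n_coeff \<Omega> c p\<bar>"

abbreviation PF :: "('m, 'n) chart \<Rightarrow> 'm \<Rightarrow> real" where
  "PF c p \<equiv> pf (\<lambda>i j. \<Omega> c p [] [i, j])"

definition \<mu>_factor :: real where "\<mu>_factor = 1 / fact n * (1 / 2 ^ n)"

lemma \<mu>_eq: "\<mu> c p = \<mu>_factor * \<bar>PF c p\<bar>"
proof -
  have "\<Omega>n_coeff \<Omega> c p = \<mu>_factor * PF c p"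
    unfolding \<Omega>n_coeff_def pf_def \<mu>_factor_def using card_n by (simp add: Let_def)
  then show ?thesis by (simp add: \<mu>_def abs_mult \<mu>_factor_def)
qed

lemma PF_nonzero: "c \<in> A \<Longrightarrow> p \<in> cdom c \<Longrightarrow> PF c p \<noteq> 0"
proof (rule E.pf_nonzero)
  assume cp: "c \<in> A" "p \<in> cdom c"
  show "\<Omega> c p [] [i, j] = - \<Omega> c p [] [j, i]" for i j by (rule \<Omega>_skew[OF cp])
  show "invertible (\<chi> i j. \<Omega> c p [] [i, j])"
    using \<Omega>_invertible[OF cp] by (simp add: two_form_matrix_def)
qed

lemma \<mu>_pos: "c \<in> A \<Longrightarrow> p \<in> cdom c \<Longrightarrow> \<mu> c p > 0"
  using PF_nonzero[of c p] by (simp add: \<mu>_eq \<mu>_factor_def)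

lemma PF_smf: "c \<in> A \<Longrightarrow> smf c (cdom c) (PF c)"
  unfolding pf_def
  by (intro chart_domain.smf_sum[OF chart_domain_cdom] chart_domain.smf_mult[OF chart_domain_cdom]
      chart_domain.smf_prod[OF chart_domain_cdom] chart_domain.smf_const[OF chart_domain_cdom] \<Omega>_smf)

lemma \<mu>_transform:
  assumes cd: "c \<in> A" "d \<in> A" "p \<in> cdom c" "p \<in> cdom d"
  shows "\<mu> d p = \<bar>det (\<chi> a i. jac c d p a i)\<bar> * \<mu> c p"
proof -
  have "PF d p = pf (\<lambda>i j. \<Sum>a\<in>UNIV. \<Sum>b\<in>UNIV. jac c d p a i * jac c d p b j * \<Omega> c p [] [a, b])"
    unfolding \<Omega>_transform[OF cd] ..
  also have "\<dots> = det (\<chi> a i. jac c d p a i) * PF c p" by (rule E.pf_transform)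
  finally show ?thesis by (simp add: \<mu>_eq abs_mult)
qed

lemma in_chart_differentiable:
  assumes "c \<in> A" "smf c (cdom c) F" "x \<in> cimage c"
  shows "in_chart c F differentiable (at x)"
  using assms smooth_on_differentiable unfolding smf_def by blast

end

context symplectic_connection
begin

text \<open>\<open>\<partial>\<^sub>b \<mu> = \<mu> \<Gamma>\<^sub>b\<^sub>a\<^sup>a\<close>: the Liouville volume is parallel.\<close>

lemma chart_pd_PF:
  assumes cp: "c \<in> A" "p \<in> cdom c"
  shows "chart_pd c b (PF c) p = (\<Sum>a\<in>UNIV. \<Gamma> c p b a a) * PF c p"
proof -
  interpret C: chart_domain c "cdom c" using chart_domain_cdom cp by blast
  let ?B = "\<lambda>p i j. \<Omega> c p [] [i, j]"
  have "chart_pd c b (\<lambda>p. \<Prod>k<n. ?B p (\<sigma> (E.x k)) (\<sigma> (E.y k))) p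
     = (\<Sum>k<n. chart_pd c b (\<lambda>p. ?B p (\<sigma> (E.x k)) (\<sigma> (E.y k))) p * (\<Prod>l\<in>{..<n} - {k}. ?B p (\<sigma> (E.x l)) (\<sigma> (E.y l))))" for \<sigma>
    using cp by (intro C.chart_pd_prod \<Omega>_smf) auto
  then have "chart_pd c b (PF c) p = (\<Sum>\<sigma> | \<sigma> permutes UNIV. of_int (sign \<sigma>) *
      (\<Sum>k<n. chart_pd c b (\<lambda>p. ?B p (\<sigma> (E.x k)) (\<sigma> (E.y k))) p * (\<Prod>l\<in>{..<n} - {k}. ?B p (\<sigma> (E.x l)) (\<sigma> (E.y l)))))"
    unfolding E.pf_eq E.pfprod_def using cp
    by (subst C.chart_pd_sum) (auto intro!: C.smf_mult C.smf_prod \<Omega>_smf sum.cong simp: C.chart_pd_cmult[OF C.smf_prod[OF \<Omega>_smf]])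
  also have "\<dots> = (\<Sum>a\<in>UNIV. \<Gamma> c p b a a) * PF c p"
    by (rule E.pf_derivation[of "\<lambda>i j. chart_pd c b (\<lambda>p. ?B p i j) p" "\<Gamma> c p b"]) (rule pd_\<Omega>[OF cp])
  finally show ?thesis .
qed

lemma pd_abs_PF:
  assumes cp: "c \<in> A" "p \<in> cdom c"
  shows "in_chart c (\<mu> c) differentiable (at (coords c p))"
    and "chart_pd c b (\<mu> c) p = (\<Sum>a\<in>UNIV. \<Gamma> c p b a a) * \<mu> c p"
proof -
  interpret C: chart_domain c "cdom c" using chart_domain_cdom cp by blast
  let ?f = "in_chart c (PF c)" and ?x = "coords c p"
  have x: "?x \<in> cimage c" using cp by simp
  have d: "?f differentiable (at y)" if "y \<in> cimage c" for y by (rule in_chart_differentiable[OF cp(1) PF_smf[OF cp(1)] that])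
  define s where "s = sgn (?f ?x)"
  define U where "U = {y \<in> cimage c. s * ?f y > 0}"
  have fx: "?f ?x = PF c p" using cp by simp
  have "?f ?x \<noteq> 0" using PF_nonzero[OF cp] fx by simp
  then have xU: "?x \<in> U" using x by (simp add: U_def s_def linorder_neq_iff sgn_if split: if_splits) auto
  have "continuous_on (cimage c) (\<lambda>y. s * ?f y)"
    using smooth_on_continuous PF_smf[OF cp(1)] by (intro continuous_intros) (simp add: smf_def)
  then have U: "open U"
    using continuous_openin_preimage_gen[of "cimage c" "\<lambda>y. s * ?f y" "{0<..}"] open_cimage[OF cp(1)]
    unfolding U_def by (auto simp: vimage_def Int_def openin_open_eq dest: openin_open_trans)
  have mu: "in_chart c (\<mu> c) y = \<mu>_factor * s * ?f y" if "y \<in> U" for y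
  proof -
    have "s * ?f y > 0" using that by (simp add: U_def)
    moreover have "s = 1 \<or> s = - 1" using \<open>?f ?x \<noteq> 0\<close> by (auto simp: s_def sgn_if)
    ultimately have "\<bar>?f y\<bar> = s * ?f y" by auto
    then show ?thesis by (simp add: in_chart_def \<mu>_eq)
  qed
  have d': "(\<lambda>y. \<mu>_factor * s * ?f y) differentiable (at ?x)" using d[OF x] by (intro differentiable_mult) auto
  show "in_chart c (\<mu> c) differentiable (at ?x)"
    by (rule differentiable_cong_open[OF U xU _ d']) (simp add: mu)
  have "chart_pd c b (\<mu> c) p = pd b (\<lambda>y. (\<mu>_factor * s) * ?f y) ?x"
    unfolding chart_pd_def using mu by (intro pd_cong[OF U xU]) simp
  also have "\<dots> = (\<mu>_factor * s) * chart_pd c b (PF c) p"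
    using pd_mult[OF differentiable_const d[OF x], of b "\<mu>_factor * s"] by (simp add: chart_pd_def)
  also have "\<dots> = (\<Sum>a\<in>UNIV. \<Gamma> c p b a a) * (\<mu>_factor * s * PF c p)"
    unfolding chart_pd_PF[OF cp] by simp
  also have "\<mu>_factor * s * PF c p = \<mu> c p" using mu[OF xU] cp fx by simp
  finally show "chart_pd c b (\<mu> c) p = (\<Sum>a\<in>UNIV. \<Gamma> c p b a a) * \<mu> c p" .
qed

end

locale compact_symplectic = symplectic A \<Omega> n
  for A :: "('m::t2_space, 'n::finite) chart set" and \<Omega> n +
  assumes compact_M: "compact (UNIV :: 'm set)"
begin

definition pou :: "('m, 'n) chart set \<times> (('m, 'n) chart \<Rightarrow> 'm \<Rightarrow> real)" where
  "pou = (SOME (C, \<rho>). partition_of_unity A C \<rho>)"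

abbreviation "CC \<equiv> fst pou"
abbreviation "\<rho> \<equiv> snd pou"

lemma pou: "partition_of_unity A CC \<rho>"
proof -
  have "\<exists>x. case x of (C, r) \<Rightarrow> partition_of_unity A C r"
    using partition_of_unity_exists[OF compact_M] by auto
  from someI_ex[OF this, folded pou_def] show ?thesis by (simp only: case_prod_beta)
qed

definition supp :: "('m, 'n) chart \<Rightarrow> 'm set" where
  "supp c = closure {p. \<rho> c p \<noteq> 0}"

lemma finite_CC: "finite CC"
  and CC_A: "c \<in> CC \<Longrightarrow> c \<in> A"
  and \<rho>_smf: "c \<in> CC \<Longrightarrow> d \<in> A \<Longrightarrow> smf d (cdom d) (\<rho> c)"
  and \<rho>_nonneg: "c \<in> CC \<Longrightarrow> 0 \<le> \<rho> c p"
  and supp_cdom: "c \<in> CC \<Longrightarrow> supp c \<subseteq> cdom c"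
  and \<rho>_sum: "(\<Sum>c\<in>CC. \<rho> c p) = 1"
  using pou unfolding partition_of_unity_def smf_def supp_def by blast+

lemma closed_supp: "closed (supp c)"
  by (simp add: supp_def)

lemma \<rho>_zero: "p \<notin> supp c \<Longrightarrow> \<rho> c p = 0"
  unfolding supp_def using closure_subset[of "{p. \<rho> c p \<noteq> 0}"] by auto

definition cint :: "('m, 'n) chart \<Rightarrow> ('m \<Rightarrow> real) \<Rightarrow> real" where
  "cint c g = (LINT x:cimage c|lborel. in_chart c (\<lambda>p. g p * \<mu> c p) x)"

lemma integral_eq: "integral_\<Omega>n A \<Omega> F = (\<Sum>c\<in>CC. cint c (\<lambda>p. \<rho> c p * F c p [] []))"
  unfolding integral_\<Omega>n_def pou_def[symmetric] cint_def \<mu>_def by (simp add: Let_def case_prod_beta)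

definition chart_cont :: "('m, 'n) chart \<Rightarrow> ('m \<Rightarrow> real) \<Rightarrow> bool" where
  "chart_cont c g \<longleftrightarrow> continuous_on (cimage c) (in_chart c g)"

lemma smf_cont: "smf c (cdom c) g \<Longrightarrow> chart_cont c g"
  unfolding smf_def chart_cont_def by (rule smooth_on_continuous)

lemma chart_cont_mult: "chart_cont c f \<Longrightarrow> chart_cont c g \<Longrightarrow> chart_cont c (\<lambda>p. f p * g p)"
  unfolding chart_cont_def in_chart_def by (rule continuous_on_mult)

lemma \<mu>_cont: "c \<in> A \<Longrightarrow> chart_cont c (\<mu> c)"
  using smf_cont[OF PF_smf, of c] unfolding chart_cont_def in_chart_def \<mu>_eq by (auto intro!: continuous_intros)

lemma compact_coords:
  assumes "c \<in> A" "closed K" "K \<subseteq> cdom c"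
  shows "compact (coords c ` K)" "coords c ` K \<subseteq> cimage c"
proof -
  have "compact K" using compact_Int_closed[OF compact_M assms(2)] by simp
  then show "compact (coords c ` K)"
    using continuous_on_subset[OF continuous_coords[OF assms(1)] assms(3)] by (rule compact_continuous_image[rotated])
qed (use assms in auto)

lemma zero_outside:
  fixes g h :: "'m \<Rightarrow> real"
  assumes c: "c \<in> A" and g: "\<And>p. p \<in> cdom c \<Longrightarrow> p \<notin> K \<Longrightarrow> g p = 0"
    and x: "x \<in> cimage c" "x \<notin> coords c ` K"
  shows "in_chart c (\<lambda>p. g p * h p) x = 0"
proof -
  interpret C: chart_domain c "cdom c" using chart_domain_cdom c by blast
  from x obtain p where p: "p \<in> cdom c" "x = coords c p" by blast
  then have "p \<notin> K" using x(2) by blast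
  then show ?thesis using p g[OF p(1)] by simp
qed

lemma cint_integrable:
  assumes c: "c \<in> A" and K: "closed K" "K \<subseteq> cdom c" and g: "chart_cont c g"
    and zero: "\<And>p. p \<in> cdom c \<Longrightarrow> p \<notin> K \<Longrightarrow> g p = 0"
  shows "set_integrable lborel (cimage c) (in_chart c (\<lambda>p. g p * \<mu> c p))"
proof (rule zero_extension_integrable[OF open_cimage[OF c]])
  show "continuous_on (cimage c) (in_chart c (\<lambda>p. g p * \<mu> c p))"
    using chart_cont_mult[OF g \<mu>_cont[OF c]] by (simp add: chart_cont_def)
qed (use compact_coords[OF c K] zero_outside[OF c zero] in auto)

lemma cint_cong:
  assumes c: "c \<in> A" and "\<And>p. p \<in> cdom c \<Longrightarrow> f p = g p"
  shows "cint c f = cint c g"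
proof -
  interpret C: chart_domain c "cdom c" using chart_domain_cdom c by blast
  show ?thesis unfolding cint_def using assms open_cimage[OF c]
    by (intro set_lebesgue_integral_cong) auto
qed

lemma cint_add:
  assumes c: "c \<in> A" and K: "closed K" "K \<subseteq> cdom c" and f: "chart_cont c f" and g: "chart_cont c g"
    and zero: "\<And>p. p \<in> cdom c \<Longrightarrow> p \<notin> K \<Longrightarrow> f p = 0" "\<And>p. p \<in> cdom c \<Longrightarrow> p \<notin> K \<Longrightarrow> g p = 0"
  shows "cint c (\<lambda>p. f p + g p) = cint c f + cint c g"
proof -
  have "cint c (\<lambda>p. f p + g p) = (LINT x:cimage c|lborel. in_chart c (\<lambda>p. f p * \<mu> c p) x + in_chart c (\<lambda>p. g p * \<mu> c p) x)"
    unfolding cint_def in_chart_def by (simp add: distrib_right)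
  also have "\<dots> = cint c f + cint c g"
    unfolding cint_def by (rule set_integral_add(2)[OF cint_integrable[OF c K f zero(1)] cint_integrable[OF c K g zero(2)]])
  finally show ?thesis .
qed

lemma cint_cmult: "cint c (\<lambda>p. r * g p) = r * cint c g"
  unfolding cint_def in_chart_def by (simp add: mult.assoc)

lemma cint_zero: "cint c (\<lambda>p. 0) = 0"
  using cint_cmult[of c 0 "\<lambda>p. 0"] by simp

lemma chart_cont_add: "chart_cont c f \<Longrightarrow> chart_cont c g \<Longrightarrow> chart_cont c (\<lambda>p. f p + g p)"
  unfolding chart_cont_def in_chart_def by (rule continuous_on_add)

lemma chart_cont_const: "chart_cont c (\<lambda>p. r)"
  unfolding chart_cont_def in_chart_def by (rule continuous_on_const)

lemma chart_cont_sum: "(\<And>i. i \<in> I \<Longrightarrow> chart_cont c (f i)) \<Longrightarrow> chart_cont c (\<lambda>p. \<Sum>i\<in>I. f i p)"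
  by (induction I rule: infinite_finite_induct) (auto intro: chart_cont_add chart_cont_const)

lemma cint_sum:
  assumes c: "c \<in> A" and K: "closed K" "K \<subseteq> cdom c"
    and f: "\<And>i. i \<in> I \<Longrightarrow> chart_cont c (f i)"
    and zero: "\<And>i p. i \<in> I \<Longrightarrow> p \<in> cdom c \<Longrightarrow> p \<notin> K \<Longrightarrow> f i p = 0"
  shows "cint c (\<lambda>p. \<Sum>i\<in>I. f i p) = (\<Sum>i\<in>I. cint c (f i))"
  using f zero
proof (induction I rule: infinite_finite_induct)
  case (insert i I)
  have "cint c (\<lambda>p. f i p + (\<Sum>i\<in>I. f i p)) = cint c (f i) + cint c (\<lambda>p. \<Sum>i\<in>I. f i p)"
    using insert.prems by (intro cint_add[OF c K] chart_cont_sum) (auto intro: sum.neutral)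
  then show ?case using insert by simp
qed (auto simp: cint_zero)

text \<open>The coordinate transition is defined on the overlap only; as the integrands vanish off \<open>K\<close>, the
  integrals over both charts reduce to the overlap, where \<open>\<mu>\<close> changes by the Jacobian determinant.\<close>

lemma cint_transition:
  assumes cd: "c \<in> A" "d \<in> A" and K: "closed K" "K \<subseteq> cdom c \<inter> cdom d"
    and eq: "\<And>p. p \<in> cdom c \<Longrightarrow> p \<in> cdom d \<Longrightarrow> g p = g' p"
    and g: "chart_cont c g" "\<And>p. p \<in> cdom c \<Longrightarrow> p \<notin> K \<Longrightarrow> g p = 0"
    and g': "chart_cont d g'" "\<And>p. p \<in> cdom d \<Longrightarrow> p \<notin> K \<Longrightarrow> g' p = 0"
  shows "cint c g = cint d g'"
proof -
  let ?W = "cdom c \<inter> cdom d"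
  interpret C: chart_domain c ?W using chart_domain_overlap cd by blast
  interpret D: chart_domain d ?W using chart_domain_overlap' cd by blast
  interpret C0: chart_domain c "cdom c" using chart_domain_cdom cd by blast
  interpret D0: chart_domain d "cdom d" using chart_domain_cdom cd by blast
  define U where "U = coords c ` ?W"
  define \<phi> where "\<phi> = (\<lambda>x. coords d (inv_into (cdom c) (coords c) x))"
  define h where "h = in_chart d (\<lambda>p. g' p * \<mu> d p)"
  have U: "open U" unfolding U_def by (rule C.open_image)
  have \<phi>p: "\<phi> (coords c p) = coords d p" if "p \<in> cdom c" for p
    using that C.inj_coords by (simp add: \<phi>_def inv_into_f_f)
  have im: "\<phi> ` U = coords d ` ?W" unfolding U_def image_image using \<phi>p by (intro image_cong) auto
  have inj: "inj_on \<phi> U"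
    unfolding U_def using \<phi>p D.inj_coords by (auto simp: inj_on_def)
  define \<phi>' where "\<phi>' = (\<lambda>x v. \<chi> a. frechet_derivative (\<lambda>x. \<phi> x $ a) (at x) v)"
  have comp: "(\<lambda>x. \<phi> x $ a) = in_chart c (\<lambda>p. coords d p $ a)" for a
    by (rule ext) (simp add: \<phi>_def in_chart_def)
  have dc: "(\<lambda>x. \<phi> x $ a) differentiable (at x)" if "x \<in> U" for x a
  proof -
    have "smf c ?W (\<lambda>p. coords d p $ a)" using smf_coords[OF cd(2,1)] by blast
    then show ?thesis unfolding comp using smooth_on_differentiable that by (auto simp: smf_def U_def)
  qed
  have der: "(\<phi> has_derivative \<phi>' x) (at x)" if "x \<in> U" for x
  proof -
    have "((\<lambda>x. \<phi> x $ a) has_derivative frechet_derivative (\<lambda>x. \<phi> x $ a) (at x)) (at x)" for a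
      using dc[OF that] frechet_derivative_works by blast
    then have "((\<lambda>x. \<Sum>a\<in>UNIV. \<phi> x $ a *\<^sub>R axis a (1::real)) has_derivative
        (\<lambda>v. \<Sum>a\<in>UNIV. frechet_derivative (\<lambda>x. \<phi> x $ a) (at x) v *\<^sub>R axis a 1)) (at x)"
      by (intro has_derivative_sum has_derivative_scaleR_left)
    then have "((\<lambda>x. \<chi> a. \<phi> x $ a) has_derivative \<phi>' x) (at x)"
      unfolding \<phi>'_def by (simp only: sum_axis)
    then show ?thesis by (simp only: vec_lambda_eta)
  qed
  have mat: "matrix (\<phi>' (coords c p)) = (\<chi> a i. jac d c p a i)" for p
    by (simp add: matrix_def \<phi>'_def vec_eq_iff jac_def chart_pd_def pd_def comp)
  have eqh: "\<bar>det (matrix (\<phi>' x))\<bar> * h (\<phi> x) = in_chart c (\<lambda>p. g p * \<mu> c p) x" if x: "x \<in> U" for x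
  proof -
    obtain p where p: "p \<in> cdom c" "p \<in> cdom d" "x = coords c p" using x by (auto simp: U_def)
    have "h (\<phi> x) = g' p * \<mu> d p" using p by (simp add: \<phi>p h_def)
    then show ?thesis
      using p eq[OF p(1,2)] \<mu>_transform[OF cd(2,1) p(2,1)] by (simp add: mat)
  qed
  have sub: "(LINT x:cimage e|lborel. f x) = (LINT x:coords e ` ?W|lborel. f x)"
    if "e = c \<or> e = d" "\<And>x. x \<in> cimage e \<Longrightarrow> x \<notin> coords e ` K \<Longrightarrow> f x = 0" for e and f :: "real^'n \<Rightarrow> real"
  proof -
    have "indicator (cimage e) x *\<^sub>R f x = indicator (coords e ` ?W) x *\<^sub>R f x" for x
    proof -
      have "coords e ` K \<subseteq> coords e ` ?W" "coords e ` ?W \<subseteq> cimage e" using that(1) K(2) by auto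
      then show ?thesis using that(2)[of x] by (auto simp: indicator_def)
    qed
    then show ?thesis unfolding set_lebesgue_integral_def by (simp only:)
  qed
  have zc: "in_chart c (\<lambda>p. g p * \<mu> c p) x = 0" if "x \<in> cimage c" "x \<notin> coords c ` K" for x
    by (rule zero_outside[OF cd(1) g(2) that])
  have zd: "h x = 0" if "x \<in> cimage d" "x \<notin> coords d ` K" for x
    unfolding h_def by (rule zero_outside[OF cd(2) g'(2) that])
  have hint: "set_integrable lborel (coords d ` ?W) h"
  proof (rule set_integrable_subset)
    show "set_integrable lborel (cimage d) h"
      unfolding h_def using K by (intro cint_integrable[OF cd(2) K(1) _ g'(1) g'(2)]) auto
  qed (use D.open_image in auto)
  have gint: "set_integrable lborel U (\<lambda>x. \<bar>det (matrix (\<phi>' x))\<bar> * h (\<phi> x))"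
  proof -
    have "set_integrable lborel (cimage c) (in_chart c (\<lambda>p. g p * \<mu> c p))"
      using K by (intro cint_integrable[OF cd(1) K(1) _ g(1) g(2)]) auto
    then have "set_integrable lborel U (in_chart c (\<lambda>p. g p * \<mu> c p))"
      by (rule set_integrable_subset) (use U in \<open>auto simp: U_def\<close>)
    moreover have "indicator U x *\<^sub>R (\<bar>det (matrix (\<phi>' x))\<bar> * h (\<phi> x)) = indicator U x *\<^sub>R in_chart c (\<lambda>p. g p * \<mu> c p) x" for x
      using eqh[of x] by (auto simp: indicator_def)
    ultimately show ?thesis unfolding set_integrable_def by (simp only:)
  qed
  have "cint d g' = (LINT y:\<phi> ` U|lborel. h y)"
    unfolding cint_def im h_def[symmetric] by (rule sub) (use zd in auto)
  also have "\<dots> = (LINT x:U|lborel. \<bar>det (matrix (\<phi>' x))\<bar> * h (\<phi> x))"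
    by (rule integral_transformation[OF U der inj]) (use hint gint in \<open>simp_all add: im\<close>)
  also have "\<dots> = (LINT x:U|lborel. in_chart c (\<lambda>p. g p * \<mu> c p) x)"
    using eqh U by (intro set_lebesgue_integral_cong) auto
  also have "\<dots> = cint c g"
    unfolding cint_def U_def by (rule sub[symmetric]) (use zc in auto)
  finally show ?thesis ..
qed

lemma tensor_chart_cont: "tensor_field A 0 0 F \<Longrightarrow> c \<in> A \<Longrightarrow> chart_cont c (\<lambda>p. F c p [] [])"
  using smf_cont tensor_field_smf[of 0 F c "[]"] by auto

lemma \<rho>_tensor_cont: "c \<in> CC \<Longrightarrow> tensor_field A 0 0 F \<Longrightarrow> chart_cont c (\<lambda>p. \<rho> c p * F c p [] [])"
  by (rule chart_cont_mult[OF smf_cont[OF \<rho>_smf[OF _ CC_A]] tensor_chart_cont[OF _ CC_A]])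

lemma integral_cong:
  assumes "\<And>c p. c \<in> A \<Longrightarrow> p \<in> cdom c \<Longrightarrow> F c p [] [] = G c p [] []"
  shows "integral_\<Omega>n A \<Omega> F = integral_\<Omega>n A \<Omega> G"
  unfolding integral_eq by (intro sum.cong refl cint_cong CC_A) (simp_all add: assms CC_A)

lemma integral_add:
  assumes "tensor_field A 0 0 F" "tensor_field A 0 0 G"
  shows "integral_\<Omega>n A \<Omega> (tadd F G) = integral_\<Omega>n A \<Omega> F + integral_\<Omega>n A \<Omega> G"
  unfolding integral_eq sum.distrib[symmetric] tadd_def distrib_left
proof (intro sum.cong refl)
  fix c assume c: "c \<in> CC"
  show "cint c (\<lambda>p. \<rho> c p * F c p [] [] + \<rho> c p * G c p [] [])
     = cint c (\<lambda>p. \<rho> c p * F c p [] []) + cint c (\<lambda>p. \<rho> c p * G c p [] [])"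
    by (rule cint_add[OF CC_A[OF c] closed_supp supp_cdom[OF c]])
      (use \<rho>_zero[of _ c] \<rho>_tensor_cont[OF c assms(1)] \<rho>_tensor_cont[OF c assms(2)] in auto)
qed

lemma integral_tscale: "integral_\<Omega>n A \<Omega> (tscale r F) = r * integral_\<Omega>n A \<Omega> F"
proof -
  have "cint c (\<lambda>p. \<rho> c p * tscale r F c p [] []) = r * cint c (\<lambda>p. \<rho> c p * F c p [] [])" for c
    unfolding cint_cmult[symmetric] tscale_def by (simp add: ac_simps)
  then show ?thesis unfolding integral_eq by (simp add: sum_distrib_left)
qed

text \<open>The divergence theorem. In each chart \<open>\<mu>\<close> times a divergence is a sum of coordinate
  derivatives; the terms with derivatives of the partition of unity are moved to one chart, where
  they cancel.\<close>

lemma integral_diverg: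
  assumes \<Gamma>: "\<Gamma> \<in> SConn A \<Omega>" and \<gamma>: "tensor_field A 0 (Suc 0) \<gamma>"
  shows "integral_\<Omega>n A \<Omega> (diverg \<Omega> \<Gamma> \<gamma>) = 0"
proof -
  interpret S: symplectic_connection A \<Omega> n \<Gamma> by unfold_locales (rule \<Gamma>)
  define X where "X = (\<lambda>c a p. \<Sum>i\<in>UNIV. \<omega> c p i a * \<gamma> c p [] [i])"
  define R :: "('m, 'n) chart \<Rightarrow> ('m, 'n) tensor" where "R = (\<lambda>c d p us ls. \<rho> c p)"
  \<comment> \<open>\<open>S c\<close> is the derivative of \<open>\<rho> c\<close> along the vector field \<open>X\<close> dual to \<open>\<gamma>\<close>.\<close>
  define S where "S = (\<lambda>c. full_contraction \<Omega> 1 \<gamma> (cov \<Gamma> (R c)))"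
  have \<gamma>s: "smf c (cdom c) (\<lambda>p. \<gamma> c p [] [i])" if "c \<in> A" for c i
    using tensor_field_smf[OF \<gamma> that, of "[i]"] by (simp add: idx_def)
  have Xs: "smf c (cdom c) (X c a)" if "c \<in> A" for c a
    unfolding X_def by (intro chart_domain.smf_sum[OF chart_domain_cdom] chart_domain.smf_mult[OF chart_domain_cdom] \<omega>_smf \<gamma>s that)
  have R: "tensor_field A 0 0 (R c)" if "c \<in> CC" for c
    by (rule tensor_fieldI) (use \<rho>_smf that in \<open>auto simp: R_def\<close>)
  have St: "tensor_field A 0 0 (S c)" if "c \<in> CC" for c
    unfolding S_def using tensor_field_cov[OF S.aff R[OF that]] \<gamma> by (intro tensor_field_full_contraction) auto
  have S_eq: "S c d p us ls = (\<Sum>a\<in>UNIV. X d a p * chart_pd d a (\<rho> c) p)" for c d p us ls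
  proof -
    have "S c d p us ls = (\<Sum>i\<in>UNIV. \<Sum>a\<in>UNIV. \<omega> d p i a * (\<gamma> d p [] [i] * chart_pd d a (\<rho> c) p))"
      unfolding S_def full_contraction_fcf One_nat_def fcf_Suc by (simp add: cov_Cons R_def)
    also have "\<dots> = (\<Sum>a\<in>UNIV. \<Sum>i\<in>UNIV. \<omega> d p i a * (\<gamma> d p [] [i] * chart_pd d a (\<rho> c) p))"
      by (rule sum.swap)
    finally show ?thesis by (simp add: X_def sum_distrib_right mult.assoc)
  qed
  have S_zero: "S c d p [] [] = 0" if "c \<in> CC" "d \<in> A" "p \<in> cdom d" "p \<notin> supp c" for c d p
  proof -
    let ?V = "cdom d - supp c"
    have V: "open ?V" using open_cdom[OF that(2)] closed_supp by blast
    interpret D: chart_domain d ?V using chart_domainI[OF that(2) V] by blast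
    have "chart_pd d a (\<rho> c) p = chart_pd d a (\<lambda>p. 0) p" for a
      using that \<rho>_zero by (intro D.chart_pd_cong) auto
    then show ?thesis unfolding S_eq by simp
  qed
  have S_sum: "(\<Sum>c\<in>CC. S c d p [] []) = 0" if d: "d \<in> A" "p \<in> cdom d" for d p
  proof -
    interpret D: chart_domain d "cdom d" using chart_domain_cdom d by blast
    have "(\<Sum>c\<in>CC. chart_pd d a (\<rho> c) p) = chart_pd d a (\<lambda>p. \<Sum>c\<in>CC. \<rho> c p) p" for a
      using \<rho>_smf d by (intro D.chart_pd_sum[symmetric]) auto
    then have "(\<Sum>c\<in>CC. chart_pd d a (\<rho> c) p) = 0" for a by (simp add: \<rho>_sum)
    moreover have "(\<Sum>c\<in>CC. S c d p [] []) = (\<Sum>a\<in>UNIV. X d a p * (\<Sum>c\<in>CC. chart_pd d a (\<rho> c) p))"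
      unfolding S_eq by (subst sum.swap) (simp add: sum_distrib_left)
    ultimately show ?thesis by simp
  qed
  have Scont: "chart_cont d (\<lambda>p. S c d p [] [])" if "c \<in> CC" "d \<in> A" for c d
    by (rule tensor_chart_cont[OF St[OF that(1)] that(2)])
  have \<rho>cont: "chart_cont d (\<rho> c)" if "c \<in> CC" "d \<in> A" for c d by (rule smf_cont[OF \<rho>_smf[OF that]])
  \<comment> \<open>The divergence of \<open>\<rho> c \<gamma>\<close> integrates to zero in the chart \<open>c\<close>.\<close>
  have parts: "cint c (\<lambda>p. \<rho> c p * diverg \<Omega> \<Gamma> \<gamma> c p [] []) = - cint c (\<lambda>p. S c c p [] [])" if c: "c \<in> CC" for c
  proof -
    have cA: "c \<in> A" by (rule CC_A[OF c])
    interpret C: chart_conn c "cdom c" \<Gamma> using S.chart_conn_cdom cA by blast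
    let ?tr = "\<lambda>a p. \<Sum>b\<in>UNIV. \<Gamma> c p a b b"
    have L0: "cint c (\<lambda>p. chart_pd c a F p + F p * ?tr a p) = 0"
      if F: "smf c (cdom c) F" and F0: "\<And>p. p \<in> cdom c \<Longrightarrow> p \<notin> supp c \<Longrightarrow> F p = 0" for F a
    proof -
      let ?h = "in_chart c (\<lambda>p. F p * \<mu> c p)"
      have hm: "?h = (\<lambda>x. in_chart c F x * in_chart c (\<mu> c) x)" by (rule ext) (simp add: in_chart_def)
      have d: "?h differentiable (at x)" and pd: "pd a ?h x = in_chart c (\<lambda>p. (chart_pd c a F p + F p * ?tr a p) * \<mu> c p) x"
        if x: "x \<in> cimage c" for x
      proof -
        obtain p where p: "p \<in> cdom c" "x = coords c p" using x by blast
        note d1 = in_chart_differentiable[OF cA F x] and d2 = S.pd_abs_PF(1)[OF cA p(1), folded p(2)]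
        show "?h differentiable (at x)" unfolding hm by (rule differentiable_mult[OF d1 d2])
        have "pd a ?h x = chart_pd c a F p * \<mu> c p + F p * chart_pd c a (\<mu> c) p"
          unfolding hm pd_mult[OF d1 d2] using p by (simp add: chart_pd_def)
        then show "pd a ?h x = in_chart c (\<lambda>p. (chart_pd c a F p + F p * ?tr a p) * \<mu> c p) x"
          unfolding S.pd_abs_PF(2)[OF cA p(1)] using p by (simp add: algebra_simps)
      qed
      have "(LINT x:cimage c|lborel. pd a ?h x) = 0"
      proof (rule integral_pd_zero_extension[OF open_cimage[OF cA] d _ compact_coords[OF cA closed_supp supp_cdom[OF c]]])
        have "chart_cont c (\<lambda>p. (chart_pd c a F p + F p * ?tr a p) * \<mu> c p)"
          by (intro chart_cont_mult \<mu>_cont cA smf_cont C.smf_add C.smf_mult C.smf_sum C.smf_chart_pd F C.\<Gamma>_smf)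
        then show "continuous_on (cimage c) (pd a ?h)"
          unfolding chart_cont_def by (rule continuous_on_eq) (simp add: pd)
        show "?h x = 0" if "x \<in> cimage c" "x \<notin> coords c ` supp c" for x
          by (rule zero_outside[OF cA F0 that])
      qed
      moreover have "cint c (\<lambda>p. chart_pd c a F p + F p * ?tr a p) = (LINT x:cimage c|lborel. pd a ?h x)"
        unfolding cint_def using pd open_cimage[OF cA] by (intro set_lebesgue_integral_cong) auto
      ultimately show ?thesis by simp
    qed
    have div: "diverg \<Omega> \<Gamma> \<gamma> c p [] [] = (\<Sum>a\<in>UNIV. chart_pd c a (X c a) p + X c a p * ?tr a p)" if p: "p \<in> cdom c" for p
    proof -
      have "(\<Sum>a\<in>UNIV. chart_pd c a (X c a) p) = (\<Sum>a\<in>UNIV. \<Sum>i\<in>UNIV. chart_pd c a (\<lambda>p. \<omega> c p i a) p * \<gamma> c p [] [i]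
          + \<omega> c p i a * chart_pd c a (\<lambda>p. \<gamma> c p [] [i]) p)"
        unfolding X_def using p
        by (intro sum.cong refl) (subst C.chart_pd_sum, auto intro!: C.smf_mult \<omega>_smf \<gamma>s cA sum.cong C.chart_pd_mult)
      also have "\<dots> = (\<Sum>a\<in>UNIV. \<Sum>i\<in>UNIV. \<omega> c p i a * chart_pd c a (\<lambda>p. \<gamma> c p [] [i]) p)
         - (\<Sum>a\<in>UNIV. \<Sum>i\<in>UNIV. (\<Sum>l\<in>UNIV. \<Gamma> c p a l i * \<omega> c p l a) * \<gamma> c p [] [i])
         - (\<Sum>a\<in>UNIV. \<Sum>i\<in>UNIV. (\<Sum>l\<in>UNIV. \<Gamma> c p a l a * \<omega> c p i l) * \<gamma> c p [] [i])"
        unfolding S.pd_\<omega>[OF cA p] by (simp add: sum.distrib sum_subtractf sum_negf left_diff_distrib)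
      also have "(\<Sum>a\<in>UNIV. \<Sum>i\<in>UNIV. (\<Sum>l\<in>UNIV. \<Gamma> c p a l i * \<omega> c p l a) * \<gamma> c p [] [i])
         = (\<Sum>a\<in>UNIV. \<Sum>i\<in>UNIV. \<omega> c p i a * (\<Sum>l\<in>UNIV. \<Gamma> c p a i l * \<gamma> c p [] [l]))"
      proof (rule sum.cong[OF refl])
        fix a
        show "(\<Sum>i\<in>UNIV. (\<Sum>l\<in>UNIV. \<Gamma> c p a l i * \<omega> c p l a) * \<gamma> c p [] [i])
          = (\<Sum>i\<in>UNIV. \<omega> c p i a * (\<Sum>l\<in>UNIV. \<Gamma> c p a i l * \<gamma> c p [] [l]))"
          by (simp add: sum_distrib_left sum_distrib_right ac_simps) (rule sum.swap)
      qed
      also have "(\<Sum>a\<in>UNIV. \<Sum>i\<in>UNIV. (\<Sum>l\<in>UNIV. \<Gamma> c p a l a * \<omega> c p i l) * \<gamma> c p [] [i])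
         = (\<Sum>a\<in>UNIV. X c a p * ?tr a p)"
      proof -
        have "(\<Sum>a\<in>UNIV. \<Sum>i\<in>UNIV. (\<Sum>l\<in>UNIV. \<Gamma> c p a l a * \<omega> c p i l) * \<gamma> c p [] [i])
          = (\<Sum>a\<in>UNIV. \<Sum>i\<in>UNIV. \<Sum>l\<in>UNIV. \<Gamma> c p a l a * (\<omega> c p i l * \<gamma> c p [] [i]))"
          by (simp add: sum_distrib_right mult.assoc)
        also have "\<dots> = (\<Sum>a\<in>UNIV. \<Sum>l\<in>UNIV. \<Sum>i\<in>UNIV. \<Gamma> c p a l a * (\<omega> c p i l * \<gamma> c p [] [i]))"
          by (rule sum.cong[OF refl], rule sum.swap)
        also have "\<dots> = (\<Sum>l\<in>UNIV. \<Sum>a\<in>UNIV. \<Sum>i\<in>UNIV. \<Gamma> c p a l a * (\<omega> c p i l * \<gamma> c p [] [i]))"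
          by (rule sum.swap)
        also have "\<dots> = (\<Sum>l\<in>UNIV. (\<Sum>a\<in>UNIV. \<Gamma> c p a l a) * X c l p)"
          by (simp add: X_def sum_product)
        also have "\<dots> = (\<Sum>a\<in>UNIV. X c a p * ?tr a p)"
        proof (rule sum.cong[OF refl])
          fix l
          have "(\<Sum>a\<in>UNIV. \<Gamma> c p a l a) = ?tr l p"
            using S.torsion_free[OF cA p] by (intro sum.cong) auto
          then show "(\<Sum>a\<in>UNIV. \<Gamma> c p a l a) * X c l p = X c l p * ?tr l p" by simp
        qed
        finally show ?thesis .
      qed
      finally have 1: "(\<Sum>a\<in>UNIV. chart_pd c a (X c a) p + X c a p * ?tr a p)
          = (\<Sum>a\<in>UNIV. \<Sum>i\<in>UNIV. \<omega> c p i a * (chart_pd c a (\<lambda>p. \<gamma> c p [] [i]) p - (\<Sum>l\<in>UNIV. \<Gamma> c p a i l * \<gamma> c p [] [l])))"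
        by (simp add: sum.distrib right_diff_distrib sum_subtractf)
      show ?thesis unfolding 1 diverg_def ctr_def by (subst sum.swap) (simp add: cov_Cons)
    qed
    have "(\<Sum>a\<in>UNIV. cint c (\<lambda>p. chart_pd c a (\<lambda>p. \<rho> c p * X c a p) p + (\<rho> c p * X c a p) * ?tr a p)) = 0"
      using \<rho>_smf[OF c cA] Xs[OF cA] \<rho>_zero[of _ c] by (intro sum.neutral ballI L0) (auto intro!: C.smf_mult)
    also have "(\<Sum>a\<in>UNIV. cint c (\<lambda>p. chart_pd c a (\<lambda>p. \<rho> c p * X c a p) p + (\<rho> c p * X c a p) * ?tr a p))
      = cint c (\<lambda>p. \<Sum>a\<in>UNIV. chart_pd c a (\<lambda>p. \<rho> c p * X c a p) p + (\<rho> c p * X c a p) * ?tr a p)"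
    proof (rule cint_sum[symmetric, OF cA closed_supp supp_cdom[OF c]])
      show "chart_cont c (\<lambda>p. chart_pd c a (\<lambda>p. \<rho> c p * X c a p) p + (\<rho> c p * X c a p) * ?tr a p)" for a
        by (intro smf_cont C.smf_add C.smf_mult C.smf_sum C.smf_chart_pd C.\<Gamma>_smf \<rho>_smf c cA Xs)
      fix a p assume p: "p \<in> cdom c" "p \<notin> supp c"
      let ?V = "cdom c - supp c"
      have V: "open ?V" using open_cdom[OF cA] closed_supp by blast
      interpret V: chart_domain c ?V using chart_domainI[OF cA V] by blast
      have "chart_pd c a (\<lambda>p. \<rho> c p * X c a p) p = chart_pd c a (\<lambda>p. 0) p"
        using p \<rho>_zero by (intro V.chart_pd_cong) auto
      then show "chart_pd c a (\<lambda>p. \<rho> c p * X c a p) p + (\<rho> c p * X c a p) * ?tr a p = 0"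
        using \<rho>_zero[OF p(2)] by simp
    qed
    also have "\<dots> = cint c (\<lambda>p. S c c p [] [] + \<rho> c p * diverg \<Omega> \<Gamma> \<gamma> c p [] [])"
    proof (rule cint_cong[OF cA])
      fix p assume p: "p \<in> cdom c"
      show "(\<Sum>a\<in>UNIV. chart_pd c a (\<lambda>p. \<rho> c p * X c a p) p + (\<rho> c p * X c a p) * ?tr a p)
        = S c c p [] [] + \<rho> c p * diverg \<Omega> \<Gamma> \<gamma> c p [] []"
        unfolding C.chart_pd_mult[OF \<rho>_smf[OF c cA] Xs[OF cA] p] S_eq div[OF p]
        by (simp add: sum.distrib sum_distrib_left algebra_simps)
    qed
    also have "\<dots> = cint c (\<lambda>p. S c c p [] []) + cint c (\<lambda>p. \<rho> c p * diverg \<Omega> \<Gamma> \<gamma> c p [] [])"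
    proof (rule cint_add[OF cA closed_supp supp_cdom[OF c] Scont[OF c cA]])
      have "tensor_field A 0 0 (diverg \<Omega> \<Gamma> \<gamma>)"
        unfolding diverg_def by (intro tensor_field_ctr tensor_field_cov S.aff \<gamma>)
      then show "chart_cont c (\<lambda>p. \<rho> c p * diverg \<Omega> \<Gamma> \<gamma> c p [] [])"
        using cA c by (intro chart_cont_mult \<rho>cont tensor_chart_cont)
    qed (use S_zero[OF c cA] \<rho>_zero[of _ c] in auto)
    finally show ?thesis by simp
  qed
  \<comment> \<open>Inserting \<open>\<Sum> \<rho> d = 1\<close> moves the integral of \<open>\<rho> d S c\<close> to the chart \<open>d\<close>, where summation over \<open>c\<close>
    gives the derivative of the constant \<open>\<Sum> \<rho> c\<close>.\<close>
  have "(\<Sum>c\<in>CC. cint c (\<lambda>p. S c c p [] [])) = (\<Sum>c\<in>CC. \<Sum>d\<in>CC. cint c (\<lambda>p. \<rho> d p * S c c p [] []))"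
  proof (rule sum.cong[OF refl])
    fix c assume c: "c \<in> CC"
    have "cint c (\<lambda>p. S c c p [] []) = cint c (\<lambda>p. \<Sum>d\<in>CC. \<rho> d p * S c c p [] [])"
      unfolding sum_distrib_right[symmetric] \<rho>_sum by simp
    also have "\<dots> = (\<Sum>d\<in>CC. cint c (\<lambda>p. \<rho> d p * S c c p [] []))"
      using S_zero[OF c CC_A[OF c]] c
      by (intro cint_sum[OF CC_A[OF c] closed_supp supp_cdom[OF c]] chart_cont_mult \<rho>cont Scont CC_A) auto
    finally show "cint c (\<lambda>p. S c c p [] []) = (\<Sum>d\<in>CC. cint c (\<lambda>p. \<rho> d p * S c c p [] []))" .
  qed
  also have "\<dots> = (\<Sum>c\<in>CC. \<Sum>d\<in>CC. cint d (\<lambda>p. \<rho> d p * S c d p [] []))"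
  proof (intro sum.cong refl)
    fix c d assume c: "c \<in> CC" and d: "d \<in> CC"
    note cA = CC_A[OF c] and dA = CC_A[OF d]
    show "cint c (\<lambda>p. \<rho> d p * S c c p [] []) = cint d (\<lambda>p. \<rho> d p * S c d p [] [])"
    proof (rule cint_transition[OF cA dA, of "supp c \<inter> supp d"])
      show "closed (supp c \<inter> supp d)" by (intro closed_Int closed_supp)
      show "supp c \<inter> supp d \<subseteq> cdom c \<inter> cdom d" using supp_cdom[OF c] supp_cdom[OF d] by blast
      show "\<rho> d p * S c c p [] [] = \<rho> d p * S c d p [] []" if "p \<in> cdom c" "p \<in> cdom d" for p
        using tensor_field_tr[OF St[OF c] cA dA that, of "[]"] by simp
      show "chart_cont c (\<lambda>p. \<rho> d p * S c c p [] [])" by (intro chart_cont_mult \<rho>cont Scont c d cA)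
      show "chart_cont d (\<lambda>p. \<rho> d p * S c d p [] [])" by (intro chart_cont_mult \<rho>cont Scont c d dA)
    qed (use S_zero[OF c cA] S_zero[OF c dA] \<rho>_zero[of _ d] in auto)
  qed
  also have "\<dots> = (\<Sum>d\<in>CC. \<Sum>c\<in>CC. cint d (\<lambda>p. \<rho> d p * S c d p [] []))" by (rule sum.swap)
  also have "\<dots> = 0"
  proof (rule sum.neutral, rule ballI)
    fix d assume d: "d \<in> CC"
    note dA = CC_A[OF d]
    have "(\<Sum>c\<in>CC. cint d (\<lambda>p. \<rho> d p * S c d p [] [])) = cint d (\<lambda>p. \<Sum>c\<in>CC. \<rho> d p * S c d p [] [])"
      using \<rho>_zero[of _ d] d dA
      by (intro cint_sum[symmetric, OF dA closed_supp supp_cdom[OF d]] chart_cont_mult \<rho>cont Scont) auto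
    also have "\<dots> = cint d (\<lambda>p. 0)"
      using S_sum[OF dA] by (intro cint_cong[OF dA]) (simp add: sum_distrib_left[symmetric])
    finally show "(\<Sum>c\<in>CC. cint d (\<lambda>p. \<rho> d p * S c d p [] [])) = 0" by (simp add: cint_zero)
  qed
  finally show ?thesis unfolding integral_eq by (simp add: parts sum_negf)
qed

text \<open>All terms of the partition are nonnegative and continuous, and \<open>\<mu>\<close> is positive.\<close>

lemma integral_nonneg_zero:
  assumes F: "tensor_field A 0 0 F" and nonneg: "\<And>c p. c \<in> A \<Longrightarrow> p \<in> cdom c \<Longrightarrow> 0 \<le> F c p [] []"
    and zero: "integral_\<Omega>n A \<Omega> F = 0" and cp: "c \<in> A" "p \<in> cdom c"
  shows "F c p [] [] = 0"
proof -
  let ?g = "\<lambda>d p. \<rho> d p * F d p [] []"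
  have cont: "chart_cont d (?g d)" if "d \<in> CC" for d
    using that CC_A by (intro chart_cont_mult smf_cont \<rho>_smf tensor_chart_cont F) auto
  have H: "continuous_on UNIV (\<lambda>x. indicator (cimage d) x *\<^sub>R in_chart d (\<lambda>p. ?g d p * \<mu> d p) x)"
    "set_integrable lborel (cimage d) (in_chart d (\<lambda>p. ?g d p * \<mu> d p))"
    "\<And>x. 0 \<le> indicator (cimage d) x *\<^sub>R in_chart d (\<lambda>p. ?g d p * \<mu> d p) x" if d: "d \<in> CC" for d
  proof -
    have dA: "d \<in> A" using CC_A d by blast
    interpret D: chart_domain d "cdom d" using chart_domain_cdom dA by blast
    show "set_integrable lborel (cimage d) (in_chart d (\<lambda>p. ?g d p * \<mu> d p))"
      using \<rho>_zero[of _ d] by (intro cint_integrable[OF dA closed_supp supp_cdom[OF d] cont[OF d]]) auto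
    have z: "in_chart d (\<lambda>p. ?g d p * \<mu> d p) x = 0" if "x \<in> cimage d" "x \<notin> coords d ` supp d" for x
      by (rule zero_outside[OF dA _ that]) (simp add: \<rho>_zero)
    show "continuous_on UNIV (\<lambda>x. indicator (cimage d) x *\<^sub>R in_chart d (\<lambda>p. ?g d p * \<mu> d p) x)"
      using chart_cont_mult[OF cont[OF d] \<mu>_cont[OF dA]]
      by (intro zero_extension_continuous[OF open_cimage[OF dA] _ compact_coords[OF dA closed_supp supp_cdom[OF d]] z])
        (simp add: chart_cont_def)
    show "0 \<le> indicator (cimage d) x *\<^sub>R in_chart d (\<lambda>p. ?g d p * \<mu> d p) x" for x
    proof (cases "x \<in> cimage d")
      case True
      then obtain p where p: "p \<in> cdom d" "x = coords d p" by blast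
      have "0 \<le> ?g d p * \<mu> d p"
        using \<rho>_nonneg[OF d] nonneg[OF dA p(1)] \<mu>_pos[OF dA p(1)] by simp
      then show ?thesis using p by simp
    qed simp
  qed
  have ge: "0 \<le> cint d (?g d)" if "d \<in> CC" for d
    unfolding cint_def set_lebesgue_integral_def by (rule Bochner_Integration.integral_nonneg) (rule H(3)[OF that])
  have "\<forall>d\<in>CC. cint d (?g d) = 0"
    using zero ge unfolding integral_eq by (subst (asm) sum_nonneg_eq_0_iff[OF finite_CC]) auto
  moreover obtain d where d: "d \<in> CC" "\<rho> d p \<noteq> 0"
    using \<rho>_sum[of p] by (metis sum.not_neutral_contains_not_neutral zero_neq_one)
  ultimately have i0: "(\<integral>x. indicator (cimage d) x *\<^sub>R in_chart d (\<lambda>p. ?g d p * \<mu> d p) x \<partial>lborel) = 0"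
    by (simp add: cint_def set_lebesgue_integral_def)
  have dA: "d \<in> A" using CC_A d by blast
  interpret D: chart_domain d "cdom d" using chart_domain_cdom dA by blast
  have pd: "p \<in> cdom d" using \<rho>_zero[of p d] d supp_cdom[OF d(1)] by auto
  have "indicator (cimage d) (coords d p) *\<^sub>R in_chart d (\<lambda>p. ?g d p * \<mu> d p) (coords d p) = 0"
    by (rule continuous_nonneg_integral_zero[OF H(1)[OF d(1)] H(3)[OF d(1)] H(2)[OF d(1), unfolded set_integrable_def] i0])
  then have "?g d p * \<mu> d p = 0" using pd by simp
  then have "F d p [] [] = 0" using d \<mu>_pos[OF dA pd] by simp
  then show ?thesis using tensor_field_tr[OF F dA cp(1) pd cp(2), of "[]"] by simp
qed

text \<open>The integral of a polynomial family is a polynomial in \<open>\<epsilon>\<close>, with the integrals of the coefficients.\<close>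

lemma integral_has_derivative:
  assumes F: "\<And>c. c \<in> A \<Longrightarrow> polyf c (cdom c) (\<lambda>\<epsilon> p. F \<epsilon> c p [] [])"
    and F': "\<And>c p. c \<in> A \<Longrightarrow> p \<in> cdom c \<Longrightarrow> ((\<lambda>\<epsilon>. F \<epsilon> c p [] []) has_real_derivative F' c p [] []) (at 0)"
  shows "((\<lambda>\<epsilon>. integral_\<Omega>n A \<Omega> (F \<epsilon>)) has_real_derivative integral_\<Omega>n A \<Omega> F') (at 0)"
  unfolding integral_eq
proof (rule DERIV_sum)
  fix c assume c: "c \<in> CC"
  have cA: "c \<in> A" by (rule CC_A[OF c])
  interpret C: chart_domain c "cdom c" using chart_domain_cdom cA by blast
  obtain N G where G: "\<And>m. smf c (cdom c) (G m)"
    "\<And>M \<epsilon> p. M \<ge> N \<Longrightarrow> p \<in> cdom c \<Longrightarrow> F \<epsilon> c p [] [] = (\<Sum>m\<le>M. G m p * \<epsilon> ^ m)"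
    using C.polyf_obtain[OF F[OF cA]] by metis
  note deriv = C.polynomial_derivative_0[where N = N]
  have eq: "cint c (\<lambda>p. \<rho> c p * F \<epsilon> c p [] []) = (\<Sum>m\<le>Suc N. cint c (\<lambda>p. \<rho> c p * G m p) * \<epsilon> ^ m)" for \<epsilon>
  proof -
    have "cint c (\<lambda>p. \<rho> c p * F \<epsilon> c p [] []) = cint c (\<lambda>p. \<Sum>m\<le>Suc N. \<epsilon> ^ m * (\<rho> c p * G m p))"
      using G(2)[of "Suc N"] by (intro cint_cong[OF cA]) (simp add: sum_distrib_left ac_simps del: sum.atMost_Suc)
    also have "\<dots> = (\<Sum>m\<le>Suc N. cint c (\<lambda>p. \<epsilon> ^ m * (\<rho> c p * G m p)))"
      using \<rho>_zero[of _ c] c cA G(1)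
      by (intro cint_sum[OF cA closed_supp supp_cdom[OF c]] chart_cont_mult chart_cont_const smf_cont \<rho>_smf) auto
    finally show ?thesis unfolding cint_cmult by (simp add: mult.commute)
  qed
  have "F' c p [] [] = G 1 p" if p: "p \<in> cdom c" for p
  proof (rule DERIV_unique[OF F'[OF cA p]])
    have "(\<lambda>\<epsilon>. F \<epsilon> c p [] []) = (\<lambda>\<epsilon>. \<Sum>m\<le>Suc N. G m p * \<epsilon> ^ m)" using G(2)[OF _ p, of "Suc N"] by auto
    then show "((\<lambda>\<epsilon>. F \<epsilon> c p [] []) has_real_derivative G 1 p) (at 0)" using deriv[of "\<lambda>m. G m p"] by (simp only:)
  qed
  then have "cint c (\<lambda>p. \<rho> c p * F' c p [] []) = cint c (\<lambda>p. \<rho> c p * G 1 p)"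
    by (intro cint_cong[OF cA]) simp
  then show "((\<lambda>\<epsilon>. cint c (\<lambda>p. \<rho> c p * F \<epsilon> c p [] [])) has_real_derivative cint c (\<lambda>p. \<rho> c p * F' c p [] [])) (at 0)"
    unfolding eq using deriv[of "\<lambda>m. cint c (\<lambda>p. \<rho> c p * G m p)"] by (simp only: \<open>cint c (\<lambda>p. \<rho> c p * F' c p [] []) = cint c (\<lambda>p. \<rho> c p * G 1 p)\<close>)
qed

end

section \<open>The variational identity\<close>

context symplectic_connection
begin

lemma tensor_field_diverg: "tensor_field A 0 (Suc k) T \<Longrightarrow> tensor_field A 0 k (diverg \<Omega> \<Gamma> T)"
  unfolding diverg_def by (intro tensor_field_ctr tensor_field_cov aff)

lemma cov_sym_last':
  assumes "\<And>p i j k. p \<in> cdom c \<Longrightarrow> T c p [] [i, j, k] = T c p [] [i, k, j]" and cp: "c \<in> A" "p \<in> cdom c"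
  shows "cov \<Gamma> T c p [] [a, i, j, k] = cov \<Gamma> T c p [] [a, i, k, j]"
proof -
  interpret C: chart_conn c "cdom c" \<Gamma> using chart_conn_cdom cp by blast
  have "chart_pd c a (\<lambda>p. T c p [] [i, j, k]) p = chart_pd c a (\<lambda>p. T c p [] [i, k, j]) p"
    using assms(1) by (intro C.chart_pd_cong cp) auto
  moreover have "(\<Sum>l\<in>UNIV. G l * T c p [] [l, j, k]) = (\<Sum>l\<in>UNIV. G l * T c p [] [l, k, j])"
    "(\<Sum>l\<in>UNIV. G l * T c p [] [i, l, k]) = (\<Sum>l\<in>UNIV. G l * T c p [] [i, k, l])"
    "(\<Sum>l\<in>UNIV. G l * T c p [] [i, j, l]) = (\<Sum>l\<in>UNIV. G l * T c p [] [i, l, j])" for G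
    using assms(1)[OF cp(2)] by (auto intro!: sum.cong)
  ultimately show ?thesis unfolding cov_Cons dop_Cons dop_Nil by simp
qed

lemma \<K>_eq:
  assumes cp: "c \<in> A" "p \<in> cdom c"
  shows "\<K> \<Omega> \<Gamma> c p us ls = diverg \<Omega> \<Gamma> (diverg \<Omega> \<Gamma> (Ric \<Gamma>)) c p [] []
    - 1 / 2 * full_contraction \<Omega> 2 (Ric \<Gamma>) (Ric \<Gamma>) c p [] []
    + 1 / 4 * full_contraction \<Omega> 4 Riem Riem c p [] []"
proof -
  have "tensor_field A 0 (Suc (Suc 1)) (cov \<Gamma> (Ric \<Gamma>))"
    using tensor_field_cov[OF aff Ric_tensor] by (simp add: numeral_2_eq_2)
  then have s: "smf c (cdom c) (\<lambda>p. cov \<Gamma> (Ric \<Gamma>) c p [] ls)" if "ls \<in> idx (Suc (Suc 1))" for ls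
    using tensor_field_smf cp(1) that by blast
  let ?R = "\<lambda>a b i j. cov \<Gamma> (cov \<Gamma> (Ric \<Gamma>)) c p [] [a, b, i, j]"
  have sym: "?R a b i j = ?R a b j i" for a b i j
    using cov_sym_last'[of c "cov \<Gamma> (Ric \<Gamma>)" p a b i j] cov_sym_last[of c "Ric \<Gamma>"] Ric_sym[of c] cp by blast
  have "diverg \<Omega> \<Gamma> (diverg \<Omega> \<Gamma> (Ric \<Gamma>)) c p [] []
      = (\<Sum>i\<in>UNIV. \<Sum>a\<in>UNIV. \<omega> c p i a * (\<Sum>j\<in>UNIV. \<Sum>b\<in>UNIV. \<omega> c p j b * ?R a b j i))"
  proof -
    have "cov \<Gamma> (ctr \<Omega> (cov \<Gamma> (Ric \<Gamma>))) c p [] [a, i] = (\<Sum>j\<in>UNIV. \<Sum>b\<in>UNIV. \<omega> c p j b * ?R a b j i)" for a i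
      using cov_ctr[where T = "cov \<Gamma> (Ric \<Gamma>)" and k = 1 and ls = "[i]" and j = a, OF s cp] by (simp add: idx_def)
    then show ?thesis unfolding diverg_def ctr_def[of _ "cov \<Gamma> (ctr \<Omega> (cov \<Gamma> (Ric \<Gamma>)))"] by simp
  qed
  also have "\<dots> = (\<Sum>i\<in>UNIV. \<Sum>a\<in>UNIV. \<Sum>j\<in>UNIV. \<Sum>b\<in>UNIV. \<omega> c p i a * \<omega> c p j b * ?R a b i j)"
    unfolding sum_distrib_left using sym by (intro sum.cong refl) simp
  also have "\<dots> = (\<Sum>i\<in>UNIV. \<Sum>j\<in>UNIV. \<Sum>a\<in>UNIV. \<Sum>b\<in>UNIV. \<omega> c p i a * \<omega> c p j b * ?R a b i j)"
    by (rule sum.cong[OF refl], rule sum.swap)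
  finally show ?thesis unfolding \<K>_def full_contraction_fcf by simp
qed

lemma \<K>_tensor: "tensor_field A 0 0 (\<K> \<Omega> \<Gamma>)"
proof (rule tensor_field_cong)
  have "tensor_field A 0 0 (diverg \<Omega> \<Gamma> (diverg \<Omega> \<Gamma> (Ric \<Gamma>)))"
    using Ric_tensor by (intro tensor_field_diverg) (simp add: numeral_2_eq_2)
  then show "tensor_field A 0 0 (tadd (diverg \<Omega> \<Gamma> (diverg \<Omega> \<Gamma> (Ric \<Gamma>)))
     (tadd (tscale (- 1 / 2) (full_contraction \<Omega> 2 (Ric \<Gamma>) (Ric \<Gamma>))) (tscale (1 / 4) (full_contraction \<Omega> 4 Riem Riem))))"
    by (intro tensor_field_tadd tensor_field_tscale tensor_field_full_contraction Ric_tensor Riem_tensor)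
qed (auto simp: \<K>_eq tadd_def tscale_def)

text \<open>The contracted Bianchi identity turns the curvature term of \<open>\<H>(f)\<close> into a divergence. This is the form
  that results from integration by parts, and its summands are visibly tensors.\<close>

lemma \<H>_divergence:
  assumes f: "tensor_field A 0 0 f" and cp: "c \<in> A" "p \<in> cdom c"
  shows "\<H> \<Omega> \<Gamma> f c p us [i, j, k] = - cov \<Gamma> (cov \<Gamma> (cov \<Gamma> f)) c p [] [i, j, k]
    - diverg \<Omega> \<Gamma> (tmul f Riem) c p [] [i, j, k] + f c p [] [] * cov \<Gamma> (Ric \<Gamma>) c p [] [i, j, k]"
proof -
  have fs: "smf c (cdom c) (\<lambda>p. f c p [] [])" using tensor_field_smf[OF f cp(1)] by simp
  let ?d = "\<lambda>r. cov \<Gamma> f c p [] [r]"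
  have "diverg \<Omega> \<Gamma> (tmul f Riem) c p [] [i, j, k]
     = (\<Sum>q\<in>UNIV. \<Sum>r\<in>UNIV. \<omega> c p q r * (?d r * Riem c p [] [q, i, j, k] + f c p [] [] * cov \<Gamma> Riem c p [] [r, q, i, j, k]))"
    unfolding diverg_def ctr_def cov_function
    by (simp add: cov_tmul[where f = f and T = Riem, OF fs Riem_smf[OF cp(1)] cp])
  also have "\<dots> = (\<Sum>q\<in>UNIV. \<Sum>r\<in>UNIV. \<omega> c p q r * ?d r * Riem c p [] [q, i, j, k])
      + f c p [] [] * diverg \<Omega> \<Gamma> Riem c p [] [i, j, k]"
    unfolding diverg_def ctr_def by (simp add: distrib_left sum.distrib sum_distrib_left ac_simps)
  also have "(\<Sum>q\<in>UNIV. \<Sum>r\<in>UNIV. \<omega> c p q r * ?d r * Riem c p [] [q, i, j, k])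
     = - (\<Sum>q\<in>UNIV. (\<Sum>r\<in>UNIV. \<omega> c p r q * ?d r) * Riem c p [] [q, i, j, k])"
  proof -
    have "\<omega> c p q r * ?d r * Riem c p [] [q, i, j, k] = - (\<omega> c p r q * ?d r * Riem c p [] [q, i, j, k])" for q r
      using \<omega>_skew[OF cp, of q r] by simp
    then have "(\<Sum>q\<in>UNIV. \<Sum>r\<in>UNIV. \<omega> c p q r * ?d r * Riem c p [] [q, i, j, k])
      = (\<Sum>q\<in>UNIV. \<Sum>r\<in>UNIV. - (\<omega> c p r q * ?d r * Riem c p [] [q, i, j, k]))"
      by (rule sum.cong[OF refl, OF sum.cong[OF refl]])
    then show ?thesis by (simp add: sum_negf sum_distrib_right)
  qed
  finally show ?thesis
    unfolding \<H>_eq[where f = f, OF fs cp] div_Riem[OF cp] by simp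
qed

lemma cov3_tensor: "tensor_field A 0 0 f \<Longrightarrow> tensor_field A 0 3 (cov \<Gamma> (cov \<Gamma> (cov \<Gamma> f)))"
  using tensor_field_cov[OF aff, of 2 "cov \<Gamma> (cov \<Gamma> f)"] tensor_field_cov[OF aff, of 1 "cov \<Gamma> f"] tensor_field_cov[OF aff, of 0 f]
  by (simp add: eval_nat_numeral)

lemma covRic_tensor: "tensor_field A 0 3 (cov \<Gamma> (Ric \<Gamma>))"
  using tensor_field_cov[OF aff Ric_tensor] by (simp add: eval_nat_numeral)

lemma \<H>_tensor:
  assumes f: "tensor_field A 0 0 f"
  shows "tensor_field A 0 3 (\<H> \<Omega> \<Gamma> f)"
proof (rule tensor_field_cong)
  have R: "tensor_field A 0 (Suc 3) Riem" using Riem_tensor by simp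
  show "tensor_field A 0 3 (tadd (tscale (- 1) (cov \<Gamma> (cov \<Gamma> (cov \<Gamma> f))))
     (tadd (tscale (- 1) (diverg \<Omega> \<Gamma> (tmul f Riem))) (tmul f (cov \<Gamma> (Ric \<Gamma>)))))"
    by (intro tensor_field_tadd tensor_field_tscale tensor_field_diverg tensor_field_tmul cov3_tensor covRic_tensor f R)
  fix c p and ls :: "'n list" assume cp: "c \<in> A" "p \<in> cdom c" and "ls \<in> idx 3"
  then show "tadd (tscale (- 1) (cov \<Gamma> (cov \<Gamma> (cov \<Gamma> f))))
     (tadd (tscale (- 1) (diverg \<Omega> \<Gamma> (tmul f Riem))) (tmul f (cov \<Gamma> (Ric \<Gamma>)))) c p [] ls = \<H> \<Omega> \<Gamma> f c p [] ls"
    by (elim idx3_cases) (simp add: \<H>_divergence[OF f cp] tadd_def tscale_def tmul_def)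
qed

end

lemma \<H>_const: "\<H> \<Omega> \<Gamma> (tconst r) = (\<lambda>c p us ls. 0)"
proof -
  have pd0: "chart_pd c i (\<lambda>q. r) p = 0" for c :: "('m, 'n::finite) chart" and i p and r :: real
  proof -
    have "in_chart c (\<lambda>q. r) = (\<lambda>x. r)" by (rule ext) (simp add: in_chart_def)
    then show ?thesis by (simp add: chart_pd_def)
  qed
  have X: "hamiltonian_field \<Omega> (tconst r) = (\<lambda>c p us ls. 0)" for \<Omega> :: "('m, 'n::finite) tensor"
    by (intro ext) (simp add: hamiltonian_field_def tconst_def pd0)
  have c0: "cov \<Gamma> (\<lambda>c p us ls. 0) = (\<lambda>c p us ls. 0)" for \<Gamma> :: "('m, 'n::finite) conn"
    by (intro ext) (simp add: cov_def pd0 split: list.splits)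
  show ?thesis by (intro ext) (simp add: \<H>_def lie_conn_def X c0)
qed

context compact_symplectic
begin

abbreviation Integ :: "('m, 'n) tensor \<Rightarrow> real" where "Integ \<equiv> integral_\<Omega>n A \<Omega>"

lemma Integ_zero: "(\<And>c p. c \<in> A \<Longrightarrow> p \<in> cdom c \<Longrightarrow> F c p [] [] = 0) \<Longrightarrow> Integ F = 0"
  using integral_cong[of F "tscale 0 F"] integral_tscale[of 0 F] by (simp add: tscale_def)

text \<open>The difference of the integrands is a divergence, by \<open>div_hook\<close>.\<close>

lemma integration_by_parts:
  assumes \<Gamma>: "\<Gamma> \<in> SConn A \<Omega>" and \<alpha>: "tensor_field A 0 k \<alpha>" and \<beta>: "tensor_field A 0 (Suc k) \<beta>"
  shows "Integ (full_contraction \<Omega> (Suc k) (cov \<Gamma> \<alpha>) \<beta>) = Integ (full_contraction \<Omega> k \<alpha> (diverg \<Omega> \<Gamma> \<beta>))"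
proof -
  interpret S: symplectic_connection A \<Omega> n \<Gamma> by unfold_locales (rule \<Gamma>)
  let ?L = "full_contraction \<Omega> (Suc k) (cov \<Gamma> \<alpha>) \<beta>" and ?R = "full_contraction \<Omega> k \<alpha> (diverg \<Omega> \<Gamma> \<beta>)"
  have L: "tensor_field A 0 0 ?L" by (intro tensor_field_full_contraction tensor_field_cov S.aff \<alpha> \<beta>)
  have R: "tensor_field A 0 0 ?R" by (intro tensor_field_full_contraction S.tensor_field_diverg \<alpha> \<beta>)
  have "0 = Integ (diverg \<Omega> \<Gamma> (hook \<Omega> k \<alpha> \<beta>))"
    by (rule integral_diverg[OF \<Gamma> tensor_field_hook[OF \<alpha> \<beta>], symmetric])
  also have "\<dots> = Integ (tadd ?R (tscale (- 1) ?L))"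
    using S.div_hook tensor_field_smf[OF \<alpha>] tensor_field_smf[OF \<beta>]
    by (intro integral_cong) (simp add: tadd_def tscale_def)
  also have "\<dots> = Integ ?R - Integ ?L"
    unfolding integral_add[OF R tensor_field_tscale[OF L]] integral_tscale by simp
  finally show ?thesis by simp
qed

text \<open>The functional \<open>\<integral> f K\<close>, in a form in which \<open>Ric\<close> is not differentiated.\<close>

definition weakK :: "('m, 'n) tensor \<Rightarrow> ('m, 'n) conn \<Rightarrow> ('m, 'n) tensor" where
  "weakK f \<Gamma> = tadd (full_contraction \<Omega> 2 (cov \<Gamma> (cov \<Gamma> f)) (Ric \<Gamma>))
     (tadd (tscale (- 1 / 2) (tmul f (full_contraction \<Omega> 2 (Ric \<Gamma>) (Ric \<Gamma>))))
       (tscale (1 / 4) (tmul f (full_contraction \<Omega> 4 (curv_low \<Omega> \<Gamma>) (curv_low \<Omega> \<Gamma>)))))"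

lemma integral_\<K>_weak:
  assumes \<Gamma>: "\<Gamma> \<in> SConn A \<Omega>" and f: "tensor_field A 0 0 f"
  shows "Integ (tmul f (\<K> \<Omega> \<Gamma>)) = Integ (weakK f \<Gamma>)"
proof -
  interpret S: symplectic_connection A \<Omega> n \<Gamma> by unfold_locales (rule \<Gamma>)
  let ?R = "Ric \<Gamma>"
  let ?H = "full_contraction \<Omega> 2 (cov \<Gamma> (cov \<Gamma> f)) ?R" and ?D = "full_contraction \<Omega> 0 f (diverg \<Omega> \<Gamma> (diverg \<Omega> \<Gamma> ?R))"
  let ?Q = "tadd (tscale (- 1 / 2) (tmul f (full_contraction \<Omega> 2 ?R ?R)))
       (tscale (1 / 4) (tmul f (full_contraction \<Omega> 4 S.Riem S.Riem)))"
  have R: "tensor_field A 0 (Suc (Suc 0)) ?R" using S.Ric_tensor by (simp add: numeral_2_eq_2)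
  have Q: "tensor_field A 0 0 ?Q"
    by (intro tensor_field_tadd tensor_field_tscale tensor_field_tmul tensor_field_full_contraction f S.Ric_tensor S.Riem_tensor)
  have D: "tensor_field A 0 0 ?D"
    by (intro tensor_field_full_contraction f S.tensor_field_diverg R)
  have H: "tensor_field A 0 0 ?H"
    unfolding numeral_2_eq_2 by (intro tensor_field_full_contraction tensor_field_cov S.aff f R)
  have "Integ (tmul f (\<K> \<Omega> \<Gamma>)) = Integ (tadd ?D ?Q)"
    by (intro integral_cong) (simp add: tmul_def tadd_def tscale_def S.\<K>_eq full_contraction_fcf algebra_simps)
  also have "\<dots> = Integ ?D + Integ ?Q" by (rule integral_add[OF D Q])
  also have "Integ ?D = Integ (full_contraction \<Omega> (Suc 0) (cov \<Gamma> f) (diverg \<Omega> \<Gamma> ?R))"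
    by (rule integration_by_parts[OF \<Gamma> f S.tensor_field_diverg[OF R], symmetric])
  also have "\<dots> = Integ (full_contraction \<Omega> (Suc (Suc 0)) (cov \<Gamma> (cov \<Gamma> f)) ?R)"
    by (rule integration_by_parts[OF \<Gamma> tensor_field_cov[OF S.aff f] R, symmetric])
  also have "\<dots> + Integ ?Q = Integ (tadd ?H ?Q)"
    using integral_add[OF H Q] by (simp add: numeral_2_eq_2)
  finally show ?thesis by (simp add: weakK_def)
qed

end

locale compact_variation = compact_symplectic A \<Omega> n + variation A \<Omega> n \<Gamma> P
  for A :: "('m::t2_space, 'n::finite) chart set" and \<Omega> n \<Gamma> P
begin

lemma P_tensor: "tensor_field A 0 3 P" using P by (rule Sk_tensor)

lemma P_tensor': "tensor_field A 0 (Suc 2) P" using P_tensor by simp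

lemma polyf_tmul:
  "tensor_field A 0 0 f \<Longrightarrow> c \<in> A \<Longrightarrow> polyf c (cdom c) (\<lambda>\<epsilon> p. F \<epsilon> c p us ls) \<Longrightarrow>
    polyf c (cdom c) (\<lambda>\<epsilon> p. tmul f (F \<epsilon>) c p us ls)"
  unfolding tmul_def using tensor_field_smf[of 0 f c "[]"]
  by (intro chart_domain.polyf_mult[OF chart_domain_cdom] chart_domain.polyf_smf[OF chart_domain_cdom]) auto

lemma polyf_weakK:
  assumes f: "tensor_field A 0 0 f" and c: "c \<in> A"
  shows "polyf c (cdom c) (\<lambda>\<epsilon> p. weakK f (\<Gamma>v \<epsilon>) c p [] [])"
proof -
  interpret C: chart_domain c "cdom c" using chart_domain_cdom c by blast
  have f0: "polyf c (cdom c) (\<lambda>\<epsilon> p. f c p [] ls)" if "ls \<in> idx 0" for ls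
    using tensor_field_smf[OF f c] that by (intro C.polyf_smf) auto
  have f1: "polyf c (cdom c) (\<lambda>\<epsilon> p. cov (\<Gamma>v \<epsilon>) f c p [] ls)" if "ls \<in> idx (Suc 0)" for ls
    by (rule polyf_cov[where T = "\<lambda>\<epsilon>. f", OF c f0 that])
  have f2: "polyf c (cdom c) (\<lambda>\<epsilon> p. cov (\<Gamma>v \<epsilon>) (cov (\<Gamma>v \<epsilon>) f) c p [] ls)" if "ls \<in> idx 2" for ls
  proof (rule polyf_cov[where T = "\<lambda>\<epsilon>. cov (\<Gamma>v \<epsilon>) f", OF c f1])
    show "ls \<in> idx (Suc (Suc 0))" using that by (simp add: numeral_2_eq_2)
  qed
  have "polyf c (cdom c) (\<lambda>\<epsilon> p. full_contraction \<Omega> 2 (cov (\<Gamma>v \<epsilon>) (cov (\<Gamma>v \<epsilon>) f)) (Ric (\<Gamma>v \<epsilon>)) c p [] [])"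
    by (rule polyf_contraction[where S = "\<lambda>\<epsilon>. cov (\<Gamma>v \<epsilon>) (cov (\<Gamma>v \<epsilon>) f)" and T = "\<lambda>\<epsilon>. Ric (\<Gamma>v \<epsilon>)", OF c f2 polyf_Ric[OF c]])
  moreover have "polyf c (cdom c) (\<lambda>\<epsilon> p. full_contraction \<Omega> 2 (Ric (\<Gamma>v \<epsilon>)) (Ric (\<Gamma>v \<epsilon>)) c p [] [])"
    by (rule polyf_contraction[where S = "\<lambda>\<epsilon>. Ric (\<Gamma>v \<epsilon>)" and T = "\<lambda>\<epsilon>. Ric (\<Gamma>v \<epsilon>)", OF c polyf_Ric[OF c] polyf_Ric[OF c]])
  moreover have "polyf c (cdom c) (\<lambda>\<epsilon> p. full_contraction \<Omega> 4 (curv_low \<Omega> (\<Gamma>v \<epsilon>)) (curv_low \<Omega> (\<Gamma>v \<epsilon>)) c p [] [])"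
    by (rule polyf_contraction[where S = "\<lambda>\<epsilon>. curv_low \<Omega> (\<Gamma>v \<epsilon>)" and T = "\<lambda>\<epsilon>. curv_low \<Omega> (\<Gamma>v \<epsilon>)", OF c polyf_Riem[OF c] polyf_Riem[OF c]])
  ultimately show ?thesis
    unfolding weakK_def tadd_def tscale_def using c f
    by (intro C.polyf_add C.polyf_mult C.polyf_smf[OF C.smf_const] polyf_tmul) auto
qed

text \<open>Moving the raised index of \<open>\<Pi>\<close> to \<open>df\<close> turns the variation of the Hessian, contracted with \<open>T\<close>, into
  a contraction of \<open>df \<otimes> T\<close> with \<open>\<Pi>\<close>.\<close>

lemma contraction_hessian_variation:
  assumes cp: "c \<in> A" "p \<in> cdom c"
  shows "fcf (\<omega> c p) 2 (\<lambda>ls. - (\<Sum>m\<in>UNIV. raise3 P c p (ls ! 0) (ls ! 1) m * cov \<Gamma> f c p [] [m])) T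
    = - fcf (\<omega> c p) 3 (\<lambda>ls. cov \<Gamma> f c p [] [hd ls] * T (tl ls)) (P c p [])"
proof -
  let ?d = "\<lambda>m. cov \<Gamma> f c p [] [m]"
  have "fcf (\<omega> c p) 3 (\<lambda>ls. ?d (hd ls) * T (tl ls)) (P c p [])
     = (\<Sum>i\<in>UNIV. \<Sum>j\<in>UNIV. (\<omega> c p i j * ?d i) * fcf (\<omega> c p) 2 T (\<lambda>js. P c p [] (j # js)))"
    unfolding numeral_3_eq_3 fcf_Suc[of _ "Suc (Suc 0)"] by (simp add: fcf_cmult_left numeral_2_eq_2 mult.assoc)
  also have "\<dots> = (\<Sum>i\<in>UNIV. \<Sum>j\<in>UNIV. (\<omega> c p i j * ?d i) * fcf (\<omega> c p) 2 (\<lambda>js. P c p [] (j # js)) T)"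
    by (subst fcf_swap[OF \<omega>_skew[OF cp]]) simp
  also have "\<dots> = fcf (\<omega> c p) 2 (\<lambda>ls. \<Sum>i\<in>UNIV. 1 * (\<Sum>j\<in>UNIV. (\<omega> c p i j * ?d i) * P c p [] (j # ls))) T"
    unfolding fcf_sum_left by simp
  also have "\<dots> = fcf (\<omega> c p) 2 (\<lambda>ls. \<Sum>m\<in>UNIV. raise3 P c p (ls ! 0) (ls ! 1) m * ?d m) T"
  proof (rule fcf_cong)
    fix ls :: "'n list" assume "ls \<in> idx 2"
    then obtain a b where ls: "ls = [a, b]" by (rule idx2_cases)
    have "P c p [] [j, a, b] = P c p [] [a, b, j]" for j
      using Sk_swap(1)[OF P cp, of j a b] Sk_swap(2)[OF P cp, of a j b] by simp
    then show "(\<Sum>i\<in>UNIV. 1 * (\<Sum>j\<in>UNIV. (\<omega> c p i j * ?d i) * P c p [] (j # ls)))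
        = (\<Sum>m\<in>UNIV. raise3 P c p (ls ! 0) (ls ! 1) m * ?d m)"
      by (simp add: ls raise3_def sum_distrib_left sum_distrib_right ac_simps)
  qed simp
  finally show ?thesis by (simp add: fcf_uminus_left)
qed

text \<open>The curvature is skew in the first pair, so both terms contribute equally.\<close>

lemma contraction_Riem_variation:
  assumes cp: "c \<in> A" "p \<in> cdom c"
  shows "fcf (\<omega> c p) 4 (\<lambda>ls. cov \<Gamma> P c p [] [ls ! 0, ls ! 1, ls ! 2, ls ! 3] - cov \<Gamma> P c p [] [ls ! 1, ls ! 0, ls ! 2, ls ! 3]) (Riem c p [])
    = 2 * fcf (\<omega> c p) 4 (cov \<Gamma> P c p []) (Riem c p [])"
proof -
  let ?\<sigma> = "Transposition.transpose 0 (Suc 0)"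
  have \<sigma>: "?\<sigma> permutes {..<4::nat}" by (rule permutes_swap_id) auto
  have perm: "permute_list ?\<sigma> [i, j, k, l] = [j, i, k, l]" for i j k l :: 'n
    by (simp add: permute_list_def upt_conv_Cons Transposition.transpose_def)
  have "fcf (\<omega> c p) 4 (\<lambda>ls. cov \<Gamma> P c p [] [ls ! 1, ls ! 0, ls ! 2, ls ! 3]) (Riem c p [])
     = fcf (\<omega> c p) 4 (\<lambda>ls. cov \<Gamma> P c p [] (permute_list ?\<sigma> ls)) (\<lambda>ls. - Riem c p [] (permute_list ?\<sigma> ls))"
  proof (rule fcf_cong)
    fix ls :: "'n list" assume "ls \<in> idx 4"
    then obtain i j k l where ls: "ls = [i, j, k, l]" by (rule idx4_cases)
    show "cov \<Gamma> P c p [] [ls ! 1, ls ! 0, ls ! 2, ls ! 3] = cov \<Gamma> P c p [] (permute_list ?\<sigma> ls)"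
      unfolding ls perm by (simp add: eval_nat_numeral)
    show "Riem c p [] ls = - Riem c p [] (permute_list ?\<sigma> ls)"
      unfolding ls perm by (rule Riem_skew)
  qed
  also have "\<dots> = - fcf (\<omega> c p) 4 (cov \<Gamma> P c p []) (Riem c p [])"
    unfolding fcf_uminus_right fcf_permute[OF \<sigma>] ..
  finally have "fcf (\<omega> c p) 4 (\<lambda>ls. cov \<Gamma> P c p [] [ls ! 1, ls ! 0, ls ! 2, ls ! 3]) (Riem c p [])
     = - fcf (\<omega> c p) 4 (cov \<Gamma> P c p []) (Riem c p [])" .
  moreover have "fcf (\<omega> c p) 4 (\<lambda>ls. cov \<Gamma> P c p [] [ls ! 0, ls ! 1, ls ! 2, ls ! 3]) (Riem c p [])
     = fcf (\<omega> c p) 4 (cov \<Gamma> P c p []) (Riem c p [])"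
  proof (rule fcf_cong)
    fix ls :: "'n list" assume "ls \<in> idx 4"
    then show "cov \<Gamma> P c p [] [ls ! 0, ls ! 1, ls ! 2, ls ! 3] = cov \<Gamma> P c p [] ls"
      by (elim idx4_cases) (simp add: eval_nat_numeral)
  qed simp
  ultimately show ?thesis unfolding fcf_diff_left by simp
qed

lemma weakK_deriv:
  assumes cp: "c \<in> A" "p \<in> cdom c"
  shows "((\<lambda>\<epsilon>. weakK f (\<Gamma>v \<epsilon>) c p [] []) has_real_derivative
     - fcf (\<omega> c p) 3 (\<lambda>ls. cov \<Gamma> f c p [] [hd ls] * Ric \<Gamma> c p [] (tl ls)) (P c p [])
     - fcf (\<omega> c p) 2 (cov \<Gamma> (cov \<Gamma> f) c p []) (diverg \<Omega> \<Gamma> P c p [])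
     + f c p [] [] * fcf (\<omega> c p) 2 (Ric \<Gamma> c p []) (diverg \<Omega> \<Gamma> P c p [])
     + f c p [] [] * fcf (\<omega> c p) 4 (cov \<Gamma> P c p []) (Riem c p [])) (at 0)"
proof -
  let ?W = "\<omega> c p"
  let ?h' = "\<lambda>ls. - (\<Sum>m\<in>UNIV. raise3 P c p (ls ! 0) (ls ! 1) m * cov \<Gamma> f c p [] [m])"
  let ?r' = "\<lambda>ls. - diverg \<Omega> \<Gamma> P c p [] ls"
  let ?R' = "\<lambda>ls. cov \<Gamma> P c p [] [ls ! 0, ls ! 1, ls ! 2, ls ! 3] - cov \<Gamma> P c p [] [ls ! 1, ls ! 0, ls ! 2, ls ! 3]"
  have h: "((\<lambda>\<epsilon>. cov (\<Gamma>v \<epsilon>) (cov (\<Gamma>v \<epsilon>) f) c p [] ls) has_real_derivative ?h' ls) (at 0)" if "ls \<in> idx 2" for ls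
    using that by (elim idx2_cases) (simp add: hessian_deriv)
  have r: "((\<lambda>\<epsilon>. Ric (\<Gamma>v \<epsilon>) c p [] ls) has_real_derivative ?r' ls) (at 0)" if "ls \<in> idx 2" for ls
    using that by (elim idx2_cases) (simp add: Ric_deriv[OF cp])
  have R: "((\<lambda>\<epsilon>. curv_low \<Omega> (\<Gamma>v \<epsilon>) c p [] ls) has_real_derivative ?R' ls) (at 0)" if "ls \<in> idx 4" for ls
    using that Riem_deriv[OF cp] by (elim idx4_cases) (simp add: eval_nat_numeral)
  have "((\<lambda>\<epsilon>. fcf ?W 2 (cov (\<Gamma>v \<epsilon>) (cov (\<Gamma>v \<epsilon>) f) c p []) (Ric (\<Gamma>v \<epsilon>) c p [])
      + (- 1 / 2 * (f c p [] [] * fcf ?W 2 (Ric (\<Gamma>v \<epsilon>) c p []) (Ric (\<Gamma>v \<epsilon>) c p []))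
       + 1 / 4 * (f c p [] [] * fcf ?W 4 (curv_low \<Omega> (\<Gamma>v \<epsilon>) c p []) (curv_low \<Omega> (\<Gamma>v \<epsilon>) c p []))))
     has_real_derivative
      (fcf ?W 2 ?h' (Ric (\<Gamma>v 0) c p []) + fcf ?W 2 (cov (\<Gamma>v 0) (cov (\<Gamma>v 0) f) c p []) ?r')
      + (- 1 / 2 * (f c p [] [] * (fcf ?W 2 ?r' (Ric (\<Gamma>v 0) c p []) + fcf ?W 2 (Ric (\<Gamma>v 0) c p []) ?r'))
       + 1 / 4 * (f c p [] [] * (fcf ?W 4 ?R' (curv_low \<Omega> (\<Gamma>v 0) c p []) + fcf ?W 4 (curv_low \<Omega> (\<Gamma>v 0) c p []) ?R')))) (at 0)"
    by (intro DERIV_add DERIV_cmult fcf_has_derivative h r R)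
  moreover have "fcf ?W 2 ?r' (Ric \<Gamma> c p []) = fcf ?W 2 (Ric \<Gamma> c p []) ?r'"
    "fcf ?W 4 (Riem c p []) ?R' = fcf ?W 4 ?R' (Riem c p [])"
    by (subst fcf_swap[OF \<omega>_skew[OF cp]], simp)+
  ultimately show ?thesis
    unfolding \<Gamma>v_0 contraction_hessian_variation[OF cp] contraction_Riem_variation[OF cp] fcf_uminus_right
    unfolding weakK_def tadd_def tscale_def tmul_def full_contraction_fcf
    by (simp add: contraction_Riem_variation[OF cp] fcf_uminus_right algebra_simps)
qed

text \<open>The operator \<open>\<H>\<close> is the formal adjoint of the linearisation of \<open>K\<close>. Integration by parts frees \<open>\<Pi>\<close> of
  derivatives; the contributions of \<open>df \<otimes> Ric\<close> from the Hessian and from the square of \<open>Ric\<close> cancel, and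
  the remaining ones form \<open>\<H>(f)\<close> in its divergence form.\<close>

lemma integral_weakK_deriv:
  assumes f: "tensor_field A 0 0 f"
  shows "((\<lambda>\<epsilon>. Integ (weakK f (\<Gamma>v \<epsilon>))) has_real_derivative pairing A \<Omega> 3 (\<H> \<Omega> \<Gamma> f) P) (at 0)"
proof -
  let ?fR = "tmul f (Ric \<Gamma>)" and ?fQ = "tmul f Riem"
  let ?H = "full_contraction \<Omega> 3 (\<H> \<Omega> \<Gamma> f) P"
  let ?a = "full_contraction \<Omega> 3 (cov \<Gamma> (cov \<Gamma> (cov \<Gamma> f))) P" and ?a' = "full_contraction \<Omega> 2 (cov \<Gamma> (cov \<Gamma> f)) (diverg \<Omega> \<Gamma> P)"
  let ?b = "full_contraction \<Omega> 3 (cov \<Gamma> ?fR) P" and ?b' = "full_contraction \<Omega> 2 ?fR (diverg \<Omega> \<Gamma> P)"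
  let ?c = "full_contraction \<Omega> 3 P (diverg \<Omega> \<Gamma> ?fQ)" and ?c' = "full_contraction \<Omega> 4 (cov \<Gamma> P) ?fQ"
  have hess: "tensor_field A 0 2 (cov \<Gamma> (cov \<Gamma> f))"
    unfolding numeral_2_eq_2 by (intro tensor_field_cov aff f)
  have fR: "tensor_field A 0 2 ?fR" by (intro tensor_field_tmul f Ric_tensor)
  have fQ: "tensor_field A 0 (Suc 3) ?fQ" using tensor_field_tmul[OF f Riem_tensor] by simp
  have aI: "Integ ?a = Integ ?a'"
    using integration_by_parts[OF SConn hess P_tensor'] by (simp add: eval_nat_numeral)
  have bI: "Integ ?b = Integ ?b'"
    using integration_by_parts[OF SConn fR P_tensor'] by (simp add: eval_nat_numeral)
  have cI: "Integ ?c' = Integ ?c"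
    using integration_by_parts[OF SConn P_tensor fQ] by (simp add: eval_nat_numeral)
  have divP: "tensor_field A 0 2 (diverg \<Omega> \<Gamma> P)" by (intro tensor_field_diverg P_tensor')
  have covfR: "tensor_field A 0 3 (cov \<Gamma> ?fR)" using tensor_field_cov[OF aff fR] by (simp add: eval_nat_numeral)
  have covP: "tensor_field A 0 4 (cov \<Gamma> P)" using tensor_field_cov[OF aff P_tensor] by (simp add: eval_nat_numeral)
  have fQ4: "tensor_field A 0 4 ?fQ" using fQ by simp
  note tf = tensor_field_full_contraction[OF \<H>_tensor[OF f] P_tensor] tensor_field_full_contraction[OF cov3_tensor[OF f] P_tensor]
    tensor_field_full_contraction[OF hess divP] tensor_field_full_contraction[OF covfR P_tensor]
    tensor_field_full_contraction[OF fR divP] tensor_field_full_contraction[OF P_tensor tensor_field_diverg[OF fQ]]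
    tensor_field_full_contraction[OF covP fQ4]
  \<comment> \<open>The pointwise derivative is \<open>?H\<close> plus the defects of three integrations by parts.\<close>
  let ?G = "tadd ?H (tadd (tadd ?a (tscale (- 1) ?a')) (tadd (tadd ?b' (tscale (- 1) ?b)) (tadd ?c' (tscale (- 1) ?c))))"
  have "((\<lambda>\<epsilon>. Integ (weakK f (\<Gamma>v \<epsilon>))) has_real_derivative Integ ?G) (at 0)"
  proof (rule integral_has_derivative)
    show "polyf c (cdom c) (\<lambda>\<epsilon> p. weakK f (\<Gamma>v \<epsilon>) c p [] [])" if "c \<in> A" for c by (rule polyf_weakK[OF f that])
    fix c p assume cp: "c \<in> A" "p \<in> cdom c"
    let ?W = "\<omega> c p" and ?P = "P c p []"
    let ?covRic = "cov \<Gamma> (Ric \<Gamma>) c p []" and ?f = "f c p [] []"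
    have fs: "smf c (cdom c) (\<lambda>p. f c p [] [])" using tensor_field_smf[OF f cp(1)] by simp
    have H: "fcf ?W 3 (\<H> \<Omega> \<Gamma> f c p []) ?P
       = - fcf ?W 3 (cov \<Gamma> (cov \<Gamma> (cov \<Gamma> f)) c p []) ?P + fcf ?W 3 ?P (diverg \<Omega> \<Gamma> ?fQ c p []) + ?f * fcf ?W 3 ?covRic ?P"
    proof -
      have "fcf ?W 3 (\<H> \<Omega> \<Gamma> f c p []) ?P = fcf ?W 3 (\<lambda>ls. - cov \<Gamma> (cov \<Gamma> (cov \<Gamma> f)) c p [] ls
         - diverg \<Omega> \<Gamma> ?fQ c p [] ls + ?f * ?covRic ls) ?P"
        by (rule fcf_cong) (auto elim!: idx3_cases simp: \<H>_divergence[OF f cp])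
      also have "\<dots> = - fcf ?W 3 (cov \<Gamma> (cov \<Gamma> (cov \<Gamma> f)) c p []) ?P - fcf ?W 3 (diverg \<Omega> \<Gamma> ?fQ c p []) ?P + ?f * fcf ?W 3 ?covRic ?P"
        unfolding fcf_add_left fcf_diff_left fcf_uminus_left fcf_cmult_left ..
      also have "fcf ?W 3 (diverg \<Omega> \<Gamma> ?fQ c p []) ?P = - fcf ?W 3 ?P (diverg \<Omega> \<Gamma> ?fQ c p [])"
        by (subst fcf_swap[OF \<omega>_skew[OF cp]]) simp
      finally show ?thesis by simp
    qed
    have B: "fcf ?W 3 (cov \<Gamma> ?fR c p []) ?P
       = fcf ?W 3 (\<lambda>ls. cov \<Gamma> f c p [] [hd ls] * Ric \<Gamma> c p [] (tl ls)) ?P + ?f * fcf ?W 3 ?covRic ?P"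
    proof -
      have "cov \<Gamma> ?fR c p [] ls = cov \<Gamma> f c p [] [hd ls] * Ric \<Gamma> c p [] (tl ls) + ?f * ?covRic ls" if "ls \<in> idx 3" for ls
      proof -
        obtain i j k where ls: "ls = [i, j, k]" using \<open>ls \<in> idx 3\<close> by (rule idx3_cases)
        have "smf c (cdom c) (\<lambda>p. Ric \<Gamma> c p [] [j, k])"
          using tensor_field_smf[OF Ric_tensor cp(1)] by (simp add: idx_def)
        from cov_tmul[where f = f and T = "Ric \<Gamma>", OF fs this cp, of i] show ?thesis
          by (simp add: ls cov_function)
      qed
      then have "fcf ?W 3 (cov \<Gamma> ?fR c p []) ?P
        = fcf ?W 3 (\<lambda>ls. cov \<Gamma> f c p [] [hd ls] * Ric \<Gamma> c p [] (tl ls) + ?f * ?covRic ls) ?P"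
        by (intro fcf_cong) auto
      then show ?thesis unfolding fcf_add_left fcf_cmult_left .
    qed
    have b': "fcf ?W 2 (?fR c p []) T = ?f * fcf ?W 2 (Ric \<Gamma> c p []) T"
      and c': "fcf ?W 4 T (?fQ c p []) = ?f * fcf ?W 4 T (Riem c p [])" for T
      unfolding tmul_def fcf_cmult_left fcf_cmult_right by simp_all
    show "((\<lambda>\<epsilon>. weakK f (\<Gamma>v \<epsilon>) c p [] []) has_real_derivative ?G c p [] []) (at 0)"
      using weakK_deriv[OF cp, of f] unfolding tadd_def tscale_def full_contraction_fcf H B b' c'
      by (simp add: algebra_simps)
  qed
  also have "Integ ?G = Integ ?H"
    by (simp add: integral_add integral_tscale tensor_field_tadd tensor_field_tscale tf aI bI cI)
  finally show ?thesis by (simp add: pairing_def)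
qed

lemma integral_\<K>_deriv:
  assumes f: "tensor_field A 0 0 f"
  shows "((\<lambda>\<epsilon>. Integ (tmul f (\<K> \<Omega> (\<Gamma>v \<epsilon>)))) has_real_derivative pairing A \<Omega> 3 (\<H> \<Omega> \<Gamma> f) P) (at 0)"
  unfolding integral_\<K>_weak[OF \<Gamma>v_SConn f] by (rule integral_weakK_deriv[OF f])

text \<open>An explicit formula would be long; \<open>integral_\<K>dot\<close> gives the integrals against all functions, which
  determine it.\<close>

definition \<K>dot :: "('m, 'n) tensor" where
  "\<K>dot = (\<lambda>c p us ls. deriv (\<lambda>\<epsilon>. \<K> \<Omega> (\<Gamma>v \<epsilon>) c p [] []) 0)"

lemma \<K>_deriv:
  assumes "c \<in> A" "p \<in> cdom c"
  shows "((\<lambda>\<epsilon>. \<K> \<Omega> (\<Gamma>v \<epsilon>) c p [] []) has_real_derivative \<K>dot c p [] []) (at 0)"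
proof -
  interpret C: chart_domain c "cdom c" using chart_domain_cdom assms by blast
  obtain D where "\<And>p. p \<in> cdom c \<Longrightarrow> ((\<lambda>\<epsilon>. \<K> \<Omega> (\<Gamma>v \<epsilon>) c p [] []) has_real_derivative D p) (at 0)"
    using C.polyf_derivative[OF polyf_\<K>[OF assms(1), of "[]" "[]"]] by metis
  from this[OF assms(2)] show ?thesis unfolding \<K>dot_def using DERIV_imp_deriv by metis
qed

lemma integral_\<K>dot:
  assumes f: "tensor_field A 0 0 f"
  shows "Integ (tmul f \<K>dot) = pairing A \<Omega> 3 (\<H> \<Omega> \<Gamma> f) P"
proof (rule DERIV_unique)
  show "((\<lambda>\<epsilon>. Integ (tmul f (\<K> \<Omega> (\<Gamma>v \<epsilon>)))) has_real_derivative Integ (tmul f \<K>dot)) (at 0)"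
  proof (rule integral_has_derivative)
    show "polyf c (cdom c) (\<lambda>\<epsilon> p. tmul f (\<K> \<Omega> (\<Gamma>v \<epsilon>)) c p [] [])" if "c \<in> A" for c
      by (rule polyf_tmul[where F = "\<lambda>\<epsilon>. \<K> \<Omega> (\<Gamma>v \<epsilon>)", OF f that polyf_\<K>[OF that]])
    show "((\<lambda>\<epsilon>. tmul f (\<K> \<Omega> (\<Gamma>v \<epsilon>)) c p [] []) has_real_derivative tmul f \<K>dot c p [] []) (at 0)"
      if "c \<in> A" "p \<in> cdom c" for c p
      unfolding tmul_def by (rule DERIV_cmult[OF \<K>_deriv[OF that]])
  qed
qed (rule integral_\<K>_deriv[OF f])

text \<open>Total \<open>K\<close> does not depend on the connection, since constants have no Hamiltonian field.\<close>

lemma integral_\<K>_const_deriv: "((\<lambda>\<epsilon>. Integ (\<K> \<Omega> (\<Gamma>v \<epsilon>))) has_real_derivative 0) (at 0)"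
proof -
  have "pairing A \<Omega> 3 (\<H> \<Omega> \<Gamma> (tconst 1)) P = 0"
    unfolding pairing_def \<H>_const by (rule Integ_zero) (simp add: full_contraction_fcf fcf_def)
  moreover have "tmul (tconst 1) F = F" for F :: "('m, 'n) tensor" by (intro ext) (simp add: tmul_def tconst_def)
  ultimately show ?thesis using integral_\<K>_deriv[OF tensor_field_tconst[of 1]] by simp
qed

lemma integral_\<K>_square_deriv:
  "((\<lambda>\<epsilon>. Integ (tmul (\<K> \<Omega> (\<Gamma>v \<epsilon>)) (\<K> \<Omega> (\<Gamma>v \<epsilon>)))) has_real_derivative 2 * pairing A \<Omega> 3 (\<H> \<Omega> \<Gamma> (\<K> \<Omega> \<Gamma>)) P) (at 0)"
proof -
  have "((\<lambda>\<epsilon>. Integ (tmul (\<K> \<Omega> (\<Gamma>v \<epsilon>)) (\<K> \<Omega> (\<Gamma>v \<epsilon>)))) has_real_derivative Integ (tscale 2 (tmul (\<K> \<Omega> \<Gamma>) \<K>dot))) (at 0)"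
  proof (rule integral_has_derivative)
    show "polyf c (cdom c) (\<lambda>\<epsilon> p. tmul (\<K> \<Omega> (\<Gamma>v \<epsilon>)) (\<K> \<Omega> (\<Gamma>v \<epsilon>)) c p [] [])" if "c \<in> A" for c
      unfolding tmul_def by (intro chart_domain.polyf_mult[OF chart_domain_cdom[OF that]] polyf_\<K> that)
    fix c p assume cp: "c \<in> A" "p \<in> cdom c"
    from DERIV_mult[OF \<K>_deriv[OF cp] \<K>_deriv[OF cp]]
    show "((\<lambda>\<epsilon>. tmul (\<K> \<Omega> (\<Gamma>v \<epsilon>)) (\<K> \<Omega> (\<Gamma>v \<epsilon>)) c p [] []) has_real_derivative
        tscale 2 (tmul (\<K> \<Omega> \<Gamma>) \<K>dot) c p [] []) (at 0)"
      by (simp add: tmul_def tscale_def algebra_simps)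
  qed
  then show ?thesis by (simp add: integral_tscale integral_\<K>dot[OF \<K>_tensor])
qed

lemma integral_Ric_square_deriv:
  "((\<lambda>\<epsilon>. Integ (full_contraction \<Omega> 2 (Ric (\<Gamma>v \<epsilon>)) (Ric (\<Gamma>v \<epsilon>)))) has_real_derivative
     - 2 * Integ (full_contraction \<Omega> 3 (cov \<Gamma> (Ric \<Gamma>)) P)) (at 0)"
proof -
  let ?F = "full_contraction \<Omega> 2 (Ric \<Gamma>) (diverg \<Omega> \<Gamma> P)"
  have "((\<lambda>\<epsilon>. Integ (full_contraction \<Omega> 2 (Ric (\<Gamma>v \<epsilon>)) (Ric (\<Gamma>v \<epsilon>)))) has_real_derivative Integ (tscale (- 2) ?F)) (at 0)"
  proof (rule integral_has_derivative)
    show "polyf c (cdom c) (\<lambda>\<epsilon> p. full_contraction \<Omega> 2 (Ric (\<Gamma>v \<epsilon>)) (Ric (\<Gamma>v \<epsilon>)) c p [] [])" if "c \<in> A" for c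
      by (rule polyf_contraction[where S = "\<lambda>\<epsilon>. Ric (\<Gamma>v \<epsilon>)" and T = "\<lambda>\<epsilon>. Ric (\<Gamma>v \<epsilon>)", OF that polyf_Ric[OF that] polyf_Ric[OF that]])
    fix c p assume cp: "c \<in> A" "p \<in> cdom c"
    let ?r' = "\<lambda>ls. - diverg \<Omega> \<Gamma> P c p [] ls"
    have r: "((\<lambda>\<epsilon>. Ric (\<Gamma>v \<epsilon>) c p [] ls) has_real_derivative ?r' ls) (at 0)" if "ls \<in> idx 2" for ls
      using that by (elim idx2_cases) (simp add: Ric_deriv[OF cp])
    have sw: "fcf (\<omega> c p) 2 ?r' (Ric \<Gamma> c p []) = fcf (\<omega> c p) 2 (Ric \<Gamma> c p []) ?r'"
      by (subst fcf_swap[OF \<omega>_skew[OF cp]]) simp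
    show "((\<lambda>\<epsilon>. full_contraction \<Omega> 2 (Ric (\<Gamma>v \<epsilon>)) (Ric (\<Gamma>v \<epsilon>)) c p [] []) has_real_derivative tscale (- 2) ?F c p [] []) (at 0)"
      using fcf_has_derivative[where k = 2 and M = "\<omega> c p" and \<alpha> = "\<lambda>\<epsilon>. Ric (\<Gamma>v \<epsilon>) c p []" and \<beta> = "\<lambda>\<epsilon>. Ric (\<Gamma>v \<epsilon>) c p []"
        and \<alpha>' = ?r' and \<beta>' = ?r', OF r r]
      unfolding full_contraction_fcf tscale_def \<Gamma>v_0 sw fcf_uminus_right by simp
  qed
  moreover have "Integ ?F = Integ (full_contraction \<Omega> 3 (cov \<Gamma> (Ric \<Gamma>)) P)"
    using integration_by_parts[OF SConn Ric_tensor P_tensor'] by (simp add: eval_nat_numeral)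
  ultimately show ?thesis by (simp add: integral_tscale)
qed

end

section \<open>Nondegeneracy of the pairing of symmetric tensors\<close>

context atlas
begin

text \<open>Adjacent exchanges generate all transpositions, hence all permutations.\<close>

lemma Sk3I:
  assumes T: "tensor_field A 0 3 T"
    and swaps: "\<And>c p i j k. c \<in> A \<Longrightarrow> p \<in> cdom c \<Longrightarrow> T c p [] [i, j, k] = T c p [] [j, i, k]"
      "\<And>c p i j k. c \<in> A \<Longrightarrow> p \<in> cdom c \<Longrightarrow> T c p [] [i, j, k] = T c p [] [i, k, j]"
  shows "T \<in> Sk A 3"
proof -
  have "\<forall>ls\<in>idx 3. T c p [] (permute_list \<sigma> ls) = T c p [] ls"
    if cp: "c \<in> A" "p \<in> cdom c" and \<sigma>: "\<sigma> permutes {..<3}" for c p \<sigma>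
    using \<sigma> finite_lessThan
  proof (induction rule: permutes_induct)
    case id then show ?case by simp
  next
    case (swap a b \<sigma>)
    let ?\<tau> = "Transposition.transpose a b"
    show ?case
    proof
      fix ls :: "'n list" assume ls: "ls \<in> idx 3"
      then obtain i j k where l: "ls = [i, j, k]" by (rule idx3_cases)
      have "permute_list (?\<tau> \<circ> \<sigma>) ls = permute_list \<sigma> (permute_list ?\<tau> ls)"
        using swap ls by (intro permute_list_compose) (simp add: idx_def)
      moreover have "permute_list ?\<tau> ls \<in> idx 3" using ls by (simp add: idx_def)
      ultimately have "T c p [] (permute_list (?\<tau> \<circ> \<sigma>) ls) = T c p [] (permute_list ?\<tau> ls)"
        using swap by simp
      also have "\<dots> = T c p [] [i, j, k]"
      proof -
        have e: "T c p [] [j, i, k] = T c p [] [i, j, k]" "T c p [] [i, k, j] = T c p [] [i, j, k]"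
          "T c p [] [k, j, i] = T c p [] [i, j, k]"
          using swaps(1)[OF cp, of i j k] swaps(2)[OF cp, of i j k] swaps(1)[OF cp, of k j i] swaps(2)[OF cp, of j k i]
          by simp_all
        have "a = 0 \<or> a = 1 \<or> a = 2" "b = 0 \<or> b = 1 \<or> b = 2" using swap by auto
        then show ?thesis
          by (elim disjE) (simp_all add: l permute_list_def upt_conv_Cons Transposition.transpose_def numeral_2_eq_2 e)
      qed
      finally show "T c p [] (permute_list (?\<tau> \<circ> \<sigma>) ls) = T c p [] ls" by (simp add: l)
    qed
  qed
  then show ?thesis using T unfolding Sk_def by blast
qed

lemma Sk_tadd: "S \<in> Sk A k \<Longrightarrow> T \<in> Sk A k \<Longrightarrow> tadd S T \<in> Sk A k"
  unfolding Sk_def using tensor_field_tadd by (auto simp: tadd_def)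

lemma Sk_tmul:
  assumes "tensor_field A 0 0 f" "T \<in> Sk A k"
  shows "tmul f T \<in> Sk A k"
  using assms tensor_field_tmul unfolding Sk_def by (auto simp: tmul_def)

lemma symmetrize_Sk:
  assumes T: "tensor_field A 0 k T"
  shows "symmetrize T \<in> Sk A k"
proof -
  have eq: "symmetrize T c p [] ls = (\<Sum>\<sigma> | \<sigma> permutes {..<k}. (1 / fact k) * T c p [] (permute_list \<sigma> ls))"
    if "ls \<in> idx k" for c p ls
    using that by (simp add: symmetrize_def idx_def sum_distrib_left)
  have perm: "permute_list \<sigma> ls \<in> idx k" if "ls \<in> idx k" for \<sigma> and ls :: "'n list"
    using that by (simp add: idx_def)
  have "tensor_field A 0 k (symmetrize T)"
  proof (rule tensor_fieldI)
    fix c and ls :: "'n list" assume c: "c \<in> A" and ls: "ls \<in> idx k"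
    interpret C: chart_domain c "cdom c" using chart_domain_cdom c by blast
    show "smf c (cdom c) (\<lambda>p. symmetrize T c p [] ls)"
      unfolding eq[OF ls] by (intro C.smf_sum C.smf_mult C.smf_const tensor_field_smf[OF T c] perm ls)
  next
    fix c d p and ls :: "'n list"
    assume cd: "c \<in> A" "d \<in> A" "p \<in> cdom c" "p \<in> cdom d" and ls: "ls \<in> idx k"
    let ?J = "jac c d p"
    have "tr ?J k (symmetrize T c p []) ls
        = tr ?J k (\<lambda>ls. \<Sum>\<sigma> | \<sigma> permutes {..<k}. (1 / fact k) * T c p [] (permute_list \<sigma> ls)) ls"
      by (rule tr_cong) (rule eq)
    also have "\<dots> = (\<Sum>\<sigma> | \<sigma> permutes {..<k}. (1 / fact k) * tr ?J k (\<lambda>ls. T c p [] (permute_list \<sigma> ls)) ls)"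
      by (rule tr_sum)
    also have "\<dots> = (\<Sum>\<sigma> | \<sigma> permutes {..<k}. (1 / fact k) * T d p [] (permute_list \<sigma> ls))"
    proof (rule sum.cong[OF refl])
      fix \<sigma> assume "\<sigma> \<in> {\<sigma>. \<sigma> permutes {..<k}}"
      then show "(1 / fact k) * tr ?J k (\<lambda>ls. T c p [] (permute_list \<sigma> ls)) ls = (1 / fact k) * T d p [] (permute_list \<sigma> ls)"
        using tr_permute[OF _ ls, of \<sigma> ?J "T c p []"] tensor_field_tr[OF T cd perm[OF ls, of \<sigma>]] by simp
    qed
    finally show "symmetrize T d p [] ls = tr ?J k (symmetrize T c p []) ls" unfolding eq[OF ls] by (rule sym)
  qed
  moreover have "symmetrize T c p [] (permute_list \<tau> ls) = symmetrize T c p [] ls"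
    if ls: "ls \<in> idx k" and \<tau>: "\<tau> permutes {..<k}" for c p \<tau> ls
  proof -
    have "permute_list \<sigma> (permute_list \<tau> ls) = permute_list (\<tau> \<circ> \<sigma>) ls" if "\<sigma> permutes {..<k}" for \<sigma>
      using permute_list_compose[of \<sigma> ls \<tau>] that ls by (simp add: idx_def)
    then have "symmetrize T c p [] (permute_list \<tau> ls)
        = (\<Sum>\<sigma> | \<sigma> permutes {..<k}. (1 / fact k) * T c p [] (permute_list (\<tau> \<circ> \<sigma>) ls))"
      unfolding eq[OF perm[OF ls]] by (intro sum.cong refl) auto
    also have "\<dots> = symmetrize T c p [] ls"
      unfolding eq[OF ls] by (rule setum_permutations_compose_left[OF \<tau>, symmetric])
    finally show ?thesis .
  qed
  ultimately show ?thesis unfolding Sk_def by blast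
qed

text \<open>\<open>dh \<otimes> T\<close>\<close>

definition dtensor :: "('m \<Rightarrow> real) \<Rightarrow> ('m, 'n) tensor \<Rightarrow> ('m, 'n) tensor" where
  "dtensor h T = (\<lambda>c p us ls. chart_pd c (hd ls) h p * T c p us (tl ls))"

lemma tensor_field_dtensor:
  assumes h: "\<And>c. c \<in> A \<Longrightarrow> smf c (cdom c) h" and T: "tensor_field A 0 k T"
  shows "tensor_field A 0 (Suc k) (dtensor h T)"
proof (rule tensor_fieldI)
  fix c and ls :: "'n list" assume c: "c \<in> A" and ls: "ls \<in> idx (Suc k)"
  interpret C: chart_domain c "cdom c" using chart_domain_cdom c by blast
  obtain i js where "ls = i # js" "js \<in> idx k" using ls by (rule idx_Suc_cases)
  then show "smf c (cdom c) (\<lambda>p. dtensor h T c p [] ls)"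
    unfolding dtensor_def using h[OF c] tensor_field_smf[OF T c] by (intro C.smf_mult C.smf_chart_pd) auto
next
  fix c d p and ls :: "'n list"
  assume cd: "c \<in> A" "d \<in> A" "p \<in> cdom c" "p \<in> cdom d" and ls: "ls \<in> idx (Suc k)"
  obtain i js where l: "ls = i # js" "js \<in> idx k" using ls by (rule idx_Suc_cases)
  have "chart_pd d i h p = (\<Sum>a\<in>UNIV. chart_pd c a h p * jac c d p a i)"
    using cd chart_domain.smf_subset[OF chart_domain_cdom h] open_Int[OF open_cdom[OF cd(1)] open_cdom[OF cd(2)]]
    by (intro chart_pd_transition[of c d "cdom c \<inter> cdom d"]) auto
  then show "dtensor h T d p [] ls = tr (jac c d p) (Suc k) (dtensor h T c p []) ls"
    unfolding l(1) tr_Suc dtensor_def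
    by (simp add: tr_cmult tensor_field_tr[OF T cd l(2)] sum_distrib_left sum_distrib_right ac_simps)
qed

text \<open>A linear function of the coordinates that vanishes at \<open>p\<close>, cut off by a bump function. Owing to this
  zero, the derivative of the bump function does not enter at \<open>p\<close>.\<close>

lemma exists_function_with_differential:
  assumes c: "c \<in> A" "p \<in> cdom c"
  obtains h where "\<And>d. d \<in> A \<Longrightarrow> smf d (cdom d) h" "\<And>j. chart_pd c j h p = r j"
proof -
  interpret C: chart_domain c "cdom c" using chart_domain_cdom c by blast
  obtain \<psi> where \<psi>: "\<And>d. d \<in> A \<Longrightarrow> smf d (cdom d) \<psi>" "\<psi> p \<noteq> 0" "closure {q. \<psi> q \<noteq> 0} \<subseteq> cdom c"
    using exists_bump_function[OF c] by metis
  define w where "w = (\<lambda>b. r b / \<psi> p)"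
  define g where "g = (\<lambda>q. \<Sum>b\<in>UNIV. w b * (coords c q $ b - coords c p $ b))"
  define h where "h = (\<lambda>q. if q \<in> cdom c then \<psi> q * g q else 0)"
  have x: "smf c (cdom c) (\<lambda>q. coords c q $ b)" for b by (rule smf_coords) (use c in auto)
  then have g: "smf c (cdom c) g" unfolding g_def by (intro C.smf_sum C.smf_mult C.smf_const C.smf_diff)
  show thesis
  proof (rule that[of h])
    show "smf d (cdom d) h" if d: "d \<in> A" for d
      unfolding h_def
    proof (rule smf_zero_extension[OF c(1) d _ closed_closure \<psi>(3)])
      show "smf c (cdom c) (\<lambda>q. \<psi> q * g q)" by (intro C.smf_mult \<psi>(1) c g)
      show "\<psi> q * g q = 0" if "q \<notin> closure {q. \<psi> q \<noteq> 0}" for q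
        using that closure_subset[of "{q. \<psi> q \<noteq> 0}"] by auto
    qed
    fix j
    have pd: "chart_pd c j (\<lambda>q. w b * (coords c q $ b - coords c p $ b)) p = w b * (if b = j then 1 else 0)" for b
      by (simp only: C.chart_pd_cmult[OF C.smf_diff[OF x C.smf_const] c(2)] C.chart_pd_diff[OF x C.smf_const c(2)]
          chart_pd_coord[OF c] C.chart_pd_const diff_zero)
    have "chart_pd c j g p = (\<Sum>b\<in>UNIV. w b * (if b = j then 1 else 0))"
      unfolding g_def C.chart_pd_sum[OF C.smf_mult[OF C.smf_const C.smf_diff[OF x C.smf_const]] c(2)] pd ..
    then have "chart_pd c j g p = r j / \<psi> p" by (simp add: w_def if_distrib cong: if_cong)
    moreover have "chart_pd c j h p = chart_pd c j (\<lambda>q. \<psi> q * g q) p"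
      using c(2) by (intro C.chart_pd_cong) (auto simp: h_def)
    moreover have "g p = 0" by (simp add: g_def)
    ultimately show "chart_pd c j h p = r j"
      using \<psi>(2) C.chart_pd_mult[OF \<psi>(1)[OF c(1)] g c(2)] by simp
  qed
qed

end

context symplectic
begin

lemma contraction_symmetrize:
  assumes E: "E \<in> Sk A k" and cp: "c \<in> A" "p \<in> cdom c"
  shows "fcf (\<omega> c p) k (symmetrize T c p []) (E c p []) = fcf (\<omega> c p) k (T c p []) (E c p [])"
    and "fcf (\<omega> c p) k (E c p []) (symmetrize T c p []) = fcf (\<omega> c p) k (E c p []) (T c p [])"
proof -
  show *: "fcf (\<omega> c p) k (symmetrize T c p []) (E c p []) = fcf (\<omega> c p) k (T c p []) (E c p [])"
    using E cp unfolding Sk_def by (intro fcf_symmetrize) blast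
  show "fcf (\<omega> c p) k (E c p []) (symmetrize T c p []) = fcf (\<omega> c p) k (E c p []) (T c p [])"
    unfolding fcf_swap[where k = k and \<alpha> = "E c p []", OF \<omega>_skew[OF cp]] * ..
qed

text \<open>As \<open>\<omega>\<close> is inverse to \<open>\<Omega>\<close> up to sign, contraction with such differentials picks out a single
  component.\<close>

lemma contraction_differentials:
  assumes cp: "c \<in> A" "p \<in> cdom c" and h: "\<And>i j. chart_pd c j (h i) p = \<Omega> c p [] [j, i]"
  shows "fcf (\<omega> c p) (length ls) \<alpha> (foldr (\<lambda>i. dtensor (h i)) ls (tconst 1) c p []) = (- 1) ^ length ls * \<alpha> ls"
proof (induction ls arbitrary: \<alpha>)
  case Nil
  show ?case by (simp add: tconst_def)
next
  case (Cons i ls)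
  let ?k = "length ls" and ?T = "foldr (\<lambda>i. dtensor (h i)) ls (tconst 1)"
  have "fcf (\<omega> c p) (Suc ?k) \<alpha> (dtensor (h i) ?T c p [])
     = (\<Sum>a\<in>UNIV. \<Sum>j\<in>UNIV. \<omega> c p a j * (\<Omega> c p [] [j, i] * ((- 1) ^ ?k * \<alpha> (a # ls))))"
  proof -
    have "dtensor (h i) ?T c p [] (j # js) = \<Omega> c p [] [j, i] * ?T c p [] js" for j js
      by (simp add: dtensor_def h)
    then show ?thesis unfolding fcf_Suc by (simp add: fcf_cmult_right Cons.IH)
  qed
  also have "\<dots> = (\<Sum>a\<in>UNIV. (if a = i then - 1 else 0) * ((- 1) ^ ?k * \<alpha> (a # ls)))"
    unfolding \<omega>\<Omega>[OF cp, symmetric] by (simp add: sum_distrib_right mult.assoc)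
  also have "\<dots> = (- 1) ^ Suc ?k * \<alpha> (i # ls)" by (simp add: if_distrib if_distribR cong: if_cong)
  finally show ?case by simp
qed

end

context compact_symplectic
begin

text \<open>For symmetric \<open>Q\<close> let \<open>e = \<langle>E, Q\<rangle>\<close> pointwise. Pairing \<open>E\<close> with \<open>e Q\<close> gives the integral of \<open>e\<^sup>2\<close>, so
  \<open>e = 0\<close>. If \<open>Q\<close> is the symmetrization of a suitable product of differentials, \<open>e\<close> is, up to sign, a
  prescribed component of \<open>E\<close> at a prescribed point.\<close>

lemma pairing_nondegenerate:
  assumes E: "E \<in> Sk A k" and zero: "\<And>P. P \<in> Sk A k \<Longrightarrow> pairing A \<Omega> k E P = 0"
  shows "vanishes A k E"
  unfolding vanishes_def
proof (intro ballI)
  fix c p and ls :: "'n list" assume cp: "c \<in> A" "p \<in> cdom c" and ls: "ls \<in> idx k"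
  have "\<exists>h. (\<forall>d\<in>A. smf d (cdom d) h) \<and> (\<forall>j. chart_pd c j h p = \<Omega> c p [] [j, i])" for i
    using exists_function_with_differential[OF cp, of "\<lambda>j. \<Omega> c p [] [j, i]"] by metis
  then obtain h where h: "\<And>i d. d \<in> A \<Longrightarrow> smf d (cdom d) (h i)" "\<And>i j. chart_pd c j (h i) p = \<Omega> c p [] [j, i]"
    by metis
  define Q where "Q = foldr (\<lambda>i. dtensor (h i)) ls (tconst 1)"
  have "tensor_field A 0 (length ls) Q" unfolding Q_def
    by (induction ls) (simp_all add: tensor_field_tconst tensor_field_dtensor h(1))
  then have Q: "symmetrize Q \<in> Sk A k" using ls by (intro symmetrize_Sk) (simp add: idx_def)
  define e where "e = full_contraction \<Omega> k E (symmetrize Q)"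
  have e: "tensor_field A 0 0 e"
    unfolding e_def by (intro tensor_field_full_contraction Sk_tensor E Q)
  have "Integ (tmul e e) = Integ (full_contraction \<Omega> k E (tmul e (symmetrize Q)))"
    by (rule integral_cong) (simp add: tmul_def full_contraction_fcf fcf_cmult_right e_def)
  also have "\<dots> = 0" using zero[OF Sk_tmul[OF e Q]] by (simp add: pairing_def)
  finally have "tmul e e c p [] [] = 0"
    by (intro integral_nonneg_zero[OF tensor_field_tmul[OF e e] _ _ cp]) (simp_all add: tmul_def)
  then have "fcf (\<omega> c p) (length ls) (E c p []) (Q c p []) = 0"
    using ls by (simp add: tmul_def e_def full_contraction_fcf contraction_symmetrize(2)[OF E cp] idx_def)
  then show "E c p [] ls = 0"
    unfolding Q_def contraction_differentials[where h = h, OF cp h(2)] by simp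
qed

lemma pairing_linear:
  assumes "tensor_field A 0 k S" "tensor_field A 0 k T" "tensor_field A 0 k P"
  shows "pairing A \<Omega> k (tadd (tscale a S) (tscale b T)) P = a * pairing A \<Omega> k S P + b * pairing A \<Omega> k T P"
proof -
  let ?S = "full_contraction \<Omega> k S P" and ?T = "full_contraction \<Omega> k T P"
  have "pairing A \<Omega> k (tadd (tscale a S) (tscale b T)) P = Integ (tadd (tscale a ?S) (tscale b ?T))"
    unfolding pairing_def
    by (rule integral_cong) (simp add: full_contraction_fcf tadd_def tscale_def fcf_add_left fcf_cmult_left)
  also have "\<dots> = a * pairing A \<Omega> k S P + b * pairing A \<Omega> k T P"
    by (simp add: integral_add integral_tscale tensor_field_tscale tensor_field_full_contraction assms pairing_def)
  finally show ?thesis .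
qed

end

section \<open>The first variation\<close>

context symplectic_connection
begin

lemma \<H>_Sk:
  assumes "tensor_field A 0 0 f"
  shows "\<H> \<Omega> \<Gamma> f \<in> Sk A 3"
proof (rule Sk3I[OF \<H>_tensor[OF assms]])
  fix c p i j k assume cp: "c \<in> A" "p \<in> cdom c"
  then have "smf c (cdom c) (\<lambda>p. f c p [] [])" using tensor_field_smf[OF assms] by simp
  from \<H>_sym[where f = f, OF this cp]
  show "\<H> \<Omega> \<Gamma> f c p [] [i, j, k] = \<H> \<Omega> \<Gamma> f c p [] [j, i, k]" "\<H> \<Omega> \<Gamma> f c p [] [i, j, k] = \<H> \<Omega> \<Gamma> f c p [] [i, k, j]"
    by blast+
qed

lemma \<delta>star_Ric_Sk: "\<delta>star \<Gamma> (Ric \<Gamma>) \<in> Sk A 3"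
  unfolding \<delta>star_def by (intro Sk_tscale symmetrize_Sk covRic_tensor)

abbreviation euler_lagrange :: "real \<Rightarrow> real \<Rightarrow> ('m, 'n) tensor" where
  "euler_lagrange s t \<equiv> tadd (tscale (t\<^sup>2) (\<H> \<Omega> \<Gamma> (\<K> \<Omega> \<Gamma>))) (tscale (s\<^sup>2) (\<delta>star \<Gamma> (Ric \<Gamma>)))"

lemma euler_lagrange_Sk: "euler_lagrange s t \<in> Sk A 3"
  by (intro Sk_tadd Sk_tscale \<H>_Sk \<K>_tensor \<delta>star_Ric_Sk)

end

context compact_symplectic
begin

lemma NN_eq:
  assumes \<Gamma>: "\<Gamma> \<in> SConn A \<Omega>"
  shows "NN A \<Omega> \<Gamma>0 a b \<Gamma> =
    b\<^sup>2 * (Integ (tmul (\<K> \<Omega> \<Gamma>) (\<K> \<Omega> \<Gamma>))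
      + (2 * (inverse (vol A \<Omega>) - inverse (vol A \<Omega>) * Integ (\<K> \<Omega> \<Gamma>)) * Integ (\<K> \<Omega> \<Gamma>)
        + (inverse (vol A \<Omega>) - inverse (vol A \<Omega>) * Integ (\<K> \<Omega> \<Gamma>))\<^sup>2 * vol A \<Omega>))
    + (3 * a)\<^sup>2 * Integ (full_contraction \<Omega> 2 (Ric \<Gamma>) (Ric \<Gamma>))"
proof -
  interpret S: symplectic_connection A \<Omega> n \<Gamma> by unfold_locales (rule \<Gamma>)
  let ?K = "\<K> \<Omega> \<Gamma>" and ?u = "inverse (vol A \<Omega>) - inverse (vol A \<Omega>) * Integ (\<K> \<Omega> \<Gamma>)"
  let ?\<alpha>0 = "tscale b (tadd (tconst (inverse (vol A \<Omega>))) (\<K>bar A \<Omega> \<Gamma>))"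
  let ?\<alpha>2 = "tscale (3 * a) (Ric \<Gamma>)" and ?\<alpha>3 = "tscale (3 * inverse b * a\<^sup>2) (conn_diff \<Omega> \<Gamma> \<Gamma>0)"
  note K = S.\<K>_tensor
  have "pairing A \<Omega> 0 ?\<alpha>0 ?\<alpha>0 = Integ (tscale (b\<^sup>2) (tadd (tmul ?K ?K) (tadd (tscale (2 * ?u) ?K) (tscale (?u\<^sup>2) (tconst 1)))))"
    unfolding pairing_def
    by (rule integral_cong)
      (simp add: full_contraction_fcf tscale_def tadd_def tconst_def tmul_def \<K>bar_def S.\<K>_eq power2_eq_square algebra_simps)
  also have "\<dots> = b\<^sup>2 * (Integ (tmul ?K ?K) + (2 * ?u * Integ ?K + ?u\<^sup>2 * vol A \<Omega>))"
    by (simp add: integral_tscale integral_add K tensor_field_tadd tensor_field_tscale tensor_field_tmul tensor_field_tconst vol_def)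
  finally have p0: "pairing A \<Omega> 0 ?\<alpha>0 ?\<alpha>0 = b\<^sup>2 * (Integ (tmul ?K ?K) + (2 * ?u * Integ ?K + ?u\<^sup>2 * vol A \<Omega>))" .
  have "pairing A \<Omega> 2 ?\<alpha>2 ?\<alpha>2 = Integ (tscale ((3 * a)\<^sup>2) (full_contraction \<Omega> 2 (Ric \<Gamma>) (Ric \<Gamma>)))"
    unfolding pairing_def
    by (rule integral_cong) (simp add: full_contraction_fcf tscale_def fcf_cmult_left fcf_cmult_right power2_eq_square)
  then have p2: "pairing A \<Omega> 2 ?\<alpha>2 ?\<alpha>2 = (3 * a)\<^sup>2 * Integ (full_contraction \<Omega> 2 (Ric \<Gamma>) (Ric \<Gamma>))"
    by (simp add: integral_tscale)
  have p3: "pairing A \<Omega> 3 ?\<alpha>3 ?\<alpha>3 = 0"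
    unfolding pairing_def
  proof (rule Integ_zero)
    fix c p assume cp: "c \<in> A" "p \<in> cdom c"
    show "full_contraction \<Omega> 3 ?\<alpha>3 ?\<alpha>3 c p [] [] = 0"
      unfolding full_contraction_fcf using fcf_swap[where k = 3 and \<alpha> = "?\<alpha>3 c p []" and \<beta> = "?\<alpha>3 c p []", OF \<omega>_skew[OF cp]] by simp
  qed
  show ?thesis unfolding NN_def Mhat_def pairing023_def prod.case p0 p2 p3 by simp
qed

end

context compact_variation
begin

text \<open>Since \<open>\<Pi>\<close> is symmetric, the symmetrization in \<open>\<delta>\<^sup>*\<close> may be dropped.\<close>

lemma pairing_\<delta>star_Ric: "pairing A \<Omega> 3 (\<delta>star \<Gamma> (Ric \<Gamma>)) P = - Integ (full_contraction \<Omega> 3 (cov \<Gamma> (Ric \<Gamma>)) P)"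
proof -
  have "pairing A \<Omega> 3 (\<delta>star \<Gamma> (Ric \<Gamma>)) P = Integ (tscale (- 1) (full_contraction \<Omega> 3 (cov \<Gamma> (Ric \<Gamma>)) P))"
    unfolding pairing_def
  proof (rule integral_cong)
    fix c p assume cp: "c \<in> A" "p \<in> cdom c"
    show "full_contraction \<Omega> 3 (\<delta>star \<Gamma> (Ric \<Gamma>)) P c p [] [] = tscale (- 1) (full_contraction \<Omega> 3 (cov \<Gamma> (Ric \<Gamma>)) P) c p [] []"
      unfolding full_contraction_fcf tscale_def \<delta>star_def fcf_cmult_left contraction_symmetrize(1)[OF P cp] ..
  qed
  then show ?thesis by (simp add: integral_tscale)
qed

lemma symplectic_form_euler_lagrange:
  "symplectic_form A \<Omega> (euler_lagrange s t) P
    = t\<^sup>2 * pairing A \<Omega> 3 (\<H> \<Omega> \<Gamma> (\<K> \<Omega> \<Gamma>)) P - s\<^sup>2 * Integ (full_contraction \<Omega> 3 (cov \<Gamma> (Ric \<Gamma>)) P)"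
  unfolding symplectic_form_def
  using pairing_linear[OF Sk_tensor[OF \<H>_Sk[OF \<K>_tensor]] Sk_tensor[OF \<delta>star_Ric_Sk] P_tensor] pairing_\<delta>star_Ric by simp

lemma first_variation:
  "has_first_variation \<Omega> (NN A \<Omega> \<Gamma>0 (s / 3) t) \<Gamma> P (2 * symplectic_form A \<Omega> (euler_lagrange s t) P)"
proof -
  have "((\<lambda>\<epsilon>. t\<^sup>2 * (J \<epsilon> + (2 * (u - u * I \<epsilon>) * I \<epsilon> + (u - u * I \<epsilon>)\<^sup>2 * v)) + (3 * (s / 3))\<^sup>2 * R \<epsilon>)
      has_real_derivative t\<^sup>2 * J' + s\<^sup>2 * R') (at 0)"
    if "(J has_real_derivative J') (at 0)" "(I has_real_derivative 0) (at 0)" "(R has_real_derivative R') (at 0)"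
    for I J R J' R' u v
    by (auto intro!: derivative_eq_intros that)
  from this[OF integral_\<K>_square_deriv integral_\<K>_const_deriv integral_Ric_square_deriv,
      of "inverse (vol A \<Omega>)" "vol A \<Omega>"] show ?thesis
    unfolding has_first_variation_def \<Gamma>v_def[symmetric] NN_eq[OF \<Gamma>v_SConn] symplectic_form_euler_lagrange by (simp add: algebra_simps)
qed

end

theorem mainTheorem2:
  fixes A :: "('m::t2_space, 'n::finite) chart set"
    and \<Omega> :: "('m, 'n) tensor"
    and \<Gamma>0 :: "('m, 'n) conn"
    and n :: nat
    and s t :: real
  assumes "symplectic_manifold n A \<Omega>"
    and "compact (UNIV :: 'm set)"
    and "connected (UNIV :: 'm set)"
    and "\<Gamma>0 \<in> SConn A \<Omega>"
    and "s \<noteq> 0"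
    and "t \<noteq> 0"
  shows "(\<forall>\<Gamma>\<in>SConn A \<Omega>. \<forall>P\<in>Sk A 3.
            has_first_variation \<Omega> (NN A \<Omega> \<Gamma>0 (s / 3) t) \<Gamma> P
              (2 * symplectic_form A \<Omega>
                 (tadd (tscale (t\<^sup>2) (\<H> \<Omega> \<Gamma> (\<K> \<Omega> \<Gamma>))) (tscale (s\<^sup>2) (\<delta>star \<Gamma> (Ric \<Gamma>)))) P))
       \<and> (\<forall>\<Gamma>\<in>SConn A \<Omega>.
            critical_point A \<Omega> (NN A \<Omega> \<Gamma>0 (s / 3) t) \<Gamma> \<longleftrightarrow>
              vanishes A 3 (tadd (tscale (t\<^sup>2) (\<H> \<Omega> \<Gamma> (\<K> \<Omega> \<Gamma>))) (tscale (s\<^sup>2) (\<delta>star \<Gamma> (Ric \<Gamma>)))))"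
proof -
  interpret M: compact_symplectic A \<Omega> n
  proof unfold_locales
    show "smooth_atlas A" using assms(1) unfolding symplectic_manifold_def by (elim conjE)
  qed (fact assms)+
  let ?E = "\<lambda>\<Gamma>. tadd (tscale (t\<^sup>2) (\<H> \<Omega> \<Gamma> (\<K> \<Omega> \<Gamma>))) (tscale (s\<^sup>2) (\<delta>star \<Gamma> (Ric \<Gamma>)))"
  let ?N = "NN A \<Omega> \<Gamma>0 (s / 3) t"
  have var: "has_first_variation \<Omega> ?N \<Gamma> P (2 * symplectic_form A \<Omega> (?E \<Gamma>) P)"
    if "\<Gamma> \<in> SConn A \<Omega>" "P \<in> Sk A 3" for \<Gamma> P
  proof -
    interpret V: compact_variation A \<Omega> n \<Gamma> P by unfold_locales (rule that)+
    show ?thesis by (rule V.first_variation)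
  qed
  moreover have "critical_point A \<Omega> ?N \<Gamma> \<longleftrightarrow> vanishes A 3 (?E \<Gamma>)" if \<Gamma>: "\<Gamma> \<in> SConn A \<Omega>" for \<Gamma>
  proof
    interpret S: symplectic_connection A \<Omega> n \<Gamma> by unfold_locales (rule \<Gamma>)
    assume crit: "critical_point A \<Omega> ?N \<Gamma>"
    show "vanishes A 3 (?E \<Gamma>)"
    proof (rule M.pairing_nondegenerate[OF S.euler_lagrange_Sk])
      fix P assume P: "P \<in> Sk A 3"
      then have "has_first_variation \<Omega> ?N \<Gamma> P 0" using crit by (simp add: critical_point_def)
      with var[OF \<Gamma> P] have "2 * symplectic_form A \<Omega> (?E \<Gamma>) P = 0"
        unfolding has_first_variation_def by (rule DERIV_unique)
      then show "pairing A \<Omega> 3 (?E \<Gamma>) P = 0" by (simp add: symplectic_form_def)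
    qed
  next
    assume "vanishes A 3 (?E \<Gamma>)"
    then have "full_contraction \<Omega> 3 (?E \<Gamma>) P c p [] [] = 0" if "c \<in> A" "p \<in> cdom c" for c p P
      using that unfolding full_contraction_def vanishes_def by (intro sum.neutral) auto
    then have "symplectic_form A \<Omega> (?E \<Gamma>) P = 0" for P
      unfolding symplectic_form_def pairing_def by (rule M.Integ_zero)
    then show "critical_point A \<Omega> ?N \<Gamma>"
      using \<Gamma> var[OF \<Gamma>] unfolding critical_point_def by simp
  qed
  ultimately show ?thesis by blast
qed

end
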